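(* Let $\Gamma$ be a non-uniform lattice in $\operatorname{PSL}(2,\mathbb R)$. Then there exists $N\in\mathbb N$ such that for any one-parameter unipotent subgroup $\{u(t)\}_{t\in\mathbb R}$ of $\operatorname{PSL}(2,\mathbb R)$ and any $p\in\operatorname{PSL}(2,\mathbb R)/\Gamma$ which is not $\{u(t)\}_{t\in\mathbb R}$-periodic, the set $\{u(x)p:x\in\Omega(N)\}$ is dense in $\operatorname{PSL}(2,\mathbb R)/\Gamma$.
   Context: A natural number $x$ is an $N$-almost prime if its prime factorization has at most $N$ prime factors counted with multiplicity; $\Omega(N)\subset\mathbb N$ denotes the set of $N$-almost primes. A one-parameter unipotent subgroup $\{u(t)\}_{t\in\mathbb R}$ is a one-parameter subgroup of $\operatorname{PSL}(2,\mathbb R)$ such that $u(t)$ is unipotent for every $t$. A point $p$ is $\{u(t)\}$-periodic if $u(t)p=p$ for some $t\neq0$. *)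

theory Defs
  imports "HOL-Analysis.Analysis" "HOL-Computational_Algebra.Primes"
begin

type_synonym mat2 = "real^2^2"

definition almost_primes :: "nat \<Rightarrow> nat set" where
  "almost_primes N = {x. x \<ge> 1 \<and> size (prime_factorization x) \<le> N}"

definition SL2 :: "mat2 set" where
  "SL2 = {A. det A = 1}"

definition unipotent :: "mat2 \<Rightarrow> bool" where
  "unipotent U \<longleftrightarrow> (U - mat 1) ** (U - mat 1) = 0"

text \<open>Haar measure on SL(2,R) in the coordinates (a,b,c), a \<noteq> 0,
  A = [[a,b],[c,(1+bc)/a]]: d mu = da db dc / |a| (the set a = 0 is null).\<close>
definition sl_param :: "real \<times> real \<times> real \<Rightarrow> mat2" where
  "sl_param = (\<lambda>(a,b,c). vector [vector [a, b], vector [c, (1 + b*c)/a]])"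

definition haar_SL2 :: "mat2 measure" where
  "haar_SL2 = distr (density lborel (\<lambda>(a,b,c). ennreal (1 / \<bar>a\<bar>))) borel sl_param"

definition subgroup_SL2 :: "mat2 set \<Rightarrow> bool" where
  "subgroup_SL2 \<Gamma> \<longleftrightarrow> \<Gamma> \<subseteq> SL2 \<and> mat 1 \<in> \<Gamma> \<and>
     (\<forall>a\<in>\<Gamma>. \<forall>b\<in>\<Gamma>. a ** b \<in> \<Gamma>) \<and> (\<forall>a\<in>\<Gamma>. matrix_inv a \<in> \<Gamma>)"

definition lattice_SL2 :: "mat2 set \<Rightarrow> bool" where
  "lattice_SL2 \<Gamma> \<longleftrightarrow> subgroup_SL2 \<Gamma> \<and> discrete \<Gamma> \<and>
     (\<exists>F \<in> sets haar_SL2. F \<subseteq> SL2 \<and> emeasure haar_SL2 F < \<infinity> \<and>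
        (\<forall>g\<in>SL2. \<exists>!\<gamma>. \<gamma> \<in> \<Gamma> \<and> g ** matrix_inv \<gamma> \<in> F))"

text \<open>Lattices in PSL(2,R) correspond exactly to lattices of SL(2,R) containing -I
  (their full preimages), and PSL(2,R)/\<Gamma> = SL(2,R)/\<Gamma>~.\<close>
definition psl_lattice :: "mat2 set \<Rightarrow> bool" where
  "psl_lattice \<Gamma> \<longleftrightarrow> lattice_SL2 \<Gamma> \<and> - mat 1 \<in> \<Gamma>"

definition quot_top :: "'a topology \<Rightarrow> ('a \<Rightarrow> 'b) \<Rightarrow> 'b topology" where
  "quot_top T f = topology (\<lambda>U. U \<subseteq> f ` topspace T \<and> openin T {x \<in> topspace T. f x \<in> U})"

definition coset :: "mat2 set \<Rightarrow> mat2 \<Rightarrow> mat2 set" where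
  "coset \<Gamma> g = (\<lambda>\<gamma>. g ** \<gamma>) ` \<Gamma>"

definition hom_space :: "mat2 set \<Rightarrow> mat2 set topology" where
  "hom_space \<Gamma> = quot_top (subtopology euclidean SL2) (coset \<Gamma>)"

definition act :: "mat2 \<Rightarrow> mat2 set \<Rightarrow> mat2 set" where
  "act g p = (\<lambda>h. g ** h) ` p"

definition one_param_unipotent :: "(real \<Rightarrow> mat2) \<Rightarrow> bool" where
  "one_param_unipotent u \<longleftrightarrow> continuous_on UNIV u \<and>
     (\<forall>s t. u (s + t) = u s ** u t) \<and> (\<forall>t. u t \<in> SL2 \<and> unipotent (u t))"

definition periodic_pt :: "(real \<Rightarrow> mat2) \<Rightarrow> mat2 set \<Rightarrow> bool" where
  "periodic_pt u p \<longleftrightarrow> (\<exists>t. t \<noteq> 0 \<and> act (u t) p = p)"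

definition non_uniform :: "mat2 set \<Rightarrow> bool" where
  "non_uniform \<Gamma> \<longleftrightarrow> \<not> compact_space (hom_space \<Gamma>)"

end

theory Submission
  imports Defs
begin

text \<open>After a conjugation the unipotent group is \<open>t \<mapsto> U (\<plusminus> t)\<close>. Let \<open>f\<close> be a bump function around the target point.
  For a non-periodic point \<open>g\<close> a commutator argument yields arbitrarily large \<open>T\<close> for which the horocycle piece of
  length \<open>T\<close> has not escaped into the cusp. For such \<open>T\<close> the time average of \<open>f\<close> is bounded below, by ergodicity
  of the horocycle flow (Mautner), and the integrals of \<open>f (U t g)\<close> against a character save a power of \<open>T\<close>: the
  orbit is thickened transversally, where \<open>U m\<close> shifts time by a quadratic polynomial in \<open>m\<close>, and Cauchy--Schwarz
  leaves quadratic exponential sums. No spectral gap enters, so the exponent saved is absolute. Fejer summation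
  converts this into equidistribution of the visits near \<open>n \<equiv> 0 (mod d)\<close> for \<open>d\<close> up to a power of \<open>T\<close>, and the
  Brun--Hooley sieve produces an \<open>n \<le> T\<close> near a visit with all prime factors above a fixed power of \<open>T\<close>.\<close>

section \<open>Two by two matrices\<close>

text \<open>The power of T saved in the twisted integrals does not depend on the base point; only
  the multiplicity bound \<open>M\<close> and the constants \<open>C\<close>, \<open>c\<close>,
  \<open>T0\<close> do, and they merely decide how large T must be. Hence one sieve exponent
  \<open>B\<close>, and with it one \<open>N\<close>, serves all u and p. For density a single good
  scale T is enough, so it suffices that good scales are unbounded. They come as
  \<open>4 ^ k\<close>, whereas the sieve works with \<open>z = 2 ^ 2 ^ r\<close>; matching the two
  costs a factor 2 in the exponent. The main obstacle is that a single orbit carries no measure. A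
  thickened orbit piece does: unfolding turns its integral into a sum over lattice translates,
  \<open>f\<close> is bounded by 1, and only a count of returns and a quadratic phase are left. No
  asymptotics for the time average are required. The sieve compares the visits near multiples of d
  with the total, whatever its value, so the lower bound \<open>c * T\<close> from qualitative
  ergodicity is sufficient.\<close>

definition mk :: "real \<Rightarrow> real \<Rightarrow> real \<Rightarrow> real \<Rightarrow> mat2" where
  "mk a b c d = vector [vector [a, b], vector [c, d]]"

lemma mk_nth [simp]: "mk a b c d $ 1 $ 1 = a" "mk a b c d $ 1 $ 2 = b"
  "mk a b c d $ 2 $ 1 = c" "mk a b c d $ 2 $ 2 = d"
  by (simp_all add: mk_def)

lemma mat2_eqI: "A $ 1 $ 1 = B $ 1 $ 1 \<Longrightarrow> A $ 1 $ 2 = B $ 1 $ 2 \<Longrightarrow> A $ 2 $ 1 = B $ 2 $ 1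
    \<Longrightarrow> A $ 2 $ 2 = B $ 2 $ 2 \<Longrightarrow> A = (B :: mat2)"
  by (simp add: vec_eq_iff forall_2)

lemma mk_eta: "mk (A $ 1 $ 1) (A $ 1 $ 2) (A $ 2 $ 1) (A $ 2 $ 2) = A"
  by (rule mat2_eqI) simp_all

lemma mat2_cases: obtains a b c d where "A = mk a b c d"
  by (metis mk_eta)

lemma mk_eq_iff [simp]: "mk a b c d = mk a' b' c' d' \<longleftrightarrow> a = a' \<and> b = b' \<and> c = c' \<and> d = d'"
  by (metis mk_nth)

lemma mk_mult [simp]: "mk a b c d ** mk a' b' c' d' =
    mk (a * a' + b * c') (a * b' + b * d') (c * a' + d * c') (c * b' + d * d')"
  by (rule mat2_eqI) (simp_all add: matrix_matrix_mult_def sum_2)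

lemma mult_nth: "(A ** B) $ i $ j = A $ i $ 1 * B $ 1 $ j + A $ i $ 2 * (B :: mat2) $ 2 $ j" for A :: mat2
  by (simp add: matrix_matrix_mult_def sum_2)

lemma mk_one: "mat 1 = mk 1 0 0 1"
  by (rule mat2_eqI) (simp_all add: mat_def)

lemma mk_diff [simp]: "mk a b c d - mk a' b' c' d' = mk (a - a') (b - b') (c - c') (d - d')"
  by (rule mat2_eqI) simp_all

lemma mk_add [simp]: "mk a b c d + mk a' b' c' d' = mk (a + a') (b + b') (c + c') (d + d')"
  by (rule mat2_eqI) simp_all


lemma det_mk [simp]: "det (mk a b c d) = a * d - b * c"
  by (simp add: det_2)

lemma SL2_mk: "mk a b c d \<in> SL2 \<longleftrightarrow> a * d - b * c = 1"
  by (simp add: SL2_def)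

text \<open>The adjugate inverts on \<open>SL2\<close>. Unlike the choice-based
  \<open>matrix_inv\<close> it is polynomial in the entries, antimultiplicative and norm preserving
  on all matrices.\<close>

definition adj :: "mat2 \<Rightarrow> mat2" where
  "adj A = mk (A $ 2 $ 2) (- A $ 1 $ 2) (- A $ 2 $ 1) (A $ 1 $ 1)"

lemma adj_mk [simp]: "adj (mk a b c d) = mk d (- b) (- c) a"
  by (simp add: adj_def)

lemma SL2_one [simp]: "mat 1 \<in> SL2" by (simp add: SL2_def)

lemma SL2_mult [simp]: "A \<in> SL2 \<Longrightarrow> B \<in> SL2 \<Longrightarrow> A ** B \<in> SL2"
  by (simp add: SL2_def det_mul)

lemma SL2_adj [simp]: "A \<in> SL2 \<Longrightarrow> adj A \<in> SL2"
  by (cases A rule: mat2_cases) (simp add: SL2_mk algebra_simps)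

lemma adj_left [simp]: "A \<in> SL2 \<Longrightarrow> adj A ** A = mat 1"
  by (cases A rule: mat2_cases) (simp add: SL2_mk mk_one algebra_simps)

lemma adj_right [simp]: "A \<in> SL2 \<Longrightarrow> A ** adj A = mat 1"
  by (cases A rule: mat2_cases) (simp add: SL2_mk mk_one algebra_simps)

lemma adj_adj [simp]: "adj (adj A) = A"
  by (cases A rule: mat2_cases) simp

lemma adj_mult: "adj (A ** B) = adj B ** adj A"
  by (cases A rule: mat2_cases, cases B rule: mat2_cases) (simp add: algebra_simps)

lemma adj_one [simp]: "adj (mat 1) = mat 1" by (simp add: mk_one)

lemma adj_left_assoc [simp]: "A \<in> SL2 \<Longrightarrow> adj A ** (A ** B) = B"
  by (simp add: matrix_mul_assoc)

lemma adj_right_assoc [simp]: "A \<in> SL2 \<Longrightarrow> A ** (adj A ** B) = B"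
  by (simp add: matrix_mul_assoc)

lemma matrix_inv_SL2: assumes "A \<in> SL2" shows "matrix_inv A = adj A"
proof -
  have "A ** matrix_inv A = mat 1 \<and> matrix_inv A ** A = mat 1"
    unfolding matrix_inv_def by (rule someI[of _ "adj A"]) (use assms in simp)
  then show ?thesis
    by (metis adj_left assms matrix_mul_assoc matrix_mul_lid matrix_mul_rid)
qed

text \<open>The entrywise sum norm is submultiplicative without a constant. The price is
  \<open>nm (mat 1) = 2\<close>, the source of the terms \<open>e + 2\<close> and of the factors 3
  in later estimates.\<close>

definition nm :: "mat2 \<Rightarrow> real" where
  "nm A = \<bar>A $ 1 $ 1\<bar> + \<bar>A $ 1 $ 2\<bar> + \<bar>A $ 2 $ 1\<bar> + \<bar>A $ 2 $ 2\<bar>"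

lemma nm_mk [simp]: "nm (mk a b c d) = \<bar>a\<bar> + \<bar>b\<bar> + \<bar>c\<bar> + \<bar>d\<bar>" by (simp add: nm_def)

lemma nm_nonneg [simp]: "0 \<le> nm A" by (simp add: nm_def)

lemma nm_eq_0 [simp]: "nm A = 0 \<longleftrightarrow> A = 0"
  by (auto simp: nm_def intro!: mat2_eqI)

lemma nm_add: "nm (A + B) \<le> nm A + nm B"
proof -
  have "nm (A + B) \<le> (\<bar>A $ 1 $ 1\<bar> + \<bar>B $ 1 $ 1\<bar>) + (\<bar>A $ 1 $ 2\<bar> + \<bar>B $ 1 $ 2\<bar>)
      + (\<bar>A $ 2 $ 1\<bar> + \<bar>B $ 2 $ 1\<bar>) + (\<bar>A $ 2 $ 2\<bar> + \<bar>B $ 2 $ 2\<bar>)"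
    unfolding nm_def vector_add_component by (intro add_mono abs_triangle_ineq)
  then show ?thesis by (simp add: nm_def)
qed

lemma nm_minus_commute: "nm (A - B) = nm (B - A)" by (simp add: nm_def abs_minus_commute)

lemma nm_uminus [simp]: "nm (- A) = nm A" by (simp add: nm_def)

lemma nm_triangle: "nm (A - C) \<le> nm (A - B) + nm (B - C)"
  using nm_add[of "A - B" "B - C"] by simp

lemma nm_adj [simp]: "nm (adj A) = nm A"
  by (cases A rule: mat2_cases) simp

lemma nm_adj_diff: "nm (adj A - adj B) = nm (A - B)"
  by (cases A rule: mat2_cases, cases B rule: mat2_cases) simp

lemma nm_mult: "nm (A ** B) \<le> nm A * nm B"
proof (cases A rule: mat2_cases, cases B rule: mat2_cases)
  fix a b c d a' b' c' d' assume A: "A = mk a b c d" and B: "B = mk a' b' c' d'"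
  have "\<bar>x * x' + y * y'\<bar> \<le> \<bar>x\<bar> * \<bar>x'\<bar> + \<bar>y\<bar> * \<bar>y'\<bar>" for x x' y y' :: real
    by (metis abs_mult abs_triangle_ineq)
  note t = this
  have "nm (A ** B) \<le> (\<bar>a\<bar> * \<bar>a'\<bar> + \<bar>b\<bar> * \<bar>c'\<bar>) + (\<bar>a\<bar> * \<bar>b'\<bar> + \<bar>b\<bar> * \<bar>d'\<bar>)
      + (\<bar>c\<bar> * \<bar>a'\<bar> + \<bar>d\<bar> * \<bar>c'\<bar>) + (\<bar>c\<bar> * \<bar>b'\<bar> + \<bar>d\<bar> * \<bar>d'\<bar>)"
    unfolding A B mk_mult nm_mk by (intro add_mono t)
  also have "\<dots> \<le> nm A * nm B" unfolding A B nm_mk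
    by (simp add: algebra_simps)
  finally show ?thesis .
qed

lemma norm_le_nm: "norm A \<le> nm A" for A :: mat2
proof -
  have "norm A \<le> (\<Sum>i\<in>UNIV. norm (A $ i))" by (simp add: norm_vec_def L2_set_le_sum)
  also have "\<dots> \<le> (\<Sum>i\<in>UNIV. \<Sum>j\<in>UNIV. norm (A $ i $ j))"
    by (intro sum_mono) (simp add: norm_vec_def L2_set_le_sum)
  finally show ?thesis by (simp add: nm_def sum_2)
qed

lemma nm_le_norm: "nm A \<le> 4 * norm A" for A :: mat2
proof -
  have "\<bar>A $ i $ j\<bar> \<le> norm A" for i j
    using Finite_Cartesian_Product.norm_nth_le[of "A $ i" j] Finite_Cartesian_Product.norm_nth_le[of A i]
    by simp
  from this[of 1 1] this[of 1 2] this[of 2 1] this[of 2 2] show ?thesis by (simp add: nm_def)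
qed

lemma continuous_mk: assumes "continuous_on S f" "continuous_on S g" "continuous_on S h" "continuous_on S k"
  shows "continuous_on S (\<lambda>x. mk (f x) (g x) (h x) (k x))"
proof -
  have e: "mk a b c d = (\<chi> i j. if i = 1 then (if j = 1 then a else b) else (if j = 1 then c else d))" for a b c d
    by (rule mat2_eqI) simp_all
  have "continuous_on S (\<lambda>x. (if i = 1 then (if j = 1 then f x else g x) else (if j = 1 then h x else k x)))" for i j :: 2
    using assms by (cases "i = 1"; cases "j = 1") auto
  then show ?thesis unfolding e by (intro continuous_on_vec_lambda)
qed


lemma continuous_mat_mult: assumes "continuous_on S f" "continuous_on S g"
  shows "continuous_on S (\<lambda>x. f x ** (g x :: mat2) :: mat2)"
proof -
  have "(\<lambda>x. f x ** g x) = (\<lambda>x. mk (f x $ 1 $ 1 * g x $ 1 $ 1 + f x $ 1 $ 2 * g x $ 2 $ 1) (f x $ 1 $ 1 * g x $ 1 $ 2 + f x $ 1 $ 2 * g x $ 2 $ 2)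
     (f x $ 2 $ 1 * g x $ 1 $ 1 + f x $ 2 $ 2 * g x $ 2 $ 1) (f x $ 2 $ 1 * g x $ 1 $ 2 + f x $ 2 $ 2 * g x $ 2 $ 2))"
    by (rule ext, rule mat2_eqI) (simp_all add: mult_nth)
  then show ?thesis using assms
    by (simp only:) (intro continuous_mk continuous_intros)
qed

lemma continuous_nm: "continuous_on S nm"
  unfolding nm_def[abs_def] by (intro continuous_intros)

lemma closed_SL2: "closed SL2"
proof -
  have e: "SL2 = {A. A $ 1 $ 1 * A $ 2 $ 2 - A $ 1 $ 2 * A $ 2 $ 1 = 1}"
    by (simp add: SL2_def det_2)
  show ?thesis unfolding e by (intro closed_Collect_eq continuous_intros)
qed

lemma mat2_measurableI:
  fixes f :: "'a \<Rightarrow> mat2"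
  assumes "\<And>i j. (\<lambda>x. f x $ i $ j) \<in> borel_measurable M"
  shows "f \<in> borel_measurable M"
proof (subst borel_measurable_euclidean_space, intro ballI)
  fix b :: mat2 assume "b \<in> Basis"
  then obtain i j where "b = axis i (axis j 1)" by (auto simp: Basis_vec_def)
  then show "(\<lambda>x. f x \<bullet> b) \<in> borel_measurable M"
    using assms by (simp add: inner_axis)
qed

lemma mk_measurable [measurable]:
  assumes "f \<in> borel_measurable M" "g \<in> borel_measurable M" "h \<in> borel_measurable M" "k \<in> borel_measurable M"
  shows "(\<lambda>x. mk (f x) (g x) (h x) (k x)) \<in> borel_measurable M"
proof (rule mat2_measurableI)
  fix i j :: 2 show "(\<lambda>x. mk (f x) (g x) (h x) (k x) $ i $ j) \<in> borel_measurable M"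
    using exhaust_2[of i] exhaust_2[of j] assms by auto
qed

lemma mat_nth_measurable [measurable]: "(\<lambda>A :: mat2. A $ i $ j) \<in> borel_measurable borel"
  by (intro borel_measurable_continuous_onI continuous_intros)

lemma mat_mult_measurable [measurable]:
  assumes [measurable]: "f \<in> borel_measurable M" "g \<in> borel_measurable M"
  shows "(\<lambda>x. f x ** (g x :: mat2) :: mat2) \<in> borel_measurable M"
  by (rule mat2_measurableI) (simp add: mult_nth)

section \<open>Elements of the horocycle, diagonal and lower triangular subgroups\<close>

definition U :: "real \<Rightarrow> mat2" where "U t = mk 1 t 0 1"
text \<open>Scaled so that \<open>low r a ** U t\<close> has first row \<open>(a, a t)\<close> and
  first column \<open>(a, r a)\<close>: the coordinates r, a, t are quotients of entries, and only
  matrices with vanishing corner entry are missed. Here t is time along the horocycle, while r and a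
  measure the displacement across it.\<close>

definition low :: "real \<Rightarrow> real \<Rightarrow> mat2" where "low r a = mk a 0 (r * a) (1 / a)"
abbreviation dg :: "real \<Rightarrow> mat2" where "dg \<equiv> low 0"

lemma U_add: "U s ** U t = U (s + t)" by (simp add: U_def)
lemma U_0 [simp]: "U 0 = mat 1" by (simp add: U_def mk_one)
lemma U_SL2 [simp]: "U t \<in> SL2" by (simp add: U_def SL2_mk)
lemma adj_U [simp]: "adj (U t) = U (- t)" by (simp add: U_def)
lemma low_SL2 [simp]: "a \<noteq> 0 \<Longrightarrow> low r a \<in> SL2" by (simp add: low_def SL2_mk)
lemma low_1 [simp]: "low 0 1 = mat 1" by (simp add: low_def mk_one)
lemma low_low: "low r a = low r 1 ** dg a" by (simp add: low_def)
lemma low_U: "low r a ** U t = mk a (a * t) (r * a) (r * a * t + 1 / a)"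
  by (simp add: low_def U_def)

text \<open>The left side has corner \<open>(1 + m r) a\<close>, lower left entry \<open>r a\<close>
  and upper right entry \<open>m / a\<close>; the parameters on the right are quotients of these.
  Pushing \<open>U m\<close> past a transversal displacement thus produces a time shift that is
  nonlinear in m and depends on r.\<close>

lemma U_low: assumes "1 + m * r \<noteq> 0" "a \<noteq> 0"
  shows "U m ** low r a = low (r / (1 + m * r)) ((1 + m * r) * a) ** U (m / (a\<^sup>2 * (1 + m * r)))"
proof -
  define q where "q = 1 + m * r"
  have q: "q \<noteq> 0" using assms by (simp add: q_def)
  have 1: "r / q * (q * a) = r * a" "q * a * (m / (a\<^sup>2 * q)) = m / a"
    using q assms by (simp_all add: power2_eq_square)
  have "r * a * (m / (a\<^sup>2 * q)) + 1 / (q * a) = (m * r + 1) / (a * q)"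
    using q assms by (simp add: power2_eq_square add_divide_distrib mult.commute)
  also have "\<dots> = 1 / a" using q by (simp add: q_def add.commute)
  finally have 2: "r * a * (m / (a\<^sup>2 * q)) + 1 / (q * a) = 1 / a" .
  show ?thesis unfolding q_def[symmetric] low_U 1 2
    using assms by (simp add: U_def low_def q_def algebra_simps)
qed

lemma SL2_decomp: assumes "A \<in> SL2" "A $ 1 $ 1 \<noteq> 0"
  shows "A = low (A $ 2 $ 1 / A $ 1 $ 1) (A $ 1 $ 1) ** U (A $ 1 $ 2 / A $ 1 $ 1)"
proof (cases A rule: mat2_cases)
  case (1 a b c d)
  then have "c / a * b + 1 / a = d" using assms by (simp add: SL2_mk field_simps)
  then show ?thesis using assms 1 by (simp add: low_U)
qed

section \<open>Haar measure\<close>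

lemma fst_snd_borel [measurable]:
  "(fst :: 'a::second_countable_topology \<times> 'b::second_countable_topology \<Rightarrow> 'a) \<in> borel_measurable borel"
  "(snd :: 'a::second_countable_topology \<times> 'b::second_countable_topology \<Rightarrow> 'b) \<in> borel_measurable borel"
  by (intro borel_measurable_continuous_onI continuous_intros)+

lemma nn_integral_lborel3:
  assumes [measurable]: "h \<in> borel_measurable (borel :: (real \<times> real \<times> real) measure)"
  shows "(\<integral>\<^sup>+x. h x \<partial>lborel) = (\<integral>\<^sup>+a. \<integral>\<^sup>+b. \<integral>\<^sup>+c. h (a, b, c) \<partial>lborel \<partial>lborel \<partial>lborel)"
proof -
  have "(\<integral>\<^sup>+x. h x \<partial>lborel) = (\<integral>\<^sup>+x. h x \<partial>(lborel \<Otimes>\<^sub>M lborel :: (real \<times> real \<times> real) measure))"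
    by (simp add: lborel_prod)
  also have "\<dots> = (\<integral>\<^sup>+a. \<integral>\<^sup>+y. h (a, y) \<partial>lborel \<partial>lborel)"
    by (rule lborel.nn_integral_fst[symmetric]) (simp add: lborel_prod)
  also have "\<dots> = (\<integral>\<^sup>+a. \<integral>\<^sup>+b. \<integral>\<^sup>+c. h (a, b, c) \<partial>lborel \<partial>lborel \<partial>lborel)"
  proof (rule nn_integral_cong)
    fix a :: real
    have "(\<integral>\<^sup>+y. h (a, y) \<partial>lborel) = (\<integral>\<^sup>+y. h (a, y) \<partial>(lborel \<Otimes>\<^sub>M lborel :: (real \<times> real) measure))"
      by (simp add: lborel_prod)
    also have "\<dots> = (\<integral>\<^sup>+b. \<integral>\<^sup>+c. h (a, b, c) \<partial>lborel \<partial>lborel)"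
      by (rule lborel.nn_integral_fst[symmetric]) (simp add: lborel_prod)
    finally show "(\<integral>\<^sup>+y. h (a, y) \<partial>lborel) = (\<integral>\<^sup>+b. \<integral>\<^sup>+c. h (a, b, c) \<partial>lborel \<partial>lborel)" .
  qed
  finally show ?thesis .
qed


lemma nn_integral_swap:
  fixes h :: "real \<Rightarrow> real \<Rightarrow> ennreal"
  assumes [measurable]: "(\<lambda>(x, y). h x y) \<in> borel_measurable (borel \<Otimes>\<^sub>M borel)"
  shows "(\<integral>\<^sup>+x. \<integral>\<^sup>+y. h x y \<partial>lborel \<partial>lborel) = (\<integral>\<^sup>+y. \<integral>\<^sup>+x. h x y \<partial>lborel \<partial>(lborel :: real measure))"
proof -
  have "(\<lambda>(x, y). h x y) \<in> borel_measurable (lborel \<Otimes>\<^sub>M (lborel :: real measure))"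
    using assms by (simp add: lborel_prod borel_prod)
  from lborel_pair.Fubini'[OF this] show ?thesis by simp
qed

lemma sl_param_eq: "sl_param p = mk (fst p) (fst (snd p)) (snd (snd p)) ((1 + fst (snd p) * snd (snd p)) / fst p)"
  by (cases p) (simp add: sl_param_def mk_def)

lemma sl_param_measurable [measurable]: "sl_param \<in> borel_measurable borel"
  unfolding sl_param_eq[abs_def] by measurable

lemma space_haar [simp]: "space haar_SL2 = UNIV" by (simp add: haar_SL2_def)
lemma sets_haar [simp, measurable_cong]: "sets haar_SL2 = sets borel" by (simp add: haar_SL2_def)

lemma nn_integral_haar:
  assumes [measurable]: "\<phi> \<in> borel_measurable borel"
  shows "(\<integral>\<^sup>+z. \<phi> z \<partial>haar_SL2) =
    (\<integral>\<^sup>+a. \<integral>\<^sup>+b. \<integral>\<^sup>+c. \<phi> (mk a b c ((1 + b * c) / a)) * ennreal (1 / \<bar>a\<bar>) \<partial>lborel \<partial>lborel \<partial>lborel)"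
proof -
  have m: "(\<lambda>(a, b, c). ennreal (1 / \<bar>a\<bar>)) \<in> borel_measurable (borel :: (real \<times> real \<times> real) measure)"
    unfolding case_prod_beta' by measurable
  have "(\<integral>\<^sup>+z. \<phi> z \<partial>haar_SL2) = (\<integral>\<^sup>+p. (\<lambda>(a, b, c). ennreal (1 / \<bar>a\<bar>)) p * \<phi> (sl_param p) \<partial>lborel)"
    unfolding haar_SL2_def using m by (subst nn_integral_distr) (auto simp: nn_integral_density)
  also have "\<dots> = (\<integral>\<^sup>+a. \<integral>\<^sup>+b. \<integral>\<^sup>+c. \<phi> (mk a b c ((1 + b * c) / a)) * ennreal (1 / \<bar>a\<bar>) \<partial>lborel \<partial>lborel \<partial>lborel)"
    by (subst nn_integral_lborel3) (use m in \<open>auto simp: sl_param_eq mult.commute\<close>)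
  finally show ?thesis .
qed

lemma nn_integral_translate:
  fixes f :: "real \<Rightarrow> ennreal"
  assumes [measurable]: "f \<in> borel_measurable borel"
  shows "(\<integral>\<^sup>+x. f (x + s) \<partial>lborel) = (\<integral>\<^sup>+x. f x \<partial>(lborel :: real measure))"
  using nn_integral_real_affine[of f 1 s] by (simp add: add.commute)

lemma nn_integral_scale:
  fixes f :: "real \<Rightarrow> ennreal"
  assumes [measurable]: "f \<in> borel_measurable borel" and "c \<noteq> 0"
  shows "(\<integral>\<^sup>+x. f (c * x) * ennreal \<bar>c\<bar> \<partial>lborel) = (\<integral>\<^sup>+x. f x \<partial>(lborel :: real measure))"
  using nn_integral_real_affine[of f c 0] assms by (simp add: nn_integral_multc mult.commute[of _ "ennreal \<bar>c\<bar>"] nn_integral_cmult)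

text \<open>In the coordinates (a, b, c) a lower unipotent acts by the translation
  \<open>c + s * a\<close>, which preserves Lebesgue measure and leaves the density
  \<open>1 / |a|\<close> alone.\<close>

lemma haar_left_lower:
  assumes [measurable]: "\<phi> \<in> borel_measurable borel"
  shows "(\<integral>\<^sup>+z. \<phi> (low s 1 ** z) \<partial>haar_SL2) = (\<integral>\<^sup>+z. \<phi> z \<partial>haar_SL2)"
proof -
  have "(\<integral>\<^sup>+c. \<phi> (low s 1 ** mk a b c ((1 + b * c) / a)) * ennreal (1 / \<bar>a\<bar>) \<partial>lborel)
    = (\<integral>\<^sup>+c. \<phi> (mk a b c ((1 + b * c) / a)) * ennreal (1 / \<bar>a\<bar>) \<partial>lborel)" for a b
  proof (cases "a = 0")
    case False
    have "low s 1 ** mk a b c ((1 + b * c) / a) = mk a b (c + s * a) ((1 + b * (c + s * a)) / a)" for c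
      using False by (simp add: low_def field_simps)
    then show ?thesis
      using nn_integral_translate[of "\<lambda>c. \<phi> (mk a b c ((1 + b * c) / a)) * ennreal (1 / \<bar>a\<bar>)" "s * a"]
      by simp
  qed simp
  then show ?thesis by (simp add: nn_integral_haar)
qed

text \<open>Transposition only exchanges the coordinates b and c. It serves to turn left invariance
  into right invariance.\<close>

lemma haar_transpose:
  assumes [measurable]: "\<phi> \<in> borel_measurable borel"
  shows "(\<integral>\<^sup>+z. \<phi> (mk (z $ 1 $ 1) (z $ 2 $ 1) (z $ 1 $ 2) (z $ 2 $ 2)) \<partial>haar_SL2) = (\<integral>\<^sup>+z. \<phi> z \<partial>haar_SL2)"
proof -
  have "(\<integral>\<^sup>+b. \<integral>\<^sup>+c. \<phi> (mk a c b ((1 + b * c) / a)) * ennreal (1 / \<bar>a\<bar>) \<partial>lborel \<partial>lborel)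
    = (\<integral>\<^sup>+b. \<integral>\<^sup>+c. \<phi> (mk a b c ((1 + b * c) / a)) * ennreal (1 / \<bar>a\<bar>) \<partial>lborel \<partial>lborel)" for a
    by (subst nn_integral_swap) (auto simp: mult.commute split_beta')
  then show ?thesis by (simp add: nn_integral_haar)
qed

definition wm :: mat2 where "wm = mk 0 1 (-1) 0"

text \<open>The product has coordinates (c, d, - a). For fixed a and c the determinant equation
  makes b an affine function of d with slope \<open>a / c\<close>, and this Jacobian trades the
  density \<open>1 / |a|\<close> for \<open>1 / |c|\<close>.\<close>

lemma haar_left_w:
  assumes [measurable]: "\<phi> \<in> borel_measurable borel"
  shows "(\<integral>\<^sup>+z. \<phi> (wm ** z) \<partial>haar_SL2) = (\<integral>\<^sup>+z. \<phi> z \<partial>haar_SL2)"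
proof -
  let ?h = "\<lambda>a c d. \<phi> (mk c d (- a) ((1 - a * d) / c)) * ennreal (1 / \<bar>c\<bar>)"
  have inner: "(\<integral>\<^sup>+b. \<phi> (mk c ((1 + b * c) / a) (- a) (- b)) * ennreal (1 / \<bar>a\<bar>) \<partial>lborel) = (\<integral>\<^sup>+d. ?h a c d \<partial>lborel)"
    if "a \<noteq> 0" "c \<noteq> 0" for a c
  proof -
    have "(\<integral>\<^sup>+b. \<phi> (mk c ((1 + b * c) / a) (- a) (- b)) * ennreal (1 / \<bar>a\<bar>) \<partial>lborel)
      = ennreal \<bar>a / c\<bar> * (\<integral>\<^sup>+d. \<phi> (mk c ((1 + (- (1 / c) + a / c * d) * c) / a) (- a) (- (- (1 / c) + a / c * d))) * ennreal (1 / \<bar>a\<bar>) \<partial>lborel)"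
      by (rule nn_integral_real_affine) (use that in auto)
    also have "\<dots> = (\<integral>\<^sup>+d. ennreal \<bar>a / c\<bar> * (\<phi> (mk c ((1 + (- (1 / c) + a / c * d) * c) / a) (- a) (- (- (1 / c) + a / c * d))) * ennreal (1 / \<bar>a\<bar>)) \<partial>lborel)"
      by (rule nn_integral_cmult[symmetric]) auto
    also have "\<dots> = (\<integral>\<^sup>+d. ?h a c d \<partial>lborel)"
    proof (rule nn_integral_cong)
      fix d
      have 1: "(1 + (- (1 / c) + a / c * d) * c) / a = d" "- (- (1 / c) + a / c * d) = (1 - a * d) / c"
        using that by (auto simp: field_simps)
      have 2: "ennreal \<bar>a / c\<bar> * ennreal (1 / \<bar>a\<bar>) = ennreal (1 / \<bar>c\<bar>)"
        using that by (simp add: ennreal_mult[symmetric] abs_divide)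
      show "ennreal \<bar>a / c\<bar> * (\<phi> (mk c ((1 + (- (1 / c) + a / c * d) * c) / a) (- a) (- (- (1 / c) + a / c * d))) * ennreal (1 / \<bar>a\<bar>)) = ?h a c d"
        unfolding 1 using 2 by (metis (no_types, lifting) mult.assoc mult.commute)
    qed
    finally show ?thesis .
  qed
  have "(\<integral>\<^sup>+z. \<phi> (wm ** z) \<partial>haar_SL2) =
     (\<integral>\<^sup>+a. \<integral>\<^sup>+b. \<integral>\<^sup>+c. \<phi> (mk c ((1 + b * c) / a) (- a) (- b)) * ennreal (1 / \<bar>a\<bar>) \<partial>lborel \<partial>lborel \<partial>lborel)"
    by (subst nn_integral_haar) (simp_all add: wm_def)
  also have "\<dots> = (\<integral>\<^sup>+a. \<integral>\<^sup>+c. \<integral>\<^sup>+b. \<phi> (mk c ((1 + b * c) / a) (- a) (- b)) * ennreal (1 / \<bar>a\<bar>) \<partial>lborel \<partial>lborel \<partial>lborel)"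
    by (intro nn_integral_cong nn_integral_swap) (simp add: split_beta')
  also have "\<dots> = (\<integral>\<^sup>+a. \<integral>\<^sup>+c. \<integral>\<^sup>+d. ?h a c d \<partial>lborel \<partial>lborel \<partial>lborel)"
  proof (rule nn_integral_cong_AE)
    show "AE a in lborel. (\<integral>\<^sup>+c. \<integral>\<^sup>+b. \<phi> (mk c ((1 + b * c) / a) (- a) (- b)) * ennreal (1 / \<bar>a\<bar>) \<partial>lborel \<partial>lborel)
       = (\<integral>\<^sup>+c. \<integral>\<^sup>+d. ?h a c d \<partial>lborel \<partial>lborel)"
      using AE_lborel_singleton[of "0::real"]
    proof eventually_elim
      fix a :: real assume "a \<noteq> 0"
      show "(\<integral>\<^sup>+c. \<integral>\<^sup>+b. \<phi> (mk c ((1 + b * c) / a) (- a) (- b)) * ennreal (1 / \<bar>a\<bar>) \<partial>lborel \<partial>lborel)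
       = (\<integral>\<^sup>+c. \<integral>\<^sup>+d. ?h a c d \<partial>lborel \<partial>lborel)"
        by (rule nn_integral_cong_AE, use AE_lborel_singleton[of "0::real"] in eventually_elim)
           (use \<open>a \<noteq> 0\<close> inner in auto)
    qed
  qed
  also have "\<dots> = (\<integral>\<^sup>+a. \<integral>\<^sup>+c. \<integral>\<^sup>+d. ?h (- a) c d \<partial>lborel \<partial>lborel \<partial>lborel)"
    using nn_integral_real_affine[of "\<lambda>a. \<integral>\<^sup>+c. \<integral>\<^sup>+d. ?h a c d \<partial>lborel \<partial>lborel" "-1" 0]
    by simp
  also have "\<dots> = (\<integral>\<^sup>+c. \<integral>\<^sup>+a. \<integral>\<^sup>+d. ?h (- a) c d \<partial>lborel \<partial>lborel \<partial>lborel)"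
    by (rule nn_integral_swap) (simp add: split_beta')
  also have "\<dots> = (\<integral>\<^sup>+c. \<integral>\<^sup>+d. \<integral>\<^sup>+a. ?h (- a) c d \<partial>lborel \<partial>lborel \<partial>lborel)"
    by (intro nn_integral_cong nn_integral_swap) (simp add: split_beta')
  also have "\<dots> = (\<integral>\<^sup>+z. \<phi> z \<partial>haar_SL2)"
    by (subst nn_integral_haar) (simp_all add: mult.commute)
  finally show ?thesis .
qed

text \<open>This property is closed under products, so invariance has to be checked on generators
  only.\<close>

definition left_inv_haar :: "mat2 \<Rightarrow> bool" where
  "left_inv_haar h \<longleftrightarrow> (\<forall>\<phi> \<in> borel_measurable borel. (\<integral>\<^sup>+z. \<phi> (h ** z) \<partial>haar_SL2) = (\<integral>\<^sup>+z. \<phi> z \<partial>haar_SL2))"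

lemma left_inv_haar_mult:
  assumes "left_inv_haar h" "left_inv_haar k" shows "left_inv_haar (h ** k)"
  unfolding left_inv_haar_def
proof
  fix \<phi> :: "mat2 \<Rightarrow> ennreal" assume m[measurable]: "\<phi> \<in> borel_measurable borel"
  have "(\<lambda>z. \<phi> (h ** z)) \<in> borel_measurable borel" by measurable
  then show "(\<integral>\<^sup>+z. \<phi> (h ** k ** z) \<partial>haar_SL2) = (\<integral>\<^sup>+z. \<phi> z \<partial>haar_SL2)"
    using assms(1)[unfolded left_inv_haar_def, rule_format, OF m]
      assms(2)[unfolded left_inv_haar_def, rule_format, of "\<lambda>z. \<phi> (h ** z)"]
    by (simp add: matrix_mul_assoc)
qed

lemma left_inv_haar_lower: "left_inv_haar (low s 1)"
  by (simp add: left_inv_haar_def haar_left_lower)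

lemma left_inv_haar_w: "left_inv_haar wm"
  by (simp add: left_inv_haar_def haar_left_w)

lemma left_inv_haar_U: "left_inv_haar (U t)"
proof -
  \<comment> \<open>Since \<open>wm ** wm = - mat 1\<close>, the triple product is the inverse of
    \<open>wm\<close>, so this is a conjugation.\<close>
  have "U t = wm ** low (- t) 1 ** (wm ** wm ** wm)" by (simp add: U_def wm_def low_def)
  then show ?thesis by (simp only:) (intro left_inv_haar_mult left_inv_haar_w left_inv_haar_lower)
qed

text \<open>An element with nonzero lower left entry factors into an upper, a lower and an upper
  unipotent; any other element acquires such an entry after multiplication by
  \<open>wm\<close>.\<close>

lemma left_inv_haar_SL2: assumes "h \<in> SL2" shows "left_inv_haar h"
proof -
  have 1: "left_inv_haar h" if "h \<in> SL2" "h $ 2 $ 1 \<noteq> 0" for h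
  proof (cases h rule: mat2_cases)
    case (1 a b c d)
    then have "h = U ((a - 1) / c) ** low c 1 ** U ((d - 1) / c)"
      using that by (auto simp: SL2_mk U_def low_def field_simps)
    then show ?thesis by (simp only:) (intro left_inv_haar_mult left_inv_haar_U left_inv_haar_lower)
  qed
  show ?thesis
  proof (cases "h $ 2 $ 1 = 0")
    case True
    then have "(h ** wm) $ 2 $ 1 \<noteq> 0" using assms
      by (cases h rule: mat2_cases) (auto simp: SL2_mk wm_def)
    then have "left_inv_haar (h ** wm)" using assms by (intro 1) (auto simp: wm_def SL2_mk)
    then have "left_inv_haar (h ** wm ** (wm ** wm ** wm))"
      by (rule left_inv_haar_mult) (intro left_inv_haar_mult left_inv_haar_w)
    moreover have "h ** wm ** (wm ** wm ** wm) = h"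
      by (cases h rule: mat2_cases) (simp add: wm_def)
    ultimately show ?thesis by simp
  qed (use 1 assms in auto)
qed

lemma nn_integral_haar_left:
  "h \<in> SL2 \<Longrightarrow> \<phi> \<in> borel_measurable borel \<Longrightarrow> (\<integral>\<^sup>+z. \<phi> (h ** z) \<partial>haar_SL2) = (\<integral>\<^sup>+z. \<phi> z \<partial>haar_SL2)"
  using left_inv_haar_SL2 by (auto simp: left_inv_haar_def)

text \<open>Transposition exchanges left and right multiplication and preserves the measure, so
  right invariance is inherited from left invariance.\<close>

lemma nn_integral_haar_right:
  assumes "h \<in> SL2" and [measurable]: "\<phi> \<in> borel_measurable borel"
  shows "(\<integral>\<^sup>+z. \<phi> (z ** h) \<partial>haar_SL2) = (\<integral>\<^sup>+z. \<phi> z \<partial>haar_SL2)"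
proof -
  define tr where "tr z = mk (z $ 1 $ 1) (z $ 2 $ 1) (z $ 1 $ 2) (z $ 2 $ 2)" for z :: mat2
  have [measurable]: "tr \<in> borel_measurable borel" unfolding tr_def[abs_def] by measurable
  have t: "tr z ** h = tr (tr h ** z)" "tr (tr z) = z" for z
    by (cases z rule: mat2_cases; cases h rule: mat2_cases; simp add: tr_def mult.commute)+
  have T: "(\<integral>\<^sup>+z. \<psi> (tr z) \<partial>haar_SL2) = (\<integral>\<^sup>+z. \<psi> z \<partial>haar_SL2)" if "\<psi> \<in> borel_measurable borel" for \<psi> :: "mat2 \<Rightarrow> ennreal"
    using haar_transpose[OF that] by (simp add: tr_def)
  have "tr h \<in> SL2" using assms by (cases h rule: mat2_cases) (simp add: tr_def SL2_mk mult.commute)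
  have "(\<integral>\<^sup>+z. \<phi> (z ** h) \<partial>haar_SL2) = (\<integral>\<^sup>+z. \<phi> (tr z ** h) \<partial>haar_SL2)"
    using T[of "\<lambda>z. \<phi> (z ** h)"] by simp
  also have "\<dots> = (\<integral>\<^sup>+z. \<phi> (tr z) \<partial>haar_SL2)"
    unfolding t using nn_integral_haar_left[OF \<open>tr h \<in> SL2\<close>, of "\<lambda>z. \<phi> (tr z)"] by simp
  also have "\<dots> = (\<integral>\<^sup>+z. \<phi> z \<partial>haar_SL2)" by (rule T) simp
  finally show ?thesis .
qed

text \<open>The substitution \<open>b = a * t\<close>, \<open>c = a * r\<close> multiplies the
  density \<open>1 / |a|\<close> by \<open>a ^ 2\<close>. In these coordinates a thickened orbit is
  a product set.\<close>

lemma nn_integral_haar_chart: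
  assumes [measurable]: "\<phi> \<in> borel_measurable borel"
  shows "(\<integral>\<^sup>+z. \<phi> z \<partial>haar_SL2) =
    (\<integral>\<^sup>+r. \<integral>\<^sup>+a. \<integral>\<^sup>+t. \<phi> (low r a ** U t) * ennreal \<bar>a\<bar> \<partial>lborel \<partial>lborel \<partial>lborel)"
proof -
  have 1: "(\<integral>\<^sup>+b. \<integral>\<^sup>+c. \<phi> (mk a b c ((1 + b * c) / a)) * ennreal (1 / \<bar>a\<bar>) \<partial>lborel \<partial>lborel)
    = (\<integral>\<^sup>+r. \<integral>\<^sup>+t. \<phi> (low r a ** U t) * ennreal \<bar>a\<bar> \<partial>lborel \<partial>lborel)" if a: "a \<noteq> 0" for a
  proof -
    have "(\<integral>\<^sup>+b. \<integral>\<^sup>+c. \<phi> (mk a b c ((1 + b * c) / a)) * ennreal (1 / \<bar>a\<bar>) \<partial>lborel \<partial>lborel)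
      = (\<integral>\<^sup>+t. (\<integral>\<^sup>+c. \<phi> (mk a (a * t) c ((1 + (a * t) * c) / a)) * ennreal (1 / \<bar>a\<bar>) \<partial>lborel) * ennreal \<bar>a\<bar> \<partial>lborel)"
      by (rule nn_integral_scale[symmetric]) (use a in auto)
    also have "\<dots> = (\<integral>\<^sup>+t. \<integral>\<^sup>+r. \<phi> (low r a ** U t) * ennreal \<bar>a\<bar> \<partial>lborel \<partial>lborel)"
    proof (rule nn_integral_cong)
      fix t
      have e: "mk a (a * t) (a * r) ((1 + (a * t) * (a * r)) / a) = low r a ** U t" for r
        using a by (simp add: low_U field_simps)
      have "(\<integral>\<^sup>+c. \<phi> (mk a (a * t) c ((1 + (a * t) * c) / a)) * ennreal (1 / \<bar>a\<bar>) \<partial>lborel)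
        = (\<integral>\<^sup>+r. (\<phi> (mk a (a * t) (a * r) ((1 + (a * t) * (a * r)) / a)) * ennreal (1 / \<bar>a\<bar>)) * ennreal \<bar>a\<bar> \<partial>lborel)"
        by (rule nn_integral_scale[symmetric]) (use a in auto)
      also have "\<dots> = (\<integral>\<^sup>+r. \<phi> (low r a ** U t) \<partial>lborel)"
        using a unfolding e by (intro nn_integral_cong) (simp add: mult.assoc ennreal_mult[symmetric])
      finally show "(\<integral>\<^sup>+c. \<phi> (mk a (a * t) c ((1 + (a * t) * c) / a)) * ennreal (1 / \<bar>a\<bar>) \<partial>lborel) * ennreal \<bar>a\<bar>
         = (\<integral>\<^sup>+r. \<phi> (low r a ** U t) * ennreal \<bar>a\<bar> \<partial>lborel)"
        unfolding low_U by (simp add: nn_integral_multc)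
    qed
    also have "\<dots> = (\<integral>\<^sup>+r. \<integral>\<^sup>+t. \<phi> (low r a ** U t) * ennreal \<bar>a\<bar> \<partial>lborel \<partial>lborel)"
      unfolding low_U by (rule nn_integral_swap) (simp add: split_beta')
    finally show ?thesis .
  qed
  have "(\<integral>\<^sup>+z. \<phi> z \<partial>haar_SL2) = (\<integral>\<^sup>+a. \<integral>\<^sup>+r. \<integral>\<^sup>+t. \<phi> (low r a ** U t) * ennreal \<bar>a\<bar> \<partial>lborel \<partial>lborel \<partial>lborel)"
    unfolding nn_integral_haar[OF assms]
    by (rule nn_integral_cong_AE, use AE_lborel_singleton[of "0::real"] in eventually_elim) (use 1 in auto)
  also have "\<dots> = (\<integral>\<^sup>+r. \<integral>\<^sup>+a. \<integral>\<^sup>+t. \<phi> (low r a ** U t) * ennreal \<bar>a\<bar> \<partial>lborel \<partial>lborel \<partial>lborel)"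
    unfolding low_U by (rule nn_integral_swap) (simp add: split_beta')
  finally show ?thesis .
qed

lemma emeasure_haar_not_SL2: "emeasure haar_SL2 (- SL2) = 0"
proof -
  have [measurable]: "SL2 \<in> sets borel" using closed_SL2 by auto
  have "emeasure haar_SL2 (- SL2) = (\<integral>\<^sup>+z. indicator (- SL2) z \<partial>haar_SL2)" by simp
  also have "\<dots> = (\<integral>\<^sup>+a. \<integral>\<^sup>+b. \<integral>\<^sup>+c. indicator (- SL2) (mk a b c ((1 + b * c) / a)) * ennreal (1 / \<bar>a\<bar>) \<partial>lborel \<partial>lborel \<partial>lborel)"
    by (rule nn_integral_haar) measurable
  also have "\<dots> = 0"
  proof -
    \<comment> \<open>Where a = 0 the quotient \<open>(1 + b * c) / a\<close> is 0 and the matrix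
      may leave \<open>SL2\<close>, but the density \<open>1 / |a|\<close> is 0 there as
      well.\<close>
    have z: "indicator (- SL2) (mk a b c ((1 + b * c) / a)) * ennreal (1 / \<bar>a\<bar>) = 0" for a b c
      by (cases "a = 0") (auto simp: SL2_mk)
    show ?thesis unfolding z by simp
  qed
  finally show ?thesis .
qed

lemma AE_haar_SL2: "AE z in haar_SL2. z \<in> SL2"
proof (rule AE_I)
  show "{z \<in> space haar_SL2. z \<notin> SL2} \<subseteq> - SL2" by auto
  show "- SL2 \<in> sets haar_SL2" using closed_SL2 by auto
qed (rule emeasure_haar_not_SL2)

section \<open>Lattices\<close>

lemma mat2_diff_left: "A ** (B - C) = A ** B - A ** (C :: mat2)" for A :: mat2
  by (rule mat2_eqI) (simp_all add: mult_nth algebra_simps)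

lemma mat2_diff_right: "(B - C) ** A = B ** A - C ** (A :: mat2)" for B :: mat2
  by (rule mat2_eqI) (simp_all add: mult_nth algebra_simps)

text \<open>The lattice comes with one fixed strict fundamental domain for right multiplication, so
  that integration over the quotient becomes integration over \<open>F\<close>.\<close>

locale sl2_lattice =
  fixes \<Gamma> F :: "mat2 set"
  assumes sub: "\<Gamma> \<subseteq> SL2" and one_in: "mat 1 \<in> \<Gamma>"
    and mult_in: "a \<in> \<Gamma> \<Longrightarrow> b \<in> \<Gamma> \<Longrightarrow> a ** b \<in> \<Gamma>"
    and adj_in: "a \<in> \<Gamma> \<Longrightarrow> adj a \<in> \<Gamma>"
    and disc: "discrete \<Gamma>"
    and F_borel [measurable]: "F \<in> sets borel" and F_sub: "F \<subseteq> SL2"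
    and F_finite: "emeasure haar_SL2 F < \<infinity>"
    and F_ex1: "z \<in> SL2 \<Longrightarrow> \<exists>!\<gamma>. \<gamma> \<in> \<Gamma> \<and> z ** adj \<gamma> \<in> F"
begin

lemma in_SL2 [simp]: "\<gamma> \<in> \<Gamma> \<Longrightarrow> \<gamma> \<in> SL2" using sub by auto

lemma isolated: obtains e where "e > 0" "\<And>\<gamma>. \<gamma> \<in> \<Gamma> \<Longrightarrow> nm (\<gamma> - mat 1) < e \<Longrightarrow> \<gamma> = mat 1"
proof -
  from disc one_in have "mat 1 isolated_in \<Gamma>" by (auto simp: discrete_def)
  then obtain T where T: "open T" "T \<inter> \<Gamma> = {mat 1}" by (auto simp: isolated_in_def)
  then obtain e where e: "e > 0" "\<And>x. dist x (mat 1) < e \<Longrightarrow> x \<in> T" unfolding open_dist by blast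
  show thesis
  proof (rule that[OF e(1)])
    fix \<gamma> assume "\<gamma> \<in> \<Gamma>" "nm (\<gamma> - mat 1) < e"
    then have "dist \<gamma> (mat 1) < e" using norm_le_nm[of "\<gamma> - mat 1"] by (simp add: dist_norm)
    then show "\<gamma> = mat 1" using e T \<open>\<gamma> \<in> \<Gamma>\<close> by blast
  qed
qed

text \<open>If two elements of bounded norm are close, their quotient is close to 1 and hence equal
  to 1. The isolation of 1 thereby spreads to a uniform separation on bounded sets, and a bounded
  uniformly discrete set is finite.\<close>

lemma finite_ball: "finite {\<gamma> \<in> \<Gamma>. nm \<gamma> \<le> R}"
proof -
  obtain e where e: "e > 0" "\<And>\<gamma>. \<gamma> \<in> \<Gamma> \<Longrightarrow> nm (\<gamma> - mat 1) < e \<Longrightarrow> \<gamma> = mat 1"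
    using isolated by blast
  define R' where "R' = max R 1"
  let ?S = "{\<gamma> \<in> \<Gamma>. nm \<gamma> \<le> R}"
  have R': "R' > 0" by (simp add: R'_def)
  have "uniform_discrete ?S"
    unfolding uniform_discrete_def
  proof (intro exI[of _ "e / (4 * R')"] conjI ballI impI)
    fix x y assume x: "x \<in> ?S" and y: "y \<in> ?S" and d: "dist x y < e / (4 * R')"
    have "nm (adj x ** y - mat 1) = nm (adj x ** (y - x))"
      using x by (simp add: mat2_diff_left)
    also have "\<dots> \<le> nm (adj x) * nm (y - x)" by (rule nm_mult)
    also have "\<dots> \<le> R' * (4 * dist x y)"
      using x nm_le_norm[of "y - x"] by (intro mult_mono) (auto simp: R'_def dist_norm norm_minus_commute)
    also have "\<dots> < e" using d R' by (simp add: field_simps)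
    finally have "adj x ** y = mat 1" using x y by (intro e(2) mult_in adj_in) auto
    then have "x ** (adj x ** y) = x" by simp
    then show "x = y" using x by simp
  qed (use e R' in auto)
  moreover have "bounded ?S"
    unfolding bounded_iff by (intro exI[of _ R]) (use norm_le_nm in \<open>auto intro: order_trans\<close>)
  ultimately show ?thesis using uniform_discrete_finite_iff by blast
qed

lemma countable_\<Gamma>: "countable \<Gamma>"
proof -
  have "\<Gamma> = (\<Union>n::nat. {\<gamma> \<in> \<Gamma>. nm \<gamma> \<le> real n})"
    using real_arch_simple by blast
  moreover have "countable (\<Union>n::nat. {\<gamma> \<in> \<Gamma>. nm \<gamma> \<le> real n})"
    by (rule countable_UN[OF countableI_type countable_finite[OF finite_ball]])
  ultimately show ?thesis by simp
qed

text \<open>The measure of the quotient, carried by \<open>F\<close>. For integrands invariant under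
  \<Gamma> it does not matter which fundamental domain carries it.\<close>

definition \<mu> where "\<mu> = density haar_SL2 (indicator F)"

lemma space_\<mu> [simp]: "space \<mu> = UNIV" and sets_\<mu> [simp, measurable_cong]: "sets \<mu> = sets borel"
  by (simp_all add: \<mu>_def)

lemma nn_integral_\<mu>: "\<phi> \<in> borel_measurable borel \<Longrightarrow> (\<integral>\<^sup>+z. \<phi> z \<partial>\<mu>) = (\<integral>\<^sup>+z. indicator F z * \<phi> z \<partial>haar_SL2)"
  unfolding \<mu>_def by (subst nn_integral_density) auto

lemma finite_measure_\<mu>: "finite_measure \<mu>"
proof
  have "emeasure \<mu> (space \<mu>) = emeasure haar_SL2 F"
    unfolding \<mu>_def by (subst emeasure_density) auto
  then show "emeasure \<mu> (space \<mu>) \<noteq> \<infinity>" using F_finite by auto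
qed

sublocale \<mu>: finite_measure \<mu> by (rule finite_measure_\<mu>)

lemma AE_\<mu>_F: "AE z in \<mu>. z \<in> F"
proof -
  have "(\<lambda>z. indicator F z :: ennreal) \<in> borel_measurable haar_SL2" by simp
  from AE_density[OF this, of "\<lambda>z. z \<in> F"] show ?thesis
    unfolding \<mu>_def by (simp add: indicator_def)
qed

lemma sum_F: assumes "z \<in> SL2" shows "(\<integral>\<^sup>+\<gamma>. indicator F (z ** adj \<gamma>) \<partial>count_space \<Gamma>) = 1"
proof -
  obtain \<gamma>0 where g: "\<gamma>0 \<in> \<Gamma>" "z ** adj \<gamma>0 \<in> F" "\<And>\<gamma>. \<gamma> \<in> \<Gamma> \<Longrightarrow> z ** adj \<gamma> \<in> F \<Longrightarrow> \<gamma> = \<gamma>0"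
    using F_ex1[OF assms] by blast
  have e: "z ** adj \<gamma> \<in> F \<longleftrightarrow> \<gamma> = \<gamma>0" if "\<gamma> \<in> \<Gamma>" for \<gamma> using g that by blast
  have "(\<integral>\<^sup>+\<gamma>. indicator F (z ** adj \<gamma>) \<partial>count_space \<Gamma>) = (\<integral>\<^sup>+\<gamma>. indicator {\<gamma>0} \<gamma> \<partial>count_space \<Gamma>)"
    by (rule nn_integral_cong) (simp add: indicator_def e)
  also have "\<dots> = 1" using g(1) by simp
  finally show ?thesis .
qed

lemma bij_adj: "bij_betw adj \<Gamma> \<Gamma>"
  by (rule bij_betwI[of _ _ _ adj]) (auto simp: adj_in)

lemma sum_F': assumes "z \<in> SL2" shows "(\<integral>\<^sup>+\<gamma>. indicator F (z ** \<gamma>) \<partial>count_space \<Gamma>) = 1"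
  using nn_integral_bij_count_space[OF bij_adj, of "\<lambda>\<gamma>. indicator F (z ** \<gamma>)"] sum_F[OF assms] by simp

text \<open>Unfolding: the factor 1 is written as the sum over \<gamma> of the indicators of
  \<open>z ** adj \<gamma> \<in> F\<close>, and each summand is translated by \<gamma> using right
  invariance.\<close>

lemma unfold_nn:
  assumes [measurable]: "\<phi> \<in> borel_measurable borel"
  shows "(\<integral>\<^sup>+z. \<phi> z \<partial>haar_SL2) = (\<integral>\<^sup>+z. \<integral>\<^sup>+\<gamma>. \<phi> (z ** \<gamma>) \<partial>count_space \<Gamma> \<partial>\<mu>)"
proof -
  have "(\<integral>\<^sup>+z. \<phi> z \<partial>haar_SL2) = (\<integral>\<^sup>+z. \<integral>\<^sup>+\<gamma>. \<phi> z * indicator F (z ** adj \<gamma>) \<partial>count_space \<Gamma> \<partial>haar_SL2)"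
    by (rule nn_integral_cong_AE, use AE_haar_SL2 in eventually_elim) (simp add: nn_integral_cmult sum_F)
  also have "\<dots> = (\<integral>\<^sup>+\<gamma>. \<integral>\<^sup>+z. \<phi> z * indicator F (z ** adj \<gamma>) \<partial>haar_SL2 \<partial>count_space \<Gamma>)"
    by (rule nn_integral_count_space_nn_integral[OF countable_\<Gamma>]) measurable
  also have "\<dots> = (\<integral>\<^sup>+\<gamma>. \<integral>\<^sup>+z. \<phi> (z ** \<gamma>) \<partial>\<mu> \<partial>count_space \<Gamma>)"
  proof (rule nn_integral_cong)
    fix \<gamma> assume "\<gamma> \<in> space (count_space \<Gamma>)"
    then have "\<gamma> \<in> \<Gamma>" by simp
    have "(\<integral>\<^sup>+z. \<phi> z * indicator F (z ** adj \<gamma>) \<partial>haar_SL2) = (\<integral>\<^sup>+z. \<phi> (z ** \<gamma>) * indicator F (z ** \<gamma> ** adj \<gamma>) \<partial>haar_SL2)"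
      by (rule nn_integral_haar_right[symmetric, of \<gamma>]) (use \<open>\<gamma> \<in> \<Gamma>\<close> in auto)
    also have "\<dots> = (\<integral>\<^sup>+z. \<phi> (z ** \<gamma>) \<partial>\<mu>)"
      using \<open>\<gamma> \<in> \<Gamma>\<close> by (simp add: nn_integral_\<mu> matrix_mul_assoc[symmetric] mult.commute)
    finally show "(\<integral>\<^sup>+z. \<phi> z * indicator F (z ** adj \<gamma>) \<partial>haar_SL2) = (\<integral>\<^sup>+z. \<phi> (z ** \<gamma>) \<partial>\<mu>)" .
  qed
  also have "\<dots> = (\<integral>\<^sup>+z. \<integral>\<^sup>+\<gamma>. \<phi> (z ** \<gamma>) \<partial>count_space \<Gamma> \<partial>\<mu>)"
    by (rule nn_integral_count_space_nn_integral[OF countable_\<Gamma>, symmetric]) measurable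
  finally show ?thesis .
qed

lemma sigma_finite_count: "sigma_finite_measure (count_space \<Gamma>)"
  by (rule sigma_finite_measure_count_space_countable[OF countable_\<Gamma>])

sublocale cp: pair_sigma_finite "count_space \<Gamma>" \<mu>
  by (intro pair_sigma_finite.intro sigma_finite_count \<mu>.sigma_finite_measure_axioms)

lemma measurable_\<Gamma>_pair:
  assumes "\<And>\<gamma>. \<gamma> \<in> \<Gamma> \<Longrightarrow> (\<lambda>z. f (\<gamma>, z)) \<in> measurable M N"
  shows "f \<in> measurable (count_space \<Gamma> \<Otimes>\<^sub>M M) N"
  using countable_\<Gamma> assms by (rule measurable_pair_measure_countable1)

lemma measurable_act: "(\<lambda>(\<gamma>, z). z ** \<gamma>) \<in> measurable (count_space \<Gamma> \<Otimes>\<^sub>M \<mu>) borel"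
  by (rule measurable_\<Gamma>_pair) simp

text \<open>Unfolding as an identity of measures, which makes Fubini available for complex
  integrands, where cancellation matters.\<close>

lemma haar_eq_distr: "haar_SL2 = distr (count_space \<Gamma> \<Otimes>\<^sub>M \<mu>) borel (\<lambda>(\<gamma>, z). z ** \<gamma>)"
proof (rule measure_eqI)
  fix A assume "A \<in> sets haar_SL2"
  then have [measurable]: "A \<in> sets borel" by simp
  note m = measurable_act
  have "emeasure haar_SL2 A = (\<integral>\<^sup>+z. indicator A z \<partial>haar_SL2)" by simp
  also have "\<dots> = (\<integral>\<^sup>+z. \<integral>\<^sup>+\<gamma>. indicator A (z ** \<gamma>) \<partial>count_space \<Gamma> \<partial>\<mu>)"
    by (rule unfold_nn) simp
  also have "\<dots> = (\<integral>\<^sup>+x. indicator A ((\<lambda>(\<gamma>, z). z ** \<gamma>) x) \<partial>(count_space \<Gamma> \<Otimes>\<^sub>M \<mu>))"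
  proof -
    have "(\<lambda>x. indicator A ((\<lambda>(\<gamma>, z). z ** \<gamma>) x) :: ennreal) \<in> borel_measurable (count_space \<Gamma> \<Otimes>\<^sub>M \<mu>)"
      using measurable_compose[OF m borel_measurable_indicator[of A borel]] by simp
    from cp.nn_integral_snd[OF this] show ?thesis by simp
  qed
  also have "\<dots> = (\<integral>\<^sup>+x. indicator A x \<partial>distr (count_space \<Gamma> \<Otimes>\<^sub>M \<mu>) borel (\<lambda>(\<gamma>, z). z ** \<gamma>))"
    by (subst nn_integral_distr[OF m]) auto
  also have "\<dots> = emeasure (distr (count_space \<Gamma> \<Otimes>\<^sub>M \<mu>) borel (\<lambda>(\<gamma>, z). z ** \<gamma>)) A" by simp
  finally show "emeasure haar_SL2 A = emeasure (distr (count_space \<Gamma> \<Otimes>\<^sub>M \<mu>) borel (\<lambda>(\<gamma>, z). z ** \<gamma>)) A" .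
qed simp

text \<open>The absolute value is taken after the summation over \<Gamma>, so the oscillation
  between different lattice translates of one point is kept.\<close>

lemma unfold_norm:
  fixes \<phi> :: "mat2 \<Rightarrow> complex"
  assumes i: "integrable haar_SL2 \<phi>"
  shows "ennreal (norm (\<integral>z. \<phi> z \<partial>haar_SL2)) \<le> (\<integral>\<^sup>+z. ennreal (norm (\<integral>\<gamma>. \<phi> (z ** \<gamma>) \<partial>count_space \<Gamma>)) \<partial>\<mu>)"
proof -
  have [measurable]: "\<phi> \<in> borel_measurable borel" using i by (auto dest: borel_measurable_integrable)
  let ?P = "count_space \<Gamma> \<Otimes>\<^sub>M \<mu>"
  have i': "integrable ?P (\<lambda>(\<gamma>, z). \<phi> (z ** \<gamma>))"
    using i unfolding haar_eq_distr by (subst (asm) integrable_distr_eq[OF measurable_act]) (auto simp: split_beta')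
  have "(\<integral>z. \<phi> z \<partial>haar_SL2) = (\<integral>x. (\<lambda>(\<gamma>, z). \<phi> (z ** \<gamma>)) x \<partial>?P)"
    unfolding haar_eq_distr by (subst integral_distr[OF measurable_act]) (auto simp: split_beta')
  also have "\<dots> = (\<integral>z. \<integral>\<gamma>. \<phi> (z ** \<gamma>) \<partial>count_space \<Gamma> \<partial>\<mu>)"
    by (rule cp.integral_snd[symmetric]) (use i' in simp)
  finally have e: "(\<integral>z. \<phi> z \<partial>haar_SL2) = (\<integral>z. \<integral>\<gamma>. \<phi> (z ** \<gamma>) \<partial>count_space \<Gamma> \<partial>\<mu>)" .
  have "integrable \<mu> (\<lambda>z. \<integral>\<gamma>. \<phi> (z ** \<gamma>) \<partial>count_space \<Gamma>)"
    by (rule cp.integrable_snd) (use i' in simp)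
  then show ?thesis unfolding e by (rule integral_norm_bound_ennreal)
qed

text \<open>Subsets of the quotient, pulled back to matrices. Invariance is demanded on
  \<open>SL2\<close>, which carries the whole Haar measure.\<close>

definition inv_set :: "mat2 set \<Rightarrow> bool" where
  "inv_set A \<longleftrightarrow> A \<in> sets borel \<and> (\<forall>z\<in>SL2. \<forall>\<gamma>\<in>\<Gamma>. z ** \<gamma> \<in> A \<longleftrightarrow> z \<in> A)"

text \<open>A left translate of \<open>F\<close> is again a fundamental domain: once
  \<open>h\<close> has been moved onto the indicator of \<open>F\<close>, unfolding collapses the
  sum over \<Gamma> to 1.\<close>

lemma emeasure_\<mu>_left:
  assumes A: "inv_set A" and h: "h \<in> SL2"
  shows "emeasure \<mu> {z. h ** z \<in> A} = emeasure \<mu> A"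
proof -
  have [measurable]: "A \<in> sets borel" using A by (simp add: inv_set_def)
  have "emeasure \<mu> {z. h ** z \<in> A} = (\<integral>\<^sup>+z. indicator A (h ** z) \<partial>\<mu>)"
  proof -
    have "{z. h ** z \<in> A} = (\<lambda>z. h ** z) -` A \<inter> space borel" by auto
    also have "\<dots> \<in> sets borel" by (rule measurable_sets[OF _ \<open>A \<in> sets borel\<close>]) simp
    finally have "emeasure \<mu> {z. h ** z \<in> A} = (\<integral>\<^sup>+z. indicator {z. h ** z \<in> A} z \<partial>\<mu>)" by simp
    then show ?thesis by (simp add: indicator_def)
  qed
  also have "\<dots> = (\<integral>\<^sup>+z. indicator F (adj h ** (h ** z)) * indicator A (h ** z) \<partial>haar_SL2)"
    using h by (simp add: nn_integral_\<mu>)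
  also have "\<dots> = (\<integral>\<^sup>+z. indicator F (adj h ** z) * indicator A z \<partial>haar_SL2)"
    by (rule nn_integral_haar_left[OF h]) simp
  also have "\<dots> = (\<integral>\<^sup>+z. \<integral>\<^sup>+\<gamma>. indicator F (adj h ** (z ** \<gamma>)) * indicator A (z ** \<gamma>) \<partial>count_space \<Gamma> \<partial>\<mu>)"
    by (rule unfold_nn) simp
  also have "\<dots> = (\<integral>\<^sup>+z. indicator A z \<partial>\<mu>)"
  proof (rule nn_integral_cong_AE, use AE_\<mu>_F in eventually_elim)
    fix z assume "z \<in> F"
    then have z: "z \<in> SL2" using F_sub by auto
    have "(\<integral>\<^sup>+\<gamma>. indicator F (adj h ** (z ** \<gamma>)) * indicator A (z ** \<gamma>) \<partial>count_space \<Gamma>)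
      = (\<integral>\<^sup>+\<gamma>. indicator F (adj h ** z ** \<gamma>) * indicator A z \<partial>count_space \<Gamma>)"
      by (rule nn_integral_cong) (use A z in \<open>auto simp: inv_set_def indicator_def matrix_mul_assoc\<close>)
    also have "\<dots> = indicator A z" using h z by (simp add: nn_integral_multc sum_F')
    finally show "(\<integral>\<^sup>+\<gamma>. indicator F (adj h ** (z ** \<gamma>)) * indicator A (z ** \<gamma>) \<partial>count_space \<Gamma>) = indicator A z" .
  qed
  finally show ?thesis by simp
qed

lemma nn_integral_count_card:
  assumes "finite {\<gamma> \<in> \<Gamma>. P \<gamma>}"
  shows "(\<integral>\<^sup>+\<gamma>. indicator {\<gamma>. P \<gamma>} \<gamma> \<partial>count_space \<Gamma>) = ennreal (card {\<gamma> \<in> \<Gamma>. P \<gamma>})"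
proof -
  have "(\<integral>\<^sup>+\<gamma>. indicator {\<gamma>. P \<gamma>} \<gamma> \<partial>count_space \<Gamma>) = (\<integral>\<^sup>+\<gamma>. indicator {\<gamma> \<in> \<Gamma>. P \<gamma>} \<gamma> \<partial>count_space \<Gamma>)"
    by (rule nn_integral_cong) (auto simp: indicator_def)
  also have "\<dots> = emeasure (count_space \<Gamma>) {\<gamma> \<in> \<Gamma>. P \<gamma>}" by (rule nn_integral_indicator) simp
  also have "\<dots> = of_nat (card {\<gamma> \<in> \<Gamma>. P \<gamma>})" by (rule emeasure_count_space_finite) (use assms in auto)
  finally show ?thesis by (simp add: ennreal_of_nat_eq_real_of_nat)
qed

text \<open>In the unfolded integral a point of the quotient is counted once for each of its lifts
  in \<open>S\<close>, and there are at most \<open>M\<close> of them.\<close>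

lemma emeasure_multiplicity:
  assumes S: "S \<in> sets borel" and A: "inv_set A"
    and m: "\<And>z. z \<in> SL2 \<Longrightarrow> finite {\<gamma> \<in> \<Gamma>. z ** \<gamma> \<in> S} \<and> card {\<gamma> \<in> \<Gamma>. z ** \<gamma> \<in> S} \<le> M"
  shows "emeasure haar_SL2 (S \<inter> A) \<le> of_nat M * emeasure \<mu> A"
proof -
  have [measurable]: "A \<in> sets borel" "S \<in> sets borel" using A S by (simp_all add: inv_set_def)
  have "emeasure haar_SL2 (S \<inter> A) = (\<integral>\<^sup>+z. indicator (S \<inter> A) z \<partial>haar_SL2)" by simp
  also have "\<dots> = (\<integral>\<^sup>+z. \<integral>\<^sup>+\<gamma>. indicator (S \<inter> A) (z ** \<gamma>) \<partial>count_space \<Gamma> \<partial>\<mu>)" by (rule unfold_nn) simp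
  also have "\<dots> \<le> (\<integral>\<^sup>+z. of_nat M * indicator A z \<partial>\<mu>)"
  proof (rule nn_integral_mono_AE, use AE_\<mu>_F in eventually_elim)
    fix z assume "z \<in> F"
    then have z: "z \<in> SL2" using F_sub by auto
    have "(\<integral>\<^sup>+\<gamma>. indicator (S \<inter> A) (z ** \<gamma>) \<partial>count_space \<Gamma>) =
       (\<integral>\<^sup>+\<gamma>. indicator {\<gamma>. z ** \<gamma> \<in> S} \<gamma> * indicator A z \<partial>count_space \<Gamma>)"
      by (rule nn_integral_cong) (use A z in \<open>auto simp: inv_set_def indicator_def\<close>)
    also have "\<dots> = ennreal (card {\<gamma> \<in> \<Gamma>. z ** \<gamma> \<in> S}) * indicator A z"
      using m[OF z] by (simp add: nn_integral_multc nn_integral_count_card)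
    also have "\<dots> \<le> of_nat M * indicator A z"
      using m[OF z] by (intro mult_right_mono) (auto simp: ennreal_of_nat_eq_real_of_nat)
    finally show "(\<integral>\<^sup>+\<gamma>. indicator (S \<inter> A) (z ** \<gamma>) \<partial>count_space \<Gamma>) \<le> of_nat M * indicator A z" .
  qed
  also have "\<dots> = of_nat M * emeasure \<mu> A" by (simp add: nn_integral_cmult)
  finally show ?thesis .
qed

text \<open>Conjugation by \<open>dg (sqrt T)\<close> shrinks the horocycle piece of length \<open>T\<close> through \<open>g\<close> to unit size, so
  \<open>return_set g T\<close> bounds how often that piece, thickened by \<open>1 / T\<close> across, overlaps itself modulo \<open>\<Gamma>\<close>.
  The radius 100 is \<open>10\<^sup>2\<close> with 10 from \<open>nm_low_U_bound\<close>.\<close>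

definition return_set :: "mat2 \<Rightarrow> real \<Rightarrow> mat2 set" where
  "return_set g T = {\<gamma> \<in> \<Gamma>. nm (adj (dg (sqrt T)) ** g ** \<gamma> ** adj g ** dg (sqrt T)) \<le> 100}"

lemma finite_return_set: assumes "g \<in> SL2" "T > 0" shows "finite (return_set g T)"
proof (rule finite_subset[OF _ finite_ball])
  define h where "h = adj (dg (sqrt T)) ** g"
  have h: "h \<in> SL2" using assms by (simp add: h_def)
  show "return_set g T \<subseteq> {\<gamma> \<in> \<Gamma>. nm \<gamma> \<le> nm h * 100 * nm h}"
  proof
    fix \<gamma> assume "\<gamma> \<in> return_set g T"
    then have g: "\<gamma> \<in> \<Gamma>" "nm (h ** \<gamma> ** adj h) \<le> 100"
      by (auto simp: return_set_def h_def adj_mult matrix_mul_assoc)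
    have "\<gamma> = adj h ** (h ** \<gamma> ** adj h) ** h" using h by (simp add: matrix_mul_assoc[symmetric])
    then have "nm \<gamma> \<le> nm (adj h ** (h ** \<gamma> ** adj h)) * nm h" by (metis nm_mult)
    also have "\<dots> \<le> (nm (adj h) * nm (h ** \<gamma> ** adj h)) * nm h" by (intro mult_right_mono nm_mult) simp
    also have "\<dots> \<le> (nm h * 100) * nm h" using g by (intro mult_right_mono mult_mono) auto
    finally show "\<gamma> \<in> {\<gamma> \<in> \<Gamma>. nm \<gamma> \<le> nm h * 100 * nm h}" using g by simp
  qed
qed

text \<open>A cell of the thickened orbit. The offset \<open>r0\<close> is free because a common
  left factor \<open>low r0 1\<close> cancels from the quotient of two points of the cell.\<close>

definition box :: "mat2 \<Rightarrow> real \<Rightarrow> real \<Rightarrow> mat2 set" where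
  "box g T r0 = {low r a ** U t ** g | r a t. r0 \<le> r \<and> r \<le> r0 + 1 / T \<and> 1 \<le> a \<and> a \<le> 2 \<and> \<bar>t\<bar> \<le> T}"

lemma nm_low_U_bound:
  assumes "0 \<le> r" "r \<le> 1" "1 \<le> a" "a \<le> 2" "\<bar>t\<bar> \<le> 1"
  shows "nm (low r a ** U t) \<le> 10"
proof -
  have "\<bar>a * t\<bar> \<le> 2 * 1" "\<bar>r * a\<bar> \<le> 1 * 2" unfolding abs_mult using assms by (intro mult_mono; simp)+
  moreover have "\<bar>r * a * t\<bar> \<le> 2 * 1" unfolding abs_mult[of "r * a"] using assms calculation(2) by (intro mult_mono) auto
  moreover have "\<bar>1 / a\<bar> \<le> 1" using assms by simp
  ultimately have "\<bar>r * a * t + 1 / a\<bar> \<le> 3" using abs_triangle_ineq[of "r * a * t" "1 / a"] by linarith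
  moreover have "\<bar>a\<bar> \<le> 2" using assms by simp
  ultimately show ?thesis unfolding low_U nm_mk
    using \<open>\<bar>a * t\<bar> \<le> 2 * 1\<close> \<open>\<bar>r * a\<bar> \<le> 1 * 2\<close> by linarith
qed

text \<open>Once a lift \<open>z ** \<gamma>1\<close> in the cell is fixed, every other lift differs
  from it by a lattice element whose conjugate is a quotient of two matrices of norm at most 10,
  hence by an element of \<open>return_set\<close>; the assignment is injective.\<close>

lemma box_card:
  assumes g: "g \<in> SL2" and T: "T > 0" and z: "z \<in> SL2"
  shows "finite {\<gamma> \<in> \<Gamma>. z ** \<gamma> \<in> box g T r0} \<and> card {\<gamma> \<in> \<Gamma>. z ** \<gamma> \<in> box g T r0} \<le> card (return_set g T)"
proof (cases "{\<gamma> \<in> \<Gamma>. z ** \<gamma> \<in> box g T r0} = {}")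
  case False
  define d where "d = dg (sqrt T)"
  have d: "d \<in> SL2" using T by (simp add: d_def)
  have key: "\<exists>c \<in> SL2. nm c \<le> 10 \<and> z ** \<gamma> = low r0 1 ** (d ** (c ** (adj d ** g)))" if "z ** \<gamma> \<in> box g T r0" for \<gamma>
  proof -
    from that obtain r a t where e: "z ** \<gamma> = low r a ** U t ** g" and r: "r0 \<le> r" "r \<le> r0 + 1 / T" "1 \<le> a" "a \<le> 2" "\<bar>t\<bar> \<le> T"
      by (auto simp: box_def)
    define c where "c = low ((r - r0) * T) a ** U (t / T)"
    have s: "sqrt T * sqrt T = T" using T by simp
    \<comment> \<open>Conjugation by \<open>d\<close> divides the lower left entry by T and
      multiplies the upper right entry by T.\<close>
    have "low r a ** U t = low r0 1 ** (d ** c ** adj d)"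
      using T r by (simp add: low_U c_def d_def, simp add: low_def, simp add: field_simps s)
    then have "z ** \<gamma> = low r0 1 ** (d ** (c ** (adj d ** g)))" by (simp add: e matrix_mul_assoc)
    moreover have "nm c \<le> 10" unfolding c_def using r T by (intro nm_low_U_bound) (auto simp: field_simps)
    moreover have "c \<in> SL2" using r by (simp add: c_def)
    ultimately show ?thesis by blast
  qed
  from False obtain \<gamma>1 where \<gamma>1: "\<gamma>1 \<in> \<Gamma>" "z ** \<gamma>1 \<in> box g T r0" by blast
  obtain c1 where c1: "c1 \<in> SL2" "nm c1 \<le> 10" "z ** \<gamma>1 = low r0 1 ** (d ** (c1 ** (adj d ** g)))"
    using key[OF \<gamma>1(2)] by blast
  have im: "(\<lambda>\<gamma>. adj \<gamma>1 ** \<gamma>) ` {\<gamma> \<in> \<Gamma>. z ** \<gamma> \<in> box g T r0} \<subseteq> return_set g T"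
  proof clarify
    fix \<gamma> assume \<gamma>: "\<gamma> \<in> \<Gamma>" "z ** \<gamma> \<in> box g T r0"
    obtain c where c: "c \<in> SL2" "nm c \<le> 10" "z ** \<gamma> = low r0 1 ** (d ** (c ** (adj d ** g)))"
      using key[OF \<gamma>(2)] by blast
    have "adj \<gamma>1 ** \<gamma> = adj (z ** \<gamma>1) ** (z ** \<gamma>)"
      using z by (simp add: adj_mult matrix_mul_assoc[symmetric])
    also have "\<dots> = adj g ** (d ** (adj c1 ** (c ** (adj d ** g))))"
      using d g c c1 by (simp add: adj_mult matrix_mul_assoc[symmetric])
    finally have "adj d ** g ** (adj \<gamma>1 ** \<gamma>) ** adj g ** d = adj c1 ** c"
      using d g by (simp add: matrix_mul_assoc[symmetric])
    moreover have "nm (adj c1 ** c) \<le> 10 * 10"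
      using c c1 by (intro order_trans[OF nm_mult] mult_mono) auto
    ultimately show "adj \<gamma>1 ** \<gamma> \<in> return_set g T"
      using \<gamma> \<gamma>1 by (simp add: return_set_def d_def mult_in adj_in)
  qed
  have inj: "inj_on (\<lambda>\<gamma>. adj \<gamma>1 ** \<gamma>) {\<gamma> \<in> \<Gamma>. z ** \<gamma> \<in> box g T r0}"
  proof (rule inj_onI)
    fix x y assume "adj \<gamma>1 ** x = adj \<gamma>1 ** y"
    then have "\<gamma>1 ** (adj \<gamma>1 ** x) = \<gamma>1 ** (adj \<gamma>1 ** y)" by simp
    then show "x = y" using \<gamma>1 by simp
  qed
  show ?thesis
    using card_inj_on_le[OF inj im finite_return_set[OF g T]] inj_on_finite[OF inj im finite_return_set[OF g T]] by blast
next
  case True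
  show ?thesis unfolding True by simp
qed

end

section \<open>Quadratic exponential sums\<close>

lemma cis_poly_deriv:
  "((\<lambda>m. cis (A * m + B * m\<^sup>2)) has_vector_derivative (\<i> * of_real (A + 2 * B * m) * cis (A * m + B * m\<^sup>2))) (at m within S)"
proof -
  have "((\<lambda>m. A * m + B * m\<^sup>2) has_real_derivative (A + 2 * B * m)) (at m within S)"
    by (auto intro!: derivative_eq_intros)
  then have "((\<lambda>m. \<i> * complex_of_real (A * m + B * m\<^sup>2)) has_vector_derivative (\<i> * of_real (A + 2 * B * m))) (at m within S)"
    by (intro has_vector_derivative_mult_right has_vector_derivative_of_real)
  from field_vector_diff_chain_within[OF this DERIV_subset[OF DERIV_exp subset_UNIV]]
  show ?thesis by (simp add: cis_conv_exp o_def)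
qed

lemma cis_quadratic_continuous: "continuous_on S (\<lambda>m. cis (A * m + B * m\<^sup>2))"
  by (intro continuous_intros)

text \<open>Integration by parts against the reciprocal of the phase derivative. That derivative is
  affine and keeps its sign, so its reciprocal is monotone and only endpoint values appear: two
  boundary terms and one variation of size \<open>2 / l\<close> make up the 4.\<close>

lemma first_derivative_test:
  assumes ab: "a \<le> b" and l: "l > 0" and P: "\<And>m. a \<le> m \<Longrightarrow> m \<le> b \<Longrightarrow> l \<le> \<bar>A + 2 * B * m\<bar>"
  shows "norm (integral {a..b} (\<lambda>m. cis (A * m + B * m\<^sup>2))) \<le> 4 / l"
proof -
  define p where "p m = A + 2 * B * m" for m
  have p0: "p m \<noteq> 0" if "m \<in> {a..b}" for m using P[of m] that l by (auto simp: p_def)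
  define G where "G m = cis (A * m + B * m\<^sup>2) / (\<i> * of_real (p m))" for m
  define R where "R m = cis (A * m + B * m\<^sup>2) * of_real (2 * B / (p m)\<^sup>2) / \<i>" for m
  have dp: "(p has_vector_derivative (2 * B)) (at m within S)" for m S
    unfolding p_def has_real_derivative_iff_has_vector_derivative[symmetric] by (auto intro!: derivative_eq_intros)
  have dG: "(G has_vector_derivative (cis (A * m + B * m\<^sup>2) - R m)) (at m within {a..b})" if "m \<in> {a..b}" for m
  proof -
    have "((\<lambda>m. inverse (p m)) has_real_derivative (- (2 * B) / (p m)\<^sup>2)) (at m within {a..b})"
      using dp[unfolded has_real_derivative_iff_has_vector_derivative[symmetric]] p0[OF that]
      by (auto intro!: derivative_eq_intros simp: power2_eq_square field_simps)
    then have "((\<lambda>m. complex_of_real (inverse (p m))) has_vector_derivative (of_real (- (2 * B) / (p m)\<^sup>2))) (at m within {a..b})"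
      using has_vector_derivative_of_real by blast
    from has_vector_derivative_mult[OF cis_poly_deriv this]
    have "((\<lambda>m. cis (A * m + B * m\<^sup>2) * of_real (inverse (p m)) / \<i>) has_vector_derivative
       ((cis (A * m + B * m\<^sup>2) * of_real (- (2 * B) / (p m)\<^sup>2) + \<i> * of_real (A + 2 * B * m) * cis (A * m + B * m\<^sup>2) * of_real (inverse (p m))) / \<i>)) (at m within {a..b})"
      by (rule has_vector_derivative_divide)
    moreover have "(cis (A * m + B * m\<^sup>2) * of_real (- (2 * B) / (p m)\<^sup>2) + \<i> * of_real (A + 2 * B * m) * cis (A * m + B * m\<^sup>2) * of_real (inverse (p m))) / \<i>
       = cis (A * m + B * m\<^sup>2) - R m"
      unfolding R_def p_def[symmetric] using p0[OF that] by (simp add: field_simps)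
    moreover have "(\<lambda>m. cis (A * m + B * m\<^sup>2) * of_real (inverse (p m)) / \<i>) = G"
      by (rule ext) (simp add: G_def divide_inverse)
    ultimately show ?thesis by simp
  qed
  have iG: "((\<lambda>m. cis (A * m + B * m\<^sup>2) - R m) has_integral (G b - G a)) {a..b}"
    by (rule fundamental_theorem_of_calculus[OF ab]) (use dG in auto)
  have ic: "(\<lambda>m. cis (A * m + B * m\<^sup>2)) integrable_on {a..b}"
    by (intro integrable_continuous_interval cis_quadratic_continuous)
  have iR: "R integrable_on {a..b}"
    using integrable_diff[OF ic has_integral_integrable[OF iG]] by simp
  have "((\<lambda>m. 2 * B / (p m)\<^sup>2) has_integral (- inverse (p b) - (- inverse (p a)))) {a..b}"
  proof (rule fundamental_theorem_of_calculus[OF ab])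
    fix m assume m: "m \<in> {a..b}"
    show "((\<lambda>m. - inverse (p m)) has_vector_derivative 2 * B / (p m)\<^sup>2) (at m within {a..b})"
      using dp[unfolded has_real_derivative_iff_has_vector_derivative[symmetric]] p0[OF m]
      unfolding has_real_derivative_iff_has_vector_derivative[symmetric]
      by (auto intro!: derivative_eq_intros simp: power2_eq_square field_simps)
  qed
  \<comment> \<open>The sign \<open>|B| / B\<close> makes the integrand nonnegative. For B = 0 the
    quotient is 0, in agreement with \<open>R\<close>.\<close>
  then have h: "((\<lambda>m. \<bar>B\<bar> / B * (2 * B / (p m)\<^sup>2)) has_integral (\<bar>B\<bar> / B * (inverse (p a) - inverse (p b)))) {a..b}"
    by (intro has_integral_mult_right) simp
  have inv: "\<bar>inverse (p m)\<bar> \<le> 1 / l" if "m \<in> {a..b}" for m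
  proof -
    have "l \<le> \<bar>p m\<bar>" using P[of m] that by (simp add: p_def)
    then have "inverse \<bar>p m\<bar> \<le> inverse l" using l by (rule le_imp_inverse_le)
    then show ?thesis by (simp add: abs_inverse inverse_eq_divide)
  qed
  have "norm (integral {a..b} R) \<le> integral {a..b} (\<lambda>m. \<bar>B\<bar> / B * (2 * B / (p m)\<^sup>2))"
  proof (rule integral_norm_bound_integral[OF iR])
    show "(\<lambda>m. \<bar>B\<bar> / B * (2 * B / (p m)\<^sup>2)) integrable_on {a..b}" using h by blast
    fix m assume "m \<in> {a..b}"
    show "norm (R m) \<le> \<bar>B\<bar> / B * (2 * B / (p m)\<^sup>2)"
      by (cases "B = 0") (auto simp: R_def norm_mult norm_divide norm_power mult.commute)
  qed
  also have "\<dots> = \<bar>B\<bar> / B * (inverse (p a) - inverse (p b))" using h by (rule integral_unique)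
  also have "\<dots> \<le> \<bar>inverse (p a) - inverse (p b)\<bar>"
    by (cases "B > 0"; cases "B = 0") (auto simp: abs_if)
  also have "\<dots> \<le> \<bar>inverse (p a)\<bar> + \<bar>inverse (p b)\<bar>" by (rule abs_triangle_ineq4)
  also have "\<dots> \<le> 1 / l + 1 / l" using inv[of a] inv[of b] ab by (intro add_mono) auto
  also have "\<dots> = 2 / l" by simp
  finally have nR: "norm (integral {a..b} R) \<le> 2 / l" .
  have nG: "norm (G m) \<le> 1 / l" if "m \<in> {a..b}" for m
    using inv[OF that] by (simp add: G_def norm_divide norm_mult abs_inverse inverse_eq_divide)
  have "integral {a..b} (\<lambda>m. cis (A * m + B * m\<^sup>2) - R m) = G b - G a" using iG by (rule integral_unique)
  then have "integral {a..b} (\<lambda>m. cis (A * m + B * m\<^sup>2)) = G b - G a + integral {a..b} R"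
    using ic iR by (simp add: Henstock_Kurzweil_Integration.integral_diff diff_eq_eq)
  then have "norm (integral {a..b} (\<lambda>m. cis (A * m + B * m\<^sup>2))) \<le> norm (G b) + norm (G a) + norm (integral {a..b} R)"
    by (metis add_right_mono norm_triangle_ineq norm_triangle_ineq4 order_trans)
  also have "\<dots> \<le> 1 / l + 1 / l + 2 / l" using nG[of a] nG[of b] nR ab by (intro add_mono) auto
  finally show ?thesis by simp
qed

lemma norm_integral_cis_le:
  assumes "a \<le> b"
  shows "norm (integral {a..b} (\<lambda>m. cis (A * m + B * m\<^sup>2))) \<le> b - a"
proof -
  have "norm (integral {a..b} (\<lambda>m. cis (A * m + B * m\<^sup>2))) \<le> 1 * (b - a)"
    by (rule integral_bound[OF assms]) (auto intro!: cis_quadratic_continuous)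
  then show ?thesis by simp
qed

text \<open>If the linear term dominates, the derivative bound \<open>8 / D\<close> and the trivial
  bound \<open>L\<close> are combined by their geometric mean. Otherwise a neighbourhood of the
  stationary point is cut out. The maximum in the hypothesis suits pairs of phases of which it is
  known only that one of the two coefficients differs.\<close>

lemma quadratic_exp_bound:
  assumes L: "L > 0" and D: "D > 0" and AB: "D \<le> max \<bar>A\<bar> (\<bar>B\<bar> * L)"
  shows "norm (integral {0..L} (\<lambda>m. cis (A * m + B * m\<^sup>2))) \<le> 12 * sqrt (L / D)"
proof (cases "\<bar>B\<bar> * L \<le> \<bar>A\<bar> / 4")
  case True
  then have A: "D \<le> \<bar>A\<bar>" using AB by auto
  let ?I = "norm (integral {0..L} (\<lambda>m. cis (A * m + B * m\<^sup>2)))"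
  have "?I \<le> 4 / (D / 2)"
  proof (rule first_derivative_test)
    fix m assume m: "0 \<le> m" "m \<le> L"
    have "\<bar>2 * B * m\<bar> \<le> 2 * (\<bar>B\<bar> * L)" unfolding abs_mult using m by (simp add: mult_left_mono)
    then have "\<bar>2 * B * m\<bar> \<le> \<bar>A\<bar> / 2" using True by linarith
    then show "D / 2 \<le> \<bar>A + 2 * B * m\<bar>" using A by linarith
  qed (use L D in auto)
  moreover have "?I \<le> L" using norm_integral_cis_le[of 0 L] L by simp
  ultimately have "?I * ?I \<le> 8 / D * L" using D by (intro mult_mono) auto
  then have "?I \<le> sqrt (8 / D * L)" by (simp add: real_le_rsqrt power2_eq_square)
  also have "\<dots> \<le> sqrt (144 * (L / D))" using L D by (intro real_sqrt_le_mono) (simp add: field_simps)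
  also have "\<dots> = 12 * sqrt (L / D)"
    using real_sqrt_unique[of 12 144] by (simp only: real_sqrt_mult) simp
  finally show ?thesis .
next
  case False
  then have BL: "\<bar>B\<bar> * L \<ge> D / 4" using AB D by auto
  then have B: "\<bar>B\<bar> > 0" using D L by (cases "B = 0") auto
  define m0 where "m0 = - A / (2 * B)"
  \<comment> \<open>At this radius the trivial bound for the middle piece and the derivative bounds
    for the outer ones have the same size \<open>2 / sqrt |B|\<close>.\<close>
  define \<eta> where "\<eta> = 1 / sqrt \<bar>B\<bar>"
  have \<eta>: "\<eta> > 0" using B by (simp add: \<eta>_def)
  have p: "\<bar>A + 2 * B * m\<bar> = 2 * \<bar>B\<bar> * \<bar>m - m0\<bar>" for m
  proof -
    have "A + 2 * B * m = 2 * B * (m - m0)" using B by (simp add: m0_def field_simps)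
    then show ?thesis by (simp add: abs_mult)
  qed
  have Bs: "\<bar>B\<bar> * \<eta> = sqrt \<bar>B\<bar>" using B by (simp add: \<eta>_def real_div_sqrt)
  define c1 where "c1 = max 0 (min L (m0 - \<eta>))"
  define c2 where "c2 = max 0 (min L (m0 + \<eta>))"
  have c: "0 \<le> c1" "c1 \<le> c2" "c2 \<le> L" using \<eta> L by (auto simp: c1_def c2_def)
  have c21: "c2 - c1 \<le> 2 * \<eta>" using \<eta> by (auto simp: c1_def c2_def)
  let ?f = "\<lambda>m. cis (A * m + B * m\<^sup>2)"
  have 1: "norm (integral {0..c1} ?f) \<le> 4 / (2 * sqrt \<bar>B\<bar>)"
  proof (cases "c1 = 0")
    case False
    show ?thesis
    proof (rule first_derivative_test)
      fix m assume "0 \<le> m" "m \<le> c1"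
      then have "\<bar>m - m0\<bar> \<ge> \<eta>" using False by (auto simp: c1_def max_def min_def split: if_splits)
      then have "2 * (\<bar>B\<bar> * \<eta>) \<le> 2 * (\<bar>B\<bar> * \<bar>m - m0\<bar>)" by (simp add: mult_left_mono)
      then show "2 * sqrt \<bar>B\<bar> \<le> \<bar>A + 2 * B * m\<bar>" unfolding p Bs by simp
    qed (use B c in auto)
  qed simp
  have 2: "norm (integral {c2..L} ?f) \<le> 4 / (2 * sqrt \<bar>B\<bar>)"
  proof (cases "c2 = L")
    case False
    show ?thesis
    proof (rule first_derivative_test)
      fix m assume "c2 \<le> m" "m \<le> L"
      then have "\<bar>m - m0\<bar> \<ge> \<eta>" using False by (auto simp: c2_def max_def min_def split: if_splits)
      then have "2 * (\<bar>B\<bar> * \<eta>) \<le> 2 * (\<bar>B\<bar> * \<bar>m - m0\<bar>)" by (simp add: mult_left_mono)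
      then show "2 * sqrt \<bar>B\<bar> \<le> \<bar>A + 2 * B * m\<bar>" unfolding p Bs by simp
    qed (use B c in auto)
  qed simp
  have 3: "norm (integral {c1..c2} ?f) \<le> 2 * \<eta>"
    using norm_integral_cis_le[OF c(2), of A B] c21 by linarith
  have i: "?f integrable_on {x..y}" for x y by (intro integrable_continuous_interval cis_quadratic_continuous)
  have "integral {0..L} ?f = integral {0..c1} ?f + integral {c1..c2} ?f + integral {c2..L} ?f"
    using Henstock_Kurzweil_Integration.integral_combine[OF c(1) order_trans[OF c(2,3)] i]
      Henstock_Kurzweil_Integration.integral_combine[OF c(2,3) i] by (simp add: add.assoc)
  then have "norm (integral {0..L} ?f) \<le> norm (integral {0..c1} ?f) + norm (integral {c1..c2} ?f) + norm (integral {c2..L} ?f)"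
    by (simp only:) (rule order_trans[OF norm_triangle_ineq add_right_mono[OF norm_triangle_ineq]])
  also have "\<dots> \<le> 4 / (2 * sqrt \<bar>B\<bar>) + 2 * \<eta> + 4 / (2 * sqrt \<bar>B\<bar>)" by (intro add_mono 1 2 3)
  also have "\<dots> = 12 * (1 / sqrt (\<bar>B\<bar> * 4))" using B by (simp add: \<eta>_def real_sqrt_mult)
  also have "\<dots> \<le> 12 * sqrt (L / D)"
  proof -
    have "1 / (\<bar>B\<bar> * 4) \<le> L / D" using BL B D by (simp add: field_simps)
    then have "sqrt (1 / (\<bar>B\<bar> * 4)) \<le> sqrt (L / D)" by (rule real_sqrt_le_mono)
    then show ?thesis by (simp add: real_sqrt_divide)
  qed
  finally show ?thesis .
qed

text \<open>Cauchy--Schwarz in m, then opening the square: as the coefficients are bounded by 1, the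
  row sums of the matrix of pairwise correlations control the whole double sum.\<close>

lemma dual_large_sieve:
  fixes L E :: real and c :: "'i \<Rightarrow> complex"
  assumes I: "finite I" and L: "L > 0" and c: "\<And>i. i \<in> I \<Longrightarrow> norm (c i) \<le> 1"
    and K: "\<And>i. i \<in> I \<Longrightarrow> (\<Sum>j\<in>I. norm (integral {0..L} (\<lambda>m. cis ((A i - A j) * m + (B i - B j) * m\<^sup>2)))) \<le> E"
  shows "integral {0..L} (\<lambda>m. norm (\<Sum>i\<in>I. c i * cis (A i * m + B i * m\<^sup>2))) \<le> sqrt (L * (card I * E))"
proof (cases "I = {}")
  case False
  define S where "S m = (\<Sum>i\<in>I. c i * cis (A i * m + B i * m\<^sup>2))" for m
  have contS: "continuous_on X S" for X unfolding S_def by (intro continuous_intros)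
  let ?K = "\<lambda>i j. integral {0..L} (\<lambda>m. cis ((A i - A j) * m + (B i - B j) * m\<^sup>2))"
  have sq: "complex_of_real ((norm (S m))\<^sup>2) = (\<Sum>i\<in>I. \<Sum>j\<in>I. c i * cnj (c j) * cis ((A i - A j) * m + (B i - B j) * m\<^sup>2))" for m
  proof -
    have "complex_of_real ((norm (S m))\<^sup>2) = S m * cnj (S m)" by (metis complex_norm_square)
    also have "\<dots> = (\<Sum>i\<in>I. \<Sum>j\<in>I. (c i * cis (A i * m + B i * m\<^sup>2)) * (cnj (c j) * cnj (cis (A j * m + B j * m\<^sup>2))))"
      unfolding S_def by (simp add: sum_product)
    also have "\<dots> = (\<Sum>i\<in>I. \<Sum>j\<in>I. c i * cnj (c j) * cis ((A i - A j) * m + (B i - B j) * m\<^sup>2))"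
    proof (intro sum.cong refl)
      fix i j
      have "cis (A i * m + B i * m\<^sup>2) * cnj (cis (A j * m + B j * m\<^sup>2)) = cis ((A i - A j) * m + (B i - B j) * m\<^sup>2)"
        by (simp add: cis_cnj cis_mult algebra_simps)
      then show "(c i * cis (A i * m + B i * m\<^sup>2)) * (cnj (c j) * cnj (cis (A j * m + B j * m\<^sup>2))) = c i * cnj (c j) * cis ((A i - A j) * m + (B i - B j) * m\<^sup>2)"
        by (metis (no_types, lifting) mult.assoc mult.left_commute)
    qed
    finally show ?thesis .
  qed
  define Q where "Q = card I * E"
  have "complex_of_real (integral {0..L} (\<lambda>m. (norm (S m))\<^sup>2)) = integral {0..L} (\<lambda>m. complex_of_real ((norm (S m))\<^sup>2))"
    by (rule integral_linear[OF _ bounded_linear_of_real, unfolded o_def, symmetric])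
       (intro integrable_continuous_interval continuous_intros contS)
  also have "\<dots> = (\<Sum>i\<in>I. \<Sum>j\<in>I. c i * cnj (c j) * ?K i j)"
    unfolding sq
    by (subst Henstock_Kurzweil_Integration.integral_sum[OF I], (intro integrable_continuous_interval continuous_intros; fail),
        intro sum.cong refl, subst Henstock_Kurzweil_Integration.integral_sum[OF I])
       (auto intro!: integrable_continuous_interval continuous_intros)
  finally have "norm (complex_of_real (integral {0..L} (\<lambda>m. (norm (S m))\<^sup>2))) \<le> (\<Sum>i\<in>I. \<Sum>j\<in>I. norm (c i * cnj (c j) * ?K i j))"
    by (simp only:) (intro order_trans[OF norm_sum] sum_mono norm_sum)
  also have "\<dots> \<le> (\<Sum>i\<in>I. \<Sum>j\<in>I. norm (?K i j))"
  proof (intro sum_mono)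
    fix i j assume "i \<in> I" "j \<in> I"
    then have "norm (c i) * norm (c j) \<le> 1 * 1" by (intro mult_mono c) auto
    then show "norm (c i * cnj (c j) * ?K i j) \<le> norm (?K i j)"
      by (simp add: norm_mult mult_left_le_one_le)
  qed
  also have "\<dots> \<le> (\<Sum>i\<in>I. E)" by (intro sum_mono K)
  finally have "norm (complex_of_real (integral {0..L} (\<lambda>m. (norm (S m))\<^sup>2))) \<le> Q" by (simp add: Q_def)
  then have i2: "integral {0..L} (\<lambda>m. (norm (S m))\<^sup>2) \<le> Q" by (simp add: norm_of_real)
  obtain i where i: "i \<in> I" using False by blast
  \<comment> \<open>The diagonal correlation equals \<open>L\<close>, which forces E > 0.\<close>
  have "L = norm (?K i i)" using L by simp
  also have "\<dots> \<le> (\<Sum>j\<in>I. norm (?K i j))" by (rule member_le_sum) (use i I in auto)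
  also have "\<dots> \<le> E" using K i by simp
  finally have "E > 0" using L by simp
  then have Q: "Q > 0" using False I by (simp add: Q_def card_gt_0_iff)
  define l where "l = sqrt (Q / L)"
  have l: "l > 0" using Q L by (simp add: l_def)
  \<comment> \<open>Cauchy--Schwarz in the form x <= l / 2 + x^2 / (2 l), where \<open>l\<close> is
    the root mean square bound for the sum.\<close>
  have "integral {0..L} (\<lambda>m. norm (S m)) \<le> integral {0..L} (\<lambda>m. l / 2 + (norm (S m))\<^sup>2 * (1 / (2 * l)))"
  proof (rule integral_le)
    fix m
    have "0 \<le> (l - norm (S m))\<^sup>2" by simp
    then have "2 * l * norm (S m) \<le> l\<^sup>2 + (norm (S m))\<^sup>2" by (simp add: power2_diff algebra_simps)
    then show "norm (S m) \<le> l / 2 + (norm (S m))\<^sup>2 * (1 / (2 * l))" using l by (simp add: field_simps power2_eq_square)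
  qed (use l in \<open>auto intro!: integrable_continuous_interval continuous_intros contS\<close>)
  also have "\<dots> = l / 2 * L + integral {0..L} (\<lambda>m. (norm (S m))\<^sup>2) * (1 / (2 * l))"
    using L l by (subst Henstock_Kurzweil_Integration.integral_add)
      (auto intro!: integrable_continuous_interval continuous_intros contS)
  also have "\<dots> \<le> l / 2 * L + Q * (1 / (2 * l))" using i2 l by (intro add_left_mono mult_right_mono) auto
  also have "\<dots> = sqrt (L * Q)"
  proof -
    have "l * L = sqrt (L * Q)" using L Q by (simp add: l_def real_sqrt_divide real_sqrt_mult field_simps)
    moreover have "Q / l = sqrt (L * Q)" using L Q by (simp add: l_def real_sqrt_divide real_sqrt_mult field_simps)
    ultimately show ?thesis by (simp add: field_simps)
  qed
  finally show ?thesis by (simp add: S_def Q_def)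
qed simp

lemma sum_inverse_sqrt: "(\<Sum>d=1..n. 1 / sqrt (real d)) \<le> 2 * sqrt (real n)"
proof (induction n)
  case (Suc n)
  have s: "sqrt (real (Suc n)) > 0" by simp
  have "sqrt (real n) * sqrt (real (Suc n)) \<le> (real n + real (Suc n)) / 2"
    using arith_geo_mean_sqrt[of "real n" "real (Suc n)"] by (simp add: real_sqrt_mult)
  then have "1 + 2 * (sqrt (real n) * sqrt (real (Suc n))) \<le> 2 * (sqrt (real (Suc n)) * sqrt (real (Suc n)))" by simp
  then have "1 / sqrt (real (Suc n)) + 2 * sqrt (real n) \<le> 2 * sqrt (real (Suc n))"
    using s by (simp add: field_simps)
  then show ?case using Suc by simp
qed simp

text \<open>Each distance from \<open>k0\<close> occurs at most twice, once on either side.\<close>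

lemma sum_abs_diff_le:
  fixes h :: "nat \<Rightarrow> real"
  assumes "\<And>d. 0 \<le> h d" "k0 \<le> J"
  shows "(\<Sum>k\<le>J. h (nat \<bar>int k - int k0\<bar>)) \<le> 2 * (\<Sum>d\<le>J. h d)"
proof -
  have "{..J} = {..<k0} \<union> {k0..J}" using assms by auto
  then have "(\<Sum>k\<le>J. h (nat \<bar>int k - int k0\<bar>)) = (\<Sum>k<k0. h (nat \<bar>int k - int k0\<bar>)) + (\<Sum>k=k0..J. h (nat \<bar>int k - int k0\<bar>))"
    by (simp only:) (rule sum.union_disjoint, auto)
  also have "(\<Sum>k<k0. h (nat \<bar>int k - int k0\<bar>)) = (\<Sum>k<k0. h (k0 - k))"
    by (rule sum.cong) (auto intro!: arg_cong[of _ _ h])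
  also have "\<dots> = sum h ((\<lambda>k. k0 - k) ` {..<k0})" by (rule sum.reindex_cong[symmetric, where l = "\<lambda>k. k0 - k"]) (auto simp: inj_on_def)
  also have "\<dots> \<le> (\<Sum>d\<le>J. h d)" using assms by (intro sum_mono2) auto
  also have "(\<Sum>k=k0..J. h (nat \<bar>int k - int k0\<bar>)) = (\<Sum>k=k0..J. h (k - k0))"
    by (rule sum.cong) (auto intro!: arg_cong[of _ _ h])
  also have "\<dots> = sum h ((\<lambda>k. k - k0) ` {k0..J})" by (rule sum.reindex_cong[symmetric, where l = "\<lambda>k. k - k0"]) (auto simp: inj_on_def)
  also have "\<dots> \<le> (\<Sum>d\<le>J. h d)" using assms by (intro sum_mono2) auto
  finally show ?thesis by simp
qed

text \<open>The points are sorted into cells of length \<open>1 / T\<close> holding at most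
  \<open>M\<close> each. Points that are d cells apart have distance at least
  \<open>(d - 1) / T\<close>, and summing \<open>1 / sqrt (d - 1)\<close> over at most
  \<open>\<rho> * T\<close> cells gives the square root in the bound.\<close>

lemma spaced_sum:
  fixes L T \<theta> \<rho> :: real and r k :: "'i \<Rightarrow> real"
  assumes I: "finite I" and L: "L > 0" and T: "T > 0" and th: "\<theta> > 0" and \<rho>: "\<rho> \<ge> 0"
    and r: "\<And>i. i \<in> I \<Longrightarrow> 0 \<le> r i \<and> r i \<le> \<rho>"
    and cell: "\<And>r0. card {i \<in> I. r0 \<le> r i \<and> r i \<le> r0 + 1 / T} \<le> M"
    and i: "i \<in> I"
    and k1: "\<And>j. j \<in> I \<Longrightarrow> k j \<le> L" and k2: "\<And>j. j \<in> I \<Longrightarrow> r i \<noteq> r j \<Longrightarrow> k j \<le> 36 / sqrt (\<theta> * \<bar>r i - r j\<bar>)"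
  shows "(\<Sum>j\<in>I. k j) \<le> M * (4 * L + 144 * T * sqrt (\<rho> / \<theta>))"
    and "card I \<le> M * (\<rho> * T + 1)"
proof -
  define q where "q j = nat \<lfloor>r j * T\<rfloor>" for j
  define J where "J = nat \<lfloor>\<rho> * T\<rfloor>"
  have rT: "real (q j) \<le> r j * T" "r j * T < real (q j) + 1" if "j \<in> I" for j
    using r[OF that] T by (auto simp: q_def of_nat_nat)
  have qJ: "q j \<le> J" if "j \<in> I" for j
    using r[OF that] T by (auto simp: q_def J_def intro!: nat_mono floor_mono mult_right_mono)
  have JT: "real J \<le> \<rho> * T" using \<rho> T by (simp add: J_def of_nat_nat)
  have cellq: "card {j \<in> I. q j = n} \<le> M" for n
  proof -
    have ss: "{j \<in> I. q j = n} \<subseteq> {j \<in> I. real n / T \<le> r j \<and> r j \<le> real n / T + 1 / T}"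
      using rT T by (auto simp: field_simps) (metis add.commute less_eq_real_def mult.commute)
    then show ?thesis using card_mono[OF _ ss] cell[of "real n / T"] I by simp
  qed
  \<comment> \<open>Points of the same or of adjacent cells can be arbitrarily close, so for d <= 1
    only the trivial bound \<open>L\<close> is available; it leads to the term
    \<open>4 * L\<close>.\<close>
  define h where "h d = (if d \<le> 1 then L else 36 * sqrt (T / \<theta>) * (1 / sqrt (real (d - 1))))" for d :: nat
  have h0: "0 \<le> h d" for d using L T th by (simp add: h_def)
  have kh: "k j \<le> h (nat \<bar>int (q j) - int (q i)\<bar>)" if j: "j \<in> I" for j
  proof (cases "nat \<bar>int (q j) - int (q i)\<bar> \<le> 1")
    case False
    define d where "d = nat \<bar>int (q j) - int (q i)\<bar>"
    have d: "d > 1" using False by (simp add: d_def)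
    have "real (d - 1) \<le> \<bar>r i * T - r j * T\<bar>"
    proof -
      have "real (d - 1) = \<bar>real (q j) - real (q i)\<bar> - 1" using d unfolding d_def by (auto simp: of_nat_diff)
      then show ?thesis using rT[OF j] rT[OF i] by linarith
    qed
    then have dd: "real (d - 1) \<le> \<bar>r i - r j\<bar> * T" using T by (simp add: left_diff_distrib[symmetric] abs_mult)
    then have ne: "r i \<noteq> r j" using d T by auto
    have "k j \<le> 36 / sqrt (\<theta> * \<bar>r i - r j\<bar>)" by (rule k2[OF j ne])
    also have "\<dots> \<le> 36 / sqrt (\<theta> * (real (d - 1) / T))"
      using dd d T th ne by (intro divide_left_mono real_sqrt_le_mono mult_left_mono mult_pos_pos) (auto simp: field_simps)
    also have "\<dots> = h d"
    proof -
      have "36 / sqrt (\<theta> * (x / T)) = 36 * sqrt (T / \<theta>) * (1 / sqrt x)" if "x > 0" for x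
        using that T th by (simp add: real_sqrt_mult real_sqrt_divide)
      then show ?thesis using d by (simp add: h_def)
    qed
    finally show ?thesis by (simp add: d_def)
  qed (use k1[OF j] in \<open>simp add: h_def\<close>)
  have hs: "(\<Sum>d\<le>J. h d) \<le> 2 * L + 72 * T * sqrt (\<rho> / \<theta>)"
  proof -
    have "(\<Sum>d\<le>J. h d) \<le> (\<Sum>d\<in>{0, 1} \<union> {2..J}. h d)" using h0 by (intro sum_mono2) auto
    also have "\<dots> = (\<Sum>d\<in>{0, 1}. h d) + (\<Sum>d=2..J. h d)" by (rule sum.union_disjoint) auto
    also have "(\<Sum>d\<in>{0, 1}. h d) = 2 * L" by (simp add: h_def)
    also have "(\<Sum>d=2..J. h d) = 36 * sqrt (T / \<theta>) * (\<Sum>d=2..J. 1 / sqrt (real (d - 1)))"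
      unfolding sum_distrib_left by (rule sum.cong) (auto simp: h_def)
    also have "(\<Sum>d=2..J. 1 / sqrt (real (d - 1))) = (\<Sum>d=1..J-1. 1 / sqrt (real d))"
      by (rule sum.reindex_bij_witness[of _ "\<lambda>d. d + 1" "\<lambda>d. d - 1"]) auto
    also have "\<dots> \<le> 2 * sqrt (real (J - 1))" by (rule sum_inverse_sqrt)
    also have "\<dots> \<le> 2 * sqrt (\<rho> * T)" using JT by (intro mult_left_mono real_sqrt_le_mono) auto
    finally have "(\<Sum>d\<le>J. h d) \<le> 2 * L + 36 * sqrt (T / \<theta>) * (2 * sqrt (\<rho> * T))"
      using T th by (simp add: mult_left_mono)
    also have "36 * sqrt (T / \<theta>) * (2 * sqrt (\<rho> * T)) = 72 * T * sqrt (\<rho> / \<theta>)"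
      using T by (simp add: real_sqrt_mult real_sqrt_divide field_simps)
    finally show ?thesis .
  qed
  have "(\<Sum>j\<in>I. k j) \<le> (\<Sum>j\<in>I. h (nat \<bar>int (q j) - int (q i)\<bar>))" by (rule sum_mono) (rule kh)
  also have "\<dots> = (\<Sum>n\<le>J. \<Sum>j\<in>{j \<in> I. q j = n}. h (nat \<bar>int (q j) - int (q i)\<bar>))"
    by (rule sum.group[symmetric]) (use I qJ in auto)
  also have "\<dots> \<le> (\<Sum>n\<le>J. M * h (nat \<bar>int n - int (q i)\<bar>))"
  proof (rule sum_mono)
    fix n
    have "(\<Sum>j\<in>{j \<in> I. q j = n}. h (nat \<bar>int (q j) - int (q i)\<bar>)) = card {j \<in> I. q j = n} * h (nat \<bar>int n - int (q i)\<bar>)" by simp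
    also have "\<dots> \<le> M * h (nat \<bar>int n - int (q i)\<bar>)" using cellq h0 by (intro mult_right_mono) auto
    finally show "(\<Sum>j\<in>{j \<in> I. q j = n}. h (nat \<bar>int (q j) - int (q i)\<bar>)) \<le> M * h (nat \<bar>int n - int (q i)\<bar>)" .
  qed
  also have "\<dots> = M * (\<Sum>n\<le>J. h (nat \<bar>int n - int (q i)\<bar>))" by (simp add: sum_distrib_left)
  also have "\<dots> \<le> M * (2 * (\<Sum>d\<le>J. h d))" by (intro mult_left_mono sum_abs_diff_le h0 qJ i) auto
  also have "\<dots> \<le> M * (2 * (2 * L + 72 * T * sqrt (\<rho> / \<theta>)))" using hs by (intro mult_left_mono) auto
  finally show "(\<Sum>j\<in>I. k j) \<le> M * (4 * L + 144 * T * sqrt (\<rho> / \<theta>))" by (simp add: algebra_simps)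
  have "card I = (\<Sum>n\<le>J. card {j \<in> I. q j = n})"
    using sum.group[of I "{..J}" q "\<lambda>_. 1::nat"] I qJ by (auto simp: image_subset_iff)
  also have "\<dots> \<le> (\<Sum>n\<le>J. M)" by (rule sum_mono) (rule cellq)
  also have "\<dots> = M * (J + 1)" by simp
  finally have "real (card I) \<le> real (M * (J + 1))" by (rule of_nat_mono)
  also have "\<dots> = M * (real J + 1)" by (simp add: algebra_simps)
  also have "\<dots> \<le> M * (\<rho> * T + 1)" by (intro mult_left_mono) (use JT in auto)
  finally show "card I \<le> M * (\<rho> * T + 1)" .
qed

text \<open>For different r two phases cannot agree in both coefficients: since
  \<open>r * L \<le> 1\<close> and \<alpha> is bounded below, nearly equal values of \<alpha> and of
  \<alpha> r would force nearly equal r. The correlation therefore decays in the distance of the r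
  alone, and \<open>L\<close> drops out of the quotient \<open>L / D\<close>.\<close>

lemma spaced_quadratic_sum:
  fixes L T \<xi> \<rho> :: real and r \<alpha> :: "'i \<Rightarrow> real" and c :: "'i \<Rightarrow> complex"
  assumes I: "finite I" and L: "L > 0" and T: "T > 0" and th: "\<xi> \<noteq> 0" and \<rho>: "\<rho> \<ge> 0" "\<rho> * L \<le> 1"
    and r: "\<And>i. i \<in> I \<Longrightarrow> 0 \<le> r i \<and> r i \<le> \<rho>" and al: "\<And>i. i \<in> I \<Longrightarrow> 1 / 4 \<le> \<alpha> i"
    and cell: "\<And>r0. card {i \<in> I. r0 \<le> r i \<and> r i \<le> r0 + 1 / T} \<le> M"
    and c: "\<And>i. i \<in> I \<Longrightarrow> norm (c i) \<le> 1"
  shows "integral {0..L} (\<lambda>m. norm (\<Sum>i\<in>I. c i * cis (\<xi> * \<alpha> i * m + (- \<xi> * \<alpha> i * r i) * m\<^sup>2)))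
    \<le> M * sqrt (L * (\<rho> * T + 1) * (4 * L + 144 * T * sqrt (\<rho> / \<bar>\<xi>\<bar>)))"
proof (cases "I = {}")
  case False
  define E where "E = M * (4 * L + 144 * T * sqrt (\<rho> / \<bar>\<xi>\<bar>))"
  let ?k = "\<lambda>i j. norm (integral {0..L} (\<lambda>m. cis ((\<xi> * \<alpha> i - \<xi> * \<alpha> j) * m + (- \<xi> * \<alpha> i * r i - - \<xi> * \<alpha> j * r j) * m\<^sup>2)))"
  have k1: "?k i j \<le> L" for i j using norm_integral_cis_le[of 0 L] L by simp
  have k2: "?k i j \<le> 36 / sqrt (\<bar>\<xi>\<bar> * \<bar>r i - r j\<bar>)" if ij: "i \<in> I" "j \<in> I" "r i \<noteq> r j" for i j
  proof -
    define Mx where "Mx = max \<bar>\<alpha> i - \<alpha> j\<bar> (\<bar>\<alpha> i * r i - \<alpha> j * r j\<bar> * L)"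
    have 1: "\<bar>\<alpha> i * r i - \<alpha> j * r j\<bar> \<le> Mx / L" using L by (simp add: Mx_def field_simps)
    have "r j * L \<le> \<rho> * L" using r[OF ij(2)] L by (intro mult_right_mono) auto
    then have "r j * L \<le> 1" using \<rho>(2) by linarith
    then have "\<bar>r j\<bar> \<le> 1 / L" using r[OF ij(2)] L by (simp add: pos_le_divide_eq)
    then have "\<bar>\<alpha> i - \<alpha> j\<bar> * \<bar>r j\<bar> \<le> Mx * (1 / L)"
      by (intro mult_mono) (auto simp: Mx_def)
    then have 2: "\<bar>(\<alpha> i - \<alpha> j) * r j\<bar> \<le> Mx / L" by (simp add: abs_mult)
    have "\<alpha> i * (r i - r j) = (\<alpha> i * r i - \<alpha> j * r j) - (\<alpha> i - \<alpha> j) * r j" by (simp add: algebra_simps)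
    then have "\<bar>\<alpha> i * (r i - r j)\<bar> \<le> 2 * Mx / L" using 1 2 by linarith
    moreover have "1 / 4 * \<bar>r i - r j\<bar> \<le> \<bar>\<alpha> i * (r i - r j)\<bar>" unfolding abs_mult using al[OF ij(1)] by (intro mult_right_mono) auto
    ultimately have "\<bar>r i - r j\<bar> / 4 \<le> 2 * Mx / L" by linarith
    then have Mx: "\<bar>r i - r j\<bar> * L / 8 \<le> Mx" using L by (simp add: field_simps)
    have D0: "\<bar>\<xi>\<bar> * (\<bar>r i - r j\<bar> * L / 8) > 0" using L ij th by simp
    have "?k i j \<le> 12 * sqrt (L / (\<bar>\<xi>\<bar> * (\<bar>r i - r j\<bar> * L / 8)))"
    proof (rule quadratic_exp_bound[OF L D0])
      have "\<bar>\<xi>\<bar> * (\<bar>r i - r j\<bar> * L / 8) \<le> \<bar>\<xi>\<bar> * Mx" using Mx by (intro mult_left_mono) auto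
      also have "\<dots> = max (\<bar>\<xi>\<bar> * \<bar>\<alpha> i - \<alpha> j\<bar>) (\<bar>\<xi>\<bar> * (\<bar>\<alpha> i * r i - \<alpha> j * r j\<bar> * L))"
        by (simp add: Mx_def max_mult_distrib_left)
      also have "\<bar>\<xi>\<bar> * \<bar>\<alpha> i - \<alpha> j\<bar> = \<bar>\<xi> * \<alpha> i - \<xi> * \<alpha> j\<bar>" by (simp add: abs_mult[symmetric] right_diff_distrib)
      also have "\<bar>\<xi>\<bar> * (\<bar>\<alpha> i * r i - \<alpha> j * r j\<bar> * L) = \<bar>- \<xi> * \<alpha> i * r i - - \<xi> * \<alpha> j * r j\<bar> * L"
      proof -
        have "- \<xi> * \<alpha> i * r i - - \<xi> * \<alpha> j * r j = - \<xi> * (\<alpha> i * r i - \<alpha> j * r j)" by (simp add: algebra_simps)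
        then show ?thesis by (simp only: abs_mult) simp
      qed
      finally show "\<bar>\<xi>\<bar> * (\<bar>r i - r j\<bar> * L / 8) \<le> max \<bar>\<xi> * \<alpha> i - \<xi> * \<alpha> j\<bar> (\<bar>- \<xi> * \<alpha> i * r i - - \<xi> * \<alpha> j * r j\<bar> * L)" .
    qed
    also have "L / (\<bar>\<xi>\<bar> * (\<bar>r i - r j\<bar> * L / 8)) = 8 / (\<bar>\<xi>\<bar> * \<bar>r i - r j\<bar>)" using L by (simp add: field_simps)
    \<comment> \<open>Rounding 8 up to 9 gives the constant 12 * 3 = 36.\<close>
    also have "12 * sqrt (8 / (\<bar>\<xi>\<bar> * \<bar>r i - r j\<bar>)) \<le> 12 * sqrt (9 / (\<bar>\<xi>\<bar> * \<bar>r i - r j\<bar>))"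
      by (intro mult_left_mono real_sqrt_le_mono divide_right_mono) auto
    also have "\<dots> = 36 / sqrt (\<bar>\<xi>\<bar> * \<bar>r i - r j\<bar>)" by (simp add: real_sqrt_divide)
    finally show ?thesis .
  qed
  note sp = spaced_sum[OF I L T _ \<rho>(1) r cell _ k1 k2]
  have row: "(\<Sum>j\<in>I. ?k i j) \<le> E" if "i \<in> I" for i
    unfolding E_def by (rule sp(1)) (use th that in auto)
  obtain i0 where "i0 \<in> I" using False by blast
  have cI: "card I \<le> M * (\<rho> * T + 1)" by (rule sp(2)[where i = i0]) (use th \<open>i0 \<in> I\<close> in auto)
  have "integral {0..L} (\<lambda>m. norm (\<Sum>i\<in>I. c i * cis (\<xi> * \<alpha> i * m + (- \<xi> * \<alpha> i * r i) * m\<^sup>2))) \<le> sqrt (L * (card I * E))"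
    by (rule dual_large_sieve[OF I L c row])
  also have "\<dots> \<le> sqrt (L * ((M * (\<rho> * T + 1)) * E))"
    using cI L T \<rho> by (intro real_sqrt_le_mono mult_left_mono mult_right_mono) (auto simp: E_def)
  also have "L * ((M * (\<rho> * T + 1)) * E) = (real M)\<^sup>2 * (L * (\<rho> * T + 1) * (4 * L + 144 * T * sqrt (\<rho> / \<bar>\<xi>\<bar>)))"
    by (simp add: E_def power2_eq_square algebra_simps)
  also have "sqrt \<dots> = M * sqrt (L * (\<rho> * T + 1) * (4 * L + 144 * T * sqrt (\<rho> / \<bar>\<xi>\<bar>)))"
    by (simp add: real_sqrt_mult)
  finally show ?thesis .
qed (use L T \<rho> in simp)

section \<open>Twisted horocycle integrals\<close>

lemma norm_cis_diff: "norm (cis x - cis y) \<le> \<bar>x - y\<bar>"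
proof -
  have 1: "norm (cis d - 1) \<le> \<bar>d\<bar>" for d
  proof -
    have "(norm (cis d - 1))\<^sup>2 = 2 - 2 * cos d"
      using sin_cos_squared_add[of d] by (simp add: cmod_power2 power2_diff)
    also have "\<dots> = (2 * sin (d / 2))\<^sup>2" using cos_double_sin[of "d / 2"] by (simp add: power_mult_distrib)
    finally have "norm (cis d - 1) = \<bar>2 * sin (d / 2)\<bar>" by (metis norm_ge_zero power2_eq_iff_nonneg abs_ge_zero power2_abs)
    also have "\<dots> \<le> \<bar>d\<bar>" using abs_sin_x_le_abs_x[of "d / 2"] by simp
    finally show ?thesis .
  qed
  have "cis x - cis y = cis y * (cis (x - y) - 1)" by (simp add: algebra_simps cis_mult)
  then show ?thesis using 1[of "x - y"] by (simp add: norm_mult)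
qed

lemma norm_triple_diff:
  fixes a b a' b' :: real
  assumes "\<bar>a\<bar> \<le> 1" "\<bar>b\<bar> \<le> 1" "\<bar>a'\<bar> \<le> 1" "\<bar>b'\<bar> \<le> 1"
  shows "norm (of_real (a * b) * cis x - of_real (a' * b') * cis y) \<le> \<bar>a - a'\<bar> + \<bar>b - b'\<bar> + \<bar>x - y\<bar>"
proof -
  have e: "complex_of_real (a * b) * cis x - of_real (a' * b') * cis y =
     of_real ((a - a') * b) * cis x + of_real (a' * (b - b')) * cis x + of_real (a' * b') * (cis x - cis y)"
    by (simp add: algebra_simps)
  have "norm (complex_of_real ((a - a') * b) * cis x) \<le> \<bar>a - a'\<bar> * 1"
    unfolding norm_mult norm_of_real abs_mult norm_cis using assms by (simp add: mult_left_le)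
  moreover have "norm (complex_of_real (a' * (b - b')) * cis x) \<le> 1 * \<bar>b - b'\<bar>"
    unfolding norm_mult norm_of_real abs_mult norm_cis using assms by (simp add: mult_left_le_one_le)
  moreover have "norm (complex_of_real (a' * b') * (cis x - cis y)) \<le> 1 * \<bar>x - y\<bar>"
    unfolding norm_mult norm_of_real abs_mult
    using assms norm_cis_diff[of x y] by (intro mult_mono) (auto intro: mult_le_one)
  ultimately show ?thesis unfolding e
    by (intro order_trans[OF norm_triangle_ineq] order_trans[OF add_right_mono[OF norm_triangle_ineq]]) simp
qed

lemma lint_norm_bound:
  fixes f :: "'a \<Rightarrow> complex"
  assumes f: "integrable M f" and g: "integrable M g" and le: "\<And>x. norm (f x) \<le> g x"
  shows "norm (\<integral>x. f x \<partial>M) \<le> (\<integral>x. g x \<partial>M)"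
proof -
  have "norm (\<integral>x. f x \<partial>M) \<le> (\<integral>x. norm (f x) \<partial>M)" by (rule integral_norm_bound)
  also have "\<dots> \<le> (\<integral>x. g x \<partial>M)" by (rule integral_mono) (use f g le in auto)
  finally show ?thesis .
qed

lemma cis_measurable [measurable]: "cis \<in> borel_measurable borel"
  by (intro borel_measurable_continuous_onI continuous_intros)

lemma low_measurable [measurable]:
  assumes [measurable]: "f \<in> borel_measurable M" "g \<in> borel_measurable M"
  shows "(\<lambda>x. low (f x) (g x)) \<in> borel_measurable M"
  unfolding low_def by measurable

lemma U_measurable [measurable]:
  assumes [measurable]: "f \<in> borel_measurable M"
  shows "(\<lambda>x. U (f x)) \<in> borel_measurable M"
  unfolding U_def by measurable

text \<open>The chart is moved to the orbit of \<open>g\<close> by right invariance and stated as an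
  image measure, the form that Bochner integrals can use.\<close>

lemma haar_chart:
  assumes g: "g \<in> SL2"
  shows "haar_SL2 = distr (density lborel (\<lambda>p. ennreal \<bar>snd (fst p)\<bar>)) borel
     (\<lambda>p. low (fst (fst p)) (snd (fst p)) ** U (snd p) ** g)" (is "_ = distr ?D borel ?c")
proof (rule measure_eqI)
  fix A assume "A \<in> sets haar_SL2"
  then have [measurable]: "A \<in> sets borel" by simp
  let ?h = "\<lambda>r a t. indicator A (low r a ** U t ** g) * ennreal \<bar>a\<bar>"
  have "emeasure haar_SL2 A = (\<integral>\<^sup>+z. indicator A z \<partial>haar_SL2)" by simp
  also have "\<dots> = (\<integral>\<^sup>+z. indicator A (z ** g) \<partial>haar_SL2)"
    by (rule nn_integral_haar_right[symmetric]) (use g in auto)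
  also have "\<dots> = (\<integral>\<^sup>+r. \<integral>\<^sup>+a. \<integral>\<^sup>+t. ?h r a t \<partial>lborel \<partial>lborel \<partial>lborel)"
    by (rule nn_integral_haar_chart) simp
  also have "\<dots> = (\<integral>\<^sup>+q. \<integral>\<^sup>+t. ?h (fst q) (snd q) t \<partial>lborel \<partial>(lborel \<Otimes>\<^sub>M lborel))"
    by (subst lborel.nn_integral_fst[symmetric]) simp_all
  also have "\<dots> = (\<integral>\<^sup>+q. \<integral>\<^sup>+t. ?h (fst q) (snd q) t \<partial>lborel \<partial>lborel)"
    by (simp only: lborel_prod)
  also have "\<dots> = (\<integral>\<^sup>+p. ?h (fst (fst p)) (snd (fst p)) (snd p) \<partial>(lborel \<Otimes>\<^sub>M lborel))"
    by (subst lborel.nn_integral_fst[symmetric]) simp_all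
  also have "\<dots> = (\<integral>\<^sup>+p. ?h (fst (fst p)) (snd (fst p)) (snd p) \<partial>lborel)"
    by (simp only: lborel_prod)
  also have "\<dots> = (\<integral>\<^sup>+p. indicator A (?c p) \<partial>?D)"
    by (subst nn_integral_density) (auto simp: mult.commute)
  also have "\<dots> = (\<integral>\<^sup>+z. indicator A z \<partial>distr ?D borel ?c)"
    by (subst nn_integral_distr) auto
  also have "\<dots> = emeasure (distr ?D borel ?c) A" by simp
  finally show "emeasure haar_SL2 A = emeasure (distr ?D borel ?c) A" .
qed simp

text \<open>The corner exceeds 1 by at most \<open>\<kappa> + 2 * \<rho> * L\<close>, its reciprocal
  falls below 1 by no more than that, and the lower left entry is at most
  \<open>2 * \<rho> * L\<close>.\<close>

lemma nm_low_shift: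
  assumes \<rho>: "0 \<le> \<rho>" and L: "1 \<le> L" and \<kappa>: "0 \<le> \<kappa>" "\<kappa> \<le> 1"
    and r: "0 \<le> r" "r \<le> \<rho>" and a: "1 \<le> a" "a \<le> 1 + \<kappa>" and m: "0 \<le> m" "m \<le> L"
  shows "nm (low (r / (1 + m * r)) ((1 + m * r) * a) - mat 1) \<le> 2 * \<kappa> + 6 * \<rho> * L"
proof -
  define h where "h = low (r / (1 + m * r)) ((1 + m * r) * a)"
  have q: "1 + m * r \<ge> 1" using m r by simp
  have mr: "m * r \<le> L * \<rho>" using m r by (intro mult_mono) auto
    have h_eq: "h - mat 1 = mk ((1 + m * r) * a - 1) 0 (r * a) (1 / ((1 + m * r) * a) - 1)"
      using q by (simp add: h_def low_def mk_one)
    have A: "1 * 1 \<le> (1 + m * r) * a" using q a by (intro mult_mono) auto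
    have "(1 + m * r) * a - 1 = (a - 1) + m * r * a" by (simp add: algebra_simps)
    also have "m * r * a \<le> (L * \<rho>) * 2" using mr m r a \<kappa> \<rho> L by (intro mult_mono) auto
    finally have B: "(1 + m * r) * a - 1 \<le> \<kappa> + 2 * (\<rho> * L)" using a by (simp add: mult.commute)
    have C: "r * a \<le> \<rho> * 2" using r a \<kappa> by (intro mult_mono) auto
    have C': "\<rho> * 1 \<le> \<rho> * L" using \<rho> L by (intro mult_left_mono) auto
    have "1 - 1 / x \<le> x - 1" if "x \<ge> 1" for x :: real
    proof -
      have "0 \<le> (x - 1) * (x - 1) / x" using that by simp
      also have "\<dots> = x - 1 - (1 - 1 / x)" using that by (simp add: field_simps)
      finally show ?thesis by simp
    qed
    from this[of "(1 + m * r) * a"] A have D: "1 - 1 / ((1 + m * r) * a) \<le> (1 + m * r) * a - 1" by simp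
    have D0: "1 / ((1 + m * r) * a) \<le> 1" using A by simp
    have "nm (h - mat 1) = ((1 + m * r) * a - 1) + r * a + (1 - 1 / ((1 + m * r) * a))"
      unfolding h_eq nm_mk using A D0 r a by simp
  then show ?thesis unfolding h_def[symmetric] using B C C' D by linarith
qed

text \<open>The Lipschitz constant is that of a fixed profile stretched to length T, so a time shift
  by L costs only \<open>C * L / T\<close>.\<close>

definition horo_weight :: "(real \<Rightarrow> real) \<Rightarrow> real \<Rightarrow> real \<Rightarrow> bool" where
  "horo_weight \<omega> T C \<longleftrightarrow> \<omega> \<in> borel_measurable borel \<and> (\<forall>t. 0 \<le> \<omega> t \<and> \<omega> t \<le> 1) \<and> (\<forall>t. \<bar>t\<bar> > T \<longrightarrow> \<omega> t = 0)
     \<and> (\<forall>s t. \<bar>\<omega> s - \<omega> t\<bar> \<le> C / T * \<bar>s - t\<bar>)"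

context sl2_lattice
begin

text \<open>The Lipschitz condition sees only \<open>h\<close>, so it is uniform over the whole
  quotient, cusps included. This is what allows the transversal factor left over by
  \<open>U_low\<close> to be discarded.\<close>

definition good_fun :: "(mat2 \<Rightarrow> real) \<Rightarrow> real \<Rightarrow> bool" where
  "good_fun f C \<longleftrightarrow> f \<in> borel_measurable borel \<and> (\<forall>z. 0 \<le> f z \<and> f z \<le> 1) \<and> (\<forall>z. \<forall>\<gamma>\<in>\<Gamma>. f (z ** \<gamma>) = f z)
     \<and> (\<forall>h\<in>SL2. \<forall>z\<in>SL2. \<bar>f (h ** z) - f z\<bar> \<le> C * nm (h - mat 1))"

lemma good_funD:
  assumes "good_fun f C"
  shows "f \<in> borel_measurable borel" "0 \<le> f z" "f z \<le> 1" "\<gamma> \<in> \<Gamma> \<Longrightarrow> f (z ** \<gamma>) = f z"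
    "h \<in> SL2 \<Longrightarrow> z \<in> SL2 \<Longrightarrow> \<bar>f (h ** z) - f z\<bar> \<le> C * nm (h - mat 1)" "0 \<le> C"
proof -
  have "0 \<le> \<bar>f (U 1 ** mat 1) - f (mat 1)\<bar>" by simp
  also have "\<dots> \<le> C * nm (U 1 - mat 1)" using assms unfolding good_fun_def by (meson SL2_one U_SL2)
  finally show "0 \<le> C" by (simp add: U_def mk_one)
qed (use assms in \<open>auto simp: good_fun_def\<close>)

lemma horo_weightD:
  assumes "horo_weight \<omega> T C"
  shows "\<omega> \<in> borel_measurable borel" "0 \<le> \<omega> t" "\<omega> t \<le> 1" "\<bar>t\<bar> > T \<Longrightarrow> \<omega> t = 0" "\<bar>\<omega> s - \<omega> t\<bar> \<le> C / T * \<bar>s - t\<bar>"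
  using assms by (auto simp: horo_weight_def)

definition twisted :: "(mat2 \<Rightarrow> real) \<Rightarrow> (real \<Rightarrow> real) \<Rightarrow> mat2 \<Rightarrow> real \<Rightarrow> complex" where
  "twisted f \<omega> g \<xi> = (\<integral>t. of_real (\<omega> t * f (U t ** g)) * cis (\<xi> * t) \<partial>lborel)"

text \<open>\<open>U_low\<close> pushes \<open>U m\<close> past the thickening; to second order it shifts the time by
  \<open>m / a\<^sup>2 - r m\<^sup>2 / a\<^sup>2\<close>, and the term quadratic in \<open>m\<close> is the source of the cancellation.\<close>

lemma thickened_orbit_close:
  assumes g: "g \<in> SL2" and f: "good_fun f Cf" and w: "horo_weight \<omega> T Cw" and T: "T \<ge> 1"
    and L: "1 \<le> L" "L \<le> T" and \<rho>: "0 \<le> \<rho>" and \<kappa>: "0 \<le> \<kappa>" "\<kappa> \<le> 1"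
    and r: "0 \<le> r" "r \<le> \<rho>" and a: "1 \<le> a" "a \<le> 1 + \<kappa>" and m: "0 \<le> m" "m \<le> L" and Cw: "Cw \<ge> 0"
  shows "norm ((\<integral>t. of_real (\<omega> t * f (U m ** (low r a ** U t ** g))) * cis (\<xi> * (t + m / a\<^sup>2 - r * m\<^sup>2 / a\<^sup>2)) \<partial>lborel) - twisted f \<omega> g \<xi>)
     \<le> 4 * T * (Cw * L / T + Cf * (2 * \<kappa> + 6 * \<rho> * L) + \<bar>\<xi>\<bar> * L ^ 3 * \<rho>\<^sup>2)"
proof -
  note [measurable] = good_funD(1)[OF f] horo_weightD(1)[OF w]
  define l where "l = m / (a\<^sup>2 * (1 + m * r))"
  have q: "1 + m * r \<ge> 1" using m r by simp
  have a2: "a\<^sup>2 \<ge> 1" using a by simp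
  have l: "0 \<le> l" "l \<le> L"
  proof -
    show "0 \<le> l" using m q a2 by (simp add: l_def)
    have "1 * 1 \<le> a\<^sup>2 * (1 + m * r)" using q a2 by (intro mult_mono) auto
    then have "l \<le> m / 1" unfolding l_def using m by (intro divide_left_mono) auto
    then show "l \<le> L" using m by simp
  qed
  define \<Phi>1 where "\<Phi>1 t = complex_of_real (\<omega> (t + l) * f (U (t + l) ** g)) * cis (\<xi> * (t + l))" for t
  define \<Phi>2 where "\<Phi>2 t = complex_of_real (\<omega> t * f (U m ** (low r a ** U t ** g))) * cis (\<xi> * (t + m / a\<^sup>2 - r * m\<^sup>2 / a\<^sup>2))" for t
  define e where "e = Cw * L / T + Cf * (2 * \<kappa> + 6 * \<rho> * L) + \<bar>\<xi>\<bar> * L ^ 3 * \<rho>\<^sup>2"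
  have e0: "0 \<le> e" using Cw L T \<rho> \<kappa> good_funD(6)[OF f] by (simp add: e_def)
  have mr: "m * r \<le> L * \<rho>" using m r by (intro mult_mono) auto
  define h where "h = low (r / (1 + m * r)) ((1 + m * r) * a)"
  have hS: "h \<in> SL2" using q a by (auto simp: h_def)
  have nh: "nm (h - mat 1) \<le> 2 * \<kappa> + 6 * \<rho> * L"
    unfolding h_def using \<kappa> \<rho> L r a m by (intro nm_low_shift) auto
  \<comment> \<open>The interval is twice as long as the support of the weight because \<Phi>1 is
    shifted by l <= L <= T.\<close>
  have close: "norm (\<Phi>2 t - \<Phi>1 t) \<le> e * indicator {-(2 * T)..2 * T} t" for t
  proof (cases "\<bar>t\<bar> \<le> 2 * T")
    case False
    then have "\<omega> t = 0" "\<omega> (t + l) = 0" using l L by (auto intro!: horo_weightD(4)[OF w])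
    then show ?thesis using e0 by (simp add: \<Phi>1_def \<Phi>2_def)
  next
    case True
    have "norm (\<Phi>2 t - \<Phi>1 t) \<le> \<bar>\<omega> t - \<omega> (t + l)\<bar> + \<bar>f (U m ** (low r a ** U t ** g)) - f (U (t + l) ** g)\<bar>
        + \<bar>\<xi> * (t + m / a\<^sup>2 - r * m\<^sup>2 / a\<^sup>2) - \<xi> * (t + l)\<bar>"
      unfolding \<Phi>1_def \<Phi>2_def
      by (rule norm_triple_diff) (use horo_weightD(2,3)[OF w] good_funD(2,3)[OF f] in \<open>auto simp: abs_le_iff intro: order_trans[of _ 0]\<close>)
    also have "\<bar>\<omega> t - \<omega> (t + l)\<bar> \<le> Cw / T * \<bar>t - (t + l)\<bar>" by (rule horo_weightD(5)[OF w])
    also have "\<dots> \<le> Cw / T * L" using l Cw T by (intro mult_left_mono) auto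
    also have "\<bar>f (U m ** (low r a ** U t ** g)) - f (U (t + l) ** g)\<bar> \<le> Cf * nm (h - mat 1)"
    proof -
      have "U m ** (low r a ** U t ** g) = (U m ** low r a) ** U t ** g" by (simp add: matrix_mul_assoc)
      also have "U m ** low r a = h ** U l" unfolding h_def l_def using q a by (intro U_low) auto
      also have "h ** U l ** U t ** g = h ** (U (t + l) ** g)" 
        by (simp add: matrix_mul_assoc[symmetric] add.commute[of t] flip: U_add)
      finally show ?thesis using good_funD(5)[OF f hS, of "U (t + l) ** g"] g by simp
    qed
    also have "\<dots> \<le> Cf * (2 * \<kappa> + 6 * \<rho> * L)" using nh good_funD(6)[OF f] by (rule mult_left_mono)
    also have "\<bar>\<xi> * (t + m / a\<^sup>2 - r * m\<^sup>2 / a\<^sup>2) - \<xi> * (t + l)\<bar> \<le> \<bar>\<xi>\<bar> * (L ^ 3 * \<rho>\<^sup>2)"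
    proof -
      \<comment> \<open>The remainder of the geometric series for \<open>1 / (1 + m * r)\<close>
        after two terms: cubic in m, but quadratic in the small r.\<close>
      have "l - (m / a\<^sup>2 - r * m\<^sup>2 / a\<^sup>2) = m ^ 3 * r\<^sup>2 / (a\<^sup>2 * (1 + m * r))"
      proof -
        have "m / (A * Q) - (m / A - r * m\<^sup>2 / A) = (m - m * Q + r * m\<^sup>2 * Q) / (A * Q)"
          if "A \<noteq> 0" "Q \<noteq> 0" for A Q using that by (simp add: field_simps)
        note 1 = this[of "a\<^sup>2" "1 + m * r"]
        have 2: "m - m * (1 + m * r) + r * m\<^sup>2 * (1 + m * r) = m ^ 3 * r\<^sup>2"
          by (simp add: algebra_simps power2_eq_square power3_eq_cube)
        have 3: "a\<^sup>2 \<noteq> 0" "1 + m * r \<noteq> 0" using q a2 by auto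
        show ?thesis unfolding l_def 1[OF 3] 2 ..
      qed
      also have "\<dots> \<le> m ^ 3 * r\<^sup>2 / 1"
        using q a2 m r mult_mono[of 1 "a\<^sup>2" 1 "1 + m * r"] by (intro divide_left_mono) auto
      also have "\<dots> \<le> L ^ 3 * \<rho>\<^sup>2" using m r by (simp add: mult_mono power_mono)
      finally have "l - (m / a\<^sup>2 - r * m\<^sup>2 / a\<^sup>2) \<le> L ^ 3 * \<rho>\<^sup>2" .
      moreover have "0 \<le> l - (m / a\<^sup>2 - r * m\<^sup>2 / a\<^sup>2)"
        unfolding \<open>l - (m / a\<^sup>2 - r * m\<^sup>2 / a\<^sup>2) = m ^ 3 * r\<^sup>2 / (a\<^sup>2 * (1 + m * r))\<close> using m q a2 by simp
      ultimately have "\<bar>l - (m / a\<^sup>2 - r * m\<^sup>2 / a\<^sup>2)\<bar> \<le> L ^ 3 * \<rho>\<^sup>2" by simp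
      moreover have "\<bar>\<xi> * (t + m / a\<^sup>2 - r * m\<^sup>2 / a\<^sup>2) - \<xi> * (t + l)\<bar> = \<bar>\<xi>\<bar> * \<bar>l - (m / a\<^sup>2 - r * m\<^sup>2 / a\<^sup>2)\<bar>"
        unfolding abs_mult[symmetric] by (subst abs_minus_commute) (simp add: algebra_simps)
      ultimately show ?thesis by (simp add: mult_left_mono)
    qed
    finally show ?thesis using True by (simp add: e_def mult.assoc indicator_def abs_le_iff)
  qed
  have i1: "integrable lborel (\<lambda>t. of_real (\<omega> t * f (U t ** g)) * cis (\<xi> * t))" (is "integrable lborel ?\<Phi>0")
  proof (rule Bochner_Integration.integrable_bound)
    show "integrable lborel (\<lambda>t. indicator {-T..T} t :: real)" using T by (simp add: integrable_indicator_iff)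
    show "AE t in lborel. norm (?\<Phi>0 t) \<le> norm (indicator {-T..T} t :: real)"
      using horo_weightD(2-4)[OF w] good_funD(2,3)[OF f]
      by (intro AE_I2) (auto simp: norm_mult abs_mult indicator_def mult_le_one abs_le_iff not_le)
  qed measurable
  have W: "twisted f \<omega> g \<xi> = (\<integral>t. \<Phi>1 t \<partial>lborel)"
    unfolding twisted_def \<Phi>1_def
    using lborel_integral_real_affine[of 1 "?\<Phi>0" l] by (simp add: add.commute)
  have j1: "integrable lborel \<Phi>1"
    unfolding \<Phi>1_def using lborel_integrable_real_affine[OF i1, of 1 l] by (simp add: add.commute)
  have j2: "integrable lborel \<Phi>2"
  proof (rule Bochner_Integration.integrable_bound)
    show "integrable lborel (\<lambda>t. indicator {-T..T} t :: real)" using T by (simp add: integrable_indicator_iff)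
    show "AE t in lborel. norm (\<Phi>2 t) \<le> norm (indicator {-T..T} t :: real)"
      using horo_weightD(2-4)[OF w] good_funD(2,3)[OF f]
      by (intro AE_I2) (auto simp: \<Phi>2_def norm_mult abs_mult indicator_def mult_le_one abs_le_iff not_le)
    show "\<Phi>2 \<in> borel_measurable lborel" unfolding \<Phi>2_def by measurable
  qed
  have "norm ((\<integral>t. \<Phi>2 t \<partial>lborel) - (\<integral>t. \<Phi>1 t \<partial>lborel)) = norm (\<integral>t. \<Phi>2 t - \<Phi>1 t \<partial>lborel)"
    using j1 j2 by simp
  also have "\<dots> \<le> (\<integral>t. e * indicator {-(2 * T)..2 * T} t \<partial>lborel)"
    by (rule lint_norm_bound) (use close j1 j2 T in \<open>auto simp: integrable_indicator_iff\<close>)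
  also have "\<dots> = 4 * T * e" using T by simp
  finally show ?thesis unfolding W by (simp add: \<Phi>2_def e_def)
qed

end

section \<open>Sums over the lattice points in a thickened orbit\<close>

context sl2_lattice
begin

lemma measurable_pair_\<Gamma>:
  assumes "\<And>\<gamma>. \<gamma> \<in> \<Gamma> \<Longrightarrow> (\<lambda>z. f (z, \<gamma>)) \<in> measurable M N"
  shows "f \<in> measurable (M \<Otimes>\<^sub>M count_space \<Gamma>) N"
proof -
  have "(\<lambda>x. f (fst x, snd x)) \<in> measurable (M \<Otimes>\<^sub>M count_space \<Gamma>) N"
    by (rule measurable_compose_countable'[where f = "\<lambda>\<gamma> x. f (fst x, \<gamma>)" and g = snd and I = \<Gamma>])
      (use assms countable_\<Gamma> in \<open>auto intro: measurable_compose[OF measurable_fst]\<close>)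
  then show ?thesis by simp
qed

text \<open>The whole thickening. For \<kappa> <= 1 its slices of width \<open>1 / T\<close> in r
  lie in \<open>box\<close>, which is where the multiplicity bound enters.\<close>

definition strip :: "mat2 \<Rightarrow> real \<Rightarrow> real \<Rightarrow> real \<Rightarrow> mat2 set" where
  "strip g T \<rho> \<kappa> = {low r a ** U t ** g | r a t. 0 \<le> r \<and> r \<le> \<rho> \<and> 1 \<le> a \<and> a \<le> 1 + \<kappa> \<and> \<bar>t\<bar> \<le> T}"

lemma finite_strip:
  assumes g: "g \<in> SL2" and z: "z \<in> SL2" and "0 \<le> \<rho>" "0 \<le> \<kappa>" "0 \<le> T"
  shows "finite {\<gamma> \<in> \<Gamma>. z ** \<gamma> \<in> strip g T \<rho> \<kappa>}"
proof (rule finite_subset[OF _ finite_ball])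
  define R where "R = (1 + \<kappa>) + (1 + \<kappa>) * T + \<rho> * (1 + \<kappa>) + (\<rho> * (1 + \<kappa>) * T + 1)"
  show "{\<gamma> \<in> \<Gamma>. z ** \<gamma> \<in> strip g T \<rho> \<kappa>} \<subseteq> {\<gamma> \<in> \<Gamma>. nm \<gamma> \<le> nm z * (R * nm g)}"
  proof clarify
    fix \<gamma> assume \<gamma>: "\<gamma> \<in> \<Gamma>" "z ** \<gamma> \<in> strip g T \<rho> \<kappa>"
    then obtain r a t where e: "z ** \<gamma> = low r a ** U t ** g" and b: "0 \<le> r" "r \<le> \<rho>" "1 \<le> a" "a \<le> 1 + \<kappa>" "\<bar>t\<bar> \<le> T"
      by (auto simp: strip_def)
    have 1: "\<bar>a * t\<bar> \<le> (1 + \<kappa>) * T" "\<bar>r * a\<bar> \<le> \<rho> * (1 + \<kappa>)"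
      unfolding abs_mult using b assms by (intro mult_mono; simp)+
    have 2: "\<bar>r * a * t\<bar> \<le> \<rho> * (1 + \<kappa>) * T"
      unfolding abs_mult[of "r * a"] using b assms 1 by (intro mult_mono) auto
    have 3: "\<bar>1 / a\<bar> \<le> 1" "\<bar>a\<bar> \<le> 1 + \<kappa>" using b by auto
    have R: "nm (low r a ** U t) \<le> R"
      unfolding low_U nm_mk R_def using 1 2 3 abs_triangle_ineq[of "r * a * t" "1 / a"] by linarith
    have "\<gamma> = adj z ** (low r a ** U t ** g)" using z by (simp flip: e)
    then have "nm \<gamma> \<le> nm (adj z) * nm (low r a ** U t ** g)" by (metis nm_mult)
    also have "nm (low r a ** U t ** g) \<le> nm (low r a ** U t) * nm g" by (rule nm_mult)
    also have "\<dots> \<le> R * nm g" using R by (intro mult_right_mono) auto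
    also have "nm (adj z) = nm z" by simp
    finally show "nm \<gamma> \<le> nm z * (R * nm g)" by (simp add: mult_left_mono)
  qed
qed

text \<open>By \<open>low_U\<close> the quotients of entries are the coordinates a, r, t, so this is
  the indicator of the thickening times the weight and the second-order phase. Written in the
  entries it is defined and measurable on all matrices.\<close>

definition thick_kernel :: "(real \<Rightarrow> real) \<Rightarrow> real \<Rightarrow> real \<Rightarrow> real \<Rightarrow> real \<Rightarrow> mat2 \<Rightarrow> complex" where
  "thick_kernel \<omega> \<xi> \<rho> \<kappa> m y = indicator {1..1 + \<kappa>} (y $ 1 $ 1) * indicator {0..\<rho>} (y $ 2 $ 1 / y $ 1 $ 1) *
     of_real (\<omega> (y $ 1 $ 2 / y $ 1 $ 1)) *
     cis (\<xi> * (y $ 1 $ 2 / y $ 1 $ 1 + m / (y $ 1 $ 1)\<^sup>2 - (y $ 2 $ 1 / y $ 1 $ 1) * m\<^sup>2 / (y $ 1 $ 1)\<^sup>2))"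

lemma thick_kernel_low_U: "thick_kernel \<omega> \<xi> \<rho> \<kappa> m (low r a ** U t) =
    indicator {1..1 + \<kappa>} a * indicator {0..\<rho>} r * of_real (\<omega> t) * cis (\<xi> * (t + m / a\<^sup>2 - r * m\<^sup>2 / a\<^sup>2))"
  by (cases "a = 0") (auto simp: thick_kernel_def low_U)

lemma thick_kernel_measurable [measurable]:
  assumes [measurable]: "\<omega> \<in> borel_measurable borel" "f \<in> borel_measurable M" "h \<in> borel_measurable M"
  shows "(\<lambda>x. thick_kernel \<omega> \<xi> \<rho> \<kappa> (f x) (h x)) \<in> borel_measurable M"
  unfolding thick_kernel_def by measurable

lemma thick_kernel_nonzeroD:
  assumes w: "horo_weight \<omega> T Cw" and z: "y \<in> SL2" and p: "thick_kernel \<omega> \<xi> \<rho> \<kappa> m (y ** adj g) \<noteq> 0" and g: "g \<in> SL2"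
  shows "y \<in> strip g T \<rho> \<kappa>"
proof -
  define x where "x = y ** adj g"
  have x: "x \<in> SL2" using z g by (simp add: x_def)
  have p: "x $ 1 $ 1 \<in> {1..1 + \<kappa>}" "x $ 2 $ 1 / x $ 1 $ 1 \<in> {0..\<rho>}" "\<omega> (x $ 1 $ 2 / x $ 1 $ 1) \<noteq> 0"
    using p unfolding thick_kernel_def x_def[symmetric] by (auto simp: indicator_def split: if_splits)
  have "x = low (x $ 2 $ 1 / x $ 1 $ 1) (x $ 1 $ 1) ** U (x $ 1 $ 2 / x $ 1 $ 1)"
    using p by (intro SL2_decomp x) auto
  moreover have "y = x ** g" using g by (simp add: x_def matrix_mul_assoc[symmetric])
  moreover have "\<bar>x $ 1 $ 2 / x $ 1 $ 1\<bar> \<le> T" using p(3) horo_weightD(4)[OF w] by (meson not_le)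
  ultimately have "y = low (x $ 2 $ 1 / x $ 1 $ 1) (x $ 1 $ 1) ** U (x $ 1 $ 2 / x $ 1 $ 1) ** g"
      "\<bar>x $ 1 $ 2 / x $ 1 $ 1\<bar> \<le> T" by simp_all
  then show ?thesis unfolding strip_def mem_Collect_eq using p(1,2)
    by (intro exI[of _ "x $ 2 $ 1 / x $ 1 $ 1"] exI[of _ "x $ 1 $ 1"] exI[of _ "x $ 1 $ 2 / x $ 1 $ 1"]) auto
qed

text \<open>For z in \<open>SL2\<close> only the finitely many translates in \<open>strip\<close>
  contribute, so this is an exponential sum whose phases are quadratic in m.\<close>

definition orbit_sum :: "(real \<Rightarrow> real) \<Rightarrow> mat2 \<Rightarrow> real \<Rightarrow> real \<Rightarrow> real \<Rightarrow> real \<Rightarrow> mat2 \<Rightarrow> complex" where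
  "orbit_sum \<omega> g \<xi> \<rho> \<kappa> m z = (\<integral>\<gamma>. thick_kernel \<omega> \<xi> \<rho> \<kappa> m (z ** \<gamma> ** adj g) \<partial>count_space \<Gamma>)"

lemma orbit_sum_measurable:
  assumes [measurable]: "\<omega> \<in> borel_measurable borel"
  shows "(\<lambda>(m, z). orbit_sum \<omega> g \<xi> \<rho> \<kappa> m z) \<in> borel_measurable (lborel \<Otimes>\<^sub>M \<mu>)"
proof -
  have "(\<lambda>x. \<integral>\<gamma>. thick_kernel \<omega> \<xi> \<rho> \<kappa> (fst x) (snd x ** \<gamma> ** adj g) \<partial>count_space \<Gamma>) \<in> borel_measurable (lborel \<Otimes>\<^sub>M \<mu>)"
    by (rule cp.M1.borel_measurable_lebesgue_integral, rule measurable_pair_\<Gamma>) simp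
  then show ?thesis unfolding orbit_sum_def split_beta' .
qed

text \<open>The translates of z in the strip become the index set of
  \<open>spaced_quadratic_sum\<close>, with \<alpha> the inverse square of the coordinate a;
  \<open>box_card\<close> bounds the number of indices in a cell.\<close>

lemma orbit_sum_integral_le:
  assumes g: "g \<in> SL2" and z: "z \<in> SL2" and w: "horo_weight \<omega> T Cw" and T: "T \<ge> 1"
    and M: "card (return_set g T) \<le> M" and L: "1 \<le> L" and \<rho>: "0 < \<rho>" "\<rho> * L \<le> 1" and \<kappa>: "0 < \<kappa>" "\<kappa> \<le> 1" and xi: "\<xi> \<noteq> 0"
  shows "(\<integral>\<^sup>+m. indicator {0..L} m * ennreal (norm (orbit_sum \<omega> g \<xi> \<rho> \<kappa> m z)) \<partial>lborel)
    \<le> ennreal (M * sqrt (L * (\<rho> * T + 1) * (4 * L + 144 * T * sqrt (\<rho> / \<bar>\<xi>\<bar>))))"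
proof -
  define I where "I = {\<gamma> \<in> \<Gamma>. z ** \<gamma> \<in> strip g T \<rho> \<kappa>}"
  have fI: "finite I" unfolding I_def using \<rho> \<kappa> T by (intro finite_strip g z) auto
  define y where "y \<gamma> = z ** \<gamma> ** adj g" for \<gamma>
  define a where "a \<gamma> = y \<gamma> $ 1 $ 1" for \<gamma>
  define r where "r \<gamma> = y \<gamma> $ 2 $ 1 / y \<gamma> $ 1 $ 1" for \<gamma>
  define t where "t \<gamma> = y \<gamma> $ 1 $ 2 / y \<gamma> $ 1 $ 1" for \<gamma>
  have yI: "y \<gamma> = low (r \<gamma>) (a \<gamma>) ** U (t \<gamma>) \<and> 0 \<le> r \<gamma> \<and> r \<gamma> \<le> \<rho> \<and> 1 \<le> a \<gamma> \<and> a \<gamma> \<le> 1 + \<kappa> \<and> \<bar>t \<gamma>\<bar> \<le> T" if "\<gamma> \<in> I" for \<gamma>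
  proof -
    obtain r' a' t' where e: "z ** \<gamma> = low r' a' ** U t' ** g" and b: "0 \<le> r'" "r' \<le> \<rho>" "1 \<le> a'" "a' \<le> 1 + \<kappa>" "\<bar>t'\<bar> \<le> T"
      using \<open>\<gamma> \<in> I\<close> by (auto simp: I_def strip_def)
    have y: "y \<gamma> = low r' a' ** U t'" unfolding y_def e using g by (simp add: matrix_mul_assoc[symmetric])
    then have "a \<gamma> = a'" "r \<gamma> = r'" "t \<gamma> = t'" using b by (auto simp: a_def r_def t_def low_U)
    then show ?thesis using y b by simp
  qed
  define \<alpha> where "\<alpha> \<gamma> = 1 / (a \<gamma>)\<^sup>2" for \<gamma>
  define c where "c \<gamma> = complex_of_real (\<omega> (t \<gamma>)) * cis (\<xi> * t \<gamma>)" for \<gamma>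
  have S: "orbit_sum \<omega> g \<xi> \<rho> \<kappa> m z = (\<Sum>\<gamma>\<in>I. c \<gamma> * cis (\<xi> * \<alpha> \<gamma> * m + (- \<xi> * \<alpha> \<gamma> * r \<gamma>) * m\<^sup>2))" for m
  proof -
    let ?p = "\<lambda>\<gamma>. thick_kernel \<omega> \<xi> \<rho> \<kappa> m (z ** \<gamma> ** adj g)"
    have sub: "{\<gamma> \<in> \<Gamma>. ?p \<gamma> \<noteq> 0} \<subseteq> I"
      unfolding I_def using thick_kernel_nonzeroD[OF w _ _ g] z by auto
    have "orbit_sum \<omega> g \<xi> \<rho> \<kappa> m z = (\<Sum>\<gamma> | \<gamma> \<in> \<Gamma> \<and> ?p \<gamma> \<noteq> 0. ?p \<gamma>)"
      unfolding orbit_sum_def by (rule lebesgue_integral_count_space_finite_support) (rule finite_subset[OF sub fI])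
    also have "\<dots> = (\<Sum>\<gamma>\<in>I. ?p \<gamma>)"
      by (rule sum.mono_neutral_left) (use sub fI in \<open>auto simp: I_def\<close>)
    also have "\<dots> = (\<Sum>\<gamma>\<in>I. c \<gamma> * cis (\<xi> * \<alpha> \<gamma> * m + (- \<xi> * \<alpha> \<gamma> * r \<gamma>) * m\<^sup>2))"
    proof (rule sum.cong[OF refl])
      fix \<gamma> assume \<gamma>: "\<gamma> \<in> I"
      have "?p \<gamma> = thick_kernel \<omega> \<xi> \<rho> \<kappa> m (low (r \<gamma>) (a \<gamma>) ** U (t \<gamma>))" using yI[OF \<gamma>] by (simp add: y_def)
      also have "\<dots> = of_real (\<omega> (t \<gamma>)) * cis (\<xi> * (t \<gamma> + m / (a \<gamma>)\<^sup>2 - r \<gamma> * m\<^sup>2 / (a \<gamma>)\<^sup>2))"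
        using yI[OF \<gamma>] by (simp add: thick_kernel_low_U)
      also have "\<dots> = c \<gamma> * cis (\<xi> * \<alpha> \<gamma> * m + (- \<xi> * \<alpha> \<gamma> * r \<gamma>) * m\<^sup>2)"
        unfolding c_def mult.assoc cis_mult by (simp add: \<alpha>_def algebra_simps)
      finally show "?p \<gamma> = c \<gamma> * cis (\<xi> * \<alpha> \<gamma> * m + (- \<xi> * \<alpha> \<gamma> * r \<gamma>) * m\<^sup>2)" .
    qed
    finally show ?thesis .
  qed
  have cont: "continuous_on {0..L} (\<lambda>m. norm (orbit_sum \<omega> g \<xi> \<rho> \<kappa> m z))" unfolding S by (intro continuous_intros)
  have int: "set_integrable lborel {0..L} (\<lambda>m. norm (orbit_sum \<omega> g \<xi> \<rho> \<kappa> m z))"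
    by (rule borel_integrable_atLeastAtMost'[OF cont])
  have "(\<integral>\<^sup>+m. indicator {0..L} m * ennreal (norm (orbit_sum \<omega> g \<xi> \<rho> \<kappa> m z)) \<partial>lborel)
    = (\<integral>\<^sup>+m. ennreal (indicator {0..L} m *\<^sub>R norm (orbit_sum \<omega> g \<xi> \<rho> \<kappa> m z)) \<partial>lborel)"
    by (rule nn_integral_cong) (auto simp: indicator_def)
  also have "\<dots> = ennreal (LINT m:{0..L}|lborel. norm (orbit_sum \<omega> g \<xi> \<rho> \<kappa> m z))"
    unfolding set_lebesgue_integral_def using int unfolding set_integrable_def by (intro nn_integral_eq_integral) auto
  also have "(LINT m:{0..L}|lborel. norm (orbit_sum \<omega> g \<xi> \<rho> \<kappa> m z)) = integral {0..L} (\<lambda>m. norm (orbit_sum \<omega> g \<xi> \<rho> \<kappa> m z))"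
    by (rule set_borel_integral_eq_integral[OF int])
  also have "\<dots> \<le> M * sqrt (L * (\<rho> * T + 1) * (4 * L + 144 * T * sqrt (\<rho> / \<bar>\<xi>\<bar>)))"
    unfolding S
  proof (rule spaced_quadratic_sum)
    fix r0
    have "{i \<in> I. r0 \<le> r i \<and> r i \<le> r0 + 1 / T} \<subseteq> {\<gamma> \<in> \<Gamma>. z ** \<gamma> \<in> box g T r0}"
    proof clarify
      fix \<gamma> assume \<gamma>: "\<gamma> \<in> I" "r0 \<le> r \<gamma>" "r \<gamma> \<le> r0 + 1 / T"
      have "z ** \<gamma> = y \<gamma> ** g" using g by (simp add: y_def matrix_mul_assoc[symmetric])
      also have "\<dots> = low (r \<gamma>) (a \<gamma>) ** U (t \<gamma>) ** g" using yI[OF \<gamma>(1)] by simp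
      finally have "z ** \<gamma> \<in> box g T r0" unfolding box_def using \<gamma> yI[OF \<gamma>(1)] \<kappa> by fastforce
      then show "\<gamma> \<in> \<Gamma> \<and> z ** \<gamma> \<in> box g T r0" using \<gamma> by (simp add: I_def)
    qed
    then have "card {i \<in> I. r0 \<le> r i \<and> r i \<le> r0 + 1 / T} \<le> card {\<gamma> \<in> \<Gamma>. z ** \<gamma> \<in> box g T r0}"
      using box_card[OF g _ z, of T r0] T by (intro card_mono) auto
    also have "\<dots> \<le> M" using box_card[OF g _ z, of T r0] T M by auto
    finally show "card {i \<in> I. r0 \<le> r i \<and> r i \<le> r0 + 1 / T} \<le> M" .
  next
    fix i assume "i \<in> I"
    then have "1 \<le> a i" "a i \<le> 2" using yI \<kappa> by fastforce+
    then have "(a i)\<^sup>2 \<le> 2\<^sup>2" "(a i)\<^sup>2 > 0" using power_mono[of "a i" 2 2] by auto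
    then show "1 / 4 \<le> \<alpha> i" unfolding \<alpha>_def by (simp add: field_simps)
    show "norm (c i) \<le> 1" using horo_weightD(2,3)[OF w] by (simp add: c_def norm_mult)
  qed (use fI L T xi \<rho> yI in auto)
  finally show ?thesis by (simp add: ennreal_leI)
qed

text \<open>Averaging over the thickening \<open>(r, a)\<close> and over \<open>m \<le> L\<close> turns the twisted integral into an integral of \<open>f\<close> over
  the fundamental domain against \<open>orbit_sum\<close>, whose mean over \<open>m\<close> is small by the dual large sieve.\<close>

lemma twisted_bound_general:
  assumes g: "g \<in> SL2" and f: "good_fun f Cf" and w: "horo_weight \<omega> T Cw" and Cw: "Cw \<ge> 0" and T: "T \<ge> 1"
    and M: "card (return_set g T) \<le> M" and L: "1 \<le> L" "L \<le> T" and \<rho>: "0 < \<rho>" "\<rho> * L \<le> 1" and \<kappa>: "0 < \<kappa>" "\<kappa> \<le> 1" and xi: "\<xi> \<noteq> 0"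
  shows "norm (twisted f \<omega> g \<xi>) \<le> 4 * T * (Cw * L / T + Cf * (2 * \<kappa> + 6 * \<rho> * L) + \<bar>\<xi>\<bar> * L ^ 3 * \<rho>\<^sup>2)
     + measure \<mu> UNIV * (M * sqrt (L * (\<rho> * T + 1) * (4 * L + 144 * T * sqrt (\<rho> / \<bar>\<xi>\<bar>)))) / (\<rho> * \<kappa> * L)"
proof -
  note [measurable] = good_funD(1)[OF f] horo_weightD(1)[OF w]
  define e where "e = 4 * T * (Cw * L / T + Cf * (2 * \<kappa> + 6 * \<rho> * L) + \<bar>\<xi>\<bar> * L ^ 3 * \<rho>\<^sup>2)"
  define Q where "Q = M * sqrt (L * (\<rho> * T + 1) * (4 * L + 144 * T * sqrt (\<rho> / \<bar>\<xi>\<bar>)))"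
  have Q0: "Q \<ge> 0" using L \<rho> T by (simp add: Q_def)
  define B where "B = {0..\<rho>} \<times> {1..1 + \<kappa>}"
  have [measurable]: "B \<in> sets borel" unfolding B_def by (intro borel_closed closed_Times) auto
  have eB: "emeasure lborel B = ennreal (\<rho> * \<kappa>)"
  proof -
    have "emeasure lborel B = emeasure (lborel \<Otimes>\<^sub>M lborel) ({0..\<rho>} \<times> {1..1 + \<kappa>})" by (simp add: lborel_prod B_def)
    also have "\<dots> = ennreal \<rho> * ennreal \<kappa>" using \<rho> \<kappa> by (subst lborel.emeasure_pair_measure_Times) auto
    finally show ?thesis using \<rho> \<kappa> by (simp add: ennreal_mult)
  qed
  define b where "b q = indicator B q * \<bar>snd q\<bar>" for q :: "real \<times> real"
  have [measurable]: "b \<in> borel_measurable borel" unfolding b_def by measurable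
  have ib: "integrable lborel b"
  proof -
    have "AE q in lborel. q \<in> B \<longrightarrow> norm \<bar>snd q\<bar> \<le> 2" by (rule AE_I2) (use \<kappa> in \<open>auto simp: B_def\<close>)
    from integrableI_bounded_set_indicator[OF _ _ _ this] show ?thesis
      using eB by (simp add: b_def[abs_def])
  qed
  \<comment> \<open>The mass of the thickening in the chart. It is at least
    \<open>\<rho> * \<kappa>\<close> because the density a is at least 1 on
    \<open>B\<close>.\<close>
  define c where "c = (\<integral>q. b q \<partial>lborel)"
  have c: "c \<ge> \<rho> * \<kappa>"
  proof -
    have "\<rho> * \<kappa> = (\<integral>q. indicator B q \<partial>lborel)" using eB \<rho> \<kappa> by (simp add: measure_def)
    also have "\<dots> \<le> c" unfolding c_def
    proof (rule integral_mono[OF _ ib])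
      show "integrable lborel (indicator B :: _ \<Rightarrow> real)" using eB by (intro integrable_real_indicator) auto
    qed (auto simp: b_def B_def indicator_def)
    finally show ?thesis .
  qed
  have c0: "c > 0" using c \<rho> \<kappa> by (meson less_le_trans mult_pos_pos)
  \<comment> \<open>A kernel anchored at \<open>g\<close> times a function invariant under \<Gamma>.
    Its integral is computed twice: in the chart as an average over the thickened orbit, and by
    unfolding as an integral of lattice sums.\<close>
  define \<phi> where "\<phi> m z = thick_kernel \<omega> \<xi> \<rho> \<kappa> m (z ** adj g) * of_real (f (U m ** z))" for m z
  have [measurable]: "\<phi> m \<in> borel_measurable borel" for m unfolding \<phi>_def by measurable
  define J where "J m q = (\<integral>t. of_real (\<omega> t * f (U m ** (low (fst q) (snd q) ** U t ** g))) * cis (\<xi> * (t + m / (snd q)\<^sup>2 - fst q * m\<^sup>2 / (snd q)\<^sup>2)) \<partial>lborel)" for m q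
  have main: "integrable haar_SL2 (\<phi> m) \<and> norm (twisted f \<omega> g \<xi>) * c \<le> norm (\<integral>z. \<phi> m z \<partial>haar_SL2) + e * c" if m: "0 \<le> m" "m \<le> L" for m
  proof -
    let ?c = "\<lambda>p :: (real \<times> real) \<times> real. low (fst (fst p)) (snd (fst p)) ** U (snd p) ** g"
    have \<phi>c: "\<bar>snd (fst p)\<bar> *\<^sub>R \<phi> m (?c p) = of_real (b (fst p)) *
        (of_real (\<omega> (snd p) * f (U m ** ?c p)) * cis (\<xi> * (snd p + m / (snd (fst p))\<^sup>2 - fst (fst p) * m\<^sup>2 / (snd (fst p))\<^sup>2)))" for p
    proof -
      have "?c p ** adj g = low (fst (fst p)) (snd (fst p)) ** U (snd p)" using g by (simp add: matrix_mul_assoc[symmetric])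
      then show ?thesis unfolding \<phi>_def by (auto simp: thick_kernel_low_U b_def B_def indicator_def scaleR_conv_of_real mem_Times_iff)
    qed
    have \<phi>J: "(\<integral>t. \<bar>snd q\<bar> *\<^sub>R \<phi> m (?c (q, t)) \<partial>lborel) = of_real (b q) * J m q" for q
    proof -
      have "(\<integral>t. \<bar>snd q\<bar> *\<^sub>R \<phi> m (?c (q, t)) \<partial>lborel) = (\<integral>t. of_real (b q) * (of_real (\<omega> t * f (U m ** (low (fst q) (snd q) ** U t ** g)))
          * cis (\<xi> * (t + m / (snd q)\<^sup>2 - fst q * m\<^sup>2 / (snd q)\<^sup>2))) \<partial>lborel)"
        by (rule Bochner_Integration.integral_cong[OF refl]) (use \<phi>c[of "(q, _)"] in simp)
      then show ?thesis by (simp only: J_def integral_mult_right_zero)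
    qed
    have mc: "?c \<in> measurable (density lborel (\<lambda>p. ennreal \<bar>snd (fst p)\<bar>)) borel" by simp
    have iL: "integrable lborel (\<lambda>p. \<bar>snd (fst p)\<bar> *\<^sub>R \<phi> m (?c p))"
    proof (rule Bochner_Integration.integrable_bound)
      show "integrable lborel (\<lambda>p. indicator (B \<times> {-T..T}) p * (2::real))"
      proof -
        have "B \<times> {-T..T} \<in> sets borel" unfolding B_def by (intro borel_closed closed_Times) auto
        moreover have "emeasure lborel (B \<times> {-T..T}) < \<infinity>"
        proof -
          have "bounded (B \<times> {-T..T})" unfolding B_def by (intro bounded_Times) auto
          then show ?thesis by (rule emeasure_bounded_finite)
        qed
        ultimately show ?thesis by (simp add: integrable_indicator_iff)
      qed
      show "AE p in lborel. norm (\<bar>snd (fst p)\<bar> *\<^sub>R \<phi> m (?c p)) \<le> norm (indicator (B \<times> {-T..T}) p * (2::real))"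
      proof (rule AE_I2)
        fix p :: "(real \<times> real) \<times> real"
        show "norm (\<bar>snd (fst p)\<bar> *\<^sub>R \<phi> m (?c p)) \<le> norm (indicator (B \<times> {-T..T}) p * (2::real))"
        proof (cases "p \<in> B \<times> {-T..T}")
          case True
          have "\<bar>b (fst p)\<bar> * (\<bar>\<omega> (snd p)\<bar> * \<bar>f (U m ** ?c p)\<bar>) \<le> 2 * (1 * 1)"
            using True \<kappa> horo_weightD(2,3)[OF w] good_funD(2,3)[OF f]
            by (intro mult_mono) (auto simp: b_def B_def)
          then show ?thesis unfolding \<phi>c using True by (simp add: norm_mult abs_mult)
        next
          case False
          then have "b (fst p) = 0 \<or> \<omega> (snd p) = 0"
          proof (cases "\<bar>snd p\<bar> > T")
            case le: False
            then have "snd p \<in> {-T..T}" by auto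
            then have "fst p \<notin> B" using False by (simp add: mem_Times_iff)
            then show ?thesis by (simp add: b_def)
          qed (simp add: horo_weightD(4)[OF w])
          then show ?thesis unfolding \<phi>c by auto
        qed
      qed
    qed measurable
    have i\<phi>: "integrable haar_SL2 (\<phi> m)"
      unfolding haar_chart[OF g]
      by (subst integrable_distr_eq[OF mc], simp, subst integrable_density) (use iL in auto)
    have "(\<integral>z. \<phi> m z \<partial>haar_SL2) = (\<integral>p. \<phi> m (?c p) \<partial>density lborel (\<lambda>p. ennreal \<bar>snd (fst p)\<bar>))"
      by (subst haar_chart[OF g]) (rule integral_distr[OF mc], simp)
    also have "\<dots> = (\<integral>p. \<bar>snd (fst p)\<bar> *\<^sub>R \<phi> m (?c p) \<partial>lborel)"
      by (rule integral_density) auto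
    also have "\<dots> = (\<integral>p. \<bar>snd (fst p)\<bar> *\<^sub>R \<phi> m (?c p) \<partial>(lborel \<Otimes>\<^sub>M lborel))" by (simp add: lborel_prod)
    also have "\<dots> = (\<integral>q. \<integral>t. \<bar>snd q\<bar> *\<^sub>R \<phi> m (?c (q, t)) \<partial>lborel \<partial>lborel)"
      by (subst lborel_pair.integral_fst'[symmetric]) (use iL in \<open>auto simp: lborel_prod\<close>)
    also have "\<dots> = (\<integral>q. of_real (b q) * J m q \<partial>lborel)"
      unfolding \<phi>J ..
    finally have I: "(\<integral>z. \<phi> m z \<partial>haar_SL2) = (\<integral>q. of_real (b q) * J m q \<partial>lborel)" .
    have ibJ: "integrable lborel (\<lambda>q. of_real (b q) * J m q)"
    proof -
      have "integrable lborel (\<lambda>q. \<integral>t. \<bar>snd q\<bar> *\<^sub>R \<phi> m (?c (q, t)) \<partial>lborel)"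
        using lborel_pair.integrable_fst'[of "\<lambda>p. \<bar>snd (fst p)\<bar> *\<^sub>R \<phi> m (?c p)"] iL by (auto simp: lborel_prod)
      then show ?thesis unfolding \<phi>J .
    qed
    have ibW: "integrable lborel (\<lambda>q. complex_of_real (b q) * twisted f \<omega> g \<xi>)"
      using ib by (intro integrable_mult_left integrable_of_real)
    have "(\<integral>q. of_real (b q) * J m q \<partial>lborel) - of_real c * twisted f \<omega> g \<xi> = (\<integral>q. of_real (b q) * J m q - of_real (b q) * twisted f \<omega> g \<xi> \<partial>lborel)"
      using ibJ ibW ib by (subst Bochner_Integration.integral_diff) (auto simp: c_def)
    also have "norm \<dots> \<le> (\<integral>q. b q * e \<partial>lborel)"
    proof (rule lint_norm_bound[rotated 2])
      fix q :: "real \<times> real"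
      show "norm (of_real (b q) * J m q - of_real (b q) * twisted f \<omega> g \<xi>) \<le> b q * e"
      proof (cases "q \<in> B")
        case True
        have "norm (J m q - twisted f \<omega> g \<xi>) \<le> e"
          unfolding J_def e_def using True Cw \<rho> \<kappa> m
          by (intro thickened_orbit_close[OF g f w T L]) (auto simp: B_def)
        then have "b q * norm (J m q - twisted f \<omega> g \<xi>) \<le> b q * e" by (intro mult_left_mono) (auto simp: b_def)
        moreover have "norm (of_real (b q) * J m q - of_real (b q) * twisted f \<omega> g \<xi>) = b q * norm (J m q - twisted f \<omega> g \<xi>)"
          unfolding right_diff_distrib[symmetric] norm_mult norm_of_real by (simp add: b_def)
        ultimately show ?thesis by simp
      qed (simp add: b_def)
    qed (use ibJ ibW ib in auto)
    also have "\<dots> = c * e" by (simp add: c_def)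
    finally have "norm ((\<integral>z. \<phi> m z \<partial>haar_SL2) - of_real c * twisted f \<omega> g \<xi>) \<le> c * e" unfolding I .
    moreover have "norm (of_real c * twisted f \<omega> g \<xi>) \<le> norm (\<integral>z. \<phi> m z \<partial>haar_SL2) + norm ((\<integral>z. \<phi> m z \<partial>haar_SL2) - of_real c * twisted f \<omega> g \<xi>)"
      by (metis add.commute norm_minus_commute norm_triangle_sub)
    ultimately show ?thesis using i\<phi> c0 by (simp add: norm_mult mult.commute)
  qed
  \<comment> \<open>What is left of the twisted integral after the approximation error, weighted by
    the mass. It is independent of m, so the lattice sums may be averaged over m, where they are
    small.\<close>
  define K where "K = (norm (twisted f \<omega> g \<xi>) - e) * c"
  have KS: "ennreal K \<le> (\<integral>\<^sup>+z. ennreal (norm (orbit_sum \<omega> g \<xi> \<rho> \<kappa> m z)) \<partial>\<mu>)" if m: "0 \<le> m" "m \<le> L" for m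
  proof -
    have "K \<le> norm (\<integral>z. \<phi> m z \<partial>haar_SL2)" using main[OF m] by (simp add: K_def algebra_simps)
    then have "ennreal K \<le> ennreal (norm (\<integral>z. \<phi> m z \<partial>haar_SL2))" by (rule ennreal_leI)
    also have "\<dots> \<le> (\<integral>\<^sup>+z. ennreal (norm (\<integral>\<gamma>. \<phi> m (z ** \<gamma>) \<partial>count_space \<Gamma>)) \<partial>\<mu>)"
      by (rule unfold_norm) (use main[OF m] in simp)
    also have "\<dots> \<le> (\<integral>\<^sup>+z. ennreal (norm (orbit_sum \<omega> g \<xi> \<rho> \<kappa> m z)) \<partial>\<mu>)"
    proof (rule nn_integral_mono)
      fix z
      \<comment> \<open>Invariance pulls \<open>f\<close> out of the lattice sum, and then only
        \<open>f \<le> 1\<close> matters.\<close>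
      have "(\<integral>\<gamma>. \<phi> m (z ** \<gamma>) \<partial>count_space \<Gamma>) = (\<integral>\<gamma>. thick_kernel \<omega> \<xi> \<rho> \<kappa> m (z ** \<gamma> ** adj g) * of_real (f (U m ** z)) \<partial>count_space \<Gamma>)"
        by (rule Bochner_Integration.integral_cong) (auto simp: \<phi>_def matrix_mul_assoc good_funD(4)[OF f])
      also have "\<dots> = orbit_sum \<omega> g \<xi> \<rho> \<kappa> m z * of_real (f (U m ** z))" by (simp add: orbit_sum_def)
      finally have "norm (\<integral>\<gamma>. \<phi> m (z ** \<gamma>) \<partial>count_space \<Gamma>) = norm (orbit_sum \<omega> g \<xi> \<rho> \<kappa> m z) * \<bar>f (U m ** z)\<bar>" by (simp add: norm_mult)
      also have "\<dots> \<le> norm (orbit_sum \<omega> g \<xi> \<rho> \<kappa> m z) * 1" using good_funD(2,3)[OF f] by (intro mult_left_mono) auto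
      finally show "ennreal (norm (\<integral>\<gamma>. \<phi> m (z ** \<gamma>) \<partial>count_space \<Gamma>)) \<le> ennreal (norm (orbit_sum \<omega> g \<xi> \<rho> \<kappa> m z))" by (simp add: ennreal_leI)
    qed
    finally show ?thesis .
  qed
  interpret P: pair_sigma_finite "lborel :: real measure" \<mu>
    by (intro pair_sigma_finite.intro lborel.sigma_finite_measure_axioms \<mu>.sigma_finite_measure_axioms)
  have meas: "(\<lambda>(m, z). indicator {0..L} m * ennreal (norm (orbit_sum \<omega> g \<xi> \<rho> \<kappa> m z))) \<in> borel_measurable (lborel \<Otimes>\<^sub>M \<mu>)"
  proof -
    have [measurable]: "(\<lambda>x. orbit_sum \<omega> g \<xi> \<rho> \<kappa> (fst x) (snd x)) \<in> borel_measurable (lborel \<Otimes>\<^sub>M \<mu>)"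
      using orbit_sum_measurable[OF horo_weightD(1)[OF w]] by (simp add: split_beta')
    show ?thesis unfolding split_beta' by measurable
  qed
  have measS: "(\<lambda>z. ennreal (norm (orbit_sum \<omega> g \<xi> \<rho> \<kappa> m z))) \<in> borel_measurable \<mu>" for m
  proof -
    have [measurable]: "(\<lambda>x. orbit_sum \<omega> g \<xi> \<rho> \<kappa> (fst x) (snd x)) \<in> borel_measurable (lborel \<Otimes>\<^sub>M \<mu>)"
      using orbit_sum_measurable[OF horo_weightD(1)[OF w]] by (simp add: split_beta')
    have "(\<lambda>z. orbit_sum \<omega> g \<xi> \<rho> \<kappa> (fst (m, z)) (snd (m, z))) \<in> borel_measurable \<mu>"
      by (rule measurable_compose[OF _ \<open>(\<lambda>x. orbit_sum \<omega> g \<xi> \<rho> \<kappa> (fst x) (snd x)) \<in> _\<close>, of "\<lambda>z. (m, z)"]) simp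
    then show ?thesis by simp
  qed
  have "ennreal (K * L) = ennreal K * ennreal L" using L by (simp add: ennreal_mult'')
  also have "\<dots> = (\<integral>\<^sup>+m. indicator {0..L} m * ennreal K \<partial>lborel)"
    using L nn_integral_cmult_indicator[of "{0..L}" lborel "ennreal K"] by (simp add: mult.commute)
  also have "\<dots> \<le> (\<integral>\<^sup>+m. indicator {0..L} m * (\<integral>\<^sup>+z. ennreal (norm (orbit_sum \<omega> g \<xi> \<rho> \<kappa> m z)) \<partial>\<mu>) \<partial>lborel)"
    by (rule nn_integral_mono) (use KS in \<open>auto simp: indicator_def\<close>)
  also have "\<dots> = (\<integral>\<^sup>+m. \<integral>\<^sup>+z. indicator {0..L} m * ennreal (norm (orbit_sum \<omega> g \<xi> \<rho> \<kappa> m z)) \<partial>\<mu> \<partial>lborel)"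
    by (intro nn_integral_cong nn_integral_cmult[symmetric] measS)
  also have "\<dots> = (\<integral>\<^sup>+z. \<integral>\<^sup>+m. indicator {0..L} m * ennreal (norm (orbit_sum \<omega> g \<xi> \<rho> \<kappa> m z)) \<partial>lborel \<partial>\<mu>)"
    using P.Fubini'[OF meas] by simp
  also have "\<dots> \<le> (\<integral>\<^sup>+z. ennreal Q \<partial>\<mu>)"
  proof (rule nn_integral_mono_AE, use AE_\<mu>_F in eventually_elim)
    fix z assume "z \<in> F"
    then have z: "z \<in> SL2" using F_sub by auto
    show "(\<integral>\<^sup>+m. indicator {0..L} m * ennreal (norm (orbit_sum \<omega> g \<xi> \<rho> \<kappa> m z)) \<partial>lborel) \<le> ennreal Q"
      unfolding Q_def by (rule orbit_sum_integral_le[OF g z w T M L(1) \<rho> \<kappa> xi])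
  qed
  also have "\<dots> = ennreal (Q * measure \<mu> UNIV)"
    using Q0 by (simp add: \<mu>.emeasure_eq_measure ennreal_mult)
  finally have KL: "K * L \<le> Q * measure \<mu> UNIV"
    using Q0 by (subst (asm) ennreal_le_iff) auto
  show ?thesis
  proof (cases "norm (twisted f \<omega> g \<xi>) \<le> e")
    case True
    moreover have "0 \<le> measure \<mu> UNIV * Q / (\<rho> * \<kappa> * L)" using Q0 \<rho> \<kappa> L by simp
    ultimately show ?thesis unfolding e_def[symmetric] Q_def[symmetric] by linarith
  next
    case False
    have "(norm (twisted f \<omega> g \<xi>) - e) * (\<rho> * \<kappa> * L) \<le> (norm (twisted f \<omega> g \<xi>) - e) * (c * L)"
      using False c L by (intro mult_left_mono mult_right_mono) auto
    also have "\<dots> \<le> Q * measure \<mu> UNIV" using KL by (simp add: K_def mult.assoc)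
    finally have "norm (twisted f \<omega> g \<xi>) - e \<le> Q * measure \<mu> UNIV / (\<rho> * \<kappa> * L)"
      using \<rho> \<kappa> L by (simp add: pos_le_divide_eq)
    then show ?thesis unfolding e_def[symmetric] Q_def[symmetric] by (simp add: mult.commute)
  qed
qed

text \<open>The general bound at \<open>T = X ^ 320\<close>, \<open>L = X ^ 80\<close>, \<open>\<rho> = X ^ (-144)\<close>, \<open>\<kappa> = 1 / X\<close>.\<close>

lemma twisted_bound:
  assumes g: "g \<in> SL2" and f: "good_fun f Cf" and Cw: "Cw \<ge> 0"
  obtains C where "C \<ge> 0"
    "\<And>X \<omega> \<xi>. X \<ge> 1 \<Longrightarrow> card (return_set g (X ^ 320)) \<le> M \<Longrightarrow> horo_weight \<omega> (X ^ 320) Cw \<Longrightarrow> 1 / X ^ 8 \<le> \<bar>\<xi>\<bar> \<Longrightarrow> \<bar>\<xi>\<bar> \<le> X ^ 8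
      \<Longrightarrow> norm (twisted f \<omega> g \<xi>) \<le> C * X ^ 319"
proof
  define C where "C = 4 * (Cw + 8 * Cf + 1) + 18 * M * measure \<mu> UNIV"
  have Cf: "0 \<le> Cf" by (rule good_funD(6)[OF f])
  show "0 \<le> C" using Cw Cf by (simp add: C_def)
  fix X \<xi> :: real and \<omega>
  assume X: "X \<ge> 1" and M: "card (return_set g (X ^ 320)) \<le> M" and w: "horo_weight \<omega> (X ^ 320) Cw" and xi: "1 / X ^ 8 \<le> \<bar>\<xi>\<bar>" "\<bar>\<xi>\<bar> \<le> X ^ 8"
  have X0: "X > 0" using X by simp
  have pw: "X ^ i \<le> X ^ j" if "i \<le> j" for i j using X that by (rule power_increasing[rotated])
  have pw1: "1 \<le> X ^ i" for i using X by (rule one_le_power)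
  have dv: "X ^ i / X ^ (i + j) = 1 / X ^ j" for i j using X0 by (simp add: power_add)
  have xi0: "\<bar>\<xi>\<bar> > 0" using xi(1) X0 by (meson less_le_trans zero_less_divide_1_iff zero_less_power)
  let ?e = "4 * X ^ 320 * (Cw * X ^ 80 / X ^ 320 + Cf * (2 * (1 / X) + 6 * (1 / X ^ 144) * X ^ 80) + \<bar>\<xi>\<bar> * (X ^ 80) ^ 3 * (1 / X ^ 144)\<^sup>2)"
  let ?Q = "M * sqrt (X ^ 80 * (1 / X ^ 144 * X ^ 320 + 1) * (4 * X ^ 80 + 144 * X ^ 320 * sqrt (1 / X ^ 144 / \<bar>\<xi>\<bar>)))"
  have "norm (twisted f \<omega> g \<xi>) \<le> ?e + measure \<mu> UNIV * ?Q / (1 / X ^ 144 * (1 / X) * X ^ 80)"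
  proof (rule twisted_bound_general[OF g f w Cw _ M])
    show "1 / X ^ 144 * X ^ 80 \<le> 1" using pw[of 80 144] X0 by (simp add: field_simps)
  qed (use X pw1 pw xi0 in auto)
  \<comment> \<open>Every summand of the error is at most a constant over X, and
    \<open>\<kappa> = 1 / X\<close> is the largest of them.\<close>
  also have "?e \<le> 4 * (Cw + 8 * Cf + 1) * X ^ 319"
  proof -
    have 1: "X ^ 80 / X ^ 320 \<le> 1 / X" using dv[of 80 240] pw[of 1 240] X0 by (simp add: frac_le)
    have 2: "1 / X ^ 144 * X ^ 80 \<le> 1 / X" using dv[of 80 64] pw[of 1 64] X0 by (simp add: frac_le)
    have 3: "\<bar>\<xi>\<bar> * (X ^ 80) ^ 3 * (1 / X ^ 144)\<^sup>2 \<le> 1 / X"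
    proof -
      have "\<bar>\<xi>\<bar> * (X ^ 80) ^ 3 * (1 / X ^ 144)\<^sup>2 \<le> X ^ 8 * (X ^ 80) ^ 3 * (1 / X ^ 144)\<^sup>2"
        using xi X0 by (intro mult_right_mono) auto
      also have "\<dots> = X ^ 248 / X ^ 288" by (simp add: power_mult[symmetric] power_add[symmetric] power_divide)
      also have "\<dots> = 1 / X ^ 40" using dv[of 248 40] by simp
      also have "\<dots> \<le> 1 / X" using pw[of 1 40] X0 by (simp add: frac_le)
      finally show ?thesis .
    qed
    have "Cw * X ^ 80 / X ^ 320 + Cf * (2 * (1 / X) + 6 * (1 / X ^ 144) * X ^ 80) + \<bar>\<xi>\<bar> * (X ^ 80) ^ 3 * (1 / X ^ 144)\<^sup>2
       = Cw * (X ^ 80 / X ^ 320) + Cf * (2 * (1 / X) + 6 * (1 / X ^ 144 * X ^ 80)) + \<bar>\<xi>\<bar> * (X ^ 80) ^ 3 * (1 / X ^ 144)\<^sup>2"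
      by simp
    also have "\<dots> \<le> Cw * (1 / X) + Cf * (2 * (1 / X) + 6 * (1 / X)) + 1 / X"
      using 1 2 3 Cw Cf by (intro add_mono mult_left_mono) auto
    also have "\<dots> = (Cw + 8 * Cf + 1) / X" by (simp add: algebra_simps) (simp add: add_divide_distrib)
    finally have "?e \<le> 4 * X ^ 320 * ((Cw + 8 * Cf + 1) / X)" using X0 by (intro mult_left_mono) auto
    also have "\<dots> = 4 * (Cw + 8 * Cf + 1) * X ^ 319" using X0 power_Suc[of X 319] by simp
    finally show ?thesis .
  qed
  \<comment> \<open>Here the exponents balance: 254 + 144 + 1 - 80 = 319, the same saving of one
    factor X as in the error term.\<close>
  also have "measure \<mu> UNIV * ?Q / (1 / X ^ 144 * (1 / X) * X ^ 80) \<le> measure \<mu> UNIV * (M * (18 * X ^ 254)) / (1 / X ^ 144 * (1 / X) * X ^ 80)"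
    using X0
  proof (intro divide_right_mono mult_left_mono[of ?Q])
    show "?Q \<le> M * (18 * X ^ 254)"
  proof -
    have 1: "1 / X ^ 144 * X ^ 320 = X ^ 176" using X0 by (simp add: field_simps power_add[symmetric])
    have "1 / X ^ 144 / \<bar>\<xi>\<bar> \<le> 1 / X ^ 144 / (1 / X ^ 8)" using xi xi0 X0 by (intro divide_left_mono) auto
    also have "\<dots> = X ^ 8 / X ^ (8 + 136)" using X0 by simp
    also have "\<dots> = 1 / X ^ 136" by (rule dv)
    also have "\<dots> = (1 / X ^ 68)\<^sup>2" by (simp add: power_divide power_mult[symmetric])
    finally have "sqrt (1 / X ^ 144 / \<bar>\<xi>\<bar>) \<le> sqrt ((1 / X ^ 68)\<^sup>2)" by (rule real_sqrt_le_mono)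
    then have s: "sqrt (1 / X ^ 144 / \<bar>\<xi>\<bar>) \<le> 1 / X ^ 68" using X0 by simp
    have "X ^ 320 * sqrt (1 / X ^ 144 / \<bar>\<xi>\<bar>) \<le> X ^ 320 * (1 / X ^ 68)" using s X0 by (intro mult_left_mono) auto
    also have "\<dots> = X ^ 252" using X0 by (simp add: field_simps power_add[symmetric])
    finally have 2: "4 * X ^ 80 + 144 * X ^ 320 * sqrt (1 / X ^ 144 / \<bar>\<xi>\<bar>) \<le> 148 * X ^ 252" using pw[of 80 252] by simp
    have "X ^ 80 * (1 / X ^ 144 * X ^ 320 + 1) * (4 * X ^ 80 + 144 * X ^ 320 * sqrt (1 / X ^ 144 / \<bar>\<xi>\<bar>))
      \<le> X ^ 80 * (2 * X ^ 176) * (148 * X ^ 252)"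
      unfolding 1 using pw1[of 176] 2 X0 by (intro mult_mono mult_left_mono) auto
    also have "\<dots> = 296 * X ^ 508" by (simp add: power_add[symmetric])
    \<comment> \<open>The constant is enlarged to the perfect square 18 * 18.\<close>
    also have "\<dots> \<le> 324 * X ^ 508" using X0 by simp
    also have "\<dots> = (18 * X ^ 254)\<^sup>2" by (simp add: power_mult_distrib power_mult[symmetric])
    finally have "sqrt (X ^ 80 * (1 / X ^ 144 * X ^ 320 + 1) * (4 * X ^ 80 + 144 * X ^ 320 * sqrt (1 / X ^ 144 / \<bar>\<xi>\<bar>))) \<le> 18 * X ^ 254"
      using X0 by (intro real_le_lsqrt) auto
    then show ?thesis by (rule mult_left_mono) simp
  qed
  qed auto
  also have "measure \<mu> UNIV * (M * (18 * X ^ 254)) / (1 / X ^ 144 * (1 / X) * X ^ 80) = 18 * M * measure \<mu> UNIV * X ^ 319"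
    using X0 power_Suc[of X 398] by (simp add: field_simps power_add[symmetric])
  finally show "norm (twisted f \<omega> g \<xi>) \<le> C * X ^ 319"
    by (simp add: C_def algebra_simps)
qed

end

section \<open>Bump functions and ergodicity of the horocycle flow\<close>

context sl2_lattice
begin

text \<open>A supremum over translates instead of a sum: it stays below 1 and keeps the Lipschitz
  constant of one tent however many translates overlap. The distance is measured by
  \<open>z ** \<gamma> ** adj z0\<close>, on which a left factor of z acts directly.\<close>

definition bump :: "mat2 \<Rightarrow> real \<Rightarrow> mat2 \<Rightarrow> real" where
  "bump z0 e z = (SUP \<gamma>\<in>\<Gamma>. max 0 (1 - nm (z ** \<gamma> ** adj z0 - mat 1) / e))"

lemma bdd_bump: "e > 0 \<Longrightarrow> bdd_above ((\<lambda>\<gamma>. max 0 (1 - nm (z ** \<gamma> ** adj z0 - mat 1) / e)) ` \<Gamma>)"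
  by (rule bdd_aboveI[of _ 1]) auto

lemma bump_upper:
  "e > 0 \<Longrightarrow> \<gamma> \<in> \<Gamma> \<Longrightarrow> 1 - nm (z ** \<gamma> ** adj z0 - mat 1) / e \<le> bump z0 e z"
  unfolding bump_def by (rule order_trans[OF max.cobounded2 cSUP_upper[OF _ bdd_bump]])

lemma bump_least:
  assumes "0 \<le> B" "\<And>\<gamma>. \<gamma> \<in> \<Gamma> \<Longrightarrow> 1 - nm (z ** \<gamma> ** adj z0 - mat 1) / e \<le> B"
  shows "bump z0 e z \<le> B"
  unfolding bump_def using one_in assms by (intro cSUP_least) auto

lemma bump_range: assumes "e > 0" shows "0 \<le> bump z0 e z" "bump z0 e z \<le> 1"
proof -
  have "0 \<le> max 0 (1 - nm (z ** mat 1 ** adj z0 - mat 1) / e)" by simp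
  also have "\<dots> \<le> bump z0 e z" unfolding bump_def by (rule cSUP_upper[OF one_in bdd_bump[OF assms]])
  finally show "0 \<le> bump z0 e z" .
  show "bump z0 e z \<le> 1" using assms by (intro bump_least) auto
qed

lemma bump_posD: assumes "e > 0" "bump z0 e z > 0" shows "\<exists>\<gamma>\<in>\<Gamma>. nm (z ** \<gamma> ** adj z0 - mat 1) < e"
proof (rule ccontr)
  assume "\<not> ?thesis"
  then have "bump z0 e z \<le> 0" using assms by (intro bump_least) (auto simp: not_less field_simps)
  with assms show False by simp
qed

lemma bump_invariant: assumes "\<gamma>0 \<in> \<Gamma>" shows "bump z0 e (z ** \<gamma>0) = bump z0 e z"
proof -
  have "(\<lambda>\<gamma>. \<gamma>0 ** \<gamma>) ` \<Gamma> = \<Gamma>"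
  proof (intro equalityI subsetI)
    fix x assume "x \<in> \<Gamma>"
    then have "x = \<gamma>0 ** (adj \<gamma>0 ** x)" "adj \<gamma>0 ** x \<in> \<Gamma>" using assms by (auto simp: mult_in adj_in)
    then show "x \<in> (\<lambda>\<gamma>. \<gamma>0 ** \<gamma>) ` \<Gamma>" by (rule image_eqI)
  qed (use assms in \<open>auto simp: mult_in\<close>)
  then have "bump z0 e z = (SUP \<gamma>\<in>(\<lambda>\<gamma>. \<gamma>0 ** \<gamma>) ` \<Gamma>. max 0 (1 - nm (z ** \<gamma> ** adj z0 - mat 1) / e))"
    by (simp add: bump_def)
  also have "\<dots> = bump z0 e (z ** \<gamma>0)" by (simp add: bump_def image_image matrix_mul_assoc)
  finally show ?thesis by simp
qed

lemma nm_one: "nm (mat 1) = 2" by (simp add: mk_one)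

text \<open>From \<open>w - h ** w = (adj h - mat 1) ** (h ** w)\<close>, where the last factor has
  norm at most \<open>e + 2\<close>.\<close>

lemma near_one_mult:
  assumes "h \<in> SL2" "nm (h ** w - mat 1) < e"
  shows "nm (w - mat 1) \<le> nm (h ** w - mat 1) + nm (h - mat 1) * (e + 2)"
proof -
  have "w - h ** w = (adj h - mat 1) ** (h ** w)" using assms by (simp add: mat2_diff_right)
  then have "nm (w - h ** w) \<le> nm (adj h - mat 1) * nm (h ** w)" by (simp add: nm_mult)
  also have "nm (adj h - mat 1) = nm (h - mat 1)" using nm_adj_diff[of h "mat 1"] by simp
  also have "nm (h ** w) \<le> e + 2"
    using nm_add[of "h ** w - mat 1" "mat 1"] assms(2) by (simp add: nm_one)
  finally have "nm (w - h ** w) \<le> nm (h - mat 1) * (e + 2)" by (simp add: mult_left_mono)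
  then show ?thesis using nm_triangle[of w "mat 1" "h ** w"] by simp
qed

text \<open>The constant 3 bounds \<open>e + 2\<close>. The opposite inequality follows by applying
  this one to \<open>adj h\<close>.\<close>

lemma bump_lipschitz_aux:
  assumes e: "0 < e" "e \<le> 1" and h: "h \<in> SL2"
  shows "bump z0 e (h ** z) \<le> bump z0 e z + 3 / e * nm (h - mat 1)"
proof (rule bump_least)
  show "0 \<le> bump z0 e z + 3 / e * nm (h - mat 1)" using bump_range[OF e(1)] e by (simp add: add_nonneg_nonneg)
  fix \<gamma> assume g: "\<gamma> \<in> \<Gamma>"
  define w where "w = z ** \<gamma> ** adj z0"
  have hw: "h ** z ** \<gamma> ** adj z0 = h ** w" by (simp add: w_def matrix_mul_assoc)
  show "1 - nm (h ** z ** \<gamma> ** adj z0 - mat 1) / e \<le> bump z0 e z + 3 / e * nm (h - mat 1)"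
  proof (cases "nm (h ** w - mat 1) < e")
    case True
    have "nm (w - mat 1) \<le> nm (h ** w - mat 1) + nm (h - mat 1) * (e + 2)"
      by (rule near_one_mult[OF h True])
    also have "nm (h - mat 1) * (e + 2) \<le> nm (h - mat 1) * 3" using e by (intro mult_left_mono) auto
    finally have "nm (w - mat 1) / e \<le> (nm (h ** w - mat 1) + nm (h - mat 1) * 3) / e"
      using e by (intro divide_right_mono) auto
    moreover have "1 - nm (w - mat 1) / e \<le> bump z0 e z" unfolding w_def using e g by (intro bump_upper) auto
    ultimately show ?thesis unfolding hw by (simp add: add_divide_distrib mult.commute)
  next
    case False
    then have "1 - nm (h ** w - mat 1) / e \<le> 0" using e by (simp add: field_simps)
    then show ?thesis unfolding hw using bump_range[OF e(1), of z0 z] e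
      by (smt (verit) divide_nonneg_nonneg mult_nonneg_nonneg nm_nonneg)
  qed
qed

lemma good_fun_bump: assumes e: "0 < e" "e \<le> 1" shows "good_fun (bump z0 e) (3 / e)"
  unfolding good_fun_def
proof (intro conjI ballI allI)
  show "bump z0 e \<in> borel_measurable borel"
    unfolding bump_def[abs_def]
  proof (rule borel_measurable_cSUP[OF countable_\<Gamma>])
    fix \<gamma> :: mat2
    have "continuous_on UNIV (\<lambda>z :: mat2. z ** \<gamma> ** adj z0)"
      by (intro continuous_mat_mult continuous_on_id continuous_on_const)
    then have "continuous_on UNIV (\<lambda>z. max 0 (1 - nm (z ** \<gamma> ** adj z0 - mat 1) / e))"
      by (intro continuous_intros continuous_on_compose2[OF continuous_nm[of UNIV]]) (use e in auto)
    then show "(\<lambda>z. max 0 (1 - nm (z ** \<gamma> ** adj z0 - mat 1) / e)) \<in> borel_measurable borel"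
      by (rule borel_measurable_continuous_onI)
  qed (use bdd_bump e in auto)
  fix h z assume h: "h \<in> SL2" and z: "z \<in> SL2"
  have "bump z0 e (adj h ** (h ** z)) \<le> bump z0 e (h ** z) + 3 / e * nm (adj h - mat 1)"
    by (rule bump_lipschitz_aux[OF e]) (use h in simp)
  then have "bump z0 e z \<le> bump z0 e (h ** z) + 3 / e * nm (h - mat 1)"
    using h nm_adj_diff[of h "mat 1"] by simp
  then show "\<bar>bump z0 e (h ** z) - bump z0 e z\<bar> \<le> 3 / e * nm (h - mat 1)"
    using bump_lipschitz_aux[OF e h, of z0 z] by simp
qed (use bump_range e bump_invariant in auto)

text \<open>A multiplicative comparison, bought by widening the bump: the additive Lipschitz error
  could swamp a lower bound for a time average. Where the narrow bump is positive, the unperturbed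
  point is within 2 e, and there the wide tent is still at least 1/2.\<close>

lemma bump_compare:
  assumes e: "0 < e" "e \<le> 1 / 4" and h: "h \<in> SL2" "nm (h - mat 1) \<le> e / 3"
  shows "bump z0 e (h ** z) \<le> 2 * bump z0 (4 * e) z"
proof (cases "bump z0 e (h ** z) > 0")
  case True
  then obtain \<gamma> where g: "\<gamma> \<in> \<Gamma>" "nm (h ** z ** \<gamma> ** adj z0 - mat 1) < e" using bump_posD[OF e(1)] by blast
  define w where "w = z ** \<gamma> ** adj z0"
  have hw: "nm (h ** w - mat 1) < e" using g by (simp add: w_def matrix_mul_assoc)
  have "nm (w - mat 1) \<le> nm (h ** w - mat 1) + nm (h - mat 1) * (e + 2)" by (rule near_one_mult[OF h(1) hw])
  also have "nm (h - mat 1) * (e + 2) \<le> e / 3 * 3" using e h by (intro mult_mono) auto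
  finally have "nm (w - mat 1) \<le> 2 * e" using hw by simp
  then have "nm (w - mat 1) / (4 * e) \<le> 1 / 2" using e by (simp add: field_simps)
  then have "1 / 2 \<le> 1 - nm (z ** \<gamma> ** adj z0 - mat 1) / (4 * e)" by (simp add: w_def)
  also have "\<dots> \<le> bump z0 (4 * e) z" using e g by (intro bump_upper) auto
  finally show ?thesis using bump_range(2)[OF e(1), of z0 "h ** z"] by linarith
next
  case False
  then show ?thesis using bump_range(1)[of "4 * e" z0 z] e by linarith
qed

lemma good_fun_continuous: assumes f: "good_fun f C" shows "continuous_on SL2 f"
proof (rule continuous_onI)
  fix x :: mat2 and e :: real assume x: "x \<in> SL2" and e: "e > 0"
  define d where "d = e / (4 * (C + 1) * (nm x + 1))"
  have C: "C \<ge> 0" by (rule good_funD(6)[OF f])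
  have p: "4 * (C + 1) * (nm x + 1) > 0" using C by (simp add: add_nonneg_pos)
  then have d: "d > 0" using e by (simp add: d_def)
  show "\<exists>d>0. \<forall>x'\<in>SL2. dist x' x < d \<longrightarrow> dist (f x') (f x) \<le> e"
  proof (intro exI[of _ d] conjI ballI impI d)
    fix y assume y: "y \<in> SL2" and yd: "dist y x < d"
    have e1: "y ** adj x ** x = y" using x by (simp add: matrix_mul_assoc[symmetric])
    have "\<bar>f (y ** adj x ** x) - f x\<bar> \<le> C * nm (y ** adj x - mat 1)" by (rule good_funD(5)[OF f]) (use x y in auto)
    also have "y ** adj x - mat 1 = (y - x) ** adj x" using x by (simp add: mat2_diff_right)
    also have "C * nm ((y - x) ** adj x) \<le> C * (nm (y - x) * nm x)" using nm_mult[of "y - x" "adj x"] C by (intro mult_left_mono) auto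
    also have "\<dots> \<le> (C + 1) * ((4 * d) * (nm x + 1))"
    proof -
      have "nm (y - x) \<le> 4 * d" using yd nm_le_norm[of "y - x"] unfolding dist_norm by linarith
      then have "nm (y - x) * nm x \<le> (4 * d) * (nm x + 1)" using d by (intro mult_mono) simp_all
      then show ?thesis using C by (intro mult_mono[of C "C + 1" "nm (y - x) * nm x"]) simp_all
    qed
    also have "\<dots> = d * (4 * (C + 1) * (nm x + 1))" by (simp only: mult_ac)
    also have "\<dots> = e"
    proof -
      have "4 * (C + 1) * (nm x + 1) \<noteq> 0" using p by linarith
      then show ?thesis unfolding d_def using nonzero_eq_divide_eq[THEN iffD1, OF _ refl] by blast
    qed
    finally show "dist (f y) (f x) \<le> e" unfolding e1 by (simp add: dist_real_def)
  qed
qed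

lemma closed_good_zero:
  assumes f: "good_fun f C" shows "closed {z \<in> SL2. \<forall>m\<ge>0. f (U m ** z) = 0}"
proof -
  have "closed {z \<in> SL2. f (U m ** z) = 0}" for m
  proof -
    have "continuous_on SL2 (\<lambda>z. f (U m ** z))"
      by (rule continuous_on_compose2[OF good_fun_continuous[OF f]]) (auto intro!: continuous_mat_mult continuous_intros)
    from continuous_closed_preimage[OF this closed_SL2, of "{0}"] show ?thesis
      by (simp add: vimage_def Int_def conj_commute)
  qed
  then have "closed (\<Inter>m\<in>{0..}. {z \<in> SL2. f (U m ** z) = 0})" by blast
  moreover have "(\<Inter>m\<in>{0..}. {z \<in> SL2. f (U m ** z) = 0}) = {z \<in> SL2. \<forall>m\<ge>0. f (U m ** z) = 0}" by auto
  ultimately show ?thesis by simp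
qed

text \<open>The \<open>h\<close> with \<open>defect Z h = 0\<close> form a closed subgroup, and Mautner's identity \<open>U x ** low r 1 ** U y = low (r / l) l\<close> forces it to be everything once it
  contains the horocycle subgroup.\<close>

definition defect :: "mat2 set \<Rightarrow> mat2 \<Rightarrow> ennreal" where
  "defect Z h = emeasure \<mu> {z \<in> Z. h ** z \<notin> Z}"

lemma left_vimage_borel:
  fixes Z :: "mat2 set" and h :: mat2
  assumes Z: "Z \<in> sets borel" shows "{z. h ** z \<in> Z} \<in> sets borel"
proof -
  have "{z. h ** z \<in> Z} = (\<lambda>z. h ** z) -` Z \<inter> space borel" by auto
  also have "\<dots> \<in> sets borel"
  proof (rule measurable_sets[OF _ Z])
    have "continuous_on UNIV (\<lambda>z :: mat2. h ** z)"
      by (intro continuous_mat_mult continuous_on_const continuous_on_id)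
    then show "(\<lambda>z :: mat2. h ** z) \<in> borel_measurable borel" by (rule borel_measurable_continuous_onI)
  qed
  finally show ?thesis .
qed

lemma inv_set_left: "inv_set Z \<Longrightarrow> h \<in> SL2 \<Longrightarrow> inv_set {z. h ** z \<in> Z}"
  unfolding inv_set_def by (auto simp: matrix_mul_assoc)

lemma inv_set_diff: "inv_set A \<Longrightarrow> inv_set B \<Longrightarrow> inv_set {z \<in> A. z \<notin> B}"
proof -
  assume "inv_set A" "inv_set B"
  moreover have "{z \<in> A. z \<notin> B} = A - B" by auto
  ultimately show ?thesis unfolding inv_set_def by auto
qed

text \<open>A point of \<open>Z\<close> that \<open>k ** h\<close> carries out of \<open>Z\<close>
  leaves under \<open>h\<close> already, or reaches a point of \<open>Z\<close> that leaves under
  \<open>k\<close>. The second set is a preimage under \<open>h\<close>, so its measure is that of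
  the points leaving under \<open>k\<close>.\<close>

lemma defect_mult:
  assumes Z: "inv_set Z" and h: "h \<in> SL2" "k \<in> SL2"
  shows "defect Z (k ** h) \<le> defect Z h + defect Z k"
proof -
  have I: "inv_set {z \<in> Z. k ** z \<notin> Z}" using inv_set_diff[OF Z inv_set_left[OF Z h(2)]] by simp
  have I': "inv_set {z \<in> Z. h ** z \<notin> Z}" using inv_set_diff[OF Z inv_set_left[OF Z h(1)]] by simp
  have "defect Z (k ** h) \<le> emeasure \<mu> ({z \<in> Z. h ** z \<notin> Z} \<union> {z. h ** z \<in> {z \<in> Z. k ** z \<notin> Z}})"
    unfolding defect_def using I I' inv_set_left[OF I h(1)]
    by (intro emeasure_mono) (auto simp: matrix_mul_assoc inv_set_def)
  also have "\<dots> \<le> defect Z h + emeasure \<mu> {z. h ** z \<in> {z \<in> Z. k ** z \<notin> Z}}"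
    unfolding defect_def using I' inv_set_left[OF I h(1)]
    by (intro emeasure_subadditive) (auto simp: inv_set_def)
  also have "emeasure \<mu> {z. h ** z \<in> {z \<in> Z. k ** z \<notin> Z}} = defect Z k"
    unfolding defect_def by (rule emeasure_\<mu>_left[OF I h(1)])
  finally show ?thesis .
qed

text \<open>\<open>Z\<close> and its preimage under \<open>h\<close> have the same finite measure,
  so the two differences have equal measure: as much enters as leaves.\<close>

lemma defect_swap:
  assumes Z: "inv_set Z" and h: "h \<in> SL2"
  shows "emeasure \<mu> {z. h ** z \<in> Z \<and> z \<notin> Z} = defect Z h"
proof -
  have m: "Z \<in> sets borel" "{z. h ** z \<in> Z} \<in> sets borel" using Z inv_set_left[OF Z h] by (auto simp: inv_set_def)
  have "{z. h ** z \<in> Z \<and> z \<notin> Z} = {z. h ** z \<in> Z} - ({z. h ** z \<in> Z} \<inter> Z)" by auto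
  then have "emeasure \<mu> {z. h ** z \<in> Z \<and> z \<notin> Z} = emeasure \<mu> {z. h ** z \<in> Z} - emeasure \<mu> ({z. h ** z \<in> Z} \<inter> Z)"
    using m by (simp only:) (rule emeasure_Diff, auto simp: \<mu>.emeasure_finite)
  also have "emeasure \<mu> {z. h ** z \<in> Z} = emeasure \<mu> Z" by (rule emeasure_\<mu>_left[OF Z h])
  also have "emeasure \<mu> Z - emeasure \<mu> ({z. h ** z \<in> Z} \<inter> Z) = emeasure \<mu> (Z - ({z. h ** z \<in> Z} \<inter> Z))"
    using m by (intro emeasure_Diff[symmetric]) (auto simp: \<mu>.emeasure_finite)
  also have "Z - ({z. h ** z \<in> Z} \<inter> Z) = {z \<in> Z. h ** z \<notin> Z}" by auto
  finally show ?thesis by (simp add: defect_def)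
qed

lemma defect_adj:
  assumes Z: "inv_set Z" and h: "h \<in> SL2" shows "defect Z (adj h) = defect Z h"
proof -
  have I: "inv_set {z \<in> Z. adj h ** z \<notin> Z}" using inv_set_diff[OF Z inv_set_left[OF Z]] h by simp
  have "defect Z (adj h) = emeasure \<mu> {z. h ** z \<in> {z \<in> Z. adj h ** z \<notin> Z}}"
    unfolding defect_def by (rule emeasure_\<mu>_left[OF I h, symmetric])
  also have "\<dots> = emeasure \<mu> {z. h ** z \<in> Z \<and> z \<notin> Z}" using h by simp
  finally show ?thesis using defect_swap[OF Z h] by simp
qed

text \<open>A point outside a closed set stays outside under small displacements, so no point enters
  \<open>Z\<close> for infinitely many n, and continuity from above applies. Counting entries rather
  than exits, by \<open>defect_swap\<close>, is what makes closedness usable.\<close>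

lemma defect_tendsto:
  assumes Z: "inv_set Z" "closed Z" and r: "r \<longlonglongrightarrow> 0"
  shows "(\<lambda>n. defect Z (low (r n) 1)) \<longlonglongrightarrow> 0"
proof -
  define E where "E n = {z. low (r n) 1 ** z \<in> Z \<and> z \<notin> Z}" for n
  have E: "E n = {z. low (r n) 1 ** z \<in> Z} - Z" for n by (auto simp: E_def)
  have Zb: "Z \<in> sets borel" using Z by simp
  have Eb [measurable]: "E n \<in> sets borel" for n
    unfolding E using Zb by (intro sets.Diff left_vimage_borel)
  define A where "A n = (\<Union>k\<in>{n..}. E k)" for n
  have Ab: "A n \<in> sets borel" for n unfolding A_def by (intro sets.countable_UN') auto
  have "(\<lambda>n. emeasure \<mu> (A n)) \<longlonglongrightarrow> emeasure \<mu> (\<Inter>n. A n)"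
  proof (rule Lim_emeasure_decseq)
    show "decseq A" unfolding decseq_def A_def by (intro allI impI UN_mono) auto
    show "range A \<subseteq> sets \<mu>" using Ab by (simp add: image_subset_iff)
    show "emeasure \<mu> (A i) \<noteq> \<infinity>" for i by (simp add: \<mu>.emeasure_finite)
  qed
  moreover have "(\<Inter>n. A n) = {}"
  proof (rule ccontr)
    assume "(\<Inter>n. A n) \<noteq> {}"
    then obtain z where z: "\<And>n. z \<in> A n" by blast
    from z[of 0] have "z \<notin> Z" unfolding A_def E_def by blast
    have lim: "(\<lambda>n. low (r n) 1 ** z) \<longlonglongrightarrow> low 0 1 ** z"
    proof -
      have c: "continuous_on UNIV (\<lambda>s. low s 1 ** z)" unfolding low_def
        by (intro continuous_mat_mult continuous_mk continuous_intros)
      from continuous_on_tendsto_compose[OF this r] show ?thesis by simp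
    qed
    have "open (- Z)" using Z(2) by (simp add: closed_def)
    moreover have "low 0 1 ** z \<in> - Z" using \<open>z \<notin> Z\<close> by simp
    ultimately have "eventually (\<lambda>n. low (r n) 1 ** z \<in> - Z) sequentially"
      using lim by (intro topological_tendstoD)
    then obtain n where "\<forall>k\<ge>n. low (r k) 1 ** z \<in> - Z"
      unfolding eventually_sequentially by (rule exE)
    then have n: "low (r k) 1 ** z \<notin> Z" if "k \<ge> n" for k using that by simp
    from z[of n] obtain k where "k \<ge> n" "low (r k) 1 ** z \<in> Z" unfolding A_def E_def by blast
    with n show False by blast
  qed
  ultimately have lim0: "(\<lambda>n. emeasure \<mu> (A n)) \<longlonglongrightarrow> 0" by simp
  have le: "defect Z (low (r n) 1) \<le> emeasure \<mu> (A n)" for n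
  proof -
    have "defect Z (low (r n) 1) = emeasure \<mu> (E n)" using defect_swap[OF Z(1), of "low (r n) 1"] by (simp add: E_def)
    also have "\<dots> \<le> emeasure \<mu> (A n)" using Ab by (intro emeasure_mono) (auto simp: A_def)
    finally show ?thesis .
  qed
  show ?thesis
    by (rule tendsto_sandwich[of "\<lambda>_. 0" "\<lambda>n. defect Z (low (r n) 1)" sequentially "\<lambda>n. emeasure \<mu> (A n)", OF _ _ tendsto_const lim0])
      (simp_all add: le)
qed

text \<open>Forward invariance settles \<open>U t\<close> for t >= 0 and \<open>defect_adj\<close>
  the negative times. Diagonal elements are then products of horocycle elements with arbitrarily
  small lower ones, and lower elements become arbitrarily small under diagonal conjugation.\<close>

lemma defect_zero:
  assumes Z: "inv_set Z" "closed Z" and fwd: "\<And>t z. t \<ge> 0 \<Longrightarrow> z \<in> Z \<Longrightarrow> U t ** z \<in> Z" and a: "a \<noteq> 0"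
  shows "defect Z (low r a ** U t) = 0"
proof -
  have U1: "defect Z (U t) = 0" if "t \<ge> 0" for t
  proof -
    have e: "{z \<in> Z. U t ** z \<notin> Z} = {}" using fwd that by auto
    show ?thesis unfolding defect_def e by simp
  qed
  have Ut: "defect Z (U t) = 0" for t
    using U1[of t] U1[of "- t"] defect_adj[OF Z(1), of "U (- t)"] by (cases "t \<ge> 0") auto
  have dg: "defect Z (dg l) = 0" if l: "l \<noteq> 0" for l
  proof -
    have le: "defect Z (dg l) \<le> defect Z (low (1 / real (Suc n)) 1) + defect Z (low (- (1 / (real (Suc n) * l))) 1)" for n
    proof -
      define r where "r = 1 / real (Suc n)"
      have r: "r \<noteq> 0" by (simp add: r_def)
      \<comment> \<open>Mautner's identity solved for \<open>dg l\<close>. Both lower factors tend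
        to 1 as n grows, and the factors \<open>U\<close> have defect 0 however long they
        are.\<close>
      have e: "dg l = low (- (r / l)) 1 ** (U ((l - 1) / r) ** (low r 1 ** U ((1 / l - 1) / r)))"
        using r l by (simp add: low_def U_def field_simps)
      have "defect Z (dg l) \<le> (defect Z (U ((1 / l - 1) / r)) + defect Z (low r 1) + defect Z (U ((l - 1) / r))) + defect Z (low (- (r / l)) 1)"
        unfolding e by (intro order_trans[OF defect_mult[OF Z(1)]] add_mono order.refl) auto
      then show ?thesis by (simp add: Ut r_def)
    qed
    have 1: "(\<lambda>n. 1 / real (Suc n)) \<longlonglongrightarrow> 0" using LIMSEQ_inverse_real_of_nat by (simp add: inverse_eq_divide)
    have "(\<lambda>n. - (1 / l * (1 / real (Suc n)))) \<longlonglongrightarrow> - (1 / l * 0)" by (intro tendsto_intros 1)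
    then have 2: "(\<lambda>n. - (1 / (real (Suc n) * l))) \<longlonglongrightarrow> 0" by (simp add: mult.commute)
    have "(\<lambda>n. defect Z (low (1 / real (Suc n)) 1) + defect Z (low (- (1 / (real (Suc n) * l))) 1)) \<longlonglongrightarrow> 0 + 0"
      by (intro tendsto_add defect_tendsto Z 1 2)
    then have "defect Z (dg l) \<le> 0" by (intro LIMSEQ_le_const[of _ 0]) (use le in auto)
    then show ?thesis by simp
  qed
  have lo: "defect Z (low r 1) = 0"
  proof -
    have le: "defect Z (low r 1) \<le> defect Z (low (r / (real (Suc n))\<^sup>2) 1)" for n
    proof -
      define l where "l = real (Suc n)"
      have l: "l \<noteq> 0" by (simp add: l_def)
      \<comment> \<open>Conjugation by \<open>dg l\<close> replaces r by
        \<open>r / l ^ 2\<close>.\<close>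
      have e: "low r 1 = adj (dg l) ** (low (r / l\<^sup>2) 1 ** dg l)"
        using l by (simp add: low_def power2_eq_square)
      have "defect Z (low r 1) \<le> (defect Z (dg l) + defect Z (low (r / l\<^sup>2) 1)) + defect Z (adj (dg l))"
        unfolding e using l by (intro order_trans[OF defect_mult[OF Z(1)]] add_mono order.refl) auto
      also have "\<dots> = defect Z (low (r / l\<^sup>2) 1)" using l defect_adj[OF Z(1), of "dg l"] by (simp add: dg)
      finally show ?thesis by (simp add: l_def)
    qed
    have 1: "(\<lambda>n. 1 / real (Suc n)) \<longlonglongrightarrow> 0" using LIMSEQ_inverse_real_of_nat by (simp add: inverse_eq_divide)
    have "(\<lambda>n. r * (1 / real (Suc n))\<^sup>2) \<longlonglongrightarrow> r * 0\<^sup>2" by (intro tendsto_intros 1)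
    then have "(\<lambda>n. r / (real (Suc n))\<^sup>2) \<longlonglongrightarrow> 0" by (simp add: power_divide)
    from defect_tendsto[OF Z this] have "defect Z (low r 1) \<le> 0" by (intro LIMSEQ_le_const[of _ 0]) (use le in auto)
    then show ?thesis by simp
  qed
  have "defect Z (low r a ** U t) \<le> defect Z (U t) + (defect Z (dg a) + defect Z (low r 1))"
    unfolding low_low[of r a] using a by (intro order_trans[OF defect_mult[OF Z(1)]] add_mono order.refl defect_mult[OF Z(1)]) auto
  then show ?thesis by (simp add: Ut dg[OF a] lo)
qed

text \<open>If the zero set had positive measure, Fubini would yield a point of it that almost every
  group element keeps inside. But the elements carrying this point near \<open>z0\<close> form a
  nonempty open set, and there the bump is positive already at m = 0.\<close>

lemma zero_set_null:
  assumes e: "0 < e" "e \<le> 1" and z0: "z0 \<in> SL2"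
  shows "emeasure \<mu> {z \<in> SL2. \<forall>m\<ge>0. bump z0 e (U m ** z) = 0} = 0" (is "emeasure \<mu> ?Z = 0")
proof (rule ccontr)
  assume pos: "emeasure \<mu> ?Z \<noteq> 0"
  note gf = good_fun_bump[OF e, of z0]
  have cl: "closed ?Z" by (rule closed_good_zero[OF gf])
  have inv: "inv_set ?Z" unfolding inv_set_def using cl
    by (auto simp: matrix_mul_assoc bump_invariant)
  have fwd: "U t ** z \<in> ?Z" if "t \<ge> 0" "z \<in> ?Z" for t z
    using that by (auto simp: matrix_mul_assoc U_add)
  let ?c = "\<lambda>p :: (real \<times> real) \<times> real. low (fst (fst p)) (snd (fst p)) ** U (snd p)"
  have [measurable]: "?Z \<in> sets borel" using cl by auto
  interpret P: pair_sigma_finite "lborel :: ((real \<times> real) \<times> real) measure" \<mu>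
    by (intro pair_sigma_finite.intro lborel.sigma_finite_measure_axioms \<mu>.sigma_finite_measure_axioms)
  let ?h = "\<lambda>p z. indicator (- {0}) (snd (fst p)) * (indicator ?Z z * indicator (- ?Z) (?c p ** z)) :: ennreal"
  have meas: "(\<lambda>(p, z). ?h p z) \<in> borel_measurable (lborel \<Otimes>\<^sub>M \<mu>)"
    unfolding split_beta' by measurable
  have "(\<integral>\<^sup>+z. \<integral>\<^sup>+p. ?h p z \<partial>lborel \<partial>\<mu>) = (\<integral>\<^sup>+p. \<integral>\<^sup>+z. ?h p z \<partial>\<mu> \<partial>lborel)"
    using P.Fubini'[OF meas] by simp
  also have "\<dots> = (\<integral>\<^sup>+p. 0 \<partial>(lborel :: ((real \<times> real) \<times> real) measure))"
  proof (rule nn_integral_cong)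
    fix p :: "(real \<times> real) \<times> real"
    show "(\<integral>\<^sup>+z. ?h p z \<partial>\<mu>) = 0"
    proof (cases "snd (fst p) \<noteq> 0")
      case True
      have "(\<integral>\<^sup>+z. ?h p z \<partial>\<mu>) = (\<integral>\<^sup>+z. indicator {z \<in> ?Z. ?c p ** z \<notin> ?Z} z \<partial>\<mu>)"
        by (rule nn_integral_cong) (use True in \<open>simp add: indicator_def\<close>)
      also have "\<dots> = defect ?Z (?c p)"
      proof -
        have "{z \<in> ?Z. ?c p ** z \<notin> ?Z} = ?Z - {z. ?c p ** z \<in> ?Z}" by auto
        also have "\<dots> \<in> sets borel" by (intro sets.Diff left_vimage_borel) simp_all
        finally show ?thesis unfolding defect_def by (intro nn_integral_indicator) simp
      qed
      also have "\<dots> = 0" by (rule defect_zero[OF inv cl fwd True])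
      finally show ?thesis .
    qed simp
  qed
  finally have "(\<integral>\<^sup>+z. \<integral>\<^sup>+p. ?h p z \<partial>lborel \<partial>\<mu>) = 0" by simp
  then have ae: "AE z in \<mu>. (\<integral>\<^sup>+p. ?h p z \<partial>lborel) = 0"
  proof (subst (asm) nn_integral_0_iff_AE)
    have "(\<lambda>(z, p). ?h p z) \<in> borel_measurable (\<mu> \<Otimes>\<^sub>M lborel)" unfolding split_beta' by measurable
    then show "(\<lambda>z. \<integral>\<^sup>+p. ?h p z \<partial>lborel) \<in> borel_measurable \<mu>" by (rule lborel.borel_measurable_nn_integral)
  qed
  have "\<exists>z\<in>?Z. (\<integral>\<^sup>+p. ?h p z \<partial>lborel) = 0"
  proof (rule ccontr)
    assume neg: "\<not> ?thesis"
    have "AE z in \<mu>. z \<notin> ?Z" using ae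
    proof eventually_elim
      fix z assume "(\<integral>\<^sup>+p. ?h p z \<partial>lborel) = 0"
      with neg show "z \<notin> ?Z" by blast
    qed
    then have "emeasure \<mu> ?Z = 0" by (subst (asm) AE_iff_measurable[OF _ refl]) auto
    with pos show False by simp
  qed
  then obtain z where z: "z \<in> ?Z" "(\<integral>\<^sup>+p. ?h p z \<partial>lborel) = 0" by blast
  have zS: "z \<in> SL2" using z by simp
  define S where "S = {p :: (real \<times> real) \<times> real. snd (fst p) \<noteq> 0}"
  have opS: "open S" unfolding S_def by (intro open_Collect_neq continuous_intros)
  define O' where "O' = {p \<in> S. nm (?c p ** z ** adj z0 - mat 1) < e}"
  have "continuous_on S (\<lambda>p. nm (?c p ** z ** adj z0 - mat 1))"
    unfolding low_def U_def
    by (intro continuous_on_compose2[OF continuous_nm[of UNIV]] continuous_intros continuous_mat_mult continuous_mk) (auto simp: S_def)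
  from continuous_open_preimage[OF this opS open_lessThan[of e]]
  have opO: "open O'" by (simp add: O'_def vimage_def Int_def)
  define q where "q = z0 ** adj z"
  have "q \<in> SL2" using zS z0 by (simp add: q_def)
  \<comment> \<open>An element with corner entry 0 lies outside the chart; a horocycle step of
    length \<open>e / 2\<close> moves it inside and keeps the target within e.\<close>
  define s where "s = (if q $ 1 $ 1 \<noteq> 0 then 0 else e / 2)"
  have s: "\<bar>s\<bar> < e" using e by (simp add: s_def)
  define x where "x = U s ** q"
  have x: "x \<in> SL2" using \<open>q \<in> SL2\<close> by (simp add: x_def)
  have x11: "x $ 1 $ 1 \<noteq> 0"
  proof (cases q rule: mat2_cases)
    case (1 a b c d)
    then show ?thesis using \<open>q \<in> SL2\<close> e by (auto simp: x_def s_def U_def SL2_mk)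
  qed
  have "x ** z ** adj z0 = U s" using zS z0 by (simp add: x_def q_def matrix_mul_assoc[symmetric])
  then have "nm (x ** z ** adj z0 - mat 1) < e" using s by (simp add: U_def mk_one)
  moreover have "x = ?c ((x $ 2 $ 1 / x $ 1 $ 1, x $ 1 $ 1), x $ 1 $ 2 / x $ 1 $ 1)"
    using SL2_decomp[OF x x11] by simp
  ultimately have "((x $ 2 $ 1 / x $ 1 $ 1, x $ 1 $ 1), x $ 1 $ 2 / x $ 1 $ 1) \<in> O'"
    using x11 by (simp add: O'_def S_def)
  then have ne: "O' \<noteq> {}" by blast
  have "emeasure lborel O' = (\<integral>\<^sup>+p. indicator O' p \<partial>lborel)" using opO by simp
  also have "\<dots> \<le> (\<integral>\<^sup>+p. ?h p z \<partial>lborel)"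
  proof (rule nn_integral_mono)
    fix p :: "(real \<times> real) \<times> real"
    show "indicator O' p \<le> ?h p z"
    proof (cases "p \<in> O'")
      case True
      then have "0 < 1 - nm (?c p ** z ** mat 1 ** adj z0 - mat 1) / e" using e by (simp add: O'_def)
      also have "\<dots> \<le> bump z0 e (?c p ** z)" using e one_in by (intro bump_upper) auto
      finally have "bump z0 e (U 0 ** (?c p ** z)) \<noteq> 0" by simp
      then have "?c p ** z \<notin> ?Z" unfolding mem_Collect_eq by blast
      then show ?thesis using z(1) True by (simp add: O'_def S_def indicator_def)
    qed simp
  qed
  finally have "emeasure lborel O' = 0" using z(2) by simp
  then have "O' \<in> null_sets lebesgue" using opO by (intro null_sets_completionI null_setsI) auto
  then show False using open_not_negligible[OF opO ne] negligible_iff_null_sets by blast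
qed

end

section \<open>Lower bound for the time spent near a point\<close>

lemma nn_integral_lborel_pair:
  fixes h :: "'a::euclidean_space \<times> 'b::euclidean_space \<Rightarrow> ennreal"
  assumes [measurable]: "h \<in> borel_measurable borel"
  shows "(\<integral>\<^sup>+p. h p \<partial>lborel) = (\<integral>\<^sup>+x. \<integral>\<^sup>+y. h (x, y) \<partial>lborel \<partial>lborel)"
proof -
  have "(\<integral>\<^sup>+p. h p \<partial>lborel) = (\<integral>\<^sup>+p. h p \<partial>(lborel \<Otimes>\<^sub>M lborel))" by (simp only: lborel_prod)
  also have "\<dots> = (\<integral>\<^sup>+x. \<integral>\<^sup>+y. h (x, y) \<partial>lborel \<partial>lborel)"
    by (rule lborel.nn_integral_fst[symmetric]) (simp add: lborel_prod)
  finally show ?thesis .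
qed

context sl2_lattice
begin

definition visit :: "mat2 \<Rightarrow> real \<Rightarrow> nat \<Rightarrow> mat2 \<Rightarrow> ennreal" where
  "visit z0 e n z = (\<integral>\<^sup>+m. indicator {0..real n} m * ennreal (bump z0 e (U m ** z)) \<partial>lborel)"

text \<open>Horizon and threshold depend on the same n, so that the sets decrease and their
  intersection lies in the zero set of the bump along forward orbits.\<close>

definition rare :: "mat2 \<Rightarrow> real \<Rightarrow> nat \<Rightarrow> mat2 set" where
  "rare z0 e n = {z \<in> SL2. visit z0 e n z < ennreal (1 / (real n + 1))}"

lemma visit_measurable [measurable]:
  assumes e: "0 < e" "e \<le> 1" shows "visit z0 e n \<in> borel_measurable borel"
proof -
  note [measurable] = good_funD(1)[OF good_fun_bump[OF e, of z0]]
  have "(\<lambda>(z, m). indicator {0..real n} m * ennreal (bump z0 e (U m ** z))) \<in> borel_measurable (borel \<Otimes>\<^sub>M lborel)"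
    unfolding split_beta' by measurable
  then show ?thesis unfolding visit_def[abs_def] by (rule lborel.borel_measurable_nn_integral)
qed

lemma inv_set_rare: assumes e: "0 < e" "e \<le> 1" shows "inv_set (rare z0 e n)"
proof -
  note [measurable] = visit_measurable[OF e, of z0 n]
  have [measurable]: "SL2 \<in> sets borel" using closed_SL2 by auto
  have "rare z0 e n = SL2 \<inter> {z \<in> space borel. visit z0 e n z < ennreal (1 / (real n + 1))}"
    by (auto simp: rare_def)
  also have "\<dots> \<in> sets borel" by measurable
  finally have "rare z0 e n \<in> sets borel" .
  moreover have "visit z0 e n (z ** \<gamma>) = visit z0 e n z" if "\<gamma> \<in> \<Gamma>" for z \<gamma>
    using that by (simp add: visit_def matrix_mul_assoc bump_invariant)
  ultimately show ?thesis by (auto simp: inv_set_def rare_def)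
qed

lemma rare_decseq: "decseq (rare z0 e)"
proof (rule decseq_SucI)
  fix n
  have "visit z0 e n z \<le> visit z0 e (Suc n) z" for z
    unfolding visit_def by (intro nn_integral_mono mult_right_mono) (auto simp: indicator_def)
  moreover have "ennreal (1 / (real (Suc n) + 1)) \<le> ennreal (1 / (real n + 1))" by (intro ennreal_leI) (simp add: frac_le)
  ultimately show "rare z0 e (Suc n) \<subseteq> rare z0 e n"
    unfolding rare_def by (blast intro: le_less_trans less_le_trans)
qed

lemma rare_Inter:
  assumes e: "0 < e" "e \<le> 1"
  shows "(\<Inter>n. rare z0 e n) \<subseteq> {z \<in> SL2. \<forall>m\<ge>0. bump z0 e (U m ** z) = 0}"
proof (intro subsetI CollectI conjI allI impI)
  fix z assume z: "z \<in> (\<Inter>n. rare z0 e n)"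
  then show zS: "z \<in> SL2" by (auto simp: rare_def)
  fix m :: real assume m: "m \<ge> 0"
  show "bump z0 e (U m ** z) = 0"
  proof (rule ccontr)
    assume "bump z0 e (U m ** z) \<noteq> 0"
    define \<eta> where "\<eta> = bump z0 e (U m ** z)"
    have \<eta>: "\<eta> > 0" using \<open>bump z0 e (U m ** z) \<noteq> 0\<close> bump_range(1)[OF e(1), of z0 "U m ** z"] by (simp add: \<eta>_def)
    \<comment> \<open>With Lipschitz constant \<open>3 / e\<close>, a drop by
      \<open>\<eta> / 2\<close> takes at least this time.\<close>
    define d where "d = \<eta> * e / 6"
    have d: "d > 0" using \<eta> e by (simp add: d_def)
    have near: "bump z0 e (U s ** z) \<ge> \<eta> / 2" if s: "s \<in> {m..m + d}" for s
    proof -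
      have "U s ** z = U (s - m) ** (U m ** z)" by (simp add: matrix_mul_assoc U_add)
      then have "\<bar>bump z0 e (U s ** z) - \<eta>\<bar> \<le> 3 / e * nm (U (s - m) - mat 1)"
        unfolding \<eta>_def using good_funD(5)[OF good_fun_bump[OF e, of z0], of "U (s - m)" "U m ** z"] zS by simp
      also have "nm (U (s - m) - mat 1) = s - m" using s by (simp add: U_def mk_one)
      also have "3 / e * (s - m) \<le> 3 / e * d" using s e by (intro mult_left_mono) auto
      also have "\<dots> = \<eta> / 2" using e by (simp add: d_def)
      finally show ?thesis by linarith
    qed
    obtain n :: nat where n: "real n \<ge> m + d + 2 / (d * \<eta>)" using real_arch_simple by blast
    have dn: "2 / (d * \<eta>) > 0" using d \<eta> by simp
    have "ennreal (d * (\<eta> / 2)) = (\<integral>\<^sup>+s. ennreal (\<eta> / 2) * indicator {m..m + d} s \<partial>lborel)"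
      using d \<eta> by (simp add: nn_integral_cmult_indicator ennreal_mult[symmetric] mult.commute)
    also have "\<dots> \<le> visit z0 e n z"
      unfolding visit_def
    proof (rule nn_integral_mono)
      fix s :: real
      show "ennreal (\<eta> / 2) * indicator {m..m + d} s \<le> indicator {0..real n} s * ennreal (bump z0 e (U s ** z))"
      proof (cases "s \<in> {m..m + d}")
        case True
        then have "s \<le> m + d" "m \<le> s" by simp_all
        then have "s \<le> real n" "0 \<le> s" using n dn m by linarith+
        then have "s \<in> {0..real n}" by simp
        then show ?thesis using True near[OF True] by (simp add: ennreal_leI)
      qed simp
    qed
    also have "\<dots> < ennreal (1 / (real n + 1))" using z by (auto simp: rare_def)
    finally have "d * (\<eta> / 2) < 1 / (real n + 1)" using d \<eta> by (simp add: ennreal_less_iff)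
    moreover have "1 / (real n + 1) \<le> d * (\<eta> / 2)"
    proof -
      have "2 / (d * \<eta>) \<le> real n + 1" using n m d by linarith
      then have "1 / (real n + 1) \<le> 1 / (2 / (d * \<eta>))" using dn by (intro divide_left_mono) auto
      then show ?thesis by simp
    qed
    ultimately show False by simp
  qed
qed

lemma rare_small:
  assumes e: "0 < e" "e \<le> 1" and z0: "z0 \<in> SL2" and \<delta>: "\<delta> > 0"
  obtains n where "n \<ge> 1" "emeasure \<mu> (rare z0 e n) < ennreal \<delta>"
proof -
  have b: "rare z0 e n \<in> sets borel" for n using inv_set_rare[OF e] by (simp add: inv_set_def)
  have lim: "(\<lambda>n. emeasure \<mu> (rare z0 e n)) \<longlonglongrightarrow> emeasure \<mu> (\<Inter>n. rare z0 e n)"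
    by (rule Lim_emeasure_decseq) (use b rare_decseq in \<open>auto simp: \<mu>.emeasure_finite\<close>)
  have "emeasure \<mu> (\<Inter>n. rare z0 e n) \<le> emeasure \<mu> {z \<in> SL2. \<forall>m\<ge>0. bump z0 e (U m ** z) = 0}"
    using closed_good_zero[OF good_fun_bump[OF e]] by (intro emeasure_mono rare_Inter[OF e]) auto
  also have "\<dots> = 0" by (rule zero_set_null[OF e z0])
  finally have "(\<lambda>n. emeasure \<mu> (rare z0 e n)) \<longlonglongrightarrow> 0" using lim by simp
  then have "eventually (\<lambda>n. emeasure \<mu> (rare z0 e n) < ennreal \<delta>) sequentially"
    using \<delta> by (intro order_tendstoD(2)) auto
  then have "eventually (\<lambda>n. n \<ge> 1 \<and> emeasure \<mu> (rare z0 e n) < ennreal \<delta>) sequentially"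
    using eventually_ge_at_top[of 1] by eventually_elim simp
  then show thesis using that eventually_happens'[of sequentially] by (metis (no_types, lifting) sequentially_bot)
qed

text \<open>An orbit piece of length T / 4, thickened by \<open>1 / T\<close>, has volume
  \<open>\<kappa> / 4\<close> in the chart, and by the multiplicity bound at most half of it lies in
  the rare set. Points of the other half see the target for a definite time within the next n units;
  \<open>U_low\<close> and \<open>bump_compare\<close> transfer these visits to the orbit of
  \<open>g\<close> itself.\<close>

lemma main_term:
  assumes g: "g \<in> SL2" and z0: "z0 \<in> SL2" and e: "0 < e" "e \<le> 1 / 4"
  obtains c T0 where "c > 0" "T0 \<ge> 1"
    "\<And>T \<omega> j. T \<ge> T0 \<Longrightarrow> card (return_set g T) \<le> M \<Longrightarrow> horo_weight \<omega> T 4 \<Longrightarrow> (\<And>t. t \<in> {j..j + T / 4} \<Longrightarrow> \<omega> t \<ge> 1 / 2)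
      \<Longrightarrow> c * T \<le> (\<integral>t. \<omega> t * bump z0 (4 * e) (U t ** g) \<partial>lborel)"
proof -
  have e1: "e \<le> 1" "0 < 4 * e" "4 * e \<le> 1" using e by auto
  \<comment> \<open>\<open>2 * \<kappa>\<close> is half of the tolerance \<open>e / 3\<close> in
    \<open>bump_compare\<close>; the other half is left to the width \<open>1 / T\<close>.\<close>
  define \<kappa> where "\<kappa> = e / 12"
  have \<kappa>: "0 < \<kappa>" "\<kappa> \<le> 1" using e by (auto simp: \<kappa>_def)
  \<comment> \<open>Even \<open>M\<close> overlaps then lose at most \<open>\<kappa> / 8\<close>,
    half of the volume.\<close>
  define \<delta> where "\<delta> = \<kappa> / (8 * (real M + 1))"
  have \<delta>: "\<delta> > 0" using \<kappa> by (simp add: \<delta>_def)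
  obtain n where n: "n \<ge> 1" "emeasure \<mu> (rare z0 e n) < ennreal \<delta>" using rare_small[OF e(1) e1(1) z0 \<delta>] by blast
  define A where "A = rare z0 e n"
  have Ainv: "inv_set A" unfolding A_def by (rule inv_set_rare[OF e(1) e1(1)])
  then have [measurable]: "A \<in> sets borel" by (simp add: inv_set_def)
  \<comment> \<open>This gives \<open>6 * n / T \<le> e / 6\<close>, and also
    \<open>16 * n \<le> T\<close>, so that a time shift by n changes the weight by at most
    1/4.\<close>
  define T0 where "T0 = max 1 (36 * real n / e)"
  define c where "c = 1 / (64 * real n * (real n + 1))"
  note [measurable] = good_funD(1)[OF good_fun_bump[OF e(1) e1(1), of z0]] good_funD(1)[OF good_fun_bump[OF e1(2,3), of z0]]
    visit_measurable[OF e(1) e1(1), of z0 n]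
  show thesis
  proof (rule that[of c T0])
    show "c > 0" "T0 \<ge> 1" using n by (auto simp: c_def T0_def)
    fix T \<omega> j assume T: "T \<ge> T0" and M: "card (return_set g T) \<le> M" and w: "horo_weight \<omega> T 4"
      and w2: "\<And>t. t \<in> {j..j + T / 4} \<Longrightarrow> \<omega> t \<ge> 1 / 2"
    note [measurable] = horo_weightD(1)[OF w]
    have T1: "T \<ge> 1" using T by (simp add: T0_def)
    have Tn: "36 * real n / e \<le> T" using T by (simp add: T0_def)
    then have Tn': "36 * real n \<le> T * e" using e by (simp add: pos_divide_le_eq)
    have Tn16: "16 * real n \<le> T"
    proof -
      have "T * e \<le> T * 1" using T1 e by (intro mult_left_mono) auto
      then show ?thesis using Tn' by linarith
    qed
    define Bq where "Bq = {0..1 / T} \<times> {1..1 + \<kappa>}"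
    have Bq: "closed Bq" unfolding Bq_def by (intro closed_Times) auto
    then have [measurable]: "Bq \<in> sets borel" by auto
    have eBq: "emeasure lborel Bq = ennreal (\<kappa> / T)"
    proof -
      have "emeasure lborel Bq = emeasure (lborel \<Otimes>\<^sub>M lborel) ({0..1 / T} \<times> {1..1 + \<kappa>})" by (simp add: lborel_prod Bq_def)
      also have "\<dots> = ennreal (1 / T) * ennreal \<kappa>" using \<kappa> T1 by (subst lborel.emeasure_pair_measure_Times) auto
      finally show ?thesis using \<kappa> T1 by (simp add: ennreal_mult'[symmetric] mult.commute)
    qed
    define J where "J = {j..j + T / 4}"
    have J: "t \<in> J \<Longrightarrow> \<bar>t\<bar> \<le> T" for t using w2[of t] horo_weightD(4)[OF w, of t] unfolding J_def by (cases "\<bar>t\<bar> \<le> T") auto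
    have [measurable]: "J \<in> sets borel" by (simp add: J_def)
    let ?c = "\<lambda>p :: (real \<times> real) \<times> real. low (fst (fst p)) (snd (fst p)) ** U (snd p) ** g"
    define S where "S = SL2 \<inter> {z \<in> space borel. (z ** adj g) $ 1 $ 1 \<in> {1..1 + \<kappa>} \<and>
       (z ** adj g) $ 2 $ 1 / (z ** adj g) $ 1 $ 1 \<in> {0..1 / T} \<and> (z ** adj g) $ 1 $ 2 / (z ** adj g) $ 1 $ 1 \<in> J}"
    have [measurable]: "SL2 \<in> sets borel" using closed_SL2 by auto
    have Sb: "S \<in> sets borel" unfolding S_def by measurable
    have Sbox: "S \<subseteq> box g T 0"
    proof
      fix z assume z: "z \<in> S"
      define y where "y = z ** adj g"
      have y: "y \<in> SL2" using z g by (simp add: S_def y_def)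
      have b: "y $ 1 $ 1 \<in> {1..1 + \<kappa>}" "y $ 2 $ 1 / y $ 1 $ 1 \<in> {0..1 / T}" "y $ 1 $ 2 / y $ 1 $ 1 \<in> J" using z by (auto simp: S_def y_def)
      have "z = y ** g" using g by (simp add: y_def matrix_mul_assoc[symmetric])
      also have "y = low (y $ 2 $ 1 / y $ 1 $ 1) (y $ 1 $ 1) ** U (y $ 1 $ 2 / y $ 1 $ 1)" using b by (intro SL2_decomp y) auto
      finally have z: "z = low (y $ 2 $ 1 / y $ 1 $ 1) (y $ 1 $ 1) ** U (y $ 1 $ 2 / y $ 1 $ 1) ** g" .
      show "z \<in> box g T 0" unfolding box_def mem_Collect_eq
        by (intro exI[of _ "y $ 2 $ 1 / y $ 1 $ 1"] exI[of _ "y $ 1 $ 1"] exI[of _ "y $ 1 $ 2 / y $ 1 $ 1"] conjI z)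
          (use b J[OF b(3)] \<kappa> in auto)
    qed
    have mult: "finite {\<gamma> \<in> \<Gamma>. z ** \<gamma> \<in> S} \<and> card {\<gamma> \<in> \<Gamma>. z ** \<gamma> \<in> S} \<le> M" if z: "z \<in> SL2" for z
    proof -
      have sub: "{\<gamma> \<in> \<Gamma>. z ** \<gamma> \<in> S} \<subseteq> {\<gamma> \<in> \<Gamma>. z ** \<gamma> \<in> box g T 0}" using Sbox by auto
      have "finite {\<gamma> \<in> \<Gamma>. z ** \<gamma> \<in> box g T 0} \<and> card {\<gamma> \<in> \<Gamma>. z ** \<gamma> \<in> box g T 0} \<le> card (return_set g T)"
        using box_card[OF g _ z] T1 by simp
      then show ?thesis using finite_subset[OF sub] card_mono[OF _ sub] M by linarith
    qed
    have small: "emeasure haar_SL2 (S \<inter> A) \<le> ennreal (\<kappa> / 8)"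
    proof -
      have "emeasure haar_SL2 (S \<inter> A) \<le> of_nat M * emeasure \<mu> A" by (rule emeasure_multiplicity[OF Sb Ainv mult])
      also have "\<dots> \<le> of_nat M * ennreal \<delta>" using n by (intro mult_left_mono) (auto simp: A_def)
      also have "\<dots> = ennreal (real M * \<delta>)" using \<delta> by (simp add: ennreal_of_nat_eq_real_of_nat ennreal_mult)
      also have "\<dots> \<le> ennreal (\<kappa> / 8)" using \<kappa> by (intro ennreal_leI) (simp add: \<delta>_def field_simps)
      finally show ?thesis .
    qed
    let ?B = "\<lambda>p :: (real \<times> real) \<times> real. indicator Bq (fst p) * indicator J (snd p) :: ennreal"
    have cS: "?c p \<in> S" and ca: "1 \<le> snd (fst p)" if p: "fst p \<in> Bq" "snd p \<in> J" for p
    proof -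
      have a: "snd (fst p) \<noteq> 0" using p by (auto simp: Bq_def)
      have "?c p ** adj g = mk (snd (fst p)) (snd (fst p) * snd p) (fst (fst p) * snd (fst p)) (fst (fst p) * snd (fst p) * snd p + 1 / snd (fst p))"
        using g by (simp add: matrix_mul_assoc[symmetric] low_U)
      then show "?c p \<in> S" using p a g unfolding S_def by (auto simp: Bq_def)
      show "1 \<le> snd (fst p)" using p by (auto simp: Bq_def)
    qed
    have 1: "(\<integral>\<^sup>+p. ?B p * indicator A (?c p) \<partial>lborel) \<le> ennreal (\<kappa> / 8)"
    proof -
      have "(\<integral>\<^sup>+p. ?B p * indicator A (?c p) \<partial>lborel) \<le> (\<integral>\<^sup>+p. ennreal \<bar>snd (fst p)\<bar> * indicator (S \<inter> A) (?c p) \<partial>lborel)"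
      proof (rule nn_integral_mono)
        fix p :: "(real \<times> real) \<times> real"
        show "?B p * indicator A (?c p) \<le> ennreal \<bar>snd (fst p)\<bar> * indicator (S \<inter> A) (?c p)"
        proof (cases "fst p \<in> Bq \<and> snd p \<in> J \<and> ?c p \<in> A")
          case True
          then show ?thesis using cS[of p] ca[of p] by (simp add: indicator_def ennreal_ge_1)
        qed (auto simp: indicator_def)
      qed
      also have "\<dots> = (\<integral>\<^sup>+p. indicator (S \<inter> A) (?c p) \<partial>density lborel (\<lambda>p. ennreal \<bar>snd (fst p)\<bar>))"
        using Sb by (subst nn_integral_density) auto
      also have "\<dots> = (\<integral>\<^sup>+z. indicator (S \<inter> A) z \<partial>haar_SL2)"
        using Sb by (subst haar_chart[OF g], subst nn_integral_distr) auto
      also have "\<dots> = emeasure haar_SL2 (S \<inter> A)" using Sb by simp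
      finally show ?thesis using small by simp
    qed
    have vol: "(\<integral>\<^sup>+p. ?B p \<partial>lborel) = ennreal (\<kappa> / 4)"
    proof -
      have "(\<integral>\<^sup>+p. ?B p \<partial>lborel) = (\<integral>\<^sup>+q. \<integral>\<^sup>+t. indicator Bq q * indicator J t \<partial>lborel \<partial>lborel)"
        by (subst nn_integral_lborel_pair) auto
      also have "\<dots> = emeasure lborel J * emeasure lborel Bq" by (simp add: nn_integral_cmult nn_integral_multc mult.commute)
      also have "\<dots> = ennreal (T / 4) * ennreal (\<kappa> / T)" unfolding eBq using T1 by (simp add: J_def)
      also have "\<dots> = ennreal (\<kappa> / 4)" using T1 \<kappa> by (subst ennreal_mult[symmetric]) auto
      finally show ?thesis .
    qed
    have 2: "ennreal (\<kappa> / 8) \<le> (\<integral>\<^sup>+p. ?B p * indicator (- A) (?c p) \<partial>lborel)"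
    proof -
      have "ennreal (\<kappa> / 4) = (\<integral>\<^sup>+p. ?B p * indicator A (?c p) + ?B p * indicator (- A) (?c p) \<partial>lborel)"
        unfolding vol[symmetric] by (rule nn_integral_cong) (auto simp: indicator_def)
      also have "\<dots> = (\<integral>\<^sup>+p. ?B p * indicator A (?c p) \<partial>lborel) + (\<integral>\<^sup>+p. ?B p * indicator (- A) (?c p) \<partial>lborel)"
        by (rule nn_integral_add) auto
      also have "\<dots> \<le> ennreal (\<kappa> / 8) + (\<integral>\<^sup>+p. ?B p * indicator (- A) (?c p) \<partial>lborel)" by (intro add_right_mono 1)
      also have "ennreal (\<kappa> / 4) = ennreal (\<kappa> / 8) + ennreal (\<kappa> / 8)" using \<kappa> by (simp flip: ennreal_plus)
      finally show ?thesis by (simp add: ennreal_add_left_cancel_le)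
    qed
    define W where "W = (\<integral>\<^sup>+t. ennreal (\<omega> t * bump z0 (4 * e) (U t ** g)) \<partial>lborel)"
    have inner: "(\<integral>\<^sup>+t. indicator J t * visit z0 e n (?c (q, t)) \<partial>lborel) \<le> of_nat n * (8 * W)" if q: "q \<in> Bq" for q
    proof -
      obtain r a where qe: "q = (r, a)" by (cases q)
      have r: "0 \<le> r" "r \<le> 1 / T" and a: "1 \<le> a" "a \<le> 1 + \<kappa>" using q by (auto simp: qe Bq_def)
      have "(\<integral>\<^sup>+t. indicator J t * visit z0 e n (?c (q, t)) \<partial>lborel)
        = (\<integral>\<^sup>+t. \<integral>\<^sup>+m. indicator J t * (indicator {0..real n} m * ennreal (bump z0 e (U m ** (low r a ** U t ** g)))) \<partial>lborel \<partial>lborel)"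
        by (simp add: visit_def qe nn_integral_cmult)
      also have "\<dots> = (\<integral>\<^sup>+m. \<integral>\<^sup>+t. indicator J t * (indicator {0..real n} m * ennreal (bump z0 e (U m ** (low r a ** U t ** g)))) \<partial>lborel \<partial>lborel)"
        by (rule nn_integral_swap) (simp add: split_beta')
      also have "\<dots> \<le> (\<integral>\<^sup>+m. indicator {0..real n} m * (8 * W) \<partial>lborel)"
      proof (rule nn_integral_mono)
        fix m :: real
        show "(\<integral>\<^sup>+t. indicator J t * (indicator {0..real n} m * ennreal (bump z0 e (U m ** (low r a ** U t ** g)))) \<partial>lborel) \<le> indicator {0..real n} m * (8 * W)"
        proof (cases "m \<in> {0..real n}")
          case True
          then have m: "0 \<le> m" "m \<le> real n" by auto
          have q1: "1 + m * r \<ge> 1" using m r by simp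
          define l where "l = m / (a\<^sup>2 * (1 + m * r))"
          have l: "0 \<le> l" "l \<le> real n"
          proof -
            have a2: "a\<^sup>2 \<ge> 1" using a by simp
            show "0 \<le> l" using m q1 a2 by (simp add: l_def)
            have "1 * 1 \<le> a\<^sup>2 * (1 + m * r)" using q1 a2 by (intro mult_mono) auto
            then have "l \<le> m / 1" unfolding l_def using m by (intro divide_left_mono) auto
            then show "l \<le> real n" using m by simp
          qed
          define h where "h = low (r / (1 + m * r)) ((1 + m * r) * a)"
          have h: "h \<in> SL2" using q1 a by (auto simp: h_def)
          have "nm (h - mat 1) \<le> 2 * \<kappa> + 6 * (1 / T) * real n"
            unfolding h_def using \<kappa> r a m n T1 by (intro nm_low_shift) auto
          also have "6 * (1 / T) * real n \<le> e / 6" using Tn' T1 by (simp add: field_simps)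
          finally have nh: "nm (h - mat 1) \<le> e / 3" by (simp add: \<kappa>_def)
          \<comment> \<open>The 8 is 2 from \<open>bump_compare\<close> times 4 from the weight,
            which is still at least 1/4 after the shift.\<close>
          have pt: "indicator J t * (indicator {0..real n} m * ennreal (bump z0 e (U m ** (low r a ** U t ** g))))
             \<le> 8 * ennreal (\<omega> (t + l) * bump z0 (4 * e) (U (t + l) ** g))" for t
          proof (cases "t \<in> J")
            case tJ: True
            have "U m ** (low r a ** U t ** g) = (U m ** low r a) ** U t ** g" by (simp add: matrix_mul_assoc)
            also have "U m ** low r a = h ** U l" unfolding h_def l_def using q1 a by (intro U_low) auto
            also have "h ** U l ** U t ** g = h ** (U (t + l) ** g)"
              by (simp add: matrix_mul_assoc[symmetric] add.commute[of t] flip: U_add)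
            finally have "bump z0 e (U m ** (low r a ** U t ** g)) \<le> 2 * bump z0 (4 * e) (U (t + l) ** g)"
              using bump_compare[OF e h nh] by simp
            also have "\<dots> \<le> 8 * (\<omega> (t + l) * bump z0 (4 * e) (U (t + l) ** g))"
            proof -
              have "\<bar>\<omega> t - \<omega> (t + l)\<bar> \<le> 4 / T * \<bar>t - (t + l)\<bar>" by (rule horo_weightD(5)[OF w])
              also have "\<dots> \<le> 4 / T * real n" using l T1 by (intro mult_left_mono) auto
              also have "\<dots> \<le> 1 / 4" using Tn16 T1 by (simp add: field_simps)
              finally have "\<omega> (t + l) \<ge> 1 / 4" using w2[of t] tJ unfolding J_def by linarith
              then have "(1 / 4) * bump z0 (4 * e) (U (t + l) ** g) \<le> \<omega> (t + l) * bump z0 (4 * e) (U (t + l) ** g)"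
                using bump_range(1)[OF e1(2)] by (intro mult_right_mono) auto
              then show ?thesis by simp
            qed
            finally have "ennreal (bump z0 e (U m ** (low r a ** U t ** g))) \<le> ennreal (8 * (\<omega> (t + l) * bump z0 (4 * e) (U (t + l) ** g)))"
              by (rule ennreal_leI)
            then show ?thesis using tJ True by (simp add: ennreal_mult')
          qed simp
          have "(\<integral>\<^sup>+t. indicator J t * (indicator {0..real n} m * ennreal (bump z0 e (U m ** (low r a ** U t ** g)))) \<partial>lborel)
            \<le> (\<integral>\<^sup>+t. 8 * ennreal (\<omega> (t + l) * bump z0 (4 * e) (U (t + l) ** g)) \<partial>lborel)"
            by (rule nn_integral_mono) (rule pt)
          also have "\<dots> = 8 * (\<integral>\<^sup>+t. ennreal (\<omega> (t + l) * bump z0 (4 * e) (U (t + l) ** g)) \<partial>lborel)"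
            by (rule nn_integral_cmult) simp
          also have "(\<integral>\<^sup>+t. ennreal (\<omega> (t + l) * bump z0 (4 * e) (U (t + l) ** g)) \<partial>lborel) = W"
            unfolding W_def by (rule nn_integral_translate) simp
          finally show ?thesis using True by simp
        qed simp
      qed
      also have "\<dots> = of_nat n * (8 * W)"
        by (simp add: nn_integral_multc ennreal_of_nat_eq_real_of_nat)
      finally show ?thesis .
    qed
    have "ennreal (1 / (real n + 1)) * ennreal (\<kappa> / 8) \<le> ennreal (1 / (real n + 1)) * (\<integral>\<^sup>+p. ?B p * indicator (- A) (?c p) \<partial>lborel)"
      by (intro mult_left_mono 2) simp
    also have "\<dots> = (\<integral>\<^sup>+p. ennreal (1 / (real n + 1)) * (?B p * indicator (- A) (?c p)) \<partial>lborel)"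
      by (rule nn_integral_cmult[symmetric]) simp
    also have "\<dots> \<le> (\<integral>\<^sup>+p. ?B p * visit z0 e n (?c p) \<partial>lborel)"
    proof (rule nn_integral_mono)
      fix p :: "(real \<times> real) \<times> real"
      show "ennreal (1 / (real n + 1)) * (?B p * indicator (- A) (?c p)) \<le> ?B p * visit z0 e n (?c p)"
      proof (cases "fst p \<in> Bq \<and> snd p \<in> J \<and> ?c p \<notin> A")
        case True
        have "?c p \<in> SL2" using cS[of p] True by (simp add: S_def)
        then have "ennreal (1 / (real n + 1)) \<le> visit z0 e n (?c p)" using True by (simp add: A_def rare_def not_less)
        then show ?thesis using True by simp
      qed (auto simp: indicator_def)
    qed
    also have "\<dots> = (\<integral>\<^sup>+q. \<integral>\<^sup>+t. indicator Bq q * indicator J t * visit z0 e n (?c (q, t)) \<partial>lborel \<partial>lborel)"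
      by (subst nn_integral_lborel_pair) auto
    also have "\<dots> = (\<integral>\<^sup>+q. indicator Bq q * (\<integral>\<^sup>+t. indicator J t * visit z0 e n (?c (q, t)) \<partial>lborel) \<partial>lborel)"
      unfolding mult.assoc by (intro nn_integral_cong nn_integral_cmult) simp
    also have "\<dots> \<le> (\<integral>\<^sup>+q. (of_nat n * (8 * W)) * indicator Bq q \<partial>lborel)"
      by (rule nn_integral_mono) (use inner in \<open>auto simp: indicator_def\<close>)
    also have "\<dots> = (of_nat n * (8 * W)) * ennreal (\<kappa> / T)"
      by (simp add: nn_integral_cmult_indicator eBq)
    finally have fin: "ennreal (1 / (real n + 1)) * ennreal (\<kappa> / 8) \<le> (of_nat n * (8 * W)) * ennreal (\<kappa> / T)" .
    have intg: "integrable lborel (\<lambda>t. \<omega> t * bump z0 (4 * e) (U t ** g))"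
    proof (rule Bochner_Integration.integrable_bound)
      show "integrable lborel (\<lambda>t. indicator {-T..T} t :: real)" using T1 by (simp add: integrable_indicator_iff)
      show "AE t in lborel. norm (\<omega> t * bump z0 (4 * e) (U t ** g)) \<le> norm (indicator {-T..T} t :: real)"
        using horo_weightD(2-4)[OF w] bump_range[OF e1(2)]
        by (intro AE_I2) (auto simp: abs_mult indicator_def mult_le_one abs_le_iff not_le)
    qed measurable
    define w0 where "w0 = (\<integral>t. \<omega> t * bump z0 (4 * e) (U t ** g) \<partial>lborel)"
    have Ww: "W = ennreal w0" unfolding W_def w0_def
      using horo_weightD(2)[OF w] bump_range(1)[OF e1(2)] by (intro nn_integral_eq_integral intg) auto
    have w0: "w0 \<ge> 0" unfolding w0_def using horo_weightD(2)[OF w] bump_range(1)[OF e1(2)] by (intro integral_nonneg_AE) auto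
    have "ennreal (1 / (real n + 1) * (\<kappa> / 8)) \<le> ennreal (real n * (8 * w0) * (\<kappa> / T))"
      using fin w0 \<kappa> T1 unfolding Ww by (simp add: ennreal_of_nat_eq_real_of_nat ennreal_mult'[symmetric] ennreal_mult''[symmetric] flip: ennreal_numeral)
    then have "1 / (real n + 1) * (\<kappa> / 8) \<le> real n * (8 * w0) * (\<kappa> / T)"
      using w0 \<kappa> T1 by (subst (asm) ennreal_le_iff) auto
    then have "\<kappa> * T \<le> \<kappa> * (w0 * (64 * real n * (real n + 1)))" using T1 by (simp add: field_simps)
    then have "T \<le> w0 * (64 * real n * (real n + 1))" using \<kappa>(1) by (simp only: mult_le_cancel_left_pos)
    moreover have "0 < 64 * real n * (real n + 1)" using n by simp
    ultimately have "T / (64 * real n * (real n + 1)) \<le> w0" by (simp only: pos_divide_le_eq)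
    then show "c * T \<le> w0" by (simp add: c_def)
  qed
qed

end

section \<open>Distribution in arithmetic progressions\<close>

lemma sin_ge_quarter: assumes "0 \<le> x" "x \<le> pi / 2" shows "x / 4 \<le> sin x"
proof (cases "x \<le> pi / 3")
  case True
  have "sin 0 - 0 / 4 \<le> sin x - x / 4"
  proof (rule DERIV_nonneg_imp_nondecreasing[OF assms(1)])
    fix y assume y: "0 \<le> y" "y \<le> x"
    have "cos (pi / 3) \<le> cos y" using y True by (intro cos_monotone_0_pi_le) auto
    then have "0 \<le> cos y - 1 / 4" by (simp add: cos_60)
    moreover have "DERIV (\<lambda>y. sin y - y / 4) y :> cos y - 1 / 4" by (auto intro!: derivative_eq_intros)
    ultimately show "\<exists>D. DERIV (\<lambda>y. sin y - y / 4) y :> D \<and> 0 \<le> D" by blast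
  qed
  then show ?thesis by simp
next
  case False
  have "pi / 6 \<le> x" using False pi_gt_zero by linarith
  then have "sin (pi / 6) \<le> sin x" using assms by (intro sin_monotone_2pi_le) auto
  then have "1 / 2 \<le> sin x" by (simp add: sin_30)
  then show ?thesis using assms pi_less_4 by linarith
qed

lemma round_dist_le_sin: "\<bar>u - of_int (round u)\<bar> \<le> 2 * \<bar>sin (pi * u)\<bar>" for u :: real
proof -
  define v where "v = u - of_int (round u)"
  have v: "\<bar>v\<bar> \<le> 1 / 2" using of_int_round_abs_le[of u] by (simp add: v_def abs_minus_commute)
  have "sin (pi * u) = sin (pi * v + pi * of_int (round u))" by (simp add: v_def algebra_simps)
  also have "\<bar>\<dots>\<bar> = \<bar>sin (pi * v)\<bar>"
    by (simp add: sin_add cos_npi_int)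
  finally have e: "\<bar>sin (pi * u)\<bar> = \<bar>sin (pi * v)\<bar>" .
  have "\<bar>sin (pi * v)\<bar> = \<bar>sin (pi * \<bar>v\<bar>)\<bar>" by (cases "v \<ge> 0") auto
  moreover have "pi * \<bar>v\<bar> / 4 \<le> sin (pi * \<bar>v\<bar>)" using v by (intro sin_ge_quarter) (auto simp: field_simps)
  moreover have "3 * \<bar>v\<bar> \<le> pi * \<bar>v\<bar>" using pi_gt3 by (intro mult_right_mono) auto
  ultimately have "\<bar>v\<bar> / 2 \<le> \<bar>sin (pi * u)\<bar>" using e by linarith
  then show ?thesis by (simp add: v_def)
qed

lemma integral_cis_period:
  assumes d: "d > 0" and j: "j \<noteq> (0::int)"
  shows "integral {0..d} (\<lambda>y. cis (2 * pi * of_int j * (t - y) / d)) = 0"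
proof -
  define c where "c = 2 * pi * of_int j / d"
  have c: "c \<noteq> 0" using d j by (simp add: c_def)
  have "((\<lambda>y. cis (c * (t - y))) has_integral (\<i> * cis (c * (t - d)) / of_real c - \<i> * cis (c * (t - 0)) / of_real c)) {0..d}"
  proof (rule fundamental_theorem_of_calculus)
    fix y assume "y \<in> {0..d}"
    have "((\<lambda>y. c * (t - y)) has_vector_derivative (- c)) (at y within {0..d})"
      unfolding has_real_derivative_iff_has_vector_derivative[symmetric] by (auto intro!: derivative_eq_intros)
    then have "((\<lambda>y. \<i> * complex_of_real (c * (t - y))) has_vector_derivative (\<i> * of_real (- c))) (at y within {0..d})"
      unfolding has_real_derivative_iff_has_vector_derivative[symmetric]
      by (intro has_vector_derivative_mult_right has_vector_derivative_of_real)
    from field_vector_diff_chain_within[OF this DERIV_subset[OF DERIV_exp subset_UNIV]]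
    have "((\<lambda>y. cis (c * (t - y))) has_vector_derivative (\<i> * of_real (- c) * cis (c * (t - y)))) (at y within {0..d})"
      by (simp add: cis_conv_exp o_def)
    then have "((\<lambda>y. (\<i> / of_real c) * cis (c * (t - y))) has_vector_derivative ((\<i> / of_real c) * (\<i> * of_real (- c) * cis (c * (t - y))))) (at y within {0..d})"
      by (rule has_vector_derivative_mult_right)
    then show "((\<lambda>y. \<i> * cis (c * (t - y)) / of_real c) has_vector_derivative cis (c * (t - y))) (at y within {0..d})"
      using c by simp
  qed (use d in simp)
  moreover have "cis (c * (t - d)) = cis (c * t)"
  proof -
    have "c * (t - d) = c * t - 2 * pi * of_int j" using d by (simp add: c_def field_simps)
    then have "cis (c * (t - d)) = cis (c * t) / cis (2 * pi * of_int j)" by (simp only: cis_divide)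
    also have "cis (2 * pi * of_int j) = 1" by (rule cis_multiple_2pi) simp
    finally show ?thesis by simp
  qed
  ultimately have "((\<lambda>y. cis (c * (t - y))) has_integral 0) {0..d}" by simp
  then have "integral {0..d} (\<lambda>y. cis (c * (t - y))) = 0" by (rule integral_unique)
  then show ?thesis by (simp add: c_def)
qed

lemma integral_cis_period':
  assumes "d > 0" shows "integral {0..d} (\<lambda>y. cis (2 * pi * of_int j * (t - y) / d)) = (if j = (0::int) then of_real d else 0)"
  using integral_cis_period[OF assms] assms by (auto simp: scaleR_conv_of_real)

text \<open>\<open>D\<close> is the Fejer kernel, nonnegative with mean 1, and the double sum is the
  Fejer mean with its frequencies uncollected. The squared sine against \<open>D\<close> has mean
  exactly \<open>1 / (2 * k)\<close>, since \<open>s ^ 2\<close> involves only the frequencies 0 and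
  1; Cauchy--Schwarz turns this into the error \<open>1 / sqrt k\<close>.\<close>

lemma fejer_approx:
  fixes P :: "real \<Rightarrow> real" and d C :: real and k :: nat
  assumes d: "d > 0" and k: "k \<ge> 1" and C: "C \<ge> 0" and P: "\<And>t y. \<bar>P t - P y\<bar> \<le> C * \<bar>sin (pi * ((t - y) / d))\<bar>"
    and cont: "continuous_on {0..d} P"
  defines "p a b \<equiv> (1 / of_real d) * integral {0..d} (\<lambda>y. of_real (P y) * cis (2 * pi * of_int (int a - int b) * (- y) / d))"
  shows "norm (of_real (P t) - (1 / of_nat k) * (\<Sum>a<k. \<Sum>b<k. p a b * cis (2 * pi * of_int (int a - int b) / d * t))) \<le> C / sqrt k"
proof -
  define e where "e j y = cis (2 * pi * of_int j * (t - y) / d)" for j y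
  define J where "J y = (1 / of_nat k) * (\<Sum>a<k. \<Sum>b<k. e (int a - int b) y)" for y
  define D where "D y = (1 / real k) * (norm (\<Sum>a<k. e (int a) y))\<^sup>2" for y
  have k0: "real k > 0" using k by simp
  have ce: "continuous_on S (e j)" for S j unfolding e_def using d by (intro continuous_intros) auto
  have cJ: "continuous_on S J" for S unfolding J_def by (intro continuous_intros ce)
  have JD: "J y = of_real (D y)" for y
  proof -
    have "complex_of_real ((norm (\<Sum>a<k. e (int a) y))\<^sup>2) = (\<Sum>a<k. e (int a) y) * cnj (\<Sum>a<k. e (int a) y)" by (rule complex_norm_square)
    also have "\<dots> = (\<Sum>a<k. \<Sum>b<k. e (int a) y * cnj (e (int b) y))" by (simp add: sum_product)
    also have "\<dots> = (\<Sum>a<k. \<Sum>b<k. e (int a - int b) y)"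
    proof (intro sum.cong refl)
      fix a b
      have "2 * pi * of_int (int a) * (t - y) / d + - (2 * pi * of_int (int b) * (t - y) / d) = 2 * pi * of_int (int a - int b) * (t - y) / d"
        by (simp add: left_diff_distrib right_diff_distrib diff_divide_distrib)
      then show "e (int a) y * cnj (e (int b) y) = e (int a - int b) y"
        unfolding e_def cis_cnj cis_mult by (rule arg_cong)
    qed
    finally show ?thesis by (simp add: J_def D_def)
  qed
  have D0: "D y \<ge> 0" for y by (simp add: D_def)
  have cD: "continuous_on S D" for S unfolding D_def by (intro continuous_intros ce)
  have ie: "e j integrable_on {0..d}" for j by (intro integrable_continuous_interval ce)
  have iE: "integral {0..d} (e j) = (if j = 0 then of_real d else 0)" for j
    unfolding e_def by (rule integral_cis_period'[OF d])
  have intJ: "integral {0..d} J = of_real d"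
  proof -
    have "integral {0..d} J = (1 / of_nat k) * (\<Sum>a<k. \<Sum>b<k. integral {0..d} (e (int a - int b)))"
      unfolding J_def by (simp add: Henstock_Kurzweil_Integration.integral_sum ie integrable_sum)
    also have "(\<Sum>a<k. \<Sum>b<k. integral {0..d} (e (int a - int b))) = (\<Sum>a<k. of_real d)"
      by (intro sum.cong refl) (simp add: iE)
    finally show ?thesis using k0 by simp
  qed
  have intD: "integral {0..d} D = d"
  proof -
    have "complex_of_real (integral {0..d} D) = integral {0..d} (\<lambda>y. complex_of_real (D y))"
      by (rule integral_linear[OF _ bounded_linear_of_real, unfolded o_def, symmetric]) (intro integrable_continuous_interval cD)
    also have "\<dots> = of_real d" using intJ by (simp add: JD[symmetric])
    finally show ?thesis by simp
  qed
  define s where "s y = sin (pi * ((t - y) / d))" for y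
  have cs: "continuous_on S s" for S unfolding s_def using d by (intro continuous_intros) auto
  \<comment> \<open>Only the k - 1 pairs with b = a + 1 survive the integration.\<close>
  have intJe: "integral {0..d} (\<lambda>y. J y * e 1 y) = of_real (d * (real k - 1) / real k)"
  proof -
    have ee: "e i y * e j y = e (i + j) y" for i j y
      unfolding e_def cis_mult by (rule arg_cong[of _ _ cis]) (simp add: algebra_simps add_divide_distrib diff_divide_distrib)
    have "integral {0..d} (\<lambda>y. J y * e 1 y) = integral {0..d} (\<lambda>y. (1 / of_nat k) * (\<Sum>a<k. \<Sum>b<k. e (int a - int b + 1) y))"
      unfolding J_def by (simp add: sum_distrib_right mult.assoc ee)
    also have "\<dots> = (1 / of_nat k) * (\<Sum>a<k. \<Sum>b<k. integral {0..d} (e (int a - int b + 1)))"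
      by (simp add: Henstock_Kurzweil_Integration.integral_sum ie integrable_sum)
    also have "(\<Sum>a<k. \<Sum>b<k. integral {0..d} (e (int a - int b + 1))) = (\<Sum>a<k. if a + 1 < k then of_real d else 0)"
    proof (intro sum.cong refl)
      fix a assume "a \<in> {..<k}"
      have "(\<Sum>b<k. integral {0..d} (e (int a - int b + 1))) = (\<Sum>b<k. if b = a + 1 then complex_of_real d else 0)"
        by (intro sum.cong refl) (auto simp: iE)
      then show "(\<Sum>b<k. integral {0..d} (e (int a - int b + 1))) = (if a + 1 < k then of_real d else 0)" by simp
    qed
    also have "\<dots> = (\<Sum>a\<in>{..<k - 1}. of_real d)"
    proof -
      have "{a \<in> {..<k}. a + 1 < k} = {..<k - 1}" by auto
      then show ?thesis by (subst sum.inter_filter[symmetric]) auto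
    qed
    finally show ?thesis using k by (simp add: of_nat_diff mult.commute)
  qed
  have intDs: "integral {0..d} (\<lambda>y. (s y)\<^sup>2 * D y) = d / (2 * real k)"
  proof -
    have sq: "(s y)\<^sup>2 = (1 - Re (e 1 y)) / 2" for y
    proof -
      have "cos (2 * (pi * ((t - y) / d))) = 1 - 2 * (s y)\<^sup>2" unfolding s_def by (rule cos_double_sin)
      then show ?thesis by (simp add: e_def mult.assoc)
    qed
    have "(s y)\<^sup>2 * D y = D y / 2 - Re (J y * e 1 y) / 2" for y
      unfolding sq JD by (simp add: field_simps)
    then have "integral {0..d} (\<lambda>y. (s y)\<^sup>2 * D y) = integral {0..d} (\<lambda>y. D y / 2 - Re (J y * e 1 y) / 2)" by simp
    also have "\<dots> = integral {0..d} D / 2 - integral {0..d} (\<lambda>y. Re (J y * e 1 y)) / 2"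
      by (subst Henstock_Kurzweil_Integration.integral_diff) (auto intro!: integrable_continuous_interval continuous_intros cD cJ ce)
    also have "integral {0..d} (\<lambda>y. Re (J y * e 1 y)) = Re (integral {0..d} (\<lambda>y. J y * e 1 y))"
      by (rule integral_linear[OF _ bounded_linear_Re, unfolded o_def]) (intro integrable_continuous_interval continuous_intros cJ ce)
    finally show ?thesis unfolding intD intJe using k0 by (simp add: field_simps)
  qed
  have A: "(1 / of_nat k) * (\<Sum>a<k. \<Sum>b<k. p a b * cis (2 * pi * of_int (int a - int b) / d * t))
     = (1 / of_real d) * integral {0..d} (\<lambda>y. of_real (P y) * J y)"
  proof -
    have cP: "continuous_on {0..d} (\<lambda>y. complex_of_real (P y))" by (intro continuous_intros cont)
    have ipe: "(\<lambda>y. of_real (P y) * e j y) integrable_on {0..d}" for j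
      by (intro integrable_continuous_interval continuous_on_mult cP ce)
    have pe: "p a b * cis (2 * pi * of_int (int a - int b) / d * t) = (1 / of_real d) * integral {0..d} (\<lambda>y. of_real (P y) * e (int a - int b) y)" for a b
    proof -
      have "cis (2 * pi * of_int (int a - int b) * (- y) / d) * cis (2 * pi * of_int (int a - int b) / d * t) = e (int a - int b) y" for y
        unfolding e_def cis_mult using d by (intro arg_cong[of _ _ cis]) (simp add: field_simps)
      then have m: "of_real (P y) * cis (2 * pi * of_int (int a - int b) * (- y) / d) * cis (2 * pi * of_int (int a - int b) / d * t) = of_real (P y) * e (int a - int b) y" for y
        by (simp only: mult.assoc)
      have "integral {0..d} (\<lambda>y. of_real (P y) * cis (2 * pi * of_int (int a - int b) * (- y) / d)) * cis (2 * pi * of_int (int a - int b) / d * t)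
        = integral {0..d} (\<lambda>y. of_real (P y) * cis (2 * pi * of_int (int a - int b) * (- y) / d) * cis (2 * pi * of_int (int a - int b) / d * t))"
        by (rule integral_mult_left[symmetric])
      also have "\<dots> = integral {0..d} (\<lambda>y. of_real (P y) * e (int a - int b) y)" by (simp only: m)
      finally show ?thesis unfolding p_def mult.assoc[of "1 / of_real d"] by (rule arg_cong)
    qed
    have "(\<lambda>y. of_real (P y) * J y) = (\<lambda>y. (1 / of_nat k) * (\<Sum>a<k. \<Sum>b<k. of_real (P y) * e (int a - int b) y))"
      by (rule ext) (simp add: J_def sum_distrib_left)
    then have "integral {0..d} (\<lambda>y. of_real (P y) * J y) = (1 / of_nat k) * (\<Sum>a<k. \<Sum>b<k. integral {0..d} (\<lambda>y. of_real (P y) * e (int a - int b) y))"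
      by (simp add: Henstock_Kurzweil_Integration.integral_sum integrable_sum ipe)
    then show ?thesis unfolding pe by (simp add: sum_distrib_left mult.commute)
  qed
  have B: "complex_of_real (P t) = (1 / of_real d) * integral {0..d} (\<lambda>y. of_real (P t) * J y)"
    using d by (simp add: intJ)
  have ci: "(\<lambda>y. complex_of_real (P t) * J y) integrable_on {0..d}" "(\<lambda>y. complex_of_real (P y) * J y) integrable_on {0..d}"
    by (intro integrable_continuous_interval continuous_intros cJ cont)+
  have "of_real (P t) - (1 / of_nat k) * (\<Sum>a<k. \<Sum>b<k. p a b * cis (2 * pi * of_int (int a - int b) / d * t))
     = (1 / of_real d) * integral {0..d} (\<lambda>y. of_real (P t) * J y - of_real (P y) * J y)"
    unfolding A using B ci by (simp add: Henstock_Kurzweil_Integration.integral_diff right_diff_distrib)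
  then have "norm (of_real (P t) - (1 / of_nat k) * (\<Sum>a<k. \<Sum>b<k. p a b * cis (2 * pi * of_int (int a - int b) / d * t)))
     = (1 / d) * norm (integral {0..d} (\<lambda>y. of_real (P t) * J y - of_real (P y) * J y))"
    using d by (simp add: norm_mult norm_divide)
  also have "\<dots> \<le> (1 / d) * integral {0..d} (\<lambda>y. C * (1 / (2 * sqrt k) * D y + sqrt k / 2 * ((s y)\<^sup>2 * D y)))"
  proof (rule mult_left_mono)
    show "norm (integral {0..d} (\<lambda>y. of_real (P t) * J y - of_real (P y) * J y)) \<le> integral {0..d} (\<lambda>y. C * (1 / (2 * sqrt k) * D y + sqrt k / 2 * ((s y)\<^sup>2 * D y)))"
    proof (rule Henstock_Kurzweil_Integration.integral_norm_bound_integral)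
      show "(\<lambda>y. complex_of_real (P t) * J y - of_real (P y) * J y) integrable_on {0..d}" using ci by (rule integrable_diff)
      show "(\<lambda>y. C * (1 / (2 * sqrt k) * D y + sqrt k / 2 * ((s y)\<^sup>2 * D y))) integrable_on {0..d}"
        using k0 by (intro integrable_continuous_interval continuous_intros cD cs) auto
      fix y
      have "norm (complex_of_real (P t) * J y - of_real (P y) * J y) = \<bar>P t - P y\<bar> * D y"
        unfolding JD left_diff_distrib[symmetric] norm_mult of_real_diff[symmetric] norm_of_real using D0 by simp
      also have "\<dots> \<le> (C * \<bar>s y\<bar>) * D y" unfolding s_def by (intro mult_right_mono P D0)
      also have "\<dots> \<le> (C * (1 / (2 * sqrt k) + sqrt k / 2 * (s y)\<^sup>2)) * D y"
      proof (intro mult_right_mono mult_left_mono C D0)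
        \<comment> \<open>The weight \<open>sqrt k\<close> balances, up to a constant, the integrals
          \<open>d\<close> and \<open>d / (2 * k)\<close> found above.\<close>
        define q where "q = sqrt k"
        have q: "q > 0" using k0 by (simp add: q_def)
        have "0 \<le> (q * \<bar>s y\<bar> - 1)\<^sup>2 / (2 * q)" using q by simp
        also have "\<dots> = 1 / (2 * q) + q / 2 * (s y)\<^sup>2 - \<bar>s y\<bar>" using q by (simp add: power2_diff power_mult_distrib field_simps power2_eq_square)
        finally show "\<bar>s y\<bar> \<le> 1 / (2 * sqrt k) + sqrt k / 2 * (s y)\<^sup>2" by (simp add: q_def)
      qed
      finally show "norm (complex_of_real (P t) * J y - of_real (P y) * J y) \<le> C * (1 / (2 * sqrt k) * D y + sqrt k / 2 * ((s y)\<^sup>2 * D y))"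
        by (simp add: algebra_simps)
    qed
  qed (use d in simp)
  also have "integral {0..d} (\<lambda>y. C * (1 / (2 * sqrt k) * D y + sqrt k / 2 * ((s y)\<^sup>2 * D y))) = C * (1 / (2 * sqrt k) * d + sqrt k / 2 * (d / (2 * real k)))"
  proof -
    have "integral {0..d} (\<lambda>y. 1 / (2 * sqrt k) * D y + sqrt k / 2 * ((s y)\<^sup>2 * D y)) = 1 / (2 * sqrt k) * integral {0..d} D + sqrt k / 2 * integral {0..d} (\<lambda>y. (s y)\<^sup>2 * D y)"
      using k0 by (subst Henstock_Kurzweil_Integration.integral_add) (auto intro!: integrable_continuous_interval continuous_intros cD cs)
    then show ?thesis by (simp add: intD intDs)
  qed
  also have "(1 / d) * (C * (1 / (2 * sqrt k) * d + sqrt k / 2 * (d / (2 * real k)))) = C * (3 / 4) / sqrt k"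
  proof -
    define q where "q = sqrt k"
    have q: "q > 0" "real k = q * q" using k0 by (auto simp: q_def)
    show ?thesis unfolding q_def[symmetric] q(2) using q(1) d by (simp add: field_simps)
  qed
  also have "\<dots> \<le> C / sqrt k" using C by (intro divide_right_mono) auto
  finally show ?thesis .
qed

section \<open>Periodic tents that detect multiples of d\<close>

definition tent :: "real \<Rightarrow> real \<Rightarrow> real" where "tent \<kappa> x = max 0 (1 - \<bar>x\<bar> / \<kappa>)"

text \<open>For \<kappa> <= 1/2 and d >= 1 the tents at different multiples of d do not overlap, so
  this is the d-periodic sum of the translates of \<open>tent \<kappa>\<close>.\<close>

definition ptent :: "real \<Rightarrow> nat \<Rightarrow> real \<Rightarrow> real" where
  "ptent \<kappa> d t = tent \<kappa> (t - real d * of_int (round (t / real d)))"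

lemma tent_lipschitz: assumes "\<kappa> > 0" shows "\<bar>tent \<kappa> x - tent \<kappa> y\<bar> \<le> \<bar>\<bar>x\<bar> - \<bar>y\<bar>\<bar> / \<kappa>"
proof -
  have "\<bar>tent \<kappa> x - tent \<kappa> y\<bar> \<le> \<bar>\<bar>x\<bar> / \<kappa> - \<bar>y\<bar> / \<kappa>\<bar>" by (auto simp: tent_def max_def)
  also have "\<dots> = \<bar>\<bar>x\<bar> - \<bar>y\<bar>\<bar> / \<kappa>" using assms by (simp add: diff_divide_distrib[symmetric] abs_divide)
  finally show ?thesis .
qed

lemma tent_range: "\<kappa> > 0 \<Longrightarrow> 0 \<le> tent \<kappa> x \<and> tent \<kappa> x \<le> 1" by (simp add: tent_def)

lemma tent_eq_0: "\<kappa> > 0 \<Longrightarrow> \<bar>x\<bar> \<ge> \<kappa> \<Longrightarrow> tent \<kappa> x = 0" by (simp add: tent_def field_simps)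

lemma lattice_dist_le: assumes "d \<ge> 1" shows "\<bar>t - real d * of_int (round (t / real d))\<bar> \<le> \<bar>t - real d * of_int m\<bar>"
proof -
  have d: "real d > 0" using assms by simp
  have "\<bar>t - real d * of_int i\<bar> = real d * \<bar>t / real d - of_int i\<bar>" for i :: int
  proof -
    have "t - real d * of_int i = real d * (t / real d - of_int i)" using d by (simp add: field_simps)
    then show ?thesis using d by (simp add: abs_mult)
  qed
  then show ?thesis using round_diff_minimal[of "t / real d" m] d by (simp add: abs_minus_commute)
qed

text \<open>The distance to the nearest multiple of d is subadditive and is bounded by the sine. The
  bound is periodic in t - y, as \<open>fejer_approx\<close> demands.\<close>

lemma ptent_lipschitz:
  assumes k: "\<kappa> > 0" and d: "d \<ge> 1"
  shows "\<bar>ptent \<kappa> d t - ptent \<kappa> d y\<bar> \<le> (2 * real d / \<kappa>) * \<bar>sin (pi * ((t - y) / real d))\<bar>"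
proof -
  have d0: "real d > 0" using d by simp
  define r where "r t = round (t / real d)" for t
  define D where "D t = \<bar>t - real d * of_int (r t)\<bar>" for t
  have "D (x + z) \<le> D x + D z" for x z
  proof -
    have "D (x + z) \<le> \<bar>x + z - real d * of_int (r x + r z)\<bar>" unfolding D_def r_def by (rule lattice_dist_le[OF d])
    also have "\<dots> \<le> D x + D z" unfolding D_def by (simp add: algebra_simps)
    finally show ?thesis .
  qed
  note sub = this
  have sym: "D (- x) \<le> D x" for x
  proof -
    have "D (- x) \<le> \<bar>- x - real d * of_int (- r x)\<bar>" unfolding D_def r_def by (rule lattice_dist_le[OF d])
    then show ?thesis by (simp add: D_def abs_minus_commute)
  qed
  have "\<bar>D t - D y\<bar> \<le> D (t - y)" using sub[of y "t - y"] sub[of t "y - t"] sym[of "t - y"] by simp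
  also have "D (t - y) = real d * \<bar>(t - y) / real d - of_int (r (t - y))\<bar>"
  proof -
    have "(t - y) - real d * of_int (r (t - y)) = real d * ((t - y) / real d - of_int (r (t - y)))" using d0 by (simp add: field_simps)
    then show ?thesis using d0 by (simp add: D_def abs_mult)
  qed
  also have "\<dots> \<le> real d * (2 * \<bar>sin (pi * ((t - y) / real d))\<bar>)" unfolding r_def by (intro mult_left_mono round_dist_le_sin) simp
  finally have "\<bar>D t - D y\<bar> / \<kappa> \<le> real d * (2 * \<bar>sin (pi * ((t - y) / real d))\<bar>) / \<kappa>" using k by (intro divide_right_mono) auto
  moreover have "\<bar>ptent \<kappa> d t - ptent \<kappa> d y\<bar> \<le> \<bar>D t - D y\<bar> / \<kappa>"
    unfolding ptent_def D_def r_def by (rule tent_lipschitz[OF k])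
  ultimately show ?thesis by (simp add: mult.commute mult.left_commute)
qed

lemma ptent_continuous: assumes k: "\<kappa> > 0" and d: "d \<ge> 1" shows "continuous_on S (ptent \<kappa> d)"
proof (rule continuous_on_subset[OF _ subset_UNIV], rule continuous_onI)
  fix x e :: real assume e: "e > 0"
  have d0: "real d > 0" using d by simp
  define C where "C = 2 * real d / \<kappa> * (pi / real d)"
  have C: "C > 0" using k d0 by (simp add: C_def)
  show "\<exists>\<delta>>0. \<forall>x'\<in>UNIV. dist x' x < \<delta> \<longrightarrow> dist (ptent \<kappa> d x') (ptent \<kappa> d x) \<le> e"
  proof (intro exI[of _ "e / C"] conjI ballI impI)
    fix y assume y: "dist y x < e / C"
    have "\<bar>ptent \<kappa> d y - ptent \<kappa> d x\<bar> \<le> (2 * real d / \<kappa>) * \<bar>sin (pi * ((y - x) / real d))\<bar>" by (rule ptent_lipschitz[OF k d])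
    also have "\<dots> \<le> (2 * real d / \<kappa>) * \<bar>pi * ((y - x) / real d)\<bar>" using k by (intro mult_left_mono abs_sin_x_le_abs_x) auto
    also have "\<dots> = C * \<bar>y - x\<bar>" using d0 by (simp add: C_def abs_mult)
    also have "\<dots> \<le> C * (e / C)" using y C by (intro mult_left_mono) (auto simp: dist_real_def)
    finally show "dist (ptent \<kappa> d y) (ptent \<kappa> d x) \<le> e" using C by (simp add: dist_real_def)
  qed (use e C in simp)
qed

lemma ptent_integral:
  assumes k: "0 < \<kappa>" "\<kappa> \<le> 1 / 2" and d: "d \<ge> 1"
  shows "integral {0..real d} (ptent \<kappa> d) = \<kappa>"
proof -
  have d1: "real d \<ge> 1" using d by simp
  have dk: "\<kappa> \<le> real d - \<kappa>" using k d1 by linarith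
  have p1: "ptent \<kappa> d t = tent \<kappa> t" if t: "0 \<le> t" "t \<le> \<kappa>" for t
  proof -
    have "t / real d < 1 / 2 \<or> round (t / real d) = 0 \<or> \<bar>t - real d * of_int (round (t / real d))\<bar> \<ge> \<bar>t\<bar>"
    proof (cases "round (t / real d) = 0")
      case False
      then have "\<bar>real_of_int (round (t / real d))\<bar> \<ge> 1" by linarith
      then have "real d * 1 \<le> real d * \<bar>real_of_int (round (t / real d))\<bar>" by (intro mult_left_mono) auto
      then have "real d \<le> \<bar>real d * of_int (round (t / real d))\<bar>" by (simp add: abs_mult)
      then show ?thesis using t k d1 by linarith
    qed simp
    moreover have "\<bar>t - real d * of_int (round (t / real d))\<bar> \<le> \<bar>t\<bar>" using lattice_dist_le[OF d, of t 0] by simp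
    moreover have "round (t / real d) = 0" if "t / real d < 1 / 2"
      using that t d1 by (intro round_unique) auto
    ultimately show ?thesis unfolding ptent_def tent_def by fastforce
  qed
  have p2: "ptent \<kappa> d t = 0" if t: "\<kappa> \<le> t" "t \<le> real d - \<kappa>" for t
  proof -
    have "\<bar>t - real d * of_int m\<bar> \<ge> \<kappa>" for m :: int
    proof (cases "m \<le> 0")
      case True
      then have "real d * of_int m \<le> 0" by (simp add: mult_nonneg_nonpos)
      then show ?thesis using t by linarith
    next
      case False
      then have "real d * 1 \<le> real d * of_int m" by (intro mult_left_mono) auto
      then show ?thesis using t by linarith
    qed
    then show ?thesis unfolding ptent_def using k by (intro tent_eq_0) auto
  qed
  have p3: "ptent \<kappa> d t = ptent \<kappa> d (real d - t)" for t
  proof -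
    have "\<bar>t - real d * of_int (round (t / real d))\<bar> = \<bar>(real d - t) - real d * of_int (round ((real d - t) / real d))\<bar>"
    proof (rule antisym)
      show "\<bar>t - real d * of_int (round (t / real d))\<bar> \<le> \<bar>(real d - t) - real d * of_int (round ((real d - t) / real d))\<bar>"
        using lattice_dist_le[OF d, of t "1 - round ((real d - t) / real d)"] by (simp add: algebra_simps)
      show "\<bar>(real d - t) - real d * of_int (round ((real d - t) / real d))\<bar> \<le> \<bar>t - real d * of_int (round (t / real d))\<bar>"
        using lattice_dist_le[OF d, of "real d - t" "1 - round (t / real d)"] by (simp add: algebra_simps)
    qed
    then show ?thesis by (simp add: ptent_def tent_def)
  qed
  have h1: "(ptent \<kappa> d has_integral \<kappa> / 2) {0..\<kappa>}"
  proof -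
    have "((\<lambda>t. 1 - t / \<kappa>) has_integral ((\<kappa> - \<kappa>\<^sup>2 / (2 * \<kappa>)) - (0 - 0\<^sup>2 / (2 * \<kappa>)))) {0..\<kappa>}"
    proof (rule fundamental_theorem_of_calculus)
      fix t
      show "((\<lambda>t. t - t\<^sup>2 / (2 * \<kappa>)) has_vector_derivative (1 - t / \<kappa>)) (at t within {0..\<kappa>})"
        unfolding has_real_derivative_iff_has_vector_derivative[symmetric] using k by (auto intro!: derivative_eq_intros)
    qed (use k in simp)
    moreover have "(\<kappa> - \<kappa>\<^sup>2 / (2 * \<kappa>)) - (0 - 0\<^sup>2 / (2 * \<kappa>)) = \<kappa> / 2" using k by (simp add: power2_eq_square)
    ultimately have "((\<lambda>t. 1 - t / \<kappa>) has_integral \<kappa> / 2) {0..\<kappa>}" by (simp only:)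
    then show ?thesis
      by (rule has_integral_eq[rotated]) (use k p1 in \<open>auto simp: tent_def\<close>)
  qed
  have h2: "(ptent \<kappa> d has_integral 0) {\<kappa>..real d - \<kappa>}"
    by (rule has_integral_is_0) (use p2 in auto)
  have h3: "(ptent \<kappa> d has_integral \<kappa> / 2) {real d - \<kappa>..real d}"
  proof -
    have "((\<lambda>t. ptent \<kappa> d (-1 * t + real d)) has_integral (1 / \<bar>-1\<bar> * (\<kappa> / 2))) ((\<lambda>x. (1 / -1) * x + - ((1 / -1) * real d)) ` {0..\<kappa>})"
      using has_integral_affinity[of "ptent \<kappa> d" "\<kappa> / 2" 0 \<kappa> "-1" "real d"] h1 by simp
    moreover have "(\<lambda>x. (1 / -1) * x + - ((1 / -1) * real d)) ` {0..\<kappa>} = {real d - \<kappa>..real d}"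
      using k by (auto simp: image_iff intro!: bexI[of _ "real d - _"])
    moreover have "ptent \<kappa> d (-1 * t + real d) = ptent \<kappa> d t" for t using p3[of t] by (simp add: algebra_simps)
    ultimately show ?thesis by simp
  qed
  have "(ptent \<kappa> d has_integral (\<kappa> / 2 + 0 + \<kappa> / 2)) {0..real d}"
    by (rule has_integral_combine[of 0 "real d - \<kappa>"], use k dk in simp, use k in simp,
        rule has_integral_combine[of 0 \<kappa>]) (use h1 h2 h3 k dk in auto)
  then show ?thesis by (simp add: integral_unique)
qed

lemma ptent_range: "\<kappa> > 0 \<Longrightarrow> 0 \<le> ptent \<kappa> d t \<and> ptent \<kappa> d t \<le> 1" unfolding ptent_def by (rule tent_range)

text \<open>The margins 1 and N - 1 ensure that a multiple of d within \<kappa> of t has its index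
  between 1 and N, so the finite sum misses no tent.\<close>

lemma tent_sum:
  fixes \<epsilon> :: int
  assumes k: "0 < \<kappa>" "\<kappa> \<le> 1 / 2" and d: "d \<ge> 1" and eps: "\<epsilon> = 1 \<or> \<epsilon> = -1"
    and t: "1 \<le> of_int \<epsilon> * t" "of_int \<epsilon> * t \<le> real N - 1"
  shows "(\<Sum>n\<in>{n \<in> {1..N}. d dvd n}. tent \<kappa> (t - of_int \<epsilon> * real n)) = ptent \<kappa> d t"
proof -
  have ee: "real_of_int \<epsilon> * real_of_int \<epsilon> = 1" "\<bar>real_of_int \<epsilon>\<bar> = 1" using eps by auto
  define m where "m = round (t / real d)"
  have near: "\<bar>t - real d * of_int m\<bar> \<le> \<bar>t - of_int \<epsilon> * real n\<bar>" if n: "d dvd n" for n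
  proof -
    obtain q where "n = d * q" using n by blast
    then have e: "of_int \<epsilon> * real n = real d * of_int (\<epsilon> * int q)" by simp
    show ?thesis unfolding m_def e by (rule lattice_dist_le[OF d])
  qed
  show ?thesis
  proof (cases "\<bar>t - real d * of_int m\<bar> \<ge> \<kappa>")
    case True
    then have "ptent \<kappa> d t = 0" unfolding ptent_def m_def[symmetric] by (intro tent_eq_0 k)
    moreover have "(\<Sum>n\<in>{n \<in> {1..N}. d dvd n}. tent \<kappa> (t - of_int \<epsilon> * real n)) = 0"
      using near True by (intro sum.neutral ballI tent_eq_0 k) fastforce
    ultimately show ?thesis by simp
  next
    case False
    define n0 where "n0 = nat (\<epsilon> * (int d * m))"
    have "\<bar>of_int \<epsilon> * t - of_int (\<epsilon> * (int d * m))\<bar> = \<bar>of_int \<epsilon> * (t - real d * of_int m)\<bar>" by (simp add: algebra_simps)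
    also have "\<dots> = \<bar>t - real d * of_int m\<bar>" by (simp add: abs_mult ee)
    finally have c: "\<bar>of_int \<epsilon> * t - of_int (\<epsilon> * (int d * m))\<bar> < \<kappa>" using False by simp
    then have "real_of_int (\<epsilon> * (int d * m)) > 0" "real_of_int (\<epsilon> * (int d * m)) < real N" using t k by linarith+
    then have pos: "\<epsilon> * (int d * m) > 0" "\<epsilon> * (int d * m) < int N" by linarith+
    have n0: "int n0 = \<epsilon> * (int d * m)" using pos by (simp add: n0_def)
    have n0r: "of_int \<epsilon> * real n0 = real d * of_int m"
    proof -
      have "of_int \<epsilon> * real n0 = real_of_int (\<epsilon> * int n0)" by simp
      also have "\<epsilon> * int n0 = int d * m" unfolding n0 using eps by auto
      finally show ?thesis by simp
    qed
    have "int d dvd int n0" unfolding n0 by simp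
    then have "d dvd n0" by (simp only: int_dvd_int_iff)
    then have n0s: "n0 \<in> {n \<in> {1..N}. d dvd n}" using pos n0 by auto
    have zero: "tent \<kappa> (t - of_int \<epsilon> * real n) = 0" if n: "n \<noteq> n0" for n
    proof (rule tent_eq_0[OF k(1)])
      have "\<bar>of_int \<epsilon> * real n - of_int \<epsilon> * real n0\<bar> = \<bar>real n - real n0\<bar>"
        unfolding right_diff_distrib[symmetric] abs_mult ee by simp
      also have "\<dots> \<ge> 1" using n by linarith
      finally show "\<kappa> \<le> \<bar>t - of_int \<epsilon> * real n\<bar>" using False k unfolding n0r by linarith
    qed
    have "(\<Sum>n\<in>{n \<in> {1..N}. d dvd n}. tent \<kappa> (t - of_int \<epsilon> * real n)) = tent \<kappa> (t - of_int \<epsilon> * real n0)"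
      using sum.remove[OF _ n0s, of "\<lambda>n. tent \<kappa> (t - of_int \<epsilon> * real n)"] zero by (simp add: sum.neutral)
    then show ?thesis unfolding n0r ptent_def m_def .
  qed
qed

context sl2_lattice
begin

lemma horo_integrable:
  assumes w: "horo_weight \<omega> T Cw" and f: "good_fun f Cf" and T: "T \<ge> 0"
    and h: "h \<in> borel_measurable borel" "\<And>t. norm (h t) \<le> 1"
  shows "integrable lborel (\<lambda>t. of_real (\<omega> t * f (U t ** g)) * (h t :: complex))"
proof (rule Bochner_Integration.integrable_bound)
  note [measurable] = good_funD(1)[OF f] horo_weightD(1)[OF w] h(1)
  show "integrable lborel (\<lambda>t. indicator {-T..T} t :: real)" using T by (simp add: integrable_indicator_iff)
  show "(\<lambda>t. of_real (\<omega> t * f (U t ** g)) * h t) \<in> borel_measurable lborel" by measurable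
  show "AE t in lborel. norm (of_real (\<omega> t * f (U t ** g)) * h t) \<le> norm (indicator {-T..T} t :: real)"
  proof (rule AE_I2)
    fix t
    have "\<bar>\<omega> t\<bar> * \<bar>f (U t ** g)\<bar> * norm (h t) \<le> 1 * 1 * 1"
      using horo_weightD(2,3)[OF w] good_funD(2,3)[OF f] h(2) by (intro mult_mono) auto
    then show "norm (of_real (\<omega> t * f (U t ** g)) * h t) \<le> norm (indicator {-T..T} t :: real)"
      using horo_weightD(4)[OF w, of t] by (cases "\<bar>t\<bar> \<le> T") (auto simp: norm_mult abs_mult indicator_def abs_le_iff)
  qed
qed

text \<open>The diagonal Fejer terms produce the density \<open>\<kappa> / d\<close>. The others
  have frequencies between \<open>1 / Y\<close> and \<open>16 * Y ^ 2\<close>, inside the range of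
  \<open>twisted_bound\<close> for \<open>X = Y ^ 4\<close>: each saves \<open>Y ^ 4\<close>, their
  number costs \<open>2 * Y ^ 2\<close>, and the Fejer error saves only Y. This accounts for the
  exponents 1276, 1278 and 1279.\<close>

lemma progression_estimate:
  assumes g: "g \<in> SL2" and f: "good_fun f Cf" and Cw: "Cw \<ge> 0" and k: "0 < \<kappa>" "\<kappa> \<le> 1 / 2"
  obtains C where "C \<ge> 0"
    "\<And>Y \<omega> d. Y \<ge> 2 \<Longrightarrow> card (return_set g (Y ^ 1280)) \<le> M \<Longrightarrow> horo_weight \<omega> (Y ^ 1280) Cw \<Longrightarrow> d \<ge> 1 \<Longrightarrow> real d \<le> Y
      \<Longrightarrow> \<bar>(\<integral>t. \<omega> t * f (U t ** g) * ptent \<kappa> d t \<partial>lborel) - \<kappa> / real d * (\<integral>t. \<omega> t * f (U t ** g) \<partial>lborel)\<bar> \<le> C * Y ^ 1279 * real d"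
proof -
  obtain C1 where C1: "C1 \<ge> 0"
    "\<And>X \<omega> \<xi>. X \<ge> 1 \<Longrightarrow> card (return_set g (X ^ 320)) \<le> M \<Longrightarrow> horo_weight \<omega> (X ^ 320) Cw \<Longrightarrow> 1 / X ^ 8 \<le> \<bar>\<xi>\<bar> \<Longrightarrow> \<bar>\<xi>\<bar> \<le> X ^ 8
      \<Longrightarrow> norm (twisted f \<omega> g \<xi>) \<le> C1 * X ^ 319"
    using twisted_bound[OF g f Cw, where M = M] by blast
  define C where "C = 4 / \<kappa> + 2 * C1"
  show thesis
  proof (rule that[of C])
    show "C \<ge> 0" using C1 k by (simp add: C_def)
    fix Y :: real and \<omega> and d :: nat
    assume Y: "Y \<ge> 2" and M: "card (return_set g (Y ^ 1280)) \<le> M" and w: "horo_weight \<omega> (Y ^ 1280) Cw" and d: "d \<ge> 1" and dY: "real d \<le> Y"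
    note [measurable] = good_funD(1)[OF f] horo_weightD(1)[OF w]
    have Y0: "Y > 0" using Y by simp
    have d0: "real d > 0" using d by simp
    define T where "T = Y ^ 1280"
    have T: "T \<ge> 0" using Y0 by (simp add: T_def)
    \<comment> \<open>The Fejer error is governed by the square root of the number of terms, here at
      least Y.\<close>
    define K where "K = nat \<lceil>Y\<^sup>2\<rceil>"
    have Y2: "Y\<^sup>2 \<ge> 4" using power_mono[of 2 Y 2] Y by simp
    have K: "Y\<^sup>2 \<le> real K" "real K \<le> 2 * Y\<^sup>2" using Y2 unfolding K_def by linarith+
    have K1: "K \<ge> 1" using K Y2 by linarith
    define P where "P = ptent \<kappa> d"
    have cP: "continuous_on S P" for S unfolding P_def by (rule ptent_continuous[OF k(1) d])
    have [measurable]: "P \<in> borel_measurable borel" by (intro borel_measurable_continuous_onI cP)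
    have P01: "0 \<le> P t \<and> P t \<le> 1" for t unfolding P_def by (rule ptent_range[OF k(1)])
    have iP: "integral {0..real d} P = \<kappa>" unfolding P_def by (rule ptent_integral[OF k d])
    define p where "p a b = (1 / complex_of_real (real d)) * integral {0..real d} (\<lambda>y. of_real (P y) * cis (2 * pi * of_int (int a - int b) * (- y) / real d))" for a b
    define A where "A t = (1 / of_nat K) * (\<Sum>a<K. \<Sum>b<K. p a b * cis (2 * pi * of_int (int a - int b) / real d * t))" for t
    have appr: "norm (of_real (P t) - A t) \<le> 2 * real d / \<kappa> / sqrt (real K)" for t
      unfolding A_def p_def
      by (rule fejer_approx[OF d0 K1]) (use k ptent_lipschitz[OF k(1) d] cP in \<open>auto simp: P_def\<close>)
    have sqK: "sqrt (real K) \<ge> Y" using K(1) Y0 by (simp add: real_le_rsqrt)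
    have appr: "norm (of_real (P t) - A t) \<le> 2 * real d / (\<kappa> * Y)" for t
    proof -
      have "2 * real d / \<kappa> / sqrt (real K) \<le> 2 * real d / \<kappa> / Y" using sqK Y0 k K1 by (intro divide_left_mono mult_pos_pos) auto
      with appr[of t] show ?thesis by simp
    qed
    have paa: "p a a = of_real (\<kappa> / real d)" for a
    proof -
      have "integral {0..real d} (\<lambda>y. complex_of_real (P y)) = of_real (integral {0..real d} P)"
        by (rule integral_linear[OF _ bounded_linear_of_real, unfolded o_def]) (intro integrable_continuous_interval cP)
      then show ?thesis by (simp add: p_def iP)
    qed
    have pab: "norm (p a b) \<le> 1" for a b
    proof -
      have "norm (integral {0..real d} (\<lambda>y. complex_of_real (P y) * cis (2 * pi * of_int (int a - int b) * (- y) / real d))) \<le> integral {0..real d} P"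
        by (rule Henstock_Kurzweil_Integration.integral_norm_bound_integral)
          (use P01 d0 in \<open>auto intro!: integrable_continuous_interval continuous_intros cP simp: norm_mult\<close>)
      then have "norm (p a b) \<le> 1 / real d * \<kappa>" unfolding p_def norm_mult iP using d0 by (simp add: norm_divide divide_right_mono)
      also have "\<dots> \<le> 1 * 1" using k d by (intro mult_mono) auto
      finally show ?thesis by simp
    qed
    define \<phi> where "\<phi> t = \<omega> t * f (U t ** g)" for t
    have int: "integrable lborel (\<lambda>t. of_real (\<phi> t) * h t)" if "h \<in> borel_measurable borel" "\<And>t. norm (h t) \<le> 1" for h :: "real \<Rightarrow> complex"
      unfolding \<phi>_def by (rule horo_integrable[OF w f]) (use that Y0 in auto)
    have i1: "integrable lborel (\<lambda>t. of_real (\<phi> t) * (of_real (P t) :: complex))" by (rule int) (use P01 in auto)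
    have ic: "integrable lborel (\<lambda>t. of_real (\<phi> t) * cis (\<xi> * t))" for \<xi> by (rule int) auto
    have twisted: "twisted f \<omega> g \<xi> = (\<integral>t. of_real (\<phi> t) * cis (\<xi> * t) \<partial>lborel)" for \<xi> by (simp add: twisted_def \<phi>_def)
    have \<phi>A: "of_real (\<phi> t) * A t = (1 / of_nat K) * (\<Sum>a<K. \<Sum>b<K. p a b * (of_real (\<phi> t) * cis (2 * pi * of_int (int a - int b) / real d * t)))" for t
      unfolding A_def by (simp add: sum_distrib_left mult_ac)
    have i2: "integrable lborel (\<lambda>t. of_real (\<phi> t) * A t)"
      unfolding \<phi>A by (intro Bochner_Integration.integrable_mult_right Bochner_Integration.integrable_sum ic)
    have I2: "(\<integral>t. of_real (\<phi> t) * A t \<partial>lborel) = (1 / of_nat K) * (\<Sum>a<K. \<Sum>b<K. p a b * twisted f \<omega> g (2 * pi * of_int (int a - int b) / real d))"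
      unfolding \<phi>A twisted
      by (subst integral_mult_right_zero, subst Bochner_Integration.integral_sum, (intro Bochner_Integration.integrable_sum Bochner_Integration.integrable_mult_right ic),
          subst Bochner_Integration.integral_sum, (intro Bochner_Integration.integrable_mult_right ic), simp only: integral_mult_right_zero)
    have twb: "norm (twisted f \<omega> g (2 * pi * of_int (int a - int b) / real d)) \<le> C1 * Y ^ 1276" if ab: "a < K" "b < K" "a \<noteq> b" for a b
    proof -
      define \<xi> where "\<xi> = 2 * pi * of_int (int a - int b) / real d"
      have ax: "\<bar>\<xi>\<bar> = 2 * pi * \<bar>real a - real b\<bar> / real d" by (simp add: \<xi>_def abs_mult)
      have ab1: "1 \<le> \<bar>real a - real b\<bar>" "\<bar>real a - real b\<bar> \<le> real K" using ab by linarith+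
      have "norm (twisted f \<omega> g \<xi>) \<le> C1 * (Y ^ 4) ^ 319"
      proof (rule C1(2))
        show "1 \<le> Y ^ 4" using Y by simp
        show "card (return_set g ((Y ^ 4) ^ 320)) \<le> M" using M by (simp add: power_mult[symmetric])
        show "horo_weight \<omega> ((Y ^ 4) ^ 320) Cw" using w by (simp add: power_mult[symmetric])
        have "1 / (Y ^ 4) ^ 8 \<le> 1 / Y"
          using Y power_increasing[of 1 32 Y] by (intro divide_left_mono) (auto simp: power_mult[symmetric])
        also have "\<dots> \<le> 1 / real d" using dY d0 by (intro divide_left_mono) auto
        also have "\<dots> \<le> \<bar>\<xi>\<bar>"
        proof -
          have "1 * 1 \<le> 2 * pi * \<bar>real a - real b\<bar>" using ab1 pi_gt3 by (intro mult_mono) auto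
          then show ?thesis unfolding ax using d0 by (intro divide_right_mono) auto
        qed
        finally show "1 / (Y ^ 4) ^ 8 \<le> \<bar>\<xi>\<bar>" .
        have "\<bar>\<xi>\<bar> \<le> 2 * pi * \<bar>real a - real b\<bar> / 1" unfolding ax using d by (intro divide_left_mono) auto
        also have "\<dots> \<le> 2 * 4 * (2 * Y\<^sup>2)" using ab1 K pi_less_4 by (simp only: div_by_1) (intro mult_mono, auto)
        also have "\<dots> = 16 * Y\<^sup>2" by simp
        also have "\<dots> \<le> Y ^ 4 * Y\<^sup>2" by (rule mult_right_mono) (use power_mono[of 2 Y 4] Y in auto)
        also have "\<dots> = Y ^ 6" by (simp add: power_add[symmetric])
        also have "\<dots> \<le> Y ^ 32" using Y by (intro power_increasing) auto
        finally show "\<bar>\<xi>\<bar> \<le> (Y ^ 4) ^ 8" by (simp add: power_mult[symmetric])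
      qed
      then show ?thesis by (simp add: \<xi>_def power_mult[symmetric])
    qed
    define S where "S = (\<Sum>a<K. \<Sum>b<K. p a b * twisted f \<omega> g (2 * pi * of_int (int a - int b) / real d))"
    define \<Phi> where "\<Phi> = (\<integral>t. \<phi> t \<partial>lborel)"
    have tw0: "twisted f \<omega> g 0 = of_real \<Phi>" unfolding twisted \<Phi>_def by simp
    have "norm (S - (\<Sum>a<K. of_real (\<kappa> / real d * \<Phi>))) \<le> (\<Sum>a<K. \<Sum>b<K. C1 * Y ^ 1276)"
    proof -
      have "S - (\<Sum>a<K. of_real (\<kappa> / real d * \<Phi>)) = (\<Sum>a<K. (\<Sum>b<K. p a b * twisted f \<omega> g (2 * pi * of_int (int a - int b) / real d)) - of_real (\<kappa> / real d * \<Phi>))"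
        unfolding S_def by (simp add: sum_subtractf)
      also have "norm \<dots> \<le> (\<Sum>a<K. \<Sum>b<K. C1 * Y ^ 1276)"
      proof (rule sum_norm_le)
        fix a assume a: "a \<in> {..<K}"
        have "(\<Sum>b<K. p a b * twisted f \<omega> g (2 * pi * of_int (int a - int b) / real d)) - of_real (\<kappa> / real d * \<Phi>)
          = (\<Sum>b\<in>{..<K} - {a}. p a b * twisted f \<omega> g (2 * pi * of_int (int a - int b) / real d))"
          using a by (subst sum.remove[of _ a]) (auto simp: paa tw0)
        also have "norm \<dots> \<le> (\<Sum>b\<in>{..<K} - {a}. C1 * Y ^ 1276)"
        proof (rule sum_norm_le)
          fix b assume b: "b \<in> {..<K} - {a}"
          have "norm (p a b) * norm (twisted f \<omega> g (2 * pi * of_int (int a - int b) / real d)) \<le> 1 * (C1 * Y ^ 1276)"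
            using a b by (intro mult_mono pab twb) auto
          then show "norm (p a b * twisted f \<omega> g (2 * pi * of_int (int a - int b) / real d)) \<le> C1 * Y ^ 1276" by (simp add: norm_mult)
        qed
        also have "\<dots> \<le> (\<Sum>b<K. C1 * Y ^ 1276)" using C1 Y0 by (intro sum_mono2) auto
        finally show "norm ((\<Sum>b<K. p a b * twisted f \<omega> g (2 * pi * of_int (int a - int b) / real d)) - of_real (\<kappa> / real d * \<Phi>)) \<le> (\<Sum>b<K. C1 * Y ^ 1276)" .
      qed
      finally show ?thesis .
    qed
    then have S: "norm (S - of_nat K * of_real (\<kappa> / real d * \<Phi>)) \<le> real K * (real K * (C1 * Y ^ 1276))" by simp
    have E1: "norm ((1 / of_nat K) * S - of_real (\<kappa> / real d * \<Phi>)) \<le> 2 * C1 * Y ^ 1278"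
    proof -
      have "(1 / of_nat K) * S - of_real (\<kappa> / real d * \<Phi>) = (1 / of_nat K) * (S - of_nat K * of_real (\<kappa> / real d * \<Phi>))"
        using K1 by (simp add: right_diff_distrib)
      then have "norm ((1 / of_nat K) * S - of_real (\<kappa> / real d * \<Phi>)) = 1 / real K * norm (S - of_nat K * of_real (\<kappa> / real d * \<Phi>))"
        by (simp add: norm_mult norm_divide)
      also have "\<dots> \<le> 1 / real K * (real K * (real K * (C1 * Y ^ 1276)))" by (intro mult_left_mono S) simp
      also have "\<dots> = real K * (C1 * Y ^ 1276)" using K1 by simp
      also have "\<dots> \<le> (2 * Y\<^sup>2) * (C1 * Y ^ 1276)" using K C1 Y0 by (intro mult_right_mono) auto
      also have "\<dots> = 2 * C1 * Y ^ 1278" by (simp add: power_add[symmetric])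
      finally show ?thesis .
    qed
    have E2: "norm ((\<integral>t. of_real (\<phi> t) * of_real (P t) \<partial>lborel) - (1 / of_nat K) * S) \<le> 4 / \<kappa> * Y ^ 1279 * real d"
    proof -
      have "(\<integral>t. of_real (\<phi> t) * of_real (P t) \<partial>lborel) - (1 / of_nat K) * S = (\<integral>t. of_real (\<phi> t) * of_real (P t) - of_real (\<phi> t) * A t \<partial>lborel)"
        using i1 i2 by (simp add: I2 S_def)
      also have "norm \<dots> \<le> (\<integral>t. 2 * real d / (\<kappa> * Y) * indicator {-T..T} t \<partial>lborel)"
      proof (rule lint_norm_bound)
        show "integrable lborel (\<lambda>t. of_real (\<phi> t) * of_real (P t) - of_real (\<phi> t) * A t)" using i1 i2 by simp
        show "integrable lborel (\<lambda>t. 2 * real d / (\<kappa> * Y) * indicator {-T..T} t)" using T by (simp add: integrable_indicator_iff)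
        fix t
        have "norm (of_real (\<phi> t) * of_real (P t) - of_real (\<phi> t) * A t) = \<bar>\<phi> t\<bar> * norm (of_real (P t) - A t)"
          unfolding right_diff_distrib[symmetric] norm_mult by simp
        also have "\<dots> \<le> \<bar>\<phi> t\<bar> * (2 * real d / (\<kappa> * Y))" by (intro mult_left_mono appr) simp
        also have "\<dots> \<le> indicator {-T..T} t * (2 * real d / (\<kappa> * Y))"
        proof (rule mult_right_mono)
          have "\<bar>\<omega> t\<bar> * \<bar>f (U t ** g)\<bar> \<le> 1 * 1" using horo_weightD(2,3)[OF w] good_funD(2,3)[OF f] by (intro mult_mono) auto
          then show "\<bar>\<phi> t\<bar> \<le> indicator {-T..T} t" using horo_weightD(4)[OF w, of t]
            by (cases "\<bar>t\<bar> \<le> T") (auto simp: \<phi>_def abs_mult T_def indicator_def abs_le_iff)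
        qed (use k Y0 in simp)
        finally show "norm (of_real (\<phi> t) * of_real (P t) - of_real (\<phi> t) * A t) \<le> 2 * real d / (\<kappa> * Y) * indicator {-T..T} t"
          by (simp add: mult.commute)
      qed
      also have "\<dots> = 2 * real d / (\<kappa> * Y) * (2 * T)" using T by simp
      also have "\<dots> = 4 / \<kappa> * Y ^ 1279 * real d"
      proof -
        have "T = Y * Y ^ 1279" unfolding T_def using power_Suc[of Y 1279] by simp
        then show ?thesis using Y0 k by simp
      qed
      finally show ?thesis .
    qed
    have "2 * C1 * Y ^ 1278 \<le> 2 * C1 * Y ^ 1279 * real d"
    proof -
      have "Y ^ 1278 * 1 \<le> Y ^ 1279 * real d" using Y d by (intro mult_mono power_increasing) auto
      then show ?thesis using C1 by (simp add: mult.assoc mult_left_mono)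
    qed
    then have "norm ((\<integral>t. of_real (\<phi> t) * of_real (P t) \<partial>lborel) - complex_of_real (\<kappa> / real d * \<Phi>)) \<le> C * Y ^ 1279 * real d"
      using norm_triangle_le[OF add_mono[OF E2 E1]] by (simp add: C_def algebra_simps)
    moreover have "(\<integral>t. of_real (\<phi> t) * of_real (P t) \<partial>lborel) = complex_of_real (\<integral>t. \<phi> t * P t \<partial>lborel)"
      by (simp flip: of_real_mult)
    ultimately have "\<bar>(\<integral>t. \<phi> t * P t \<partial>lborel) - \<kappa> / real d * \<Phi>\<bar> \<le> C * Y ^ 1279 * real d"
      by (simp only: of_real_diff[symmetric] norm_of_real)
    then show "\<bar>(\<integral>t. \<omega> t * f (U t ** g) * ptent \<kappa> d t \<partial>lborel) - \<kappa> / real d * (\<integral>t. \<omega> t * f (U t ** g) \<partial>lborel)\<bar> \<le> C * Y ^ 1279 * real d"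
      by (simp add: \<phi>_def \<Phi>_def P_def)
  qed
qed

end

section \<open>A lower bound sieve\<close>

lemma prod_primes_dvd_iff:
  fixes A :: "nat set"
  assumes "finite A" "\<And>p. p \<in> A \<Longrightarrow> prime p"
  shows "\<Prod>A dvd n \<longleftrightarrow> A \<subseteq> {p. p dvd n}"
  using assms
proof (induction A rule: finite_induct)
  case (insert p A)
  have "coprime p (\<Prod>A)"
  proof (rule prod_coprime_right)
    fix q assume "q \<in> A"
    then show "coprime p q" using insert by (metis insert_iff primes_coprime)
  qed
  then have "p * \<Prod>A dvd n \<longleftrightarrow> p dvd n \<and> \<Prod>A dvd n"
    by (metis divides_mult dvd_mult_left dvd_mult_right)
  then show ?case using insert by simp
qed simp

text \<open>A function \<open>c\<close> on sets of primes encodes the sieve weight \<open>d \<mapsto> c A\<close> at \<open>d = \<Prod>A\<close>; for \<open>D\<close> the set of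
  divisors of \<open>n\<close>, \<open>psum c P D\<close> is the sum of the weights over \<open>d dvd n\<close>.\<close>

definition psum :: "(nat set \<Rightarrow> real) \<Rightarrow> nat set \<Rightarrow> nat set \<Rightarrow> real" where
  "psum c P D = (\<Sum>A\<in>Pow P. c A * of_bool (A \<subseteq> D))"

definition dens :: "(nat set \<Rightarrow> real) \<Rightarrow> nat set \<Rightarrow> real" where
  "dens c P = (\<Sum>A\<in>Pow P. c A / real (\<Prod>A))"

text \<open>The factor by which the sieve multiplies the remainder \<open>E\<close>.\<close>

definition mass :: "(nat set \<Rightarrow> real) \<Rightarrow> nat set \<Rightarrow> real" where
  "mass c P = (\<Sum>A\<in>Pow P. \<bar>c A\<bar>)"

lemma Pow_disjoint_sum:
  fixes h k :: "nat set \<Rightarrow> real"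
  assumes "finite P" "finite Q" "P \<inter> Q = {}"
  shows "(\<Sum>A\<in>Pow (P \<union> Q). h (A \<inter> P) * k (A \<inter> Q)) = (\<Sum>A\<in>Pow P. h A) * (\<Sum>B\<in>Pow Q. k B)"
proof -
  have "(\<Sum>A\<in>Pow (P \<union> Q). h (A \<inter> P) * k (A \<inter> Q)) = (\<Sum>(A, B)\<in>Pow P \<times> Pow Q. h A * k B)"
    by (rule sum.reindex_bij_witness[of _ "\<lambda>(A, B). A \<union> B" "\<lambda>A. (A \<inter> P, A \<inter> Q)"]) (use assms in \<open>auto, (rule arg_cong2[of _ _ _ _ "(*)"]; rule arg_cong[of _ _ h] arg_cong[of _ _ k]; blast)?\<close>)
  also have "\<dots> = (\<Sum>A\<in>Pow P. h A) * (\<Sum>B\<in>Pow Q. k B)"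
    by (simp add: sum_product sum.cartesian_product)
  finally show ?thesis .
qed

text \<open>A set of primes in a disjoint union splits uniquely, so for these weights divisor sums,
  densities and masses are all products.\<close>

definition tens :: "nat set \<Rightarrow> nat set \<Rightarrow> (nat set \<Rightarrow> real) \<Rightarrow> (nat set \<Rightarrow> real) \<Rightarrow> nat set \<Rightarrow> real" where
  "tens P Q c c' A = c (A \<inter> P) * c' (A \<inter> Q)"

lemma psum_tens:
  assumes "finite P" "finite Q" "P \<inter> Q = {}"
  shows "psum (tens P Q c c') (P \<union> Q) D = psum c P D * psum c' Q D"
proof -
  have "psum (tens P Q c c') (P \<union> Q) D = (\<Sum>A\<in>Pow (P \<union> Q). (c (A \<inter> P) * of_bool (A \<inter> P \<subseteq> D)) * (c' (A \<inter> Q) * of_bool (A \<inter> Q \<subseteq> D)))"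
    unfolding psum_def tens_def by (rule sum.cong) auto
  also have "\<dots> = psum c P D * psum c' Q D"
    unfolding psum_def by (rule Pow_disjoint_sum[OF assms, of "\<lambda>A. c A * of_bool (A \<subseteq> D)" "\<lambda>A. c' A * of_bool (A \<subseteq> D)"])
  finally show ?thesis .
qed

lemma dens_tens:
  assumes "finite P" "finite Q" "P \<inter> Q = {}"
  shows "dens (tens P Q c c') (P \<union> Q) = dens c P * dens c' Q"
proof -
  have "dens (tens P Q c c') (P \<union> Q) = (\<Sum>A\<in>Pow (P \<union> Q). (c (A \<inter> P) / real (\<Prod>(A \<inter> P))) * (c' (A \<inter> Q) / real (\<Prod>(A \<inter> Q))))"
    unfolding dens_def tens_def
  proof (rule sum.cong[OF refl])
    fix A assume "A \<in> Pow (P \<union> Q)"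
    then have A: "A = (A \<inter> P) \<union> (A \<inter> Q)" by auto
    have "\<Prod>((A \<inter> P) \<union> (A \<inter> Q)) = \<Prod>(A \<inter> P) * \<Prod>(A \<inter> Q)"
      using assms by (intro prod.union_disjoint) auto
    then have "\<Prod>A = \<Prod>(A \<inter> P) * \<Prod>(A \<inter> Q)" using A by simp
    then show "c (A \<inter> P) * c' (A \<inter> Q) / real (\<Prod>A) = (c (A \<inter> P) / real (\<Prod>(A \<inter> P))) * (c' (A \<inter> Q) / real (\<Prod>(A \<inter> Q)))" by simp
  qed
  also have "\<dots> = dens c P * dens c' Q"
    unfolding dens_def by (rule Pow_disjoint_sum[OF assms, of "\<lambda>A. c A / real (\<Prod>A)" "\<lambda>A. c' A / real (\<Prod>A)"])
  finally show ?thesis .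
qed

lemma mass_tens:
  assumes "finite P" "finite Q" "P \<inter> Q = {}"
  shows "mass (tens P Q c c') (P \<union> Q) = mass c P * mass c' Q"
  unfolding mass_def tens_def abs_mult
  by (rule Pow_disjoint_sum[OF assms, of "\<lambda>A. \<bar>c A\<bar>" "\<lambda>A. \<bar>c' A\<bar>"])

lemma dens_diff: "dens (\<lambda>A. c A - c' A) P = dens c P - dens c' P"
  by (simp add: dens_def sum_subtractf diff_divide_distrib)

lemma psum_diff: "psum (\<lambda>A. c A - c' A) P D = psum c P D - psum c' P D"
  by (simp add: psum_def sum_subtractf left_diff_distrib)

lemma mass_diff: "finite P \<Longrightarrow> mass (\<lambda>A. c A - c' A) P \<le> mass c P + mass c' P"
  unfolding mass_def sum.distrib[symmetric] by (intro sum_mono abs_triangle_ineq4)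

lemma mass_nonneg: "0 \<le> mass c P" by (simp add: mass_def sum_nonneg)

lemma Pow_insert_sum:
  fixes f :: "nat set \<Rightarrow> real"
  assumes "finite P" "p \<notin> P"
  shows "(\<Sum>A\<in>Pow (insert p P). f A) = (\<Sum>A\<in>Pow P. f A + f (insert p A))"
proof -
  have "(\<Sum>A\<in>Pow (insert p P). f A) = (\<Sum>A\<in>Pow P. f A) + (\<Sum>A\<in>insert p ` Pow P. f A)"
    unfolding Pow_insert using assms by (intro sum.union_disjoint) auto
  also have "(\<Sum>A\<in>insert p ` Pow P. f A) = (\<Sum>A\<in>Pow P. f (insert p A))"
    by (rule sum.reindex_cong[where l = "insert p"]) (use assms in \<open>auto simp: inj_on_def\<close>)
  finally show ?thesis by (simp add: sum.distrib)
qed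

text \<open>The density of \<open>c\<close> is its expectation when every \<open>p \<in> P\<close> is selected independently with
  probability \<open>1 / p\<close>, hence it is nonnegative as soon as all partial psum are.\<close>

lemma dens_nonneg:
  assumes "finite P" "\<And>p. p \<in> P \<Longrightarrow> prime p" "\<And>D. D \<subseteq> P \<Longrightarrow> 0 \<le> psum c P D"
  shows "0 \<le> dens c P"
  using assms
proof (induction P arbitrary: c rule: finite_induct)
  case empty
  then show ?case using empty(2)[of "{}"] by (simp add: dens_def psum_def)
next
  case (insert p P)
  define x where "x = 1 / real p"
  have x: "0 \<le> x" "x \<le> 1" using insert prime_ge_1_nat[of p] by (auto simp: x_def)
  have pr: "real (\<Prod>(insert p A)) = real p * real (\<Prod>A)" if "A \<in> Pow P" for A
  proof -
    have "finite A" "p \<notin> A" using that insert finite_subset by auto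
    then show ?thesis by simp
  qed
  have "dens c (insert p P) = (\<Sum>A\<in>Pow P. c A / real (\<Prod>A) + c (insert p A) / real (\<Prod>(insert p A)))"
    unfolding dens_def by (rule Pow_insert_sum) (use insert in auto)
  also have "\<dots> = (\<Sum>A\<in>Pow P. (1 - x) * (c A / real (\<Prod>A)) + x * ((c A + c (insert p A)) / real (\<Prod>A)))"
    by (rule sum.cong[OF refl]) (simp only: pr x_def, simp add: algebra_simps add_divide_distrib diff_divide_distrib)
  also have "\<dots> = (1 - x) * dens c P + x * dens (\<lambda>A. c A + c (insert p A)) P"
    by (simp add: dens_def sum.distrib sum_distrib_left)
  also have "\<dots> \<ge> 0"
  proof (intro add_nonneg_nonneg mult_nonneg_nonneg)
    show "0 \<le> dens c P"
    proof (rule insert.IH)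
      fix D assume D: "D \<subseteq> P"
      have "psum c (insert p P) D = (\<Sum>A\<in>Pow P. c A * of_bool (A \<subseteq> D) + c (insert p A) * of_bool (insert p A \<subseteq> D))"
        unfolding psum_def by (rule Pow_insert_sum) (use insert in auto)
      also have "\<dots> = psum c P D" unfolding psum_def by (rule sum.cong) (use D insert in auto)
      finally show "0 \<le> psum c P D" using insert.prems(2)[of D] D by auto
    qed (use insert in auto)
    show "0 \<le> dens (\<lambda>A. c A + c (insert p A)) P"
    proof (rule insert.IH)
      fix D assume D: "D \<subseteq> P"
      have "psum c (insert p P) (insert p D) = (\<Sum>A\<in>Pow P. c A * of_bool (A \<subseteq> insert p D) + c (insert p A) * of_bool (insert p A \<subseteq> insert p D))"
        unfolding psum_def by (rule Pow_insert_sum) (use insert in auto)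
      also have "\<dots> = psum (\<lambda>A. c A + c (insert p A)) P D" unfolding psum_def
      proof (rule sum.cong[OF refl])
        fix A assume "A \<in> Pow P"
        then have "A \<subseteq> insert p D \<longleftrightarrow> A \<subseteq> D" "insert p A \<subseteq> insert p D \<longleftrightarrow> A \<subseteq> D" using insert by auto
        then show "c A * of_bool (A \<subseteq> insert p D) + c (insert p A) * of_bool (insert p A \<subseteq> insert p D) = (c A + c (insert p A)) * of_bool (A \<subseteq> D)" by simp
      qed
      finally show "0 \<le> psum (\<lambda>A. c A + c (insert p A)) P D" using insert.prems(2)[of "insert p D"] D by auto
    qed (use insert in auto)
  qed (use x in auto)
  finally show ?case .
qed

lemma dens_moebius:
  assumes "finite P" "\<And>p. p \<in> P \<Longrightarrow> prime p"
  shows "dens (\<lambda>A. (-1) ^ card A) P = (\<Prod>p\<in>P. 1 - 1 / real p)"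
  using assms
proof (induction P rule: finite_induct)
  case (insert p P)
  have "dens (\<lambda>A. (-1) ^ card A) (insert p P) = (\<Sum>A\<in>Pow P. (-1) ^ card A / real (\<Prod>A) + (-1) ^ card (insert p A) / real (\<Prod>(insert p A)))"
    unfolding dens_def by (rule Pow_insert_sum) (use insert in auto)
  also have "\<dots> = (\<Sum>A\<in>Pow P. (1 - 1 / real p) * ((-1) ^ card A / real (\<Prod>A)))"
  proof (rule sum.cong[OF refl])
    fix A assume "A \<in> Pow P"
    then have "finite A" "p \<notin> A" using insert finite_subset by auto
    then show "(-1) ^ card A / real (\<Prod>A) + (-1) ^ card (insert p A) / real (\<Prod>(insert p A)) = (1 - 1 / real p) * ((-1) ^ card A / real (\<Prod>A))"
      by (simp add: algebra_simps diff_divide_distrib)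
  qed
  also have "\<dots> = (1 - 1 / real p) * dens (\<lambda>A. (-1) ^ card A) P" by (simp add: dens_def sum_distrib_left)
  finally show ?case using insert by simp
qed (simp add: dens_def)

section \<open>Truncated inclusion-exclusion\<close>

lemma sum_Pow_card:
  fixes f :: "nat \<Rightarrow> real"
  assumes "finite S"
  shows "(\<Sum>A\<in>Pow S. f (card A)) = (\<Sum>i\<le>card S. real (card S choose i) * f i)"
proof -
  have "(\<Sum>A\<in>Pow S. f (card A)) = (\<Sum>i\<le>card S. \<Sum>A\<in>{A \<in> Pow S. card A = i}. f (card A))"
    by (rule sum.group[symmetric]) (use assms in \<open>auto intro: card_mono\<close>)
  also have "\<dots> = (\<Sum>i\<le>card S. real (card S choose i) * f i)"
  proof (rule sum.cong[OF refl])
    fix i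
    have "(\<Sum>A\<in>{A \<in> Pow S. card A = i}. f (card A)) = real (card {A \<in> Pow S. card A = i}) * f i" by simp
    also have "card {A \<in> Pow S. card A = i} = card S choose i" using n_subsets[OF assms, of i] by simp
    finally show "(\<Sum>A\<in>{A \<in> Pow S. card A = i}. f (card A)) = real (card S choose i) * f i" .
  qed
  finally show ?thesis .
qed

lemma psum_card:
  assumes "finite P"
  shows "psum (\<lambda>A. f (card A)) P D = (\<Sum>i\<le>card (P \<inter> D). real (card (P \<inter> D) choose i) * f i)"
proof -
  have "psum (\<lambda>A. f (card A)) P D = (\<Sum>A\<in>Pow (P \<inter> D). f (card A))"
    unfolding psum_def by (rule sum.mono_neutral_cong_right) (use assms in auto)
  then show ?thesis using sum_Pow_card[of "P \<inter> D" f] assms by simp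
qed

lemma alternating_choose: "(\<Sum>i\<le>b. (-1) ^ i * real (Suc m choose i)) = (-1) ^ b * real (m choose b)"
proof (induction b)
  case (Suc b)
  have "(\<Sum>i\<le>Suc b. (-1) ^ i * real (Suc m choose i)) = (-1) ^ b * real (m choose b) + (-1) ^ Suc b * real (Suc m choose Suc b)"
    using Suc by simp
  also have "\<dots> = (-1) ^ Suc b * real (m choose Suc b)" by (simp add: algebra_simps)
  finally show ?case .
qed simp

text \<open>Brun's truncation of the Moebius function to at most b prime factors. The next layer,
  \<open>overshoot\<close>, majorizes what the truncation overcounts.\<close>

definition even_trunc :: "nat \<Rightarrow> nat set \<Rightarrow> real" where "even_trunc b A = (if card A \<le> b then (-1) ^ card A else 0)"
definition overshoot :: "nat \<Rightarrow> nat set \<Rightarrow> real" where "overshoot b A = (if card A = Suc b then 1 else 0)"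

lemma psum_even_trunc:
  assumes "finite P" "even b"
  shows "psum (even_trunc b) P D = (if P \<inter> D = {} then 1 else real ((card (P \<inter> D) - 1) choose b))"
proof -
  let ?n = "card (P \<inter> D)"
  have "psum (even_trunc b) P D = (\<Sum>i\<le>?n. real (?n choose i) * (if i \<le> b then (-1) ^ i else 0))"
    unfolding even_trunc_def[abs_def] by (rule psum_card[OF assms(1)])
  also have "\<dots> = (\<Sum>i\<le>max ?n b. real (?n choose i) * (if i \<le> b then (-1) ^ i else 0))"
    by (rule sum.mono_neutral_left) (auto simp: binomial_eq_0)
  also have "\<dots> = (\<Sum>i\<le>b. (-1) ^ i * real (?n choose i))"
    by (rule sum.mono_neutral_cong_right) auto
  finally have e: "psum (even_trunc b) P D = (\<Sum>i\<le>b. (-1) ^ i * real (?n choose i))" .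
  show ?thesis
  proof (cases "P \<inter> D = {}")
    case True
    have "(\<Sum>i\<le>b. (-1) ^ i * real (0 choose i)) = (\<Sum>i\<in>{0}. (-1) ^ i * real (0 choose i))"
      by (rule sum.mono_neutral_right) (auto simp: binomial_eq_0)
    then show ?thesis using True e by simp
  next
    case False
    then have "?n = Suc (?n - 1)" using assms by (simp add: card_gt_0_iff)
    then have "psum (even_trunc b) P D = (-1) ^ b * real ((?n - 1) choose b)" using e alternating_choose[where b = b and m = "?n - 1"] by simp
    then show ?thesis using False assms by simp
  qed
qed

lemma psum_overshoot:
  assumes "finite P"
  shows "psum (overshoot b) P D = real (card (P \<inter> D) choose Suc b)"
proof -
  let ?n = "card (P \<inter> D)"
  have "psum (overshoot b) P D = (\<Sum>i\<le>?n. real (?n choose i) * (if i = Suc b then 1 else 0))"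
    unfolding overshoot_def[abs_def] by (rule psum_card[OF assms])
  also have "\<dots> = (\<Sum>i\<le>?n. if i = Suc b then real (?n choose i) else 0)" by (rule sum.cong) auto
  also have "\<dots> = real (?n choose Suc b)" by (auto simp: binomial_eq_0)
  finally show ?thesis .
qed

definition free :: "nat set \<Rightarrow> nat set \<Rightarrow> real" where "free P D = of_bool (P \<inter> D = {})"

text \<open>If n > 0 primes of the block divide, the truncated sum is the binomial coefficient of n
  - 1 over b, which by Pascal's rule is at most that of n over b + 1, the number of overshoot
  sets.\<close>

lemma even_trunc_bounds:
  assumes "finite P" "even b"
  shows "free P D \<le> psum (even_trunc b) P D" "0 \<le> psum (even_trunc b) P D" "psum (even_trunc b) P D - psum (overshoot b) P D \<le> free P D" "0 \<le> psum (overshoot b) P D"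
proof -
  have "real ((card (P \<inter> D) - 1) choose b) \<le> real (card (P \<inter> D) choose Suc b)" if "P \<inter> D \<noteq> {}"
  proof -
    have "card (P \<inter> D) \<noteq> 0" using that assms(1) by simp
    then obtain m where "card (P \<inter> D) = Suc m" using not0_implies_Suc by blast
    then show ?thesis by simp
  qed
  then show "psum (even_trunc b) P D - psum (overshoot b) P D \<le> free P D" using assms by (auto simp: psum_even_trunc psum_overshoot free_def)
qed (use assms in \<open>auto simp: psum_even_trunc psum_overshoot free_def\<close>)

text \<open>The truncation dominates the full Moebius sum for every set of dividing primes;
  \<open>dens_nonneg\<close>, applied to the difference, carries this over to the densities.\<close>

lemma dens_even_trunc_ge:
  assumes "finite P" "\<And>p. p \<in> P \<Longrightarrow> prime p" "even b"
  shows "(\<Prod>p\<in>P. 1 - 1 / real p) \<le> dens (even_trunc b) P"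
proof -
  have "0 \<le> dens (\<lambda>A. even_trunc b A - (-1) ^ card A) P"
  proof (rule dens_nonneg[OF assms(1,2)])
    fix D
    have "psum (\<lambda>A. (-1) ^ card A) P D = (\<Sum>i\<le>card (P \<inter> D). real (card (P \<inter> D) choose i) * (-1) ^ i)"
      by (rule psum_card[OF assms(1)])
    also have "\<dots> = free P D"
    proof (cases "P \<inter> D = {}")
      case False
      then obtain m where m: "card (P \<inter> D) = Suc m" using assms by (metis card_gt_0_iff finite_Int gr0_implies_Suc)
      show ?thesis using alternating_choose[where b = "Suc m" and m = m] False unfolding m by (simp add: mult.commute free_def binomial_eq_0)
    qed (simp add: free_def)
    finally show "0 \<le> psum (\<lambda>A. even_trunc b A - (-1) ^ card A) P D" using even_trunc_bounds(1)[OF assms(1,3), of D] by (simp add: psum_diff)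
  qed
  then show ?thesis using dens_moebius[OF assms(1,2)] by (simp add: dens_diff)
qed

text \<open>An elementary symmetric polynomial of degree k is at most the k-th power of the sum over
  k!, because each k-set occurs k! times in the expanded power.\<close>

lemma dens_level:
  assumes "finite P"
  shows "(\<Sum>A\<in>Pow P. of_bool (card A = k) / real (\<Prod>A)) \<le> (\<Sum>p\<in>P. 1 / real p) ^ k / fact k"
  using assms
proof (induction P arbitrary: k rule: finite_induct)
  case empty
  then show ?case by (cases k) auto
next
  case (insert p P)
  define l where "l = (\<Sum>p\<in>P. 1 / real p)"
  define x where "x = 1 / real p"
  have l0: "l \<ge> 0" "x \<ge> 0" by (auto simp: l_def x_def sum_nonneg)
  have fin: "finite A" "p \<notin> A" if "A \<in> Pow P" for A using that insert finite_subset by auto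
  have "(\<Sum>A\<in>Pow (insert p P). of_bool (card A = k) / real (\<Prod>A)) =
    (\<Sum>A\<in>Pow P. of_bool (card A = k) / real (\<Prod>A) + of_bool (card (insert p A) = k) / real (\<Prod>(insert p A)))"
    by (rule Pow_insert_sum) (use insert in auto)
  also have "\<dots> = (\<Sum>A\<in>Pow P. of_bool (card A = k) / real (\<Prod>A) + x * (of_bool (Suc (card A) = k) / real (\<Prod>A)))"
    by (rule sum.cong[OF refl]) (use fin in \<open>simp add: x_def\<close>)
  also have "\<dots> = (\<Sum>A\<in>Pow P. of_bool (card A = k) / real (\<Prod>A)) + x * (\<Sum>A\<in>Pow P. of_bool (Suc (card A) = k) / real (\<Prod>A))"
    by (simp add: sum.distrib sum_distrib_left)
  also have "\<dots> \<le> (l + x) ^ k / fact k"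
  proof (cases k)
    case 0
    then show ?thesis using insert.IH[of 0] by (simp add: l_def)
  next
    case (Suc j)
    have "(\<Sum>A\<in>Pow P. of_bool (card A = Suc j) / real (\<Prod>A)) + x * (\<Sum>A\<in>Pow P. of_bool (card A = j) / real (\<Prod>A))
      \<le> l ^ Suc j / fact (Suc j) + x * (l ^ j / fact j)"
      unfolding l_def using l0 by (intro add_mono mult_left_mono insert.IH) auto
    also have "\<dots> = (l ^ Suc j + real (Suc j) * l ^ j * x) / fact (Suc j)"
    proof -
      have "x * (l ^ j / fact j) = (real (Suc j) * l ^ j * x) / fact (Suc j)" by (simp add: divide_simps del: of_nat_Suc)
      then show ?thesis by (simp only: add_divide_distrib)
    qed
    also have "\<dots> \<le> (l + x) ^ Suc j / fact (Suc j)"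
    proof (rule divide_right_mono)
      show "l ^ Suc j + real (Suc j) * l ^ j * x \<le> (l + x) ^ Suc j"
      proof (induction j)
        case (Suc j)
        have "l ^ Suc (Suc j) + real (Suc (Suc j)) * l ^ Suc j * x \<le> (l + x) * (l ^ Suc j + real (Suc j) * l ^ j * x)"
          using l0 by (simp add: algebra_simps)
        also have "\<dots> \<le> (l + x) * (l + x) ^ Suc j" using l0 by (intro mult_left_mono Suc) auto
        finally show ?case by simp
      qed simp
    qed simp
    finally show ?thesis using Suc by simp
  qed
  finally show ?case using insert by (simp add: l_def x_def add.commute)
qed

lemma dens_overshoot_le:
  assumes "finite P"
  shows "dens (overshoot b) P \<le> (\<Sum>p\<in>P. 1 / real p) ^ Suc b / fact (Suc b)"
  using dens_level[OF assms, of "Suc b"] by (simp add: dens_def overshoot_def[abs_def] of_bool_def if_distrib cong: if_cong)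

lemma mass_even_trunc_le: assumes "finite P" shows "mass (even_trunc b) P \<le> (real (card P) + 1) ^ b"
proof -
  have "mass (even_trunc b) P = (\<Sum>A\<in>Pow P. (if card A \<le> b then 1 else 0))"
    unfolding mass_def even_trunc_def by (rule sum.cong) (auto simp: power_abs)
  also have "\<dots> = (\<Sum>i\<le>card P. real (card P choose i) * (if i \<le> b then 1 else 0))" by (rule sum_Pow_card[OF assms])
  also have "\<dots> \<le> (\<Sum>i\<le>max (card P) b. real (card P choose i) * (if i \<le> b then 1 else 0))" by (rule sum_mono2) auto
  also have "\<dots> = (\<Sum>i\<le>b. real (card P choose i))" by (rule sum.mono_neutral_cong_right) auto
  also have "\<dots> \<le> (\<Sum>i\<le>b. real (b choose i) * real (card P) ^ i)"
  proof (rule sum_mono)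
    fix i assume i: "i \<in> {..b}"
    have "real (card P choose i) \<le> real (card P) ^ i"
    proof (cases "i \<le> card P")
      case True
      then have "(card P choose i) \<le> card P ^ i" by (rule binomial_le_pow)
      then show ?thesis by (metis of_nat_le_iff of_nat_power)
    qed (simp add: binomial_eq_0)
    also have "1 * real (card P) ^ i \<le> real (b choose i) * real (card P) ^ i"
      using i by (intro mult_right_mono) (auto simp: Suc_leI)
    finally show "real (card P choose i) \<le> real (b choose i) * real (card P) ^ i" by simp
  qed
  also have "\<dots> = (real (card P) + 1) ^ b" by (simp add: binomial_ring mult.commute)
  finally show ?thesis .
qed

lemma mass_overshoot_le: assumes "finite P" shows "mass (overshoot b) P \<le> real (card P) ^ Suc b"
proof -
  have "mass (overshoot b) P = psum (overshoot b) P P" unfolding mass_def psum_def by (rule sum.cong) (auto simp: overshoot_def)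
  also have "\<dots> = real (card P choose Suc b)" using assms by (simp add: psum_overshoot)
  also have "\<dots> \<le> real (card P) ^ Suc b"
  proof (cases "Suc b \<le> card P")
    case True
    then have "(card P choose Suc b) \<le> card P ^ Suc b" by (rule binomial_le_pow)
    then show ?thesis by (metis of_nat_le_iff of_nat_power)
  qed (simp add: binomial_eq_0)
  finally show ?thesis .
qed

text \<open>The blocks grow doubly exponentially so that the reciprocals of the primes of each block
  have a bounded sum. The case i = 0 has no lower end and yields the single prime 2.\<close>

definition prime_block :: "nat \<Rightarrow> nat set" where
  "prime_block i = {p. prime p \<and> p \<le> 2 ^ 2 ^ i \<and> (i > 0 \<longrightarrow> 2 ^ 2 ^ (i - 1) < p)}"

definition blocks_below :: "nat \<Rightarrow> nat set" where "blocks_below i = (\<Union>j<i. prime_block j)"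

lemma prime_block_props: "finite (prime_block i)" "p \<in> prime_block i \<Longrightarrow> prime p" "card (prime_block i) + 1 \<le> 2 ^ 2 ^ i"
proof -
  have sub: "prime_block i \<subseteq> {2..2 ^ 2 ^ i}" by (auto simp: prime_block_def dest: prime_ge_2_nat)
  then show "finite (prime_block i)" by (rule finite_subset) simp
  have "card (prime_block i) \<le> card {2..(2::nat) ^ 2 ^ i}" using sub by (intro card_mono) auto
  moreover have "(2::nat) ^ 2 ^ i \<ge> 2" using self_le_power[of 2 "2 ^ i"] by simp
  ultimately show "card (prime_block i) + 1 \<le> 2 ^ 2 ^ i" by simp
qed (auto simp: prime_block_def)

lemma blocks_below_props: "finite (blocks_below i)" "p \<in> blocks_below i \<Longrightarrow> prime p" "blocks_below (Suc i) = blocks_below i \<union> prime_block i" "blocks_below i \<inter> prime_block i = {}"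
proof -
  show "blocks_below i \<inter> prime_block i = {}"
  proof (rule ccontr)
    assume "blocks_below i \<inter> prime_block i \<noteq> {}"
    then obtain p j where p: "j < i" "p \<in> prime_block j" "p \<in> prime_block i" by (auto simp: blocks_below_def)
    then have "p \<le> 2 ^ 2 ^ j" "2 ^ 2 ^ (i - 1) < p" by (auto simp: prime_block_def)
    moreover have "(2::nat) ^ 2 ^ j \<le> 2 ^ 2 ^ (i - 1)" using p by (intro power_increasing) auto
    ultimately show False by linarith
  qed
qed (auto simp: blocks_below_def prime_block_props lessThan_Suc)

lemma blocks_below_eq: "blocks_below (Suc i) = {p. prime p \<and> p \<le> 2 ^ 2 ^ i}"
proof (induction i)
  case 0
  then show ?case by (auto simp: blocks_below_def prime_block_def)
next
  case (Suc i)
  have le: "(2::nat) ^ 2 ^ i \<le> 2 ^ 2 ^ Suc i" by (intro power_increasing) auto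
  show ?case unfolding blocks_below_props(3)[of "Suc i"] Suc prime_block_def using le by (auto simp: not_le simp del: power_Suc intro: order_trans)
qed

text \<open>Chebyshev's argument: all these primes divide the central binomial coefficient, which is
  at most \<open>2 ^ 2 ^ Suc i\<close>, so there are at most \<open>2 ^ Suc i / i\<close> of
  them.\<close>

lemma dyadic_primes: assumes i: "i \<ge> 1" shows "(\<Sum>p | prime p \<and> 2 ^ i < p \<and> p \<le> 2 ^ Suc i. 1 / real p) \<le> 2 / real i"
proof -
  let ?S = "{p :: nat. prime p \<and> 2 ^ i < p \<and> p \<le> 2 ^ Suc i}"
  let ?B = "(2 ^ Suc i) choose (2 ^ i) :: nat"
  have fin: "finite ?S" by (rule finite_subset[of _ "{..2 ^ Suc i}"]) auto
  have dv: "p dvd ?B" if p: "p \<in> ?S" for p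
  proof -
    have f: "fact (2 ^ i) * fact (2 ^ Suc i - 2 ^ i) * ?B = (fact (2 ^ Suc i) :: nat)" by (rule binomial_fact_lemma) simp
    have "p dvd (fact (2 ^ Suc i) :: nat)" using p by (simp add: prime_dvd_fact_iff)
    then have "p dvd fact (2 ^ i) \<or> p dvd fact (2 ^ Suc i - 2 ^ i) \<or> p dvd ?B"
      using p unfolding f[symmetric] by (auto simp: prime_dvd_mult_iff)
    then show ?thesis using p by (auto simp: prime_dvd_fact_iff)
  qed
  have "\<Prod>?S dvd ?B" using prod_primes_dvd_iff[OF fin, of ?B] dv by auto
  then have "\<Prod>?S \<le> ?B" by (intro dvd_imp_le) auto
  also have "?B \<le> 2 ^ 2 ^ Suc i" by (rule binomial_le_pow2)
  finally have 1: "\<Prod>?S \<le> 2 ^ 2 ^ Suc i" .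
  have "(\<Prod>p\<in>?S. 2 ^ i) \<le> \<Prod>?S" by (rule prod_mono) auto
  then have "2 ^ (i * card ?S) \<le> (2::nat) ^ 2 ^ Suc i" using 1 by (simp add: power_mult)
  then have c: "i * card ?S \<le> 2 ^ Suc i" by (subst (asm) power_increasing_iff) auto
  have "(\<Sum>p\<in>?S. 1 / real p) \<le> (\<Sum>p\<in>?S. 1 / 2 ^ i)"
  proof (rule sum_mono)
    fix p assume "p \<in> ?S"
    then have "(2::nat) ^ i \<le> p" by auto
    then have "real (2 ^ i) \<le> real p" by (rule of_nat_mono)
    then show "1 / real p \<le> 1 / 2 ^ i" by (intro divide_left_mono) (use \<open>p \<in> ?S\<close> in \<open>auto simp: prime_gt_0_nat\<close>)
  qed
  also have "\<dots> = real (card ?S) / 2 ^ i" by simp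
  also have "\<dots> \<le> 2 / real i"
  proof -
    have "real (i * card ?S) \<le> real (2 ^ Suc i)" using c by (rule of_nat_mono)
    then show ?thesis using i by (simp add: field_simps)
  qed
  finally show ?thesis .
qed

lemma sum_UN_le:
  fixes f :: "'a \<Rightarrow> real"
  assumes "finite I" "\<And>i. i \<in> I \<Longrightarrow> finite (S i)" "\<And>x. 0 \<le> f x"
  shows "sum f (\<Union>i\<in>I. S i) \<le> (\<Sum>i\<in>I. sum f (S i))"
  using assms(1,2)
proof (induction I rule: finite_induct)
  case (insert i I)
  have "sum f (S i \<union> (\<Union>i\<in>I. S i)) + sum f (S i \<inter> (\<Union>i\<in>I. S i)) = sum f (S i) + sum f (\<Union>i\<in>I. S i)"
    by (rule sum.union_inter) (use insert in auto)
  then show ?case using insert sum_nonneg[of "S i \<inter> (\<Union>i\<in>I. S i)" f] assms(3) by fastforce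
qed simp

text \<open>For i = j + 1 the block is covered by \<open>2 ^ j\<close> dyadic intervals, and by
  \<open>dyadic_primes\<close> each contributes at most \<open>2 / 2 ^ j\<close>.\<close>

lemma prime_block_recip: "(\<Sum>p\<in>prime_block i. 1 / real p) \<le> 2"
proof (cases i)
  case 0
  have "prime_block 0 = {2}" by (auto simp: prime_block_def dest: prime_ge_2_nat)
  then show ?thesis using 0 by simp
next
  case (Suc j)
  let ?S = "\<lambda>i. {p :: nat. prime p \<and> 2 ^ i < p \<and> p \<le> 2 ^ Suc i}"
  have fin: "finite (?S i)" for i by (rule finite_subset[of _ "{..2 ^ Suc i}"]) auto
  have sub: "prime_block i \<subseteq> (\<Union>k\<in>{2 ^ j..<2 ^ i}. ?S k)"
  proof
    fix p assume p: "p \<in> prime_block i"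
    then have pp: "prime p" "p \<le> 2 ^ 2 ^ i" "2 ^ 2 ^ j < p" using Suc by (auto simp: prime_block_def)
    define k where "k = (LEAST k. p \<le> 2 ^ Suc k)"
    have "p \<le> 2 ^ Suc (2 ^ i)" using pp(2) by simp
    then have k1: "p \<le> 2 ^ Suc k" unfolding k_def by (rule LeastI)
    have k2: "2 ^ k < p"
    proof (rule ccontr)
      assume n: "\<not> 2 ^ k < p"
      show False
      proof (cases k)
        case 0
        then show False using n pp by (simp add: prime_ge_2_nat not_less) (metis not_prime_0 not_prime_1 le_Suc_eq le_zero_eq One_nat_def)
      next
        case (Suc k')
        then have "p \<le> 2 ^ Suc k'" using n by simp
        then have "k \<le> k'" unfolding k_def by (rule Least_le)
        then show False using Suc by simp
      qed
    qed
    have "(2::nat) ^ k < 2 ^ 2 ^ i" using k2 pp(2) by linarith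
    then have "k < 2 ^ i" by (subst (asm) power_strict_increasing_iff) auto
    moreover have "(2::nat) ^ 2 ^ j < 2 ^ Suc k" using k1 pp(3) by linarith
    then have "2 ^ j < Suc k" by (subst (asm) power_strict_increasing_iff) auto
    ultimately show "p \<in> (\<Union>k\<in>{2 ^ j..<2 ^ i}. ?S k)" using k1 k2 pp(1) by auto
  qed
  have "(\<Sum>p\<in>prime_block i. 1 / real p) \<le> (\<Sum>p\<in>(\<Union>k\<in>{2 ^ j..<2 ^ i}. ?S k). 1 / real p)"
    using sub fin by (intro sum_mono2) auto
  also have "\<dots> \<le> (\<Sum>k\<in>{2 ^ j..<2 ^ i}. \<Sum>p\<in>?S k. 1 / real p)"
    by (rule sum_UN_le) (use fin in auto)
  also have "\<dots> \<le> (\<Sum>k\<in>{2 ^ j..<(2::nat) ^ i}. 2 / 2 ^ j)"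
  proof (rule sum_mono)
    fix k assume k: "k \<in> {2 ^ j..<(2::nat) ^ i}"
    have "(1::nat) \<le> 2 ^ j" by simp
    then have k1: "1 \<le> k" using k unfolding atLeastLessThan_iff by linarith
    have "real (2 ^ j) \<le> real k" using k by (intro of_nat_mono) simp
    then have "2 / real k \<le> 2 / 2 ^ j" using k1 by (intro divide_left_mono) auto
    then show "(\<Sum>p\<in>?S k. 1 / real p) \<le> 2 / 2 ^ j" using dyadic_primes[OF k1] by linarith
  qed
  also have "\<dots> = 2" using Suc by simp
  finally show ?thesis .
qed

text \<open>For x <= 1/2 one has 1 - x >= exp (- 2 x), and the reciprocals in a block sum to at most
  2.\<close>

lemma prime_block_prod_ge: "exp (-4) \<le> (\<Prod>p\<in>prime_block i. 1 - 1 / real p)"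
proof -
  have "exp (-4) \<le> exp (\<Sum>p\<in>prime_block i. - 2 * (1 / real p))"
    using prime_block_recip[of i] unfolding sum_distrib_left[symmetric] by simp
  also have "\<dots> = (\<Prod>p\<in>prime_block i. exp (- 2 * (1 / real p)))"
    by (rule exp_sum) (simp add: prime_block_props)
  also have "\<dots> \<le> (\<Prod>p\<in>prime_block i. 1 - 1 / real p)"
  proof (rule prod_mono, intro conjI)
    fix p assume "p \<in> prime_block i"
    then have p: "real p \<ge> 2" using prime_ge_2_nat[OF prime_block_props(2)] by (metis of_nat_le_iff of_nat_numeral)
    define x where "x = 1 / real p"
    have x: "0 \<le> x" "x \<le> 1 / 2" using p by (auto simp: x_def field_simps)
    have "1 \<le> (1 - x) * (1 + 2 * x)" using mult_nonneg_nonneg[of x "1 - 2 * x"] x by (simp add: algebra_simps)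
    also have "\<dots> \<le> (1 - x) * exp (2 * x)" using x exp_ge_add_one_self[of "2 * x"] by (intro mult_left_mono) auto
    finally have "exp (- (2 * x)) \<le> 1 - x" by (simp add: exp_minus field_simps)
    then show "exp (- 2 * (1 / real p)) \<le> 1 - 1 / real p" by (simp add: x_def)
  qed simp
  finally show ?thesis .
qed


text \<open>The upper Brun--Hooley weight. Each even truncation is a nonnegative upper bound for the
  indicator of its block, so their product bounds the product of the indicators.\<close>

primrec upper_weight :: "nat \<Rightarrow> nat \<Rightarrow> nat \<Rightarrow> nat set \<Rightarrow> real" where
  "upper_weight b r 0 = (\<lambda>A. 1)"
| "upper_weight b r (Suc i) = tens (blocks_below i) (prime_block i) (upper_weight b r i) (even_trunc (b + 2 * (r - i)))"

text \<open>Writing \<open>F\<close>, \<open>Y\<close>, \<open>B\<close> for the free indicator of a new block, its even truncation and the overshoot,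
  one has \<open>F \<ge> Y - B\<close>, and \<open>L Y - U B\<close> is again a lower bound for the product of the indicators.\<close>

primrec lower_weight :: "nat \<Rightarrow> nat \<Rightarrow> nat \<Rightarrow> nat set \<Rightarrow> real" where
  "lower_weight b r 0 = (\<lambda>A. 1)"
| "lower_weight b r (Suc i) = (\<lambda>A. tens (blocks_below i) (prime_block i) (lower_weight b r i) (even_trunc (b + 2 * (r - i))) A
      - tens (blocks_below i) (prime_block i) (upper_weight b r i) (overshoot (b + 2 * (r - i))) A)"

lemma blocks_below_0: "blocks_below 0 = {}" by (simp add: blocks_below_def)

lemmas tens_rules = psum_tens[OF blocks_below_props(1) prime_block_props(1) blocks_below_props(4)] dens_tens[OF blocks_below_props(1) prime_block_props(1) blocks_below_props(4)]
  mass_tens[OF blocks_below_props(1) prime_block_props(1) blocks_below_props(4)]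

text \<open>In \<open>l * y - u * k\<close> the retained term needs a lower bound and the subtracted
  one an upper bound; y and k are nonnegative, so it is at most \<open>f * (y - k)\<close>, and
  \<open>y - k \<le> h\<close> finishes.\<close>

lemma weight_signs:
  assumes "even b"
  shows "free (blocks_below i) D \<le> psum (upper_weight b r i) (blocks_below i) D \<and> psum (lower_weight b r i) (blocks_below i) D \<le> free (blocks_below i) D"
proof (induction i)
  case 0
  show ?case by (simp add: blocks_below_0 psum_def free_def)
next
  case (Suc i)
  define n where "n = b + 2 * (r - i)"
  have n: "even n" using assms by (simp add: n_def)
  note c = even_trunc_bounds[OF prime_block_props(1)[of i] n, of D]
  define f where "f = free (blocks_below i) D"
  define h where "h = free (prime_block i) D"
  define l where "l = psum (lower_weight b r i) (blocks_below i) D"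
  define u where "u = psum (upper_weight b r i) (blocks_below i) D"
  define y where "y = psum (even_trunc n) (prime_block i) D"
  define k where "k = psum (overshoot n) (prime_block i) D"
  have fr: "free (blocks_below (Suc i)) D = f * h"
    by (auto simp: f_def h_def free_def blocks_below_props(3))
  have f0: "0 \<le> f" "0 \<le> h" by (auto simp: f_def h_def free_def)
  have b: "f \<le> u" "l \<le> f" "h \<le> y" "0 \<le> y" "y - k \<le> h" "0 \<le> k"
    using Suc c by (auto simp: f_def h_def l_def u_def y_def k_def)
  have U: "psum (upper_weight b r (Suc i)) (blocks_below (Suc i)) D = u * y"
    unfolding upper_weight.simps blocks_below_props(3) tens_rules u_def y_def n_def ..
  have L: "psum (lower_weight b r (Suc i)) (blocks_below (Suc i)) D = l * y - u * k"
    unfolding lower_weight.simps blocks_below_props(3) psum_diff tens_rules l_def u_def y_def k_def n_def ..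
  have "l * y \<le> f * y" using b by (intro mult_right_mono) auto
  moreover have "f * k \<le> u * k" using b by (intro mult_right_mono) auto
  moreover have "f * (y - k) \<le> f * h" using b f0 by (intro mult_left_mono) auto
  ultimately have "l * y - u * k \<le> f * h" by (simp add: algebra_simps)
  moreover have "f * h \<le> u * y" using b f0 by (intro mult_mono) auto
  ultimately show ?case unfolding U L fr by simp
qed

lemma prod_blocks_below_Suc: "(\<Prod>p\<in>blocks_below (Suc i). g p) = (\<Prod>p\<in>blocks_below i. g p) * (\<Prod>p\<in>prime_block i. g p)" for g :: "nat \<Rightarrow> real"
  unfolding blocks_below_props(3) by (rule prod.union_disjoint) (auto simp: blocks_below_props prime_block_props)

text \<open>A bound for overshoot density relative to truncated density in a block: the former is at
  most \<open>2 ^ n / fact n\<close>, the latter at least \<open>exp (-4)\<close>.\<close>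

definition loss :: "nat \<Rightarrow> real" where "loss n = exp 4 * 2 ^ n / fact n"

lemma loss_nonneg: "0 \<le> loss n" by (simp add: loss_def)

lemma prime_factor_pos: "(p::nat) \<in> S \<Longrightarrow> (\<And>p. p \<in> S \<Longrightarrow> prime p) \<Longrightarrow> 0 < 1 - 1 / real p"
  using prime_gt_1_nat[of p] by simp

text \<open>Each block multiplies both densities by \<open>y\<close> and subtracts from the lower
  one at most the fraction \<open>loss\<close> of the new upper density, so the losses simply add
  up.\<close>

lemma weight_dens:
  assumes "even b"
  shows "(\<Prod>p\<in>blocks_below i. 1 - 1 / real p) \<le> dens (upper_weight b r i) (blocks_below i) \<and>
    dens (upper_weight b r i) (blocks_below i) * (1 - (\<Sum>j<i. loss (Suc (b + 2 * (r - j))))) \<le> dens (lower_weight b r i) (blocks_below i)"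
proof (induction i)
  case 0
  show ?case by (simp add: blocks_below_0 dens_def)
next
  case (Suc i)
  define n where "n = b + 2 * (r - i)"
  have n: "even n" using assms by (simp add: n_def)
  define S where "S = (\<Sum>j<i. loss (Suc (b + 2 * (r - j))))"
  define l where "l = dens (lower_weight b r i) (blocks_below i)"
  define u where "u = dens (upper_weight b r i) (blocks_below i)"
  define y where "y = dens (even_trunc n) (prime_block i)"
  define k where "k = dens (overshoot n) (prime_block i)"
  define w where "w = (\<Prod>p\<in>prime_block i. 1 - 1 / real p)"
  define v where "v = (\<Prod>p\<in>blocks_below i. 1 - 1 / real p)"
  have v: "0 < v" unfolding v_def by (rule prod_pos) (use prime_factor_pos blocks_below_props in blast)
  have u: "v \<le> u" using Suc by (simp add: u_def v_def)
  have w: "exp (-4) \<le> w" "w \<le> y" unfolding w_def y_def using prime_block_prod_ge dens_even_trunc_ge[OF prime_block_props(1,2) n] by auto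
  have y: "0 < y" "exp (-4) \<le> y" using w exp_gt_zero[of "-4::real"] by linarith+
  have U: "dens (upper_weight b r (Suc i)) (blocks_below (Suc i)) = u * y"
    unfolding upper_weight.simps blocks_below_props(3) tens_rules u_def y_def n_def ..
  have L: "dens (lower_weight b r (Suc i)) (blocks_below (Suc i)) = l * y - u * k"
    unfolding lower_weight.simps blocks_below_props(3) dens_diff tens_rules l_def u_def y_def k_def n_def ..
  have "k \<le> (\<Sum>p\<in>prime_block i. 1 / real p) ^ Suc n / fact (Suc n)" unfolding k_def by (rule dens_overshoot_le[OF prime_block_props(1)])
  also have "\<dots> \<le> 2 ^ Suc n / fact (Suc n)"
    by (intro divide_right_mono power_mono prime_block_recip sum_nonneg) auto
  also have "\<dots> = exp (-4) * loss (Suc n)" by (simp add: loss_def exp_minus)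
  also have "\<dots> \<le> y * loss (Suc n)" by (intro mult_right_mono y loss_nonneg)
  finally have k: "u * k \<le> u * (y * loss (Suc n))" using u v by (intro mult_left_mono) auto
  have "u * (1 - S) \<le> l" using Suc by (simp add: u_def l_def S_def)
  then have "u * (1 - S) * y \<le> l * y" using y by (intro mult_right_mono) auto
  then have "u * y * (1 - (S + loss (Suc n))) \<le> l * y - u * k" using k by (simp add: algebra_simps)
  moreover have "v * w \<le> u * y" using u v w y by (intro mult_mono) (auto intro: order_trans[OF _ w(1)])
  moreover have "(\<Prod>p\<in>blocks_below (Suc i). 1 - 1 / real p) = v * w" unfolding prod_blocks_below_Suc v_def w_def ..
  moreover have "(\<Sum>j<Suc i. loss (Suc (b + 2 * (r - j)))) = S + loss (Suc n)" by (simp add: S_def n_def)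
  ultimately show ?case unfolding U L by simp
qed

definition supported :: "(nat set \<Rightarrow> real) \<Rightarrow> nat set \<Rightarrow> nat \<Rightarrow> bool" where
  "supported c P m \<longleftrightarrow> (\<forall>A\<in>Pow P. c A \<noteq> 0 \<longrightarrow> \<Prod>A \<le> m)"

lemma supported_tens:
  assumes "finite P" "finite Q" "P \<inter> Q = {}" "supported c P m" "supported c' Q m'"
  shows "supported (tens P Q c c') (P \<union> Q) (m * m')"
  unfolding supported_def
proof (intro ballI impI)
  fix A assume A: "A \<in> Pow (P \<union> Q)" "tens P Q c c' A \<noteq> 0"
  have e: "(A \<inter> P) \<union> (A \<inter> Q) = A" using A by auto
  have "\<Prod>((A \<inter> P) \<union> (A \<inter> Q)) = \<Prod>(A \<inter> P) * \<Prod>(A \<inter> Q)"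
    using assms by (intro prod.union_disjoint) auto
  moreover have "\<Prod>(A \<inter> P) \<le> m" "\<Prod>(A \<inter> Q) \<le> m'"
    using A assms unfolding supported_def tens_def by auto
  ultimately show "\<Prod>A \<le> m * m'" unfolding e by (simp add: mult_le_mono)
qed

lemma supported_prime_block:
  assumes "\<And>A. c A \<noteq> 0 \<Longrightarrow> card A \<le> Suc n"
  shows "supported c (prime_block i) ((2 ^ 2 ^ i) ^ Suc n)"
  unfolding supported_def
proof (intro ballI impI)
  fix A assume A: "A \<in> Pow (prime_block i)" "c A \<noteq> 0"
  have "\<Prod>A \<le> (\<Prod>p\<in>A. 2 ^ 2 ^ i)" by (rule prod_mono) (use A in \<open>auto simp: prime_block_def\<close>)
  also have "\<dots> = (2 ^ 2 ^ i) ^ card A" by simp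
  also have "\<dots> \<le> (2 ^ 2 ^ i) ^ Suc n" using assms[OF A(2)] by (rule power_increasing) simp
  finally show "\<Prod>A \<le> (2 ^ 2 ^ i) ^ Suc n" .
qed

text \<open>With truncation at \<open>b + 2 (r - i)\<close> in block \<open>i\<close> the level stays a fixed power of \<open>2 ^ 2 ^ r\<close>, while the
  losses \<open>2 ^ n / n!\<close> remain summable.\<close>

definition level :: "nat \<Rightarrow> nat \<Rightarrow> nat \<Rightarrow> nat" where
  "level b r i = 2 ^ (\<Sum>j<i. 2 ^ j * Suc (b + 2 * (r - j)))"

lemma level_Suc: "level b r (Suc i) = level b r i * (2 ^ 2 ^ i) ^ Suc (b + 2 * (r - i))"
  unfolding level_def sum.lessThan_Suc power_add power_mult ..

lemma level_le: "level b r (Suc r) \<le> (2 ^ 2 ^ r) ^ (2 * b + 6)"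
proof -
  have "(\<Sum>j<Suc r. 2 ^ j * Suc (b + 2 * (r - j))) \<le> 2 ^ r * (2 * b + 6)"
  proof (induction r)
    case (Suc r)
    have "(\<Sum>j<Suc (Suc r). 2 ^ j * Suc (b + 2 * (Suc r - j)))
      = (\<Sum>j<Suc r. 2 ^ j * Suc (b + 2 * (r - j)) + 2 * 2 ^ j) + 2 ^ Suc r * Suc b"
      by (subst sum.lessThan_Suc) (auto intro!: sum.cong simp: Suc_diff_le algebra_simps)
    also have "\<dots> = (\<Sum>j<Suc r. 2 ^ j * Suc (b + 2 * (r - j))) + 2 * (\<Sum>j<Suc r. 2 ^ j) + 2 ^ Suc r * Suc b"
      unfolding sum.distrib sum_distrib_left[symmetric] ..
    also have "\<dots> \<le> 2 ^ r * (2 * b + 6) + 2 * 2 ^ Suc r + 2 ^ Suc r * Suc b"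
    proof -
      have "(\<Sum>j<Suc r. 2 ^ j) \<le> (2::nat) ^ Suc r"
        unfolding lessThan_atLeast0 sum_power2 by simp
      then show ?thesis using Suc by linarith
    qed
    also have "\<dots> = 2 ^ Suc r * (2 * b + 6)" by (simp add: algebra_simps)
    finally show ?case .
  qed simp
  then show ?thesis unfolding level_def power_mult[symmetric] by (rule power_increasing) simp
qed

text \<open>A block has fewer than \<open>2 ^ 2 ^ i\<close> primes, each at most that large, so
  support and mass grow by the same power. The lower weight gains one further upper mass in every
  step, whence the factor \<open>Suc i\<close>.\<close>

lemma weight_size:
  "supported (upper_weight b r i) (blocks_below i) (level b r i) \<and> supported (lower_weight b r i) (blocks_below i) (level b r i) \<and>
   mass (upper_weight b r i) (blocks_below i) \<le> real (level b r i) \<and>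
   mass (lower_weight b r i) (blocks_below i) \<le> real (Suc i) * real (level b r i)"
proof (induction i)
  case 0
  show ?case by (simp add: blocks_below_0 level_def supported_def mass_def)
next
  case (Suc i)
  define n where "n = b + 2 * (r - i)"
  define z :: nat where "z = 2 ^ 2 ^ i"
  define m where "m = level b r i"
  have lv: "level b r (Suc i) = m * z ^ Suc n" by (simp only: level_Suc m_def z_def n_def)
  have z1: "1 \<le> z" by (simp add: z_def)
  have card: "card (prime_block i) + 1 \<le> z" using prime_block_props(3) by (simp add: z_def)
  have sY: "supported (even_trunc n) (prime_block i) (z ^ Suc n)" unfolding z_def by (rule supported_prime_block) (auto simp: even_trunc_def split: if_splits)
  have sB: "supported (overshoot n) (prime_block i) (z ^ Suc n)" unfolding z_def by (rule supported_prime_block) (auto simp: overshoot_def split: if_splits)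
  have "mass (even_trunc n) (prime_block i) \<le> (real (card (prime_block i)) + 1) ^ n" by (rule mass_even_trunc_le[OF prime_block_props(1)])
  also have "\<dots> \<le> real z ^ n" using card by (intro power_mono) auto
  also have "\<dots> \<le> real z ^ Suc n" using z1 by (intro power_increasing) auto
  finally have mY: "mass (even_trunc n) (prime_block i) \<le> real z ^ Suc n" .
  have "mass (overshoot n) (prime_block i) \<le> real (card (prime_block i)) ^ Suc n" by (rule mass_overshoot_le[OF prime_block_props(1)])
  also have "\<dots> \<le> real z ^ Suc n" using card by (intro power_mono) auto
  finally have mB: "mass (overshoot n) (prime_block i) \<le> real z ^ Suc n" .
  note fin = blocks_below_props(1)[of i] prime_block_props(1)[of i] blocks_below_props(4)[of i]
  have IH: "supported (upper_weight b r i) (blocks_below i) m" "supported (lower_weight b r i) (blocks_below i) m"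
    "mass (upper_weight b r i) (blocks_below i) \<le> real m" "mass (lower_weight b r i) (blocks_below i) \<le> real (Suc i) * real m"
    using Suc by (auto simp: m_def)
  have 1: "supported (upper_weight b r (Suc i)) (blocks_below (Suc i)) (level b r (Suc i))"
    unfolding upper_weight.simps blocks_below_props(3) lv n_def[symmetric] by (rule supported_tens[OF fin IH(1) sY])
  have "supported (tens (blocks_below i) (prime_block i) (lower_weight b r i) (even_trunc n)) (blocks_below i \<union> prime_block i) (m * z ^ Suc n)"
    "supported (tens (blocks_below i) (prime_block i) (upper_weight b r i) (overshoot n)) (blocks_below i \<union> prime_block i) (m * z ^ Suc n)"
    by (rule supported_tens[OF fin IH(2) sY]) (rule supported_tens[OF fin IH(1) sB])
  then have 2: "supported (lower_weight b r (Suc i)) (blocks_below (Suc i)) (level b r (Suc i))"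
    unfolding lower_weight.simps blocks_below_props(3) lv n_def[symmetric] supported_def by (metis (lifting) diff_0_right)
  have 3: "mass (upper_weight b r (Suc i)) (blocks_below (Suc i)) \<le> real (level b r (Suc i))"
    unfolding upper_weight.simps blocks_below_props(3) lv n_def[symmetric] tens_rules of_nat_mult of_nat_power
    by (intro mult_mono IH mY mass_nonneg) auto
  have "mass (lower_weight b r (Suc i)) (blocks_below (Suc i)) \<le>
    mass (lower_weight b r i) (blocks_below i) * mass (even_trunc n) (prime_block i) + mass (upper_weight b r i) (blocks_below i) * mass (overshoot n) (prime_block i)"
    unfolding lower_weight.simps blocks_below_props(3) n_def[symmetric] tens_rules[symmetric] by (rule mass_diff) (use fin in auto)
  also have "\<dots> \<le> (real (Suc i) * real m) * real z ^ Suc n + real m * real z ^ Suc n"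
    by (intro add_mono mult_mono IH mY mB mass_nonneg) auto
  also have "\<dots> = real (Suc (Suc i)) * real (level b r (Suc i))"
    unfolding lv of_nat_mult of_nat_power of_nat_Suc by (simp only: distrib_right mult_1 mult.assoc)
  finally show ?case using 1 2 3 by simp
qed

text \<open>The product over all integers from 2 to z telescopes to \<open>1 / z\<close>, and the
  composite factors are at most 1. Losing a full power of z is harmless next to a saved power of
  T.\<close>

lemma prod_primes_lower: "1 / real z \<le> (\<Prod>p | prime p \<and> p \<le> z. 1 - 1 / real p)" if "z \<ge> 1" for z :: nat
proof -
  let ?P = "{p. prime p \<and> p \<le> z}"
  have "(\<Prod>k\<in>{2..z}. 1 - 1 / real k) = 1 / real z"
    using that
  proof (induction z rule: dec_induct)
    case (step n)
    have "(\<Prod>k\<in>{2..Suc n}. 1 - 1 / real k) = (\<Prod>k\<in>{2..n}. 1 - 1 / real k) * (1 - 1 / real (Suc n))"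
      using step(1) by (intro prod.cl_ivl_Suc[THEN trans]) auto
    also have "\<dots> = 1 / real (Suc n)" using step by (simp add: field_simps)
    finally show ?case .
  qed simp
  moreover have "(\<Prod>k\<in>{2..z}. 1 - 1 / real k) = (\<Prod>k\<in>{2..z} - ?P. 1 - 1 / real k) * (\<Prod>k\<in>?P. 1 - 1 / real k)"
    by (rule prod.subset_diff) (auto dest: prime_ge_2_nat)
  moreover have "(\<Prod>k\<in>{2..z} - ?P. 1 - 1 / real k) \<le> 1" by (rule prod_le_1) auto
  moreover have "0 \<le> (\<Prod>k\<in>?P. 1 - 1 / real k)"
    by (rule prod_nonneg) (auto dest!: prime_ge_2_nat)
  ultimately show ?thesis using mult_right_mono[of "\<Prod>k\<in>{2..z} - ?P. 1 - 1 / real k" 1 "\<Prod>k\<in>?P. 1 - 1 / real k"] by simp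
qed

text \<open>A sieve for arbitrary nonnegative sequences with an absolute exponent. The remainder is
  uniform in d, and the final inequality pays for the mass of the weights with
  \<open>(r + 2) * z ^ B\<close> and for their density with \<open>1 / (2 * z)\<close>.\<close>

definition sieving_exponent :: "nat \<Rightarrow> bool" where
  "sieving_exponent B \<longleftrightarrow> (\<forall>r (a :: nat \<Rightarrow> real) N Y E z. z = 2 ^ 2 ^ r \<longrightarrow> (\<forall>n. 0 \<le> a n) \<longrightarrow> 0 \<le> Y \<longrightarrow> 0 \<le> E \<longrightarrow>
      (\<forall>d. 1 \<le> d \<longrightarrow> d \<le> z ^ B \<longrightarrow> \<bar>(\<Sum>n | n \<in> {1..N} \<and> d dvd n. a n) - Y / real d\<bar> \<le> E) \<longrightarrow>
      E * real (r + 2) * real z ^ B < Y / (2 * real z) \<longrightarrow>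
      (\<exists>n\<in>{1..N}. 0 < a n \<and> (\<forall>p. prime p \<longrightarrow> p dvd n \<longrightarrow> z < p)))"

text \<open>Once the losses sum to at most 1/2, the lower weight has at least half of the upper
  density. The weighted count of n free of primes up to z is then positive, so one of its terms
  is.\<close>

theorem brun_hooley: "\<exists>B. sieving_exponent B"
proof -
  have "summable (\<lambda>n. exp 4 * (2 ^ n / fact n) :: real)"
    using summable_exp[of "2::real"] by (intro summable_mult) (simp add: divide_inverse mult.commute)
  then have "summable loss" by (simp add: loss_def[abs_def])
  then obtain N0 where N0: "\<And>m n. m \<ge> N0 \<Longrightarrow> norm (sum loss {m..<n}) < 1 / 2"
    unfolding summable_Cauchy by (meson half_gt_zero zero_less_one)
  \<comment> \<open>Even, as the truncations require, and at least \<open>N0\<close>: the losses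
    have distinct indices above b, so their sum is part of a Cauchy tail below 1/2.\<close>
  define b where "b = 2 * N0"
  have b: "even b" by (simp add: b_def)
  have loss: "(\<Sum>j<Suc r. loss (Suc (b + 2 * (r - j)))) \<le> 1 / 2" for r
  proof -
    have "(\<Sum>j<Suc r. loss (Suc (b + 2 * (r - j)))) = sum loss ((\<lambda>j. Suc (b + 2 * (r - j))) ` {..<Suc r})"
      by (rule sum.reindex_cong[symmetric, where l = "\<lambda>j. Suc (b + 2 * (r - j))"]) (auto simp: inj_on_def)
    also have "\<dots> \<le> sum loss {b..<b + 2 * r + 2}"
      by (rule sum_mono2) (auto simp: loss_nonneg)
    also have "\<dots> \<le> 1 / 2" using N0[of b "b + 2 * r + 2"] unfolding real_norm_def abs_less_iff by (simp add: b_def del: sum.op_ivl_Suc)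
    finally show ?thesis .
  qed
  have main: "\<exists>n\<in>{1..N}. 0 < a n \<and> (\<forall>p. prime p \<longrightarrow> p dvd n \<longrightarrow> z < p)"
    if z: "z = 2 ^ 2 ^ r" and a: "\<And>n. 0 \<le> a n" and Y: "0 \<le> Y" and E: "0 \<le> E"
      and d: "\<And>d. 1 \<le> d \<Longrightarrow> d \<le> z ^ (2 * b + 6) \<Longrightarrow> \<bar>(\<Sum>n | n \<in> {1..N} \<and> d dvd n. a n) - Y / real d\<bar> \<le> E"
      and big: "E * real (r + 2) * real z ^ (2 * b + 6) < Y / (2 * real z)"
    for r and a :: "nat \<Rightarrow> real" and N z Y E
  proof -
    define P where "P = blocks_below (Suc r)"
    define L where "L = lower_weight b r (Suc r)"
    define D where "D n = {p. p dvd n}" for n :: nat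
    have P: "finite P" "\<And>p. p \<in> P \<Longrightarrow> prime p" unfolding P_def by (rule blocks_below_props(1), rule blocks_below_props(2))
    have Pz: "P = {p. prime p \<and> p \<le> z}" unfolding P_def blocks_below_eq z ..
    have z1: "1 \<le> z" by (simp add: z)
    have "supported L P (level b r (Suc r))" unfolding L_def P_def using weight_size by blast
    then have sup: "\<Prod>A \<le> z ^ (2 * b + 6)" if "A \<subseteq> P" "L A \<noteq> 0" for A
      using that level_le[of b r] unfolding supported_def z by (meson PowI order_trans)
    have "mass L P \<le> real (Suc (Suc r)) * real (level b r (Suc r))" unfolding L_def P_def using weight_size by blast
    also have "\<dots> \<le> real (Suc (Suc r)) * real ((2 ^ 2 ^ r) ^ (2 * b + 6))"
      by (intro mult_left_mono of_nat_mono level_le) simp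
    also have "\<dots> = real (r + 2) * real z ^ (2 * b + 6)" unfolding z by simp
    finally have mass: "mass L P \<le> real (r + 2) * real z ^ (2 * b + 6)" .
    have "1 / real z \<le> (\<Prod>p\<in>P. 1 - 1 / real p)" unfolding Pz by (rule prod_primes_lower[OF z1])
    also have "\<dots> \<le> dens (upper_weight b r (Suc r)) P" unfolding P_def using weight_dens[OF b] by blast
    finally have dU: "1 / real z \<le> dens (upper_weight b r (Suc r)) P" .
    have "1 / (2 * real z) \<le> dens (upper_weight b r (Suc r)) P * (1 / 2)" using dU by simp
    also have "\<dots> \<le> dens (upper_weight b r (Suc r)) P * (1 - (\<Sum>j<Suc r. loss (Suc (b + 2 * (r - j)))))"
    proof (rule mult_left_mono)
      show "1 / 2 \<le> 1 - (\<Sum>j<Suc r. loss (Suc (b + 2 * (r - j))))" using loss[of r] by linarith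
      show "0 \<le> dens (upper_weight b r (Suc r)) P" by (rule order_trans[OF _ dU]) simp
    qed
    also have "\<dots> \<le> dens L P" unfolding P_def L_def using weight_dens[OF b] by blast
    finally have dL: "1 / (2 * real z) \<le> dens L P" .
    have "0 < Y * dens L P - E * mass L P"
    proof -
      have "E * mass L P \<le> E * (real (r + 2) * real z ^ (2 * b + 6))" using E mass by (intro mult_left_mono)
      also have "\<dots> < Y * (1 / (2 * real z))" using big by (simp add: mult.assoc)
      also have "\<dots> \<le> Y * dens L P" using Y dL by (intro mult_left_mono)
      finally show ?thesis by simp
    qed
    also have "Y * dens L P - E * mass L P = (\<Sum>A\<in>Pow P. L A * (Y / real (\<Prod>A)) - E * \<bar>L A\<bar>)"
      by (simp add: dens_def mass_def sum_subtractf sum_distrib_left mult.commute)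
    also have "\<dots> \<le> (\<Sum>A\<in>Pow P. L A * (\<Sum>n | n \<in> {1..N} \<and> \<Prod>A dvd n. a n))"
    proof (rule sum_mono)
      fix A assume A: "A \<in> Pow P"
      define s where "s = (\<Sum>n | n \<in> {1..N} \<and> \<Prod>A dvd n. a n)"
      show "L A * (Y / real (\<Prod>A)) - E * \<bar>L A\<bar> \<le> L A * (\<Sum>n | n \<in> {1..N} \<and> \<Prod>A dvd n. a n)"
      proof (cases "L A = 0")
        case False
        have "\<Prod>A \<noteq> 0" using A P finite_subset[of A P] by (auto simp: prod_zero_iff ) (metis not_prime_0 subsetD)
        then have "\<bar>s - Y / real (\<Prod>A)\<bar> \<le> E" unfolding s_def using sup[of A] A False by (intro d) auto
        then have "\<bar>L A\<bar> * \<bar>s - Y / real (\<Prod>A)\<bar> \<le> \<bar>L A\<bar> * E" by (intro mult_left_mono) auto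
        then have "\<bar>L A * s - L A * (Y / real (\<Prod>A))\<bar> \<le> E * \<bar>L A\<bar>"
          by (simp only: abs_mult[symmetric] right_diff_distrib mult.commute)
        then show ?thesis unfolding s_def[symmetric] by linarith
      qed simp
    qed
    also have "\<dots> = (\<Sum>A\<in>Pow P. \<Sum>n\<in>{1..N}. a n * (L A * of_bool (A \<subseteq> D n)))"
    proof (rule sum.cong[OF refl])
      fix A assume A: "A \<in> Pow P"
      then have "finite A" "\<And>p. p \<in> A \<Longrightarrow> prime p" using P finite_subset by auto
      note dv = prod_primes_dvd_iff[OF this]
      have "(\<Sum>n | n \<in> {1..N} \<and> \<Prod>A dvd n. a n) = (\<Sum>n\<in>{1..N}. a n * of_bool (A \<subseteq> D n))"
        by (rule sum.mono_neutral_cong_left) (auto simp: D_def dv)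
      then show "L A * (\<Sum>n | n \<in> {1..N} \<and> \<Prod>A dvd n. a n) = (\<Sum>n\<in>{1..N}. a n * (L A * of_bool (A \<subseteq> D n)))"
        by (simp only: sum_distrib_left mult.left_commute[of "L A"])
    qed
    also have "\<dots> = (\<Sum>n\<in>{1..N}. a n * psum L P (D n))"
      unfolding psum_def sum_distrib_left by (rule sum.swap)
    also have "\<dots> \<le> (\<Sum>n\<in>{1..N}. a n * free P (D n))"
      unfolding L_def P_def by (rule sum_mono, rule mult_left_mono[OF conjunct2[OF weight_signs[OF b]] a])
    finally have pos: "0 < (\<Sum>n\<in>{1..N}. a n * free P (D n))" .
    have "\<exists>n\<in>{1..N}. 0 < a n * free P (D n)"
    proof (rule ccontr)
      assume "\<not> ?thesis"
      then have "(\<Sum>n\<in>{1..N}. a n * free P (D n)) \<le> 0" by (intro sum_nonpos) (auto simp: not_less)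
      then show False using pos by simp
    qed
    then obtain n where n: "n \<in> {1..N}" "0 < a n * free P (D n)" by blast
    then have "free P (D n) \<noteq> 0" by auto
    then have "P \<inter> D n = {}" by (simp add: free_def)
    moreover have "0 < a n" using n(2) a[of n] by (auto simp: zero_less_mult_iff free_def split: if_splits)
    ultimately show ?thesis using n(1) by (intro bexI[of _ n]) (auto simp: Pz D_def not_le[symmetric] disjoint_iff)
  qed
  show ?thesis unfolding sieving_exponent_def by (intro exI[of _ "2 * b + 6"] allI impI, rule main) blast+
qed

section \<open>Nondivergence\<close>

text \<open>Conjugation by \<open>dg (sqrt (4 ^ k))\<close>, written without the root. The scales
  are powers of 4, so that neighbouring ones stay comparable.\<close>

definition rescale :: "nat \<Rightarrow> mat2 \<Rightarrow> mat2" where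
  "rescale k A = mk (A $ 1 $ 1) (A $ 1 $ 2 / 4 ^ k) (4 ^ k * A $ 2 $ 1) (A $ 2 $ 2)"

lemma rescale_mk [simp]: "rescale k (mk a b c d) = mk a (b / 4 ^ k) (4 ^ k * c) d" by (simp add: rescale_def)

lemma rescale_mult: "rescale k (A ** B) = rescale k A ** rescale k B"
  by (cases A rule: mat2_cases, cases B rule: mat2_cases) (simp add: algebra_simps add_divide_distrib)


lemma rescale_adj: "rescale k (adj A) = adj (rescale k A)"
  by (cases A rule: mat2_cases) simp

lemma rescale_SL2: "A \<in> SL2 \<Longrightarrow> rescale k A \<in> SL2"
  by (cases A rule: mat2_cases) (simp add: SL2_mk)

lemma rescale_conj: "adj (dg (sqrt (4 ^ k))) ** A ** dg (sqrt (4 ^ k)) = rescale k A"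
proof (cases A rule: mat2_cases)
  case (1 a b c d)
  define s :: real where "s = sqrt (4 ^ k)"
  have s: "4 ^ k = s * s" "s \<noteq> 0" by (simp_all add: s_def)
  show ?thesis unfolding 1 rescale_mk s_def[symmetric] unfolding s(1) using s(2) by (simp add: low_def)
qed

text \<open>Going back one scale enlarges only the upper right entry, and that by the factor 4. This
  makes the shortest elements of consecutive scales comparable.\<close>

lemma rescale_pred_bound: "nm (rescale k A - mat 1) \<le> 4 * nm (rescale (Suc k) A - mat 1)"
proof (cases A rule: mat2_cases)
  case (1 a b c d)
  have "\<bar>4 ^ k * c\<bar> \<le> 4 * \<bar>4 * 4 ^ k * c\<bar>" by (simp add: abs_mult)
  moreover have "\<bar>b / 4 ^ k\<bar> = 4 * \<bar>b / (4 * 4 ^ k)\<bar>" by (simp add: abs_mult)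
  moreover have "nm (rescale k A - mat 1) = \<bar>a - 1\<bar> + \<bar>b / 4 ^ k\<bar> + \<bar>4 ^ k * c\<bar> + \<bar>d - 1\<bar>"
    "nm (rescale (Suc k) A - mat 1) = \<bar>a - 1\<bar> + \<bar>b / (4 * 4 ^ k)\<bar> + \<bar>4 * 4 ^ k * c\<bar> + \<bar>d - 1\<bar>"
    unfolding 1 by (simp_all add: mk_one)
  ultimately show ?thesis by (smt (verit) abs_ge_zero)
qed

text \<open>With X and Y the deviations from 1, the commutator deviates from 1 by
  \<open>(X ** Y - Y ** X) ** adj x ** adj y\<close>. The first factor is quadratically small and
  the others have norm at most 3, so 18 = 2 * 3 * 3.\<close>

lemma commutator_bound:
  assumes "x \<in> SL2" "y \<in> SL2" "nm (x - mat 1) \<le> 1" "nm (y - mat 1) \<le> 1"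
  shows "nm (x ** y ** adj x ** adj y - mat 1) \<le> 18 * (nm (x - mat 1) * nm (y - mat 1))"
proof -
  define X where "X = x - mat 1"
  define Y where "Y = y - mat 1"
  have xy: "x = X + mat 1" "y = Y + mat 1" by (simp_all add: X_def Y_def)
  have one: "nm (mat 1) = 2" by (simp add: mk_one)
  have n3: "nm x \<le> 3" "nm y \<le> 3"
    using nm_add[of "x - mat 1" "mat 1"] nm_add[of "y - mat 1" "mat 1"] assms(3,4) one by auto
  have "x ** y - y ** x = X ** Y - Y ** X"
    unfolding xy by (cases X rule: mat2_cases, cases Y rule: mat2_cases) (simp add: mk_one algebra_simps)
  moreover have "x ** y ** adj x ** adj y - mat 1 = (x ** y - y ** x) ** adj x ** adj y"
  proof -
    have "y ** x ** adj x ** adj y = mat 1" using assms by (simp add: matrix_mul_assoc[symmetric])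
    then show ?thesis by (simp add: mat2_diff_right)
  qed
  ultimately have "nm (x ** y ** adj x ** adj y - mat 1) \<le> nm ((X ** Y - Y ** X) ** adj x) * nm (adj y)"
    by (metis nm_mult)
  also have "\<dots> \<le> (nm (X ** Y - Y ** X) * nm (adj x)) * nm (adj y)"
    by (intro mult_right_mono nm_mult) simp
  also have "\<dots> \<le> ((2 * (nm X * nm Y)) * 3) * 3"
  proof (intro mult_mono)
    have "nm (X ** Y - Y ** X) \<le> nm (X ** Y) + nm (Y ** X)" using nm_add[of "X ** Y" "- (Y ** X)"] by simp
    also have "\<dots> \<le> nm X * nm Y + nm Y * nm X" by (intro add_mono nm_mult)
    finally show "nm (X ** Y - Y ** X) \<le> 2 * (nm X * nm Y)" by (simp add: mult.commute)
  qed (use n3 in auto)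
  finally show ?thesis by (simp add: X_def Y_def)
qed

text \<open>The equations of commutation say that the trace-free parts have vanishing cross product;
  as that of \<open>B\<close> is nonzero, that of \<open>A\<close> is a multiple of it.\<close>

lemma commute_proportional:
  fixes A B :: mat2
  assumes "A ** B = B ** A" and "\<not> (B $ 1 $ 2 = 0 \<and> B $ 2 $ 1 = 0 \<and> B $ 1 $ 1 = B $ 2 $ 2)"
  obtains t where "A $ 1 $ 2 = t * B $ 1 $ 2" "A $ 2 $ 1 = t * B $ 2 $ 1"
    "A $ 1 $ 1 - A $ 2 $ 2 = t * (B $ 1 $ 1 - B $ 2 $ 2)"
proof (cases A rule: mat2_cases, cases B rule: mat2_cases)
  fix a b c d a' b' c' d' assume A: "A = mk a b c d" and B: "B = mk a' b' c' d'"
  from assms(1) have raw: "a * a' + b * c' = a' * a + b' * c" "a * b' + b * d' = a' * b + b' * d" "c * a' + d * c' = c' * a + d' * c"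
    unfolding A B mk_mult mk_eq_iff by auto
  have e: "b * c' = b' * c" "(a - d) * b' = (a' - d') * b" "(a - d) * c' = (a' - d') * c"
    using raw by algebra+
  consider "b' \<noteq> 0" | "c' \<noteq> 0" | "a' - d' \<noteq> 0" using assms(2) unfolding B by auto
  then show thesis
  proof cases
    case 1 then show ?thesis using e that[of "b / b'"] unfolding A B by (simp add: field_simps)
  next
    case 2 then show ?thesis using e that[of "c / c'"] unfolding A B by (simp add: field_simps)
  next
    case 3 
    have "b = (a - d) / (a' - d') * b'" "c = (a - d) / (a' - d') * c'" "a - d = (a - d) / (a' - d') * (a' - d')"
      using 3 e by (simp_all add: nonzero_eq_divide_eq mult.commute)
    then show ?thesis using that[of "(a - d) / (a' - d')"] unfolding A B by simp
  qed
qed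

text \<open>The centralizer of a nonscalar matrix consists of combinations of it and 1, hence is
  commutative.\<close>

lemma commute_trans:
  fixes A B C :: mat2
  assumes "A ** B = B ** A" "C ** B = B ** C" "\<not> (B $ 1 $ 2 = 0 \<and> B $ 2 $ 1 = 0 \<and> B $ 1 $ 1 = B $ 2 $ 2)"
  shows "A ** C = C ** A"
proof -
  obtain t where t: "A $ 1 $ 2 = t * B $ 1 $ 2" "A $ 2 $ 1 = t * B $ 2 $ 1" "A $ 1 $ 1 - A $ 2 $ 2 = t * (B $ 1 $ 1 - B $ 2 $ 2)"
    using commute_proportional[OF assms(1,3)] .
  obtain u where u: "C $ 1 $ 2 = u * B $ 1 $ 2" "C $ 2 $ 1 = u * B $ 2 $ 1" "C $ 1 $ 1 - C $ 2 $ 2 = u * (B $ 1 $ 1 - B $ 2 $ 2)"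
    using commute_proportional[OF assms(2,3)] .
  define p where "p = B $ 1 $ 1 - B $ 2 $ 2"
  have A: "A $ 1 $ 1 = A $ 2 $ 2 + t * p" and C: "C $ 1 $ 1 = C $ 2 $ 2 + u * p" using t u by (simp_all add: p_def)
  show ?thesis
    by (rule mat2_eqI) (simp_all only: mult_nth A C t u, simp_all add: algebra_simps)
qed

text \<open>Pigeonhole in a totally bounded ball. The bound m is uniform in \<open>f\<close> and
  \<open>S\<close> because both change with the scale. The radius \<open>\<epsilon> / 8\<close>
  allows for two radii and for \<open>nm \<le> 4 * norm\<close>.\<close>

lemma close_pair:
  assumes "\<epsilon> > 0"
  shows "\<exists>m::nat. \<forall>(f :: 'a \<Rightarrow> mat2) S. finite S \<longrightarrow> m < card S \<longrightarrow> (\<forall>s\<in>S. nm (f s) \<le> R) \<longrightarrow>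
    (\<exists>s\<in>S. \<exists>s'\<in>S. s \<noteq> s' \<and> nm (f s - f s') < \<epsilon>)"
proof -
  have "compact (cball (0::mat2) R)" by simp
  then have "\<forall>e>0. \<exists>Q. finite Q \<and> cball (0::mat2) R \<subseteq> (\<Union>x\<in>Q. ball x e)"
    unfolding compact_eq_totally_bounded by blast
  then have "\<exists>Q. finite Q \<and> cball (0::mat2) R \<subseteq> (\<Union>x\<in>Q. ball x (\<epsilon> / 8))" using assms by (auto dest!: spec[of _ "\<epsilon> / 8"])
  then obtain Q :: "mat2 set" where Q: "finite Q" "cball 0 R \<subseteq> (\<Union>x\<in>Q. ball x (\<epsilon> / 8))" by blast
  have "\<exists>s\<in>S. \<exists>s'\<in>S. s \<noteq> s' \<and> nm (f s - f s') < \<epsilon>"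
    if S: "finite S" "card Q < card S" "\<And>s. s \<in> S \<Longrightarrow> nm (f s) \<le> R" for f :: "'a \<Rightarrow> mat2" and S
  proof -
    have "\<exists>x\<in>Q. f s \<in> ball x (\<epsilon> / 8)" if "s \<in> S" for s
      using Q(2) S(3)[OF that] norm_le_nm[of "f s"] by (auto simp: subset_iff)
    then obtain h where h: "\<And>s. s \<in> S \<Longrightarrow> h s \<in> Q \<and> f s \<in> ball (h s) (\<epsilon> / 8)" by metis
    have "\<not> inj_on h S"
      using card_inj_on_le[of h S Q] h Q(1) S(2) by (metis image_subsetI not_le)
    then obtain s s' where s: "s \<in> S" "s' \<in> S" "s \<noteq> s'" "h s = h s'" by (auto simp: inj_on_def)
    have "dist (f s) (f s') < \<epsilon> / 8 + \<epsilon> / 8"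
      using h[OF s(1)] h[OF s(2)] s(4) dist_triangle_less_add[of "f s" "h s" "\<epsilon> / 8" "f s'" "\<epsilon> / 8"] by (simp add: dist_commute)
    then have "nm (f s - f s') < \<epsilon>" using nm_le_norm[of "f s - f s'"] by (simp add: dist_norm)
    then show ?thesis using s by blast
  qed
  note * = this
  show ?thesis by (intro exI[of _ "card Q"] allI impI) (rule *, auto)
qed

context sl2_lattice
begin

text \<open>Two of the many rescaled return elements are within \<open>\<epsilon> / 100\<close> of
  each other; their norms are at most 100, so their quotient is within \<epsilon> of 1.\<close>

lemma small_element:
  assumes g: "g \<in> SL2" and \<epsilon>: "\<epsilon> > 0"
    and div: "\<And>M. \<exists>K. \<forall>k\<ge>K. M < card (return_set g (4 ^ k))"
  obtains K where "\<And>k. k \<ge> K \<Longrightarrow> \<exists>\<gamma>\<in>\<Gamma>. \<gamma> \<noteq> mat 1 \<and> nm (rescale k (g ** \<gamma> ** adj g) - mat 1) < \<epsilon>"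
proof -
  define x where "x k \<gamma> = rescale k (g ** \<gamma> ** adj g)" for k \<gamma>
  have xS: "x k \<gamma> \<in> SL2" if "\<gamma> \<in> \<Gamma>" for k \<gamma> using that g by (simp add: x_def rescale_SL2)
  have xm: "x k (adj a ** b) = adj (x k a) ** x k b" for k a b
    using g unfolding x_def rescale_adj[symmetric] rescale_mult[symmetric] by (simp add: adj_mult matrix_mul_assoc[symmetric])
  have e100: "\<epsilon> / 100 > 0" using \<epsilon> by simp
  obtain m :: nat where m: "\<And>(f :: mat2 \<Rightarrow> mat2) S. finite S \<Longrightarrow> m < card S \<Longrightarrow> \<forall>s\<in>S. nm (f s) \<le> 100 \<Longrightarrow>
    \<exists>s\<in>S. \<exists>s'\<in>S. s \<noteq> s' \<and> nm (f s - f s') < \<epsilon> / 100"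
    using close_pair[OF e100, where 'a = mat2 and R = 100] by metis
  obtain K where K: "\<And>k. k \<ge> K \<Longrightarrow> m < card (return_set g (4 ^ k))" using div by blast
  have "\<exists>\<gamma>\<in>\<Gamma>. \<gamma> \<noteq> mat 1 \<and> nm (x k \<gamma> - mat 1) < \<epsilon>" if k: "k \<ge> K" for k
  proof -
    have cnt: "\<gamma> \<in> return_set g (4 ^ k) \<Longrightarrow> \<gamma> \<in> \<Gamma> \<and> nm (x k \<gamma>) \<le> 100" for \<gamma>
      unfolding return_set_def x_def by (simp add: rescale_conj[symmetric] matrix_mul_assoc)
    obtain a b where ab: "a \<in> \<Gamma>" "b \<in> \<Gamma>" "a \<noteq> b" "nm (x k a - x k b) < \<epsilon> / 100" "nm (x k a) \<le> 100"
      using m[OF finite_return_set[OF g] K[OF k], of "x k"] cnt by (metis zero_less_power zero_less_numeral)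
    have "x k (adj a ** b) - mat 1 = adj (x k a) ** (x k b - x k a)"
      using xS[OF ab(1)] by (simp add: xm mat2_diff_left)
    then have "nm (x k (adj a ** b) - mat 1) \<le> nm (x k a) * nm (x k a - x k b)"
      using nm_mult[of "adj (x k a)" "x k b - x k a"] by (simp add: nm_minus_commute)
    also have "\<dots> \<le> 100 * nm (x k a - x k b)" using ab by (intro mult_right_mono) auto
    also have "\<dots> < \<epsilon>" using ab by simp
    finally have "nm (x k (adj a ** b) - mat 1) < \<epsilon>" .
    moreover have "adj a ** b \<noteq> mat 1"
    proof
      assume "adj a ** b = mat 1"
      then have "a ** (adj a ** b) = a" by simp
      then show False using ab by simp
    qed
    ultimately show ?thesis using ab by (intro bexI[of _ "adj a ** b"]) (auto simp: mult_in adj_in)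
  qed
  then show thesis using that unfolding x_def by blast
qed

text \<open>If the return sets grew, then at every scale \<open>4 ^ k\<close> the conjugated lattice would have a shortest nontrivial
  element close to 1. Shortest elements at consecutive scales commute because their commutator is shorter, so they
  all lie in one abelian subgroup; being contracted forever, it is the upper unipotent one.\<close>

lemma nondivergence:
  assumes g: "g \<in> SL2" and np: "\<And>\<tau>. \<tau> \<noteq> 0 \<Longrightarrow> adj g ** U \<tau> ** g \<notin> \<Gamma>"
  obtains M where "\<And>K. \<exists>k\<ge>K. card (return_set g (4 ^ k)) \<le> M"
proof (rule ccontr)
  assume "\<not> thesis"
  then have div: "\<And>M. \<exists>K. \<forall>k\<ge>K. M < card (return_set g (4 ^ k))" using that by (metis not_le)
  define G where "G \<gamma> = g ** \<gamma> ** adj g" for \<gamma>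
  define n where "n k \<gamma> = nm (rescale k (G \<gamma>) - mat 1)" for k \<gamma>
  have GS: "G \<gamma> \<in> SL2" if "\<gamma> \<in> \<Gamma>" for \<gamma> using that g by (simp add: G_def)
  have Gm: "G (a ** b) = G a ** G b" for a b using g by (simp add: G_def matrix_mul_assoc[symmetric])
  have Ga: "G (adj a) = adj (G a)" for a by (simp add: G_def adj_mult matrix_mul_assoc)
  have Gi: "adj g ** G \<gamma> ** g = \<gamma>" for \<gamma> using g by (simp add: G_def matrix_mul_assoc[symmetric])
  have G1: "G \<gamma> = mat 1 \<Longrightarrow> \<gamma> = mat 1" for \<gamma> using Gi[of \<gamma>] g by simp
  have n0: "0 < n k \<gamma>" if "\<gamma> \<noteq> mat 1" for k \<gamma>
  proof -
    have "rescale k (G \<gamma>) \<noteq> mat 1"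
    proof
      assume s: "rescale k (G \<gamma>) = mat 1"
      have "G \<gamma> = mat 1" using s by (cases "G \<gamma>" rule: mat2_cases) (simp add: mk_one)
      then show False using G1 that by blast
    qed
    then have "n k \<gamma> \<noteq> 0" by (simp add: n_def)
    moreover have "0 \<le> n k \<gamma>" by (simp add: n_def)
    ultimately show ?thesis by linarith
  qed
  \<comment> \<open>Only finitely many elements compete, because undoing the rescaling increases
    norms by at most \<open>4 ^ k\<close>.\<close>
  have ex_min: "\<exists>\<gamma>\<in>\<Gamma>. \<gamma> \<noteq> mat 1 \<and> n k \<gamma> < 1 / 1000 \<and> (\<forall>\<beta>\<in>\<Gamma>. \<beta> \<noteq> mat 1 \<longrightarrow> n k \<gamma> \<le> n k \<beta>)"
    if e: "\<gamma>0 \<in> \<Gamma>" "\<gamma>0 \<noteq> mat 1" "n k \<gamma>0 < 1 / 1000" for k \<gamma>0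
  proof -
    define S where "S = {\<gamma> \<in> \<Gamma>. \<gamma> \<noteq> mat 1 \<and> n k \<gamma> \<le> n k \<gamma>0}"
    have "S \<subseteq> {\<gamma> \<in> \<Gamma>. nm \<gamma> \<le> nm g * (3 * 4 ^ k) * nm g}"
    proof clarify
      fix \<gamma> assume \<gamma>: "\<gamma> \<in> S"
      have "nm (G \<gamma>) \<le> 4 ^ k * nm (rescale k (G \<gamma>))"
      proof (cases "G \<gamma>" rule: mat2_cases)
        case (1 a b c d)
        have 4: "(1::real) \<le> 4 ^ k" by simp
        have "\<bar>a\<bar> \<le> 4 ^ k * \<bar>a\<bar>" "\<bar>d\<bar> \<le> 4 ^ k * \<bar>d\<bar>" "\<bar>b\<bar> = 4 ^ k * \<bar>b / 4 ^ k\<bar>"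
          using mult_right_mono[OF 4, of "\<bar>a\<bar>"] mult_right_mono[OF 4, of "\<bar>d\<bar>"] by (auto simp: abs_mult)
        moreover have "\<bar>c\<bar> \<le> 4 ^ k * \<bar>4 ^ k * c\<bar>"
          using mult_right_mono[of 1 "4 ^ k * 4 ^ k" "\<bar>c\<bar>"] mult_mono[OF 4 4] by (simp add: abs_mult)
        ultimately show ?thesis unfolding 1 by (simp add: distrib_left)
      qed
      also have "\<dots> \<le> 4 ^ k * 3"
      proof -
        have "nm (rescale k (G \<gamma>)) \<le> n k \<gamma> + nm (mat 1)" using nm_add[of "rescale k (G \<gamma>) - mat 1" "mat 1"] by (simp add: n_def)
        also have "nm (mat 1) = 2" by (simp add: mk_one)
        finally have "nm (rescale k (G \<gamma>)) \<le> 3" using \<gamma> e(3) by (auto simp: S_def)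
        then show ?thesis by simp
      qed
      finally have G3: "nm (G \<gamma>) \<le> 3 * 4 ^ k" by simp
      have "nm \<gamma> \<le> nm (adj g ** G \<gamma>) * nm g" using nm_mult[of "adj g ** G \<gamma>" g] by (simp add: Gi)
      also have "\<dots> \<le> (nm (adj g) * nm (G \<gamma>)) * nm g" by (intro mult_right_mono nm_mult) simp
      also have "\<dots> \<le> (nm g * (3 * 4 ^ k)) * nm g" using G3 by (intro mult_right_mono mult_mono) auto
      finally show "\<gamma> \<in> \<Gamma> \<and> nm \<gamma> \<le> nm g * (3 * 4 ^ k) * nm g" using \<gamma> by (simp add: S_def)
    qed
    then have "finite S" using finite_ball finite_subset by blast
    moreover have "S \<noteq> {}" using e by (auto simp: S_def)
    ultimately obtain \<gamma> where "\<gamma> \<in> S" "\<forall>\<beta>\<in>S. n k \<gamma> \<le> n k \<beta>"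
      by (metis arg_min_if_finite(1) arg_min_least)
    then have \<gamma>: "\<gamma> \<in> \<Gamma>" "\<gamma> \<noteq> mat 1" "n k \<gamma> \<le> n k \<gamma>0" "\<And>\<beta>. \<beta> \<in> S \<Longrightarrow> n k \<gamma> \<le> n k \<beta>" by (auto simp: S_def)
    have "n k \<gamma> \<le> n k \<beta>" if "\<beta> \<in> \<Gamma>" "\<beta> \<noteq> mat 1" for \<beta>
      using \<gamma>(3) \<gamma>(4)[of \<beta>] that by (cases "n k \<beta> \<le> n k \<gamma>0") (auto simp: S_def)
    then show ?thesis using \<gamma> e(3) by (intro bexI[of _ \<gamma>]) auto
  qed
  obtain K where "\<And>k. k \<ge> K \<Longrightarrow> \<exists>\<gamma>\<in>\<Gamma>. \<gamma> \<noteq> mat 1 \<and> n k \<gamma> < 1 / 1000"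
    using small_element[OF g _ div, of "1 / 1000"] unfolding n_def G_def by auto
  then have "\<exists>\<gamma>. k \<ge> K \<longrightarrow> \<gamma> \<in> \<Gamma> \<and> \<gamma> \<noteq> mat 1 \<and> n k \<gamma> < 1 / 1000 \<and> (\<forall>\<beta>\<in>\<Gamma>. \<beta> \<noteq> mat 1 \<longrightarrow> n k \<gamma> \<le> n k \<beta>)" for k
    using ex_min by meson
  then have "\<exists>c. \<forall>k. k \<ge> K \<longrightarrow> c k \<in> \<Gamma> \<and> c k \<noteq> mat 1 \<and> n k (c k) < 1 / 1000 \<and> (\<forall>\<beta>\<in>\<Gamma>. \<beta> \<noteq> mat 1 \<longrightarrow> n k (c k) \<le> n k \<beta>)"
    by (intro choice allI)
  then obtain c where "\<forall>k. k \<ge> K \<longrightarrow> c k \<in> \<Gamma> \<and> c k \<noteq> mat 1 \<and> n k (c k) < 1 / 1000 \<and> (\<forall>\<beta>\<in>\<Gamma>. \<beta> \<noteq> mat 1 \<longrightarrow> n k (c k) \<le> n k \<beta>)"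
    by (elim exE)
  then have c: "\<And>k. k \<ge> K \<Longrightarrow> c k \<in> \<Gamma>" "\<And>k. k \<ge> K \<Longrightarrow> c k \<noteq> mat 1" "\<And>k. k \<ge> K \<Longrightarrow> n k (c k) < 1 / 1000"
    "\<And>k \<beta>. k \<ge> K \<Longrightarrow> \<beta> \<in> \<Gamma> \<Longrightarrow> \<beta> \<noteq> mat 1 \<Longrightarrow> n k (c k) \<le> n k \<beta>" by simp_all
  have step: "G (c k) ** G (c (Suc k)) = G (c (Suc k)) ** G (c k)" if k: "k \<ge> K" for k
  proof -
    let ?a = "c k" and ?b = "c (Suc k)"
    have K': "Suc k \<ge> K" using k by simp
    define w where "w = ?a ** ?b ** adj ?a ** adj ?b"
    have w: "w \<in> \<Gamma>" using c(1)[OF k] c(1)[OF K'] by (simp add: w_def mult_in adj_in)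
    have b: "n k ?b \<le> 4 * n (Suc k) ?b" unfolding n_def by (rule rescale_pred_bound)
    \<comment> \<open>The commutator is shorter than \<open>?a\<close> by the factor 18 * 4 / 1000 <
      1, which contradicts minimality unless it is trivial.\<close>
    have "n k w \<le> 18 * (n k ?a * n k ?b)"
      unfolding n_def w_def Gm Ga rescale_mult rescale_adj
      by (rule commutator_bound) (use c(1,3)[OF k] c(1,3)[OF K'] b in \<open>auto simp: n_def intro: rescale_SL2 GS\<close>)
    also have "\<dots> \<le> 18 * (n k ?a * (4 / 1000))" using b c(3)[OF K'] by (intro mult_left_mono) (auto simp: n_def)
    also have "\<dots> < n k ?a" using n0[OF c(2)[OF k], of k] by simp
    finally have "n k w < n k ?a" .
    then have "w = mat 1" using c(4)[OF k w] by (meson not_le)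
    moreover have "w ** (?b ** ?a) = ?a ** ?b"
      using c(1)[OF k] c(1)[OF K'] by (simp add: w_def matrix_mul_assoc[symmetric])
    ultimately have "?a ** ?b = ?b ** ?a" by simp
    then show ?thesis by (metis Gm)
  qed
  \<comment> \<open>A scalar element of determinant 1 is 1 or -1, and -1 is far from 1 at every
    scale.\<close>
  have nonscalar: "\<not> (G (c k) $ 1 $ 2 = 0 \<and> G (c k) $ 2 $ 1 = 0 \<and> G (c k) $ 1 $ 1 = G (c k) $ 2 $ 2)" if k: "k \<ge> K" for k
  proof (cases "G (c k)" rule: mat2_cases)
    case (1 p q r s)
    have d: "p * s - q * r = 1" using GS[OF c(1)[OF k]] 1 by (simp add: SL2_mk)
    have nk: "n k (c k) = \<bar>p - 1\<bar> + \<bar>q / 4 ^ k\<bar> + \<bar>4 ^ k * r\<bar> + \<bar>s - 1\<bar>" by (simp add: n_def 1 mk_one)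
    show ?thesis
    proof
      assume "G (c k) $ 1 $ 2 = 0 \<and> G (c k) $ 2 $ 1 = 0 \<and> G (c k) $ 1 $ 1 = G (c k) $ 2 $ 2"
      then have z: "q = 0" "r = 0" "p = s" unfolding 1 by auto
      then have "p\<^sup>2 = 1" using d by (simp add: power2_eq_square)
      then have "p = 1 \<or> p = -1" by (simp add: power2_eq_1_iff)
      moreover have "p \<noteq> -1" using nk z c(3)[OF k] by auto
      ultimately have "G (c k) = mat 1" using 1 z by (simp add: mk_one)
      then show False using G1 c(2)[OF k] by blast
    qed
  qed
  have comm: "G (c (K + j)) ** G (c K) = G (c K) ** G (c (K + j))" for j
  proof (induction j)
    case (Suc j)
    show ?case using commute_trans[OF step[of "K + j", symmetric] Suc[symmetric] nonscalar[of "K + j"]] by simp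
  qed simp
  define p where "p = G (c K) $ 1 $ 1 - G (c K) $ 2 $ 2"
  define q where "q = G (c K) $ 1 $ 2"
  define r where "r = G (c K) $ 2 $ 1"
  \<comment> \<open>Rescaling does not contract the difference of the diagonal entries or the lower
    left entry. If one of them is nonzero, proportionality bounds the upper right entry as well, so
    the elements \<open>c k\<close> come arbitrarily close to 1 in \<Gamma> itself, against
    discreteness.\<close>
  have "p = 0 \<and> r = 0"
  proof (rule ccontr)
    assume "\<not> (p = 0 \<and> r = 0)"
    then have pr: "0 < \<bar>p\<bar> + \<bar>r\<bar>" by auto
    obtain e where e: "e > 0" "\<And>\<gamma>. \<gamma> \<in> \<Gamma> \<Longrightarrow> nm (\<gamma> - mat 1) < e \<Longrightarrow> \<gamma> = mat 1" using isolated by blast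
    define C where "C = nm g * nm g * (1 + (\<bar>q\<bar> + \<bar>r\<bar>) / (\<bar>p\<bar> + \<bar>r\<bar>))"
    have C0: "0 \<le> C" using pr by (simp add: C_def)
    have bd: "nm (c k - mat 1) \<le> C * n k (c k)" if k: "k \<ge> K" for k
    proof (cases "G (c k)" rule: mat2_cases)
      case (1 a b d f)
      have "G (c k) ** G (c K) = G (c K) ** G (c k)" using comm[of "k - K"] k by simp
      then obtain t where t: "b = t * q" "d = t * r" "a - f = t * p"
        using commute_proportional[OF _ nonscalar[of K]] unfolding p_def q_def r_def 1
        by (metis mk_nth order_refl)
      define N where "N = n k (c k)"
      have nk: "N = \<bar>a - 1\<bar> + \<bar>b / 4 ^ k\<bar> + \<bar>4 ^ k * d\<bar> + \<bar>f - 1\<bar>" by (simp add: N_def n_def 1 mk_one)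
      have "\<bar>d\<bar> \<le> \<bar>4 ^ k * d\<bar>" using mult_right_mono[of 1 "4 ^ k" "\<bar>d\<bar>"] by (simp add: abs_mult)
      then have "\<bar>a - f\<bar> + \<bar>d\<bar> \<le> N" unfolding nk by linarith
      then have "\<bar>t\<bar> * (\<bar>p\<bar> + \<bar>r\<bar>) \<le> N" unfolding t by (simp add: abs_mult distrib_left)
      then have tb: "\<bar>t\<bar> \<le> N / (\<bar>p\<bar> + \<bar>r\<bar>)" using pr by (simp add: pos_le_divide_eq)
      have "nm (G (c k) - mat 1) = \<bar>a - 1\<bar> + \<bar>f - 1\<bar> + \<bar>t\<bar> * (\<bar>q\<bar> + \<bar>r\<bar>)"
        unfolding 1 by (simp add: mk_one t abs_mult distrib_left)
      also have "\<dots> \<le> N + (N / (\<bar>p\<bar> + \<bar>r\<bar>)) * (\<bar>q\<bar> + \<bar>r\<bar>)"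
        using nk by (intro add_mono mult_right_mono tb) auto
      finally have Gb: "nm (G (c k) - mat 1) \<le> N + (N / (\<bar>p\<bar> + \<bar>r\<bar>)) * (\<bar>q\<bar> + \<bar>r\<bar>)" .
      have "c k - mat 1 = adj g ** (G (c k) - mat 1) ** g"
        using g Gi[of "c k"] by (simp add: mat2_diff_left mat2_diff_right)
      then have "nm (c k - mat 1) \<le> nm (adj g ** (G (c k) - mat 1)) * nm g" using nm_mult by metis
      also have "\<dots> \<le> (nm (adj g) * nm (G (c k) - mat 1)) * nm g" by (intro mult_right_mono nm_mult) simp
      also have "\<dots> \<le> (nm g * (N + (N / (\<bar>p\<bar> + \<bar>r\<bar>)) * (\<bar>q\<bar> + \<bar>r\<bar>))) * nm g"
        using Gb by (intro mult_right_mono mult_mono) auto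
      also have "\<dots> = C * N" by (simp add: C_def algebra_simps)
      finally show ?thesis by (simp add: N_def)
    qed
    obtain K' where K': "\<And>k. k \<ge> K' \<Longrightarrow> \<exists>\<gamma>\<in>\<Gamma>. \<gamma> \<noteq> mat 1 \<and> n k \<gamma> < e / (C + 1)"
      using small_element[OF g _ div, of "e / (C + 1)"] e C0 unfolding n_def G_def by auto
    define k where "k = max K K'"
    have k: "k \<ge> K" by (simp add: k_def)
    obtain \<gamma> where "\<gamma> \<in> \<Gamma>" "\<gamma> \<noteq> mat 1" "n k \<gamma> < e / (C + 1)" using K'[of k] by (auto simp: k_def)
    then have N: "n k (c k) < e / (C + 1)" using c(4)[OF k] by fastforce
    have "nm (c k - mat 1) \<le> C * n k (c k)" by (rule bd[OF k])
    also have "\<dots> \<le> C * (e / (C + 1))" using N C0 by (intro mult_left_mono) auto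
    also have "\<dots> < e" using e C0 by (simp add: field_simps)
    finally show False using e(2) c(1,2)[OF k] by blast
  qed
  \<comment> \<open>What remains is upper triangular with equal diagonal entries; being close to 1
    it is some \<open>U b\<close> with b nonzero, which \<open>np\<close> forbids.\<close>
  then have pr: "p = 0" "r = 0" by auto
  show False
  proof (cases "G (c K)" rule: mat2_cases)
    case (1 a b d f)
    have z: "d = 0" "a = f" using pr unfolding p_def r_def 1 by auto
    have det: "a * f - b * d = 1" using GS[OF c(1)[of K]] 1 by (simp add: SL2_mk)
    then have "a\<^sup>2 = 1" using z by (simp add: power2_eq_square)
    then have "a = 1 \<or> a = -1" by (simp add: power2_eq_1_iff)
    moreover have "n K (c K) \<ge> \<bar>a - 1\<bar>" by (simp add: n_def 1 mk_one)
    ultimately have "a = 1" using c(3)[of K] by auto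
    then have GU: "G (c K) = U b" using 1 z by (simp add: U_def)
    have "b \<noteq> 0" using GU G1[of "c K"] c(2)[of K] by auto
    then show False using np[of b] Gi[of "c K"] c(1)[of K] unfolding GU by simp
  qed
qed

end

section \<open>Almost primes in horocycle orbits\<close>

lemma size_bound_of_large_factors:
  fixes z :: nat
  assumes "\<And>p. p \<in># A \<Longrightarrow> z \<le> p"
  shows "z ^ size A \<le> prod_mset A"
  using assms by (induction A) (auto intro: mult_le_mono)

lemma almost_primeI:
  fixes z n :: nat
  assumes "1 \<le> n" "1 < z" "n \<le> z ^ m" "\<And>p. prime p \<Longrightarrow> p dvd n \<Longrightarrow> z < p"
  shows "n \<in> almost_primes m"
proof -
  have "z ^ size (prime_factorization n) \<le> prod_mset (prime_factorization n)"
    by (rule size_bound_of_large_factors) (use assms(4) in \<open>auto simp: in_prime_factors_iff less_imp_le\<close>)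
  also have "\<dots> = n" using assms(1) by (simp add: prod_mset_prime_factorization_nat)
  also have "\<dots> \<le> z ^ m" by (rule assms(3))
  finally have "size (prime_factorization n) \<le> m" using assms(2) by (simp add: power_increasing_iff)
  then show ?thesis using assms(1) by (simp add: almost_primes_def)
qed

text \<open>A tent of slope \<open>4 / T\<close> centred at s t = T / 2. The sign s selects the
  direction of time, and the support between T / 4 and 3 T / 4 leaves the margins needed in
  \<open>tent_sum\<close>.\<close>

definition window :: "real \<Rightarrow> real \<Rightarrow> real \<Rightarrow> real" where
  "window s T t = max 0 (1 - \<bar>4 * (s * t) / T - 2\<bar>)"

lemma horo_weight_window:
  assumes s: "\<bar>s\<bar> = 1" and T: "T > 0"
  shows "horo_weight (window s T) T 4"
  unfolding horo_weight_def
proof (intro conjI allI impI)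
  show "window s T \<in> borel_measurable borel" unfolding window_def[abs_def] by measurable
  show "0 \<le> window s T t" "window s T t \<le> 1" for t by (auto simp: window_def)
  show "window s T t = 0" if "T < \<bar>t\<bar>" for t
  proof -
    have "\<bar>4 * (s * t) / T\<bar> = 4 * (\<bar>t\<bar> / T)" using s T by (simp add: abs_mult)
    moreover have "1 < \<bar>t\<bar> / T" using that T by simp
    ultimately show ?thesis unfolding window_def by linarith
  qed
  show "\<bar>window s T x - window s T y\<bar> \<le> 4 / T * \<bar>x - y\<bar>" for x y
  proof -
    have "\<bar>window s T x - window s T y\<bar> \<le> \<bar>4 * (s * x) / T - 4 * (s * y) / T\<bar>"
      unfolding window_def by linarith
    also have "\<dots> = \<bar>(4 / T) * (s * (x - y))\<bar>" by (simp add: algebra_simps diff_divide_distrib)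
    also have "\<dots> = 4 / T * \<bar>x - y\<bar>" using s T by (simp add: abs_mult)
    finally show ?thesis .
  qed
qed

lemma window_support:
  assumes "T > 0" "window s T t \<noteq> 0"
  shows "T / 4 < s * t" "s * t < 3 * T / 4"
proof -
  have "\<bar>4 * (s * t) / T - 2\<bar> < 1" using assms(2) by (auto simp: window_def)
  then have "1 < 4 * (s * t) / T" "4 * (s * t) / T < 3" by linarith+
  then show "T / 4 < s * t" "s * t < 3 * T / 4" using assms(1) by (simp_all add: field_simps)
qed

lemma window_ge_half:
  assumes s: "s = 1 \<or> s = -1" and T: "T > 0"
  obtains j where "\<And>t. t \<in> {j..j + T / 4} \<Longrightarrow> window s T t \<ge> 1 / 2"
proof -
  have w: "window s T t \<ge> 1 / 2" if "3 * T / 8 \<le> s * t" "s * t \<le> 5 * T / 8" for t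
  proof -
    have "3 / 2 \<le> 4 * (s * t) / T" "4 * (s * t) / T \<le> 5 / 2" using that T by (simp_all add: field_simps)
    then show ?thesis unfolding window_def by linarith
  qed
  from s show thesis
  proof
    assume "s = 1" then show thesis using that[of "3 * T / 8"] w by auto
  next
    assume "s = -1" then show thesis using that[of "- 5 * T / 8"] w by auto
  qed
qed

text \<open>The sieve only knows z of the form \<open>2 ^ 2 ^ r\<close>, so the logarithm of z can
  be matched to k up to a factor 2. That factor enters the final number of primes.\<close>

lemma dyadic_scale: fixes Q k :: nat assumes "Q \<ge> 1" "Q \<le> k" obtains r where "Q * 2 ^ r \<le> k" "k < Q * 2 ^ Suc r"
proof -
  define r where "r = (LEAST r. k < Q * 2 ^ Suc r)"
  have "k < Q * 2 ^ Suc k" using assms less_exp[of k] by (simp add: order.strict_trans2[of k "2 ^ k"] mult_le_mono)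
  then have 1: "k < Q * 2 ^ Suc r" unfolding r_def by (rule LeastI)
  have 2: "Q * 2 ^ r \<le> k"
  proof (cases r)
    case 0 then show ?thesis using assms by simp
  next
    case (Suc r')
    then have "\<not> k < Q * 2 ^ Suc r'" unfolding r_def by (metis lessI not_less_Least)
    then show ?thesis using Suc by simp
  qed
  from 1 2 that show thesis by blast
qed

context sl2_lattice
begin

text \<open>At a scale T from nondivergence, z is chosen with \<open>z ^ Q \<le> Y\<close> and
  \<open>Y ^ 1280 = T\<close>. The saving of one Y over the trivial bound then pays for all losses
  of the sieve, and n <= T is at most \<open>z ^ (2560 * Q)\<close>.\<close>

lemma almost_prime_core:
  fixes \<epsilon> :: int
  assumes sieve: "sieving_exponent B"
    and g: "g \<in> SL2" and np: "\<And>\<tau>. \<tau> \<noteq> 0 \<Longrightarrow> adj g ** U \<tau> ** g \<notin> \<Gamma>"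
    and eps: "\<epsilon> = 1 \<or> \<epsilon> = -1" and z0: "z0 \<in> SL2" and \<eta>: "\<eta> > 0"
  shows "\<exists>n\<in>almost_primes (2560 * (2 * B + 3)). \<exists>\<gamma>\<in>\<Gamma>. nm (U (of_int \<epsilon> * real n) ** g ** \<gamma> ** adj z0 - mat 1) < \<eta>"
proof -
  define s where "s = real_of_int \<epsilon>"
  have s: "s = 1 \<or> s = -1" "\<bar>s\<bar> = 1" using eps by (auto simp: s_def)
  \<comment> \<open>The final distance is below \<open>4 * e + 3 * \<kappa>\<close>, at most 7/8 of
    \<eta>.\<close>
  define e where "e = min (1 / 4) (\<eta> / 8)"
  define \<kappa> where "\<kappa> = min (1 / 2) (\<eta> / 8)"
  have e: "0 < e" "e \<le> 1 / 4" "e \<le> \<eta> / 8" and \<kappa>: "0 < \<kappa>" "\<kappa> \<le> 1 / 2" "\<kappa> \<le> \<eta> / 8" using \<eta> by (auto simp: e_def \<kappa>_def)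
  define f where "f = bump z0 (4 * e)"
  have f: "good_fun f (3 / (4 * e))" unfolding f_def by (rule good_fun_bump) (use e in auto)
  note f_borel [measurable] = good_funD(1)[OF f]
  obtain M where M: "\<And>K. \<exists>k\<ge>K. card (return_set g (4 ^ k)) \<le> M" using nondivergence[OF g np] by blast
  have "\<exists>c T0. c > 0 \<and> T0 \<ge> 1 \<and> (\<forall>T \<omega> j. T \<ge> T0 \<longrightarrow> card (return_set g T) \<le> M \<longrightarrow> horo_weight \<omega> T 4 \<longrightarrow>
      (\<forall>t\<in>{j..j + T / 4}. \<omega> t \<ge> 1 / 2) \<longrightarrow> c * T \<le> (\<integral>t. \<omega> t * f (U t ** g) \<partial>lborel))"
  proof (rule main_term[OF g z0 e(1,2), of M])
    fix c T0 assume h: "0 < (c::real)" "1 \<le> (T0::real)" "\<And>T \<omega> j. T \<ge> T0 \<Longrightarrow> card (return_set g T) \<le> M \<Longrightarrow> horo_weight \<omega> T 4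
      \<Longrightarrow> (\<And>t. t \<in> {j..j + T / 4} \<Longrightarrow> \<omega> t \<ge> 1 / 2) \<Longrightarrow> c * T \<le> (\<integral>t. \<omega> t * bump z0 (4 * e) (U t ** g) \<partial>lborel)"
    show ?thesis unfolding f_def
      by (rule exI[of _ c], rule exI[of _ T0], intro conjI allI impI h(1,2), rule h(3)) (assumption | erule bspec)+
  qed
  then obtain c T0 where c: "c > 0" "T0 \<ge> 1" and main:
    "\<forall>T \<omega> j. T \<ge> T0 \<longrightarrow> card (return_set g T) \<le> M \<longrightarrow> horo_weight \<omega> T 4 \<longrightarrow>
      (\<forall>t\<in>{j..j + T / 4}. \<omega> t \<ge> 1 / 2) \<longrightarrow> c * T \<le> (\<integral>t. \<omega> t * f (U t ** g) \<partial>lborel)"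
    by (elim exE conjE)
  have "\<exists>C\<ge>0. \<forall>Y \<omega> d. Y \<ge> 2 \<longrightarrow> card (return_set g (Y ^ 1280)) \<le> M \<longrightarrow> horo_weight \<omega> (Y ^ 1280) 4 \<longrightarrow> d \<ge> 1 \<longrightarrow> real d \<le> Y
      \<longrightarrow> \<bar>(\<integral>t. \<omega> t * f (U t ** g) * ptent \<kappa> d t \<partial>lborel) - \<kappa> / real d * (\<integral>t. \<omega> t * f (U t ** g) \<partial>lborel)\<bar> \<le> C * Y ^ 1279 * real d"
  proof (rule progression_estimate[OF g f _ \<kappa>(1,2), where M = M and Cw = 4])
    fix C assume h: "0 \<le> (C::real)" "\<And>Y \<omega> d. Y \<ge> 2 \<Longrightarrow> card (return_set g (Y ^ 1280)) \<le> M \<Longrightarrow> horo_weight \<omega> (Y ^ 1280) 4 \<Longrightarrow> d \<ge> 1 \<Longrightarrow> real d \<le> Y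
      \<Longrightarrow> \<bar>(\<integral>t. \<omega> t * f (U t ** g) * ptent \<kappa> d t \<partial>lborel) - \<kappa> / real d * (\<integral>t. \<omega> t * f (U t ** g) \<partial>lborel)\<bar> \<le> C * Y ^ 1279 * real d"
    show ?thesis by (rule exI[of _ C], intro conjI allI impI h)
  qed simp
  then obtain C where C: "C \<ge> 0" and progr:
    "\<forall>Y \<omega> d. Y \<ge> 2 \<longrightarrow> card (return_set g (Y ^ 1280)) \<le> M \<longrightarrow> horo_weight \<omega> (Y ^ 1280) 4 \<longrightarrow> d \<ge> 1 \<longrightarrow> real d \<le> Y
      \<longrightarrow> \<bar>(\<integral>t. \<omega> t * f (U t ** g) * ptent \<kappa> d t \<partial>lborel) - \<kappa> / real d * (\<integral>t. \<omega> t * f (U t ** g) \<partial>lborel)\<bar> \<le> C * Y ^ 1279 * real d"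
    by (elim exE conjE)
  define Q where "Q = 2 * B + 3"
  \<comment> \<open>A bound for the constants of the analysis. The lower bound on k imposed next
    forces r > L, so z exceeds all of them.\<close>
  obtain L :: nat where L: "T0 \<le> real L" "8 * C / (\<kappa> * c) + 1 \<le> real L"
    using real_arch_simple[of "max T0 (8 * C / (\<kappa> * c) + 1)"] by (auto simp: max_def split: if_splits)
  obtain k where k: "k \<ge> 640 * Q * 2 ^ Suc L" "card (return_set g (4 ^ k)) \<le> M" using M by blast
  have "(1::nat) \<le> 2 ^ Suc L" by simp
  then have "640 * Q \<le> 640 * Q * 2 ^ Suc L" by (metis mult.right_neutral mult_le_mono2)
  then have Qk: "640 * Q \<le> k" using k(1) by (rule order_trans)
  have Q1: "1 \<le> 640 * Q" by (simp add: Q_def)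
  obtain r where r: "640 * Q * 2 ^ r \<le> k" "k < 640 * Q * 2 ^ Suc r"
    using dyadic_scale[OF Q1 Qk] by blast
  have "640 * Q * 2 ^ Suc L < 640 * Q * 2 ^ Suc r" using k(1) r(2) by linarith
  then have "(2::nat) ^ Suc L < 2 ^ Suc r" by simp
  then have Lr: "L < r" by (metis Suc_less_eq power_strict_increasing_iff one_less_numeral_iff semiring_norm(76))
  have kL: "L \<le> k"
  proof -
    have "L < 2 ^ L" by (rule less_exp)
    also have "2 ^ L \<le> 640 * Q * (2::nat) ^ Suc L" by (simp add: Q_def)
    finally show ?thesis using k(1) by linarith
  qed
  define z :: nat where "z = 2 ^ 2 ^ r"
  define T :: real where "T = 4 ^ k"
  \<comment> \<open>Chosen so that \<open>Y ^ 1280 = 4 ^ k\<close>; the condition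
    \<open>640 * Q * 2 ^ r \<le> k\<close> then reads \<open>z ^ Q \<le> Y\<close>.\<close>
  define Y where "Y = 2 powr (real k / 640)"
  have YT: "Y ^ 1280 = T"
  proof -
    have "Y ^ 1280 = 2 powr (real k / 640 * 1280)" unfolding Y_def by (simp add: powr_powr powr_realpow[symmetric])
    also have "\<dots> = 2 powr (real (2 * k))" by (simp add: mult.commute)
    also have "\<dots> = 2 ^ (2 * k)" by (rule powr_realpow) simp
    also have "\<dots> = T" unfolding T_def by (simp add: power_mult)
    finally show ?thesis .
  qed
  have zL: "real L < real z"
  proof -
    have "r < 2 ^ r" "2 ^ r < (2::nat) ^ 2 ^ r" by (rule less_exp)+
    then show ?thesis using Lr unfolding z_def by (intro of_nat_less_iff[THEN iffD2]) linarith
  qed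
  have rz: "r + 2 \<le> 2 * z"
  proof -
    have "r < 2 ^ r" "2 ^ r < (2::nat) ^ 2 ^ r" by (rule less_exp)+
    then show ?thesis unfolding z_def by linarith
  qed
  have zQ: "real z ^ Q \<le> Y"
  proof -
    have "real (640 * Q * 2 ^ r) \<le> real k" using r(1) by (rule of_nat_mono)
    then have "real (2 ^ r * Q) \<le> real k / 640" by (simp add: mult_ac)
    then have "2 powr real (2 ^ r * Q) \<le> Y" unfolding Y_def by simp
    then show ?thesis unfolding z_def by (simp add: powr_realpow power_mult del: of_nat_mult)
  qed
  have z2: "2 \<le> z" unfolding z_def using self_le_power[of "2::nat" "2 ^ r"] by simp
  have z1: "1 \<le> real z" using z2 by simp
  have Y2: "2 \<le> Y"
  proof -
    have "real z ^ 1 \<le> real z ^ Q" using z1 by (intro power_increasing) (auto simp: Q_def)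
    moreover have "2 \<le> real z" using z2 by simp
    ultimately show ?thesis using zQ unfolding power_one_right by linarith
  qed
  have T4: "4 \<le> T" "T0 \<le> T"
  proof -
    have "1 \<le> k" using Q1 Qk by linarith
    then show "4 \<le> T" unfolding T_def using power_increasing[of 1 k "4::real"] by simp
    have "real k \<le> real (4 ^ k)" using less_exp[of k] power_mono[of "2::nat" 4 k] by (intro of_nat_mono) linarith
    moreover have "real L \<le> real k" using kL by simp
    moreover have "real (4 ^ k) = T" by (simp add: T_def)
    ultimately show "T0 \<le> T" using L(1) by linarith
  qed
  define \<omega> where "\<omega> = window s T"
  have w: "horo_weight \<omega> T 4" unfolding \<omega>_def by (rule horo_weight_window) (use s T4 in auto)
  note w_borel [measurable] = horo_weightD(1)[OF w]
  define \<phi> where "\<phi> t = \<omega> t * f (U t ** g)" for t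
  have \<phi>0: "0 \<le> \<phi> t" for t unfolding \<phi>_def using w good_funD(2)[OF f] by (simp add: horo_weight_def)
  define I where "I = (\<integral>t. \<phi> t \<partial>lborel)"
  obtain j where j: "\<And>t. t \<in> {j..j + T / 4} \<Longrightarrow> \<omega> t \<ge> 1 / 2"
    unfolding \<omega>_def using window_ge_half[OF s(1), of T] T4 by auto
  have I: "c * T \<le> I" unfolding I_def \<phi>_def by (rule main[rule_format, OF T4(2) _ w j]) (use k in \<open>simp_all add: T_def\<close>)
  have integ: "integrable lborel (\<lambda>t. \<phi> t * h t)" if "h \<in> borel_measurable borel" "\<And>t. \<bar>h t\<bar> \<le> 1" for h
  proof -
    have "integrable lborel (\<lambda>t. complex_of_real (\<omega> t * f (U t ** g)) * complex_of_real (h t))"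
      by (rule horo_integrable[OF w f]) (use that T4 in auto)
    then show ?thesis unfolding of_real_mult[symmetric] complex_of_real_integrable_eq \<phi>_def .
  qed
  \<comment> \<open>The sieve weight of n is the weighted presence near the target at times within
    \<kappa> of s n, so a positive weight yields an actual visit.\<close>
  define a where "a n = (\<integral>t. \<phi> t * tent \<kappa> (t - s * real n) \<partial>lborel)" for n :: nat
  have tent_borel: "(\<lambda>t. tent \<kappa> (t - x)) \<in> borel_measurable borel" for x unfolding tent_def by measurable
  have a0: "0 \<le> a n" for n unfolding a_def using \<phi>0 tent_range[OF \<kappa>(1)] by (intro integral_nonneg_AE) auto
  have tent1: "\<bar>tent \<kappa> x\<bar> \<le> 1" for x using tent_range[OF \<kappa>(1), of x] by simp
  define N where "N = (4::nat) ^ k"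
  have sums: "(\<Sum>n | n \<in> {1..N} \<and> d dvd n. a n) = (\<integral>t. \<phi> t * ptent \<kappa> d t \<partial>lborel)" if d: "d \<ge> 1" for d
  proof -
    have "(\<Sum>n | n \<in> {1..N} \<and> d dvd n. a n) = (\<integral>t. (\<Sum>n | n \<in> {1..N} \<and> d dvd n. \<phi> t * tent \<kappa> (t - s * real n)) \<partial>lborel)"
      unfolding a_def by (intro Bochner_Integration.integral_sum[symmetric] integ tent_borel tent1)
    also have "\<dots> = (\<integral>t. \<phi> t * ptent \<kappa> d t \<partial>lborel)"
    proof (rule Bochner_Integration.integral_cong[OF refl])
      fix t
      show "(\<Sum>n | n \<in> {1..N} \<and> d dvd n. \<phi> t * tent \<kappa> (t - s * real n)) = \<phi> t * ptent \<kappa> d t"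
      proof (cases "\<omega> t = 0")
        case False
        then have st: "T / 4 < s * t" "s * t < 3 * T / 4"
          using window_support[of T s t] T4 unfolding \<omega>_def by auto
        have "real N = T" by (simp add: N_def T_def)
        then have "(\<Sum>n\<in>{n \<in> {1..N}. d dvd n}. tent \<kappa> (t - of_int \<epsilon> * real n)) = ptent \<kappa> d t"
          using st T4 by (intro tent_sum[OF \<kappa>(1,2) d eps]) (auto simp: s_def)
        then show ?thesis unfolding sum_distrib_left[symmetric] s_def by simp
      qed (simp add: \<phi>_def)
    qed
    finally show ?thesis .
  qed
  define E where "E = C * Y ^ 1279 * real z ^ B"
  have zB: "real z ^ B \<le> Y"
  proof -
    have "real z ^ B \<le> real z ^ Q" using z1 by (intro power_increasing) (auto simp: Q_def)
    then show ?thesis using zQ by simp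
  qed
  have "\<exists>n\<in>{1..N}. 0 < a n \<and> (\<forall>p. prime p \<longrightarrow> p dvd n \<longrightarrow> z < p)"
  proof (rule sieve[unfolded sieving_exponent_def, rule_format, where r = r and Y = "\<kappa> * I" and E = E])
    show "z = 2 ^ 2 ^ r" by (rule z_def)
    show "0 \<le> a n" for n by (rule a0)
    have "0 \<le> I" unfolding I_def using \<phi>0 by (intro integral_nonneg_AE) auto
    then show "0 \<le> \<kappa> * I" using \<kappa> by simp
    show "0 \<le> E" unfolding E_def using C Y2 by simp
    show "\<bar>(\<Sum>n | n \<in> {1..N} \<and> d dvd n. a n) - \<kappa> * I / real d\<bar> \<le> E" if d: "1 \<le> d" "d \<le> z ^ B" for d
    proof -
      have dz: "real d \<le> real z ^ B" using d(2) by (metis of_nat_le_iff of_nat_power)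
      have "\<bar>(\<integral>t. \<phi> t * ptent \<kappa> d t \<partial>lborel) - \<kappa> / real d * I\<bar> \<le> C * Y ^ 1279 * real d"
        unfolding \<phi>_def I_def using k(2) w order_trans[OF dz zB] d(1) Y2 unfolding T_def[symmetric] YT[symmetric] by (intro progr[rule_format]) auto
      also have "\<dots> \<le> E" unfolding E_def using dz C Y2 by (intro mult_left_mono) auto
      finally show ?thesis unfolding sums[OF d(1)] by simp
    qed
    show "E * real (r + 2) * real z ^ B < \<kappa> * I / (2 * real z)"
    proof -
      define y where "y = Y ^ 1279"
      define x where "x = real z ^ B"
      \<comment> \<open>Two powers \<open>z ^ B\<close> come from \<open>E\<close> and from the
        mass, one z from \<open>r + 2 \<le> 2 * z\<close>, one from the density, and the last one
        absorbs the constants: this is \<open>Q = 2 * B + 3\<close>.\<close>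
      have xQ: "real z ^ Q = x * x * real z * real z * real z"
        unfolding Q_def x_def mult_2 power_add by (simp add: power3_eq_cube)
      have yx: "0 < y * (x * x * real z * real z)" unfolding y_def x_def using Y2 z2 by simp
      have "E * real (r + 2) * real z ^ B * (2 * real z) = (2 * C * y) * (real (r + 2) * (x * x * real z))"
        by (simp only: E_def y_def[symmetric] x_def[symmetric] mult_ac)
      also have "\<dots> \<le> (2 * C * y) * (real (2 * z) * (x * x * real z))"
        using C Y2 unfolding y_def x_def by (intro mult_left_mono mult_right_mono of_nat_mono rz) auto
      also have "\<dots> = (y * (x * x * real z * real z)) * (4 * C)" by (simp add: mult_ac)
      also have "\<dots> < (y * (x * x * real z * real z)) * (\<kappa> * c * real z)"
      proof (rule mult_strict_left_mono[OF _ yx])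
        have "8 * C / (\<kappa> * c) < real z" using L(2) zL by linarith
        then have "8 * C < \<kappa> * c * real z" using \<kappa>(1) c(1) by (simp add: pos_divide_less_eq mult_ac)
        then show "4 * C < \<kappa> * c * real z" using C by linarith
      qed
      also have "\<dots> = \<kappa> * c * (Y ^ 1279 * real z ^ Q)" unfolding xQ y_def[symmetric] by (simp only: mult_ac)
      also have "\<dots> \<le> \<kappa> * c * (Y ^ 1279 * Y)" using \<kappa> c Y2 by (intro mult_left_mono zQ) auto
      also have "Y ^ 1279 * Y = T" unfolding YT[symmetric] using power_Suc2[of Y 1279] by simp
      also have "\<kappa> * c * T \<le> \<kappa> * I" using I \<kappa> by (simp add: mult.assoc)
      finally show ?thesis using z2 by (simp add: pos_less_divide_eq)
    qed
  qed
  then obtain n where n: "1 \<le> n" "n \<le> N" "0 < a n" "\<And>p. prime p \<Longrightarrow> p dvd n \<Longrightarrow> z < p" by auto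
  \<comment> \<open>The upper half of the scale matching:
    \<open>2 * k < 2560 * Q * 2 ^ r\<close>.\<close>
  have "N \<le> z ^ (2560 * Q)"
  proof -
    have "N = 2 ^ (2 * k)" unfolding N_def by (simp add: power_mult)
    also have "\<dots> \<le> 2 ^ (2 ^ r * (2560 * Q))" using r(2) by (intro power_increasing) auto
    also have "\<dots> = z ^ (2560 * Q)" unfolding z_def by (simp only: power_mult)
    finally show ?thesis .
  qed
  then have "n \<in> almost_primes (2560 * Q)" using n z2 by (intro almost_primeI[of n z]) auto
  moreover have "\<exists>\<gamma>\<in>\<Gamma>. nm (U (s * real n) ** g ** \<gamma> ** adj z0 - mat 1) < \<eta>"
  proof -
    have "\<exists>t. \<phi> t * tent \<kappa> (t - s * real n) \<noteq> 0"
    proof (rule ccontr)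
      assume "\<not> ?thesis"
      then have "(\<lambda>t. \<phi> t * tent \<kappa> (t - s * real n)) = (\<lambda>t. 0)" by blast
      then have "a n = 0" unfolding a_def by (simp only: Bochner_Integration.integral_zero)
      then show False using n(3) by simp
    qed
    then obtain t where t: "f (U t ** g) \<noteq> 0" "tent \<kappa> (t - s * real n) \<noteq> 0" by (auto simp: \<phi>_def)
    have "0 < bump z0 (4 * e) (U t ** g)" using t(1) bump_range(1)[of "4 * e" z0 "U t ** g"] e unfolding f_def by linarith
    then obtain \<gamma> where \<gamma>: "\<gamma> \<in> \<Gamma>" "nm (U t ** g ** \<gamma> ** adj z0 - mat 1) < 4 * e"
      using bump_posD[of "4 * e" z0 "U t ** g"] e by auto
    have tn: "\<bar>t - s * real n\<bar> < \<kappa>" using t(2) tent_eq_0[OF \<kappa>(1)] by (meson not_le)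
    define w where "w = U (s * real n) ** g ** \<gamma> ** adj z0"
    have hw: "U (t - s * real n) ** w = U t ** g ** \<gamma> ** adj z0"
      unfolding w_def by (simp add: matrix_mul_assoc U_add)
    have "nm (w - mat 1) \<le> nm (U (t - s * real n) ** w - mat 1) + nm (U (t - s * real n) - mat 1) * (4 * e + 2)"
      by (rule near_one_mult) (use \<gamma> in \<open>simp_all add: hw\<close>)
    also have "nm (U (t - s * real n) - mat 1) = \<bar>t - s * real n\<bar>" by (simp add: U_def mk_one)
    also have "\<bar>t - s * real n\<bar> * (4 * e + 2) \<le> \<kappa> * 3" using tn e by (intro mult_mono) auto
    finally have "nm (w - mat 1) < 4 * e + 3 * \<kappa>" using \<gamma>(2) unfolding hw by simp
    also have "\<dots> < \<eta>" using e \<kappa> \<eta> by linarith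
    finally show ?thesis using \<gamma>(1) unfolding w_def by blast
  qed
  ultimately show ?thesis unfolding Q_def s_def by blast
qed

end

section \<open>One-parameter unipotent subgroups\<close>

text \<open>After subtraction of a linear function the additive function has period 1, so it is
  bounded by compactness, and a bounded additive function vanishes.\<close>

lemma continuous_additive_real:
  fixes f :: "real \<Rightarrow> real"
  assumes cont: "continuous_on UNIV f" and add: "\<And>s t. f (s + t) = f s + f t"
  shows "f t = t * f 1"
proof -
  define h where "h x = f x - x * f 1" for x
  have hadd: "h (x + y) = h x + h y" for x y by (simp add: h_def add algebra_simps)
  have hn: "h (real n * x) = real n * h x" for n x
  proof (induction n)
    case 0 then show ?case using hadd[of 0 0] by simp
  next
    case (Suc n)
    have "h (real (Suc n) * x) = h (real n * x + x)" by (simp add: algebra_simps)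
    then show ?case using Suc hadd by (simp add: algebra_simps)
  qed
  have h1: "h (real n) = 0" for n using hn[of n 1] by (simp add: h_def)
  have hneg: "h (- x) = - h x" for x using hadd[of x "- x"] hadd[of 0 0] by simp
  have hint: "h (of_int m) = 0" for m :: int
  proof (cases m rule: int_cases2)
    case (nonneg n) then show ?thesis using h1 by simp
  next
    case (nonpos n) then show ?thesis using h1[of n] hneg[of "real n"] by simp
  qed
  have "continuous_on {0..1} h" unfolding h_def by (intro continuous_intros continuous_on_subset[OF cont]) auto
  then have "bounded (h ` {0..1})" by (intro compact_imp_bounded compact_continuous_image) auto
  then obtain B where B: "\<forall>x\<in>{0..1}. \<bar>h x\<bar> \<le> B" by (auto simp: bounded_iff)
  have hB: "\<bar>h x\<bar> \<le> B" for x
  proof -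
    have "h x = h (frac x)" using hadd[of "of_int \<lfloor>x\<rfloor>" "frac x"] hint[of "\<lfloor>x\<rfloor>"] by (simp add: frac_def)
    then show ?thesis using B frac_lt_1[of x] frac_ge_0[of x] by (auto dest: less_imp_le)
  qed
  have "h t = 0"
  proof (rule ccontr)
    assume "h t \<noteq> 0"
    then obtain n where "B < real n * \<bar>h t\<bar>" using reals_Archimedean3[of "\<bar>h t\<bar>"] by auto
    then show False using hB[of "real n * t"] unfolding hn by (simp add: abs_mult)
  qed
  then show ?thesis by (simp add: h_def)
qed

lemma square_zero_mk:
  assumes "mk a b c d ** mk a b c d = 0"
  shows "d = - a" "a\<^sup>2 + b * c = 0"
proof -
  have e: "a * a + b * c = 0" "b * (a + d) = 0" "c * (a + d) = 0" "b * c + d * d = 0"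
    using assms by (auto simp: vec_eq_iff forall_2 algebra_simps)
  show "d = - a"
  proof (rule ccontr)
    assume "d \<noteq> - a"
    then have "a + d \<noteq> 0" by simp
    then have "b = 0" "c = 0" using e by auto
    then show False using e \<open>d \<noteq> - a\<close> by simp
  qed
  show "a\<^sup>2 + b * c = 0" using e by (simp add: power2_eq_square)
qed

text \<open>On trace-free matrices \<open>a ^ 2 + b * c\<close> is a quadratic form of signature
  (2,1). The hypotheses describe two orthogonal isotropic vectors; these are proportional, so the
  product is a multiple of a square that is 0.\<close>

lemma nilpotent_product:
  fixes a b c :: real
  assumes "a\<^sup>2 + b * c = 0" "a'\<^sup>2 + b' * c' = 0" "2 * a * a' + b * c' + c * b' = 0"
  shows "mk a b c (- a) ** mk a' b' c' (- a') = 0"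
proof -
  have "(b * c' - c * b')\<^sup>2 = 0" using assms by algebra
  then have bc: "b * c' = c * b'" by simp
  have "(a * b' - b * a')\<^sup>2 = 0" "(c * a' - a * c')\<^sup>2 = 0" using assms bc by algebra+
  then have "a * b' = b * a'" "c * a' = a * c'" by simp_all
  moreover have "a * a' + b * c' = 0" "a * a' + c * b' = 0" using assms(3) bc by linarith+
  ultimately show ?thesis by (intro mat2_eqI) (simp_all add: algebra_simps)
qed

text \<open>For \<open>k\<close> with first column \<open>(x, y)\<close>, conjugation by \<open>k\<close> sends the elementary nilpotent matrix to the
  matrix with rows \<open>(- x y, x\<^sup>2)\<close> and \<open>(- y\<^sup>2, x y)\<close>.\<close>

lemma nilpotent_normal_form:
  assumes "p\<^sup>2 + q * r = 0" "\<not> (q = 0 \<and> r = 0)"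
  obtains k and \<epsilon> :: int where "k \<in> SL2" "\<epsilon> = 1 \<or> \<epsilon> = -1"
    "\<And>t. mk (1 + t * p) (t * q) (t * r) (1 - t * p) = k ** U (of_int \<epsilon> * t) ** adj k"
proof -
  \<comment> \<open>The product q r is nonpositive, so q and - r never have opposite signs. Their
    common sign is invariant under conjugation in \<open>SL2\<close>, which is why \<epsilon> cannot
    be avoided.\<close>
  define \<epsilon> :: int where "\<epsilon> = (if q > 0 \<or> r < 0 then 1 else -1)"
  define x where "x = sqrt \<bar>q\<bar>"
  define y where "y = (if of_int \<epsilon> * p \<le> 0 then sqrt \<bar>r\<bar> else - sqrt \<bar>r\<bar>)"
  have eps: "\<epsilon> = 1 \<or> \<epsilon> = -1" by (simp add: \<epsilon>_def)
  have qr: "q * r \<le> 0" using assms(1) zero_le_power2[of p] by linarith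
  have sq: "q = of_int \<epsilon> * x\<^sup>2" "r = - of_int \<epsilon> * y\<^sup>2"
    using qr assms(2) by (auto simp: \<epsilon>_def x_def y_def mult_le_0_iff)
  have "\<bar>x * y\<bar> = \<bar>p\<bar>"
  proof (rule power2_eq_imp_eq)
    have "(of_int \<epsilon>)\<^sup>2 = (1::real)" using eps by auto
    then have "p\<^sup>2 = x\<^sup>2 * y\<^sup>2" using assms(1) unfolding sq by (simp add: power2_eq_square algebra_simps)
    then show "\<bar>x * y\<bar>\<^sup>2 = \<bar>p\<bar>\<^sup>2" by (simp add: power_mult_distrib)
  qed auto
  moreover have "x \<ge> 0" "of_int \<epsilon> * p \<le> 0 \<Longrightarrow> y \<ge> 0" "of_int \<epsilon> * p > 0 \<Longrightarrow> y \<le> 0" by (auto simp: x_def y_def)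
  ultimately have p: "p = - of_int \<epsilon> * (x * y)"
    using eps by (cases "of_int \<epsilon> * p \<le> 0") (auto simp: abs_mult)
  define n where "n = x\<^sup>2 + y\<^sup>2"
  have n: "n > 0" using assms(2) sq unfolding n_def by (auto simp: sum_power2_gt_zero_iff)
  define w where "w = - y / n"
  define v where "v = x / n"
  have "x * v - w * y = (x\<^sup>2 + y\<^sup>2) / n" by (simp add: w_def v_def power2_eq_square add_divide_distrib)
  then have det: "x * v - w * y = 1" using n by (simp add: n_def[symmetric])
  define k where "k = mk x w y v"
  show thesis
  proof (rule that[of k \<epsilon>])
    show "k \<in> SL2" using det by (simp add: k_def SL2_mk mult.commute)
    show "mk (1 + t * p) (t * q) (t * r) (1 - t * p) = k ** U (of_int \<epsilon> * t) ** adj k" for t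
      unfolding k_def U_def adj_mk mk_mult mk_eq_iff p sq using det by (intro conjI) (algebra | simp add: algebra_simps power2_eq_square)+
  qed (rule eps)
qed

text \<open>The nilpotent parts of any two members have product 0, so they are additive in t and by
  continuity linear. The trivial group, which \<open>one_param_unipotent\<close> admits, is the
  first alternative.\<close>

lemma one_param_normal_form:
  assumes "one_param_unipotent u"
  obtains "\<And>t. u t = mat 1"
  | k and \<epsilon> :: int where "k \<in> SL2" "\<epsilon> = 1 \<or> \<epsilon> = -1" "\<And>t. u t = k ** U (of_int \<epsilon> * t) ** adj k"
proof -
  have cont: "continuous_on UNIV u" and mul: "\<And>s t. u (s + t) = u s ** u t"
    and uni: "\<And>t. (u t - mat 1) ** (u t - mat 1) = 0"
    using assms by (auto simp: one_param_unipotent_def unipotent_def)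
  define a where "a t = u t $ 1 $ 1 - 1" for t
  define b where "b t = u t $ 1 $ 2" for t
  define c where "c t = u t $ 2 $ 1" for t
  have "u t - mat 1 = mk (a t) (b t) (c t) (u t $ 2 $ 2 - 1)" for t
    by (rule mat2_eqI) (simp_all add: a_def b_def c_def mk_one)
  then have q: "u t $ 2 $ 2 - 1 = - a t" "(a t)\<^sup>2 + b t * c t = 0" for t
    using square_zero_mk uni[of t] by metis+
  have u: "u t = mk (1 + a t) (b t) (c t) (1 - a t)" for t
    using q(1)[of t] by (intro mat2_eqI) (simp_all add: a_def b_def c_def)
  have e: "a (s + t) = a s + a t + (a s * a t + b s * c t)" "b (s + t) = b s + b t + (a s * b t - b s * a t)"
    "c (s + t) = c s + c t + (c s * a t - a s * c t)" "- a (s + t) = - a s - a t + (c s * b t + a s * a t)" for s t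
    using mul[of s t] unfolding u mk_mult mk_eq_iff by (auto simp: algebra_simps)
  \<comment> \<open>The diagonal entries of \<open>u (s + t)\<close> deviate from 1 by opposite
    amounts; comparing the two gives the orthogonality that \<open>nilpotent_product\<close> asks
    for.\<close>
  have "mk (a s) (b s) (c s) (- a s) ** mk (a t) (b t) (c t) (- a t) = 0" for s t
    by (rule nilpotent_product[OF q(2) q(2)]) (use e(1,4)[of s t] in simp)
  then have "a s * a t + b s * c t = 0" "a s * b t - b s * a t = 0" "c s * a t - a s * c t = 0" for s t
    by (auto simp: vec_eq_iff forall_2)
  then have add: "a (s + t) = a s + a t" "b (s + t) = b s + b t" "c (s + t) = c s + c t" for s t
    using e[of s t] by simp_all
  have ca: "continuous_on UNIV a" "continuous_on UNIV b" "continuous_on UNIV c"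
    unfolding a_def b_def c_def by (intro continuous_intros cont)+
  have lin: "a t = t * a 1" "b t = t * b 1" "c t = t * c 1" for t
    using continuous_additive_real[OF ca(1) add(1)] continuous_additive_real[OF ca(2) add(2)] continuous_additive_real[OF ca(3) add(3)] by blast+
  have ul: "u t = mk (1 + t * a 1) (t * b 1) (t * c 1) (1 - t * a 1)" for t
    using u[of t] lin by metis
  show thesis
  proof (cases "b 1 = 0 \<and> c 1 = 0")
    case True
    then have "a 1 = 0" using q(2)[of 1] by simp
    then show ?thesis using True ul that(1) by (simp add: mk_one)
  next
    case False
    show ?thesis by (rule nilpotent_normal_form[OF q(2) False]) (rule that(2), simp_all add: ul)
  qed
qed

section \<open>The homogeneous space\<close>

text \<open>The characterization holds only because the predicate inside \<open>topology\<close> is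
  a topology, which preimages inherit from \<open>X\<close>.\<close>

lemma openin_quot_top:
  "openin (quot_top X f) W \<longleftrightarrow> W \<subseteq> f ` topspace X \<and> openin X {x \<in> topspace X. f x \<in> W}"
proof -
  have "istopology (\<lambda>W. W \<subseteq> f ` topspace X \<and> openin X {x \<in> topspace X. f x \<in> W})"
    unfolding istopology_def
  proof (intro conjI allI impI)
    fix S T assume "S \<subseteq> f ` topspace X \<and> openin X {x \<in> topspace X. f x \<in> S}" "T \<subseteq> f ` topspace X \<and> openin X {x \<in> topspace X. f x \<in> T}"
    moreover have "{x \<in> topspace X. f x \<in> S \<inter> T} = {x \<in> topspace X. f x \<in> S} \<inter> {x \<in> topspace X. f x \<in> T}" by auto
    ultimately show "S \<inter> T \<subseteq> f ` topspace X" "openin X {x \<in> topspace X. f x \<in> S \<inter> T}" by auto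
  next
    fix \<K> assume K: "\<forall>S\<in>\<K>. S \<subseteq> f ` topspace X \<and> openin X {x \<in> topspace X. f x \<in> S}"
    then show "\<Union>\<K> \<subseteq> f ` topspace X" by auto
    have "{x \<in> topspace X. f x \<in> \<Union>\<K>} = (\<Union>S\<in>\<K>. {x \<in> topspace X. f x \<in> S})" by auto
    then show "openin X {x \<in> topspace X. f x \<in> \<Union>\<K>}" using K by auto
  qed
  then show ?thesis unfolding quot_top_def by (simp add: topology_inverse')
qed

lemma topspace_quot_top: "topspace (quot_top X f) = f ` topspace X"
proof -
  have "{x \<in> topspace X. f x \<in> f ` topspace X} = topspace X" by auto
  then have "openin (quot_top X f) (f ` topspace X)" by (simp add: openin_quot_top)
  then have "f ` topspace X \<subseteq> topspace (quot_top X f)" by (rule openin_subset)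
  moreover have "topspace (quot_top X f) \<subseteq> f ` topspace X"
    using openin_topspace[of "quot_top X f"] unfolding openin_quot_top by blast
  ultimately show ?thesis by blast
qed

lemma topspace_hom_space: "topspace (hom_space \<Gamma>) = coset \<Gamma> ` SL2"
  by (simp add: hom_space_def topspace_quot_top)

lemma act_coset: "act g (coset \<Gamma> h) = coset \<Gamma> (g ** h)"
  by (simp add: act_def coset_def image_image matrix_mul_assoc)

text \<open>Open sets of the quotient pull back to open sets of \<open>SL2\<close>, so approximation
  in the group suffices. Nearness is measured by \<open>w ** adj z\<close>, as for the bumps; the
  radius \<open>d / (nm z + 1)\<close> converts it into a ball around z.\<close>

lemma hom_space_dense:
  assumes "S \<subseteq> topspace (hom_space \<Gamma>)"
    and "\<And>z \<eta>. z \<in> SL2 \<Longrightarrow> \<eta> > 0 \<Longrightarrow> \<exists>w\<in>SL2. coset \<Gamma> w \<in> S \<and> nm (w ** adj z - mat 1) < \<eta>"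
  shows "hom_space \<Gamma> closure_of S = topspace (hom_space \<Gamma>)"
proof
  show "topspace (hom_space \<Gamma>) \<subseteq> hom_space \<Gamma> closure_of S"
  proof
    fix q assume q: "q \<in> topspace (hom_space \<Gamma>)"
    then obtain z where z: "z \<in> SL2" "q = coset \<Gamma> z" by (auto simp: topspace_hom_space)
    have "\<exists>y. y \<in> S \<and> y \<in> W" if W: "q \<in> W" "openin (hom_space \<Gamma>) W" for W
    proof -
      have "openin (top_of_set SL2) {x \<in> SL2. coset \<Gamma> x \<in> W}" using W(2) by (simp add: hom_space_def openin_quot_top)
      then obtain V where V: "open V" "{x \<in> SL2. coset \<Gamma> x \<in> W} = SL2 \<inter> V" by (auto simp: openin_open)
      then have "z \<in> V" using z W by auto
      then obtain d where d: "d > 0" "\<And>x. dist x z < d \<Longrightarrow> x \<in> V" using V(1) unfolding open_dist by blast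
      have pz: "nm z + 1 > 0" using nm_nonneg[of z] by linarith
      obtain w where w: "w \<in> SL2" "coset \<Gamma> w \<in> S" "nm (w ** adj z - mat 1) < d / (nm z + 1)"
        using assms(2)[OF z(1), of "d / (nm z + 1)"] d(1) pz by auto
      have "w - z = (w ** adj z - mat 1) ** z" using z(1) by (simp add: mat2_diff_right matrix_mul_assoc[symmetric])
      then have "nm (w - z) \<le> nm (w ** adj z - mat 1) * nm z" by (metis nm_mult)
      also have "\<dots> \<le> d / (nm z + 1) * nm z" using w(3) by (intro mult_right_mono) auto
      also have "\<dots> < d" using d(1) pz by (simp add: pos_divide_less_eq algebra_simps)
      finally have "dist w z < d" using norm_le_nm[of "w - z"] by (simp add: dist_norm)
      then have "w \<in> V" by (rule d(2))
      then have "coset \<Gamma> w \<in> W" using V(2) w(1) by blast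
      then show ?thesis using w(2) by blast
    qed
    then show "q \<in> hom_space \<Gamma> closure_of S" using q by (auto simp: in_closure_of)
  qed
qed (rule closure_of_subset_topspace)

lemma psl_lattice_sl2_lattice:
  assumes "psl_lattice \<Gamma>"
  obtains F where "sl2_lattice \<Gamma> F"
proof -
  from assms have sub: "subgroup_SL2 \<Gamma>" and disc: "discrete \<Gamma>" by (auto simp: psl_lattice_def lattice_SL2_def)
  from assms obtain F where F: "F \<in> sets haar_SL2" "F \<subseteq> SL2" "emeasure haar_SL2 F < \<infinity>"
    "\<And>g. g \<in> SL2 \<Longrightarrow> \<exists>!\<gamma>. \<gamma> \<in> \<Gamma> \<and> g ** matrix_inv \<gamma> \<in> F" by (auto simp: psl_lattice_def lattice_SL2_def)
  have S: "\<Gamma> \<subseteq> SL2" using sub by (simp add: subgroup_SL2_def)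
  have inv: "matrix_inv \<gamma> = adj \<gamma>" if "\<gamma> \<in> \<Gamma>" for \<gamma> using that S matrix_inv_SL2 by blast
  have "sl2_lattice \<Gamma> F"
  proof
    show "\<Gamma> \<subseteq> SL2" by (rule S)
    show "mat 1 \<in> \<Gamma>" "\<And>a b. a \<in> \<Gamma> \<Longrightarrow> b \<in> \<Gamma> \<Longrightarrow> a ** b \<in> \<Gamma>" using sub by (auto simp: subgroup_SL2_def)
    show "adj a \<in> \<Gamma>" if "a \<in> \<Gamma>" for a using sub inv[OF that] that by (auto simp: subgroup_SL2_def)
    show "discrete \<Gamma>" by (rule disc)
    show "F \<in> sets borel" using F(1) by (simp add: haar_SL2_def)
    show "F \<subseteq> SL2" "emeasure haar_SL2 F < \<infinity>" by (rule F)+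
    show "\<exists>!\<gamma>. \<gamma> \<in> \<Gamma> \<and> z ** adj \<gamma> \<in> F" if "z \<in> SL2" for z
      using F(4)[OF that] inv by (metis (full_types))
  qed
  then show thesis by (rule that)
qed

lemma (in sl2_lattice) coset_mult: "\<gamma> \<in> \<Gamma> \<Longrightarrow> coset \<Gamma> (h ** \<gamma>) = coset \<Gamma> h"
proof -
  assume \<gamma>: "\<gamma> \<in> \<Gamma>"
  have "h ** \<beta> \<in> coset \<Gamma> (h ** \<gamma>)" if "\<beta> \<in> \<Gamma>" for \<beta>
    unfolding coset_def using that \<gamma>
    by (intro image_eqI[of _ _ "adj \<gamma> ** \<beta>"]) (simp_all add: matrix_mul_assoc[symmetric] mult_in adj_in)
  moreover have "h ** \<gamma> ** \<beta> \<in> coset \<Gamma> h" if "\<beta> \<in> \<Gamma>" for \<beta>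
    unfolding coset_def using that \<gamma>
    by (intro image_eqI[of _ _ "\<gamma> ** \<beta>"]) (simp_all add: matrix_mul_assoc[symmetric] mult_in)
  ultimately show ?thesis by (auto simp: coset_def)
qed

theorem theorem1p2:
  assumes "psl_lattice \<Gamma>" and "non_uniform \<Gamma>"
  shows "\<exists>N::nat. \<forall>u p. one_param_unipotent u \<and> p \<in> topspace (hom_space \<Gamma>) \<and> \<not> periodic_pt u p
     \<longrightarrow> (hom_space \<Gamma>) closure_of {act (u (real x)) p | x. x \<in> almost_primes N}
         = topspace (hom_space \<Gamma>)"
proof -
  obtain F where F: "sl2_lattice \<Gamma> F" using psl_lattice_sl2_lattice[OF assms(1)] .
  interpret sl2_lattice \<Gamma> F by (rule F)
  obtain B where B: "sieving_exponent B" using brun_hooley by blast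
  define N where "N = 2560 * (2 * B + 3)"
  have "(hom_space \<Gamma>) closure_of {act (u (real x)) p | x. x \<in> almost_primes N} = topspace (hom_space \<Gamma>)"
    if u: "one_param_unipotent u" and p: "p \<in> topspace (hom_space \<Gamma>)" and np: "\<not> periodic_pt u p" for u p
  proof -
    obtain h where h: "h \<in> SL2" "p = coset \<Gamma> h" using p by (auto simp: topspace_hom_space)
    have uS: "u t \<in> SL2" for t using u by (simp add: one_param_unipotent_def)
    show ?thesis
    proof (rule hom_space_dense)
      show "{act (u (real x)) p | x. x \<in> almost_primes N} \<subseteq> topspace (hom_space \<Gamma>)"
        using h uS by (auto simp: topspace_hom_space act_coset)
      fix z \<eta> assume z: "z \<in> SL2" and \<eta>: "(\<eta>::real) > 0"
      show "\<exists>w\<in>SL2. coset \<Gamma> w \<in> {act (u (real x)) p | x. x \<in> almost_primes N} \<and> nm (w ** adj z - mat 1) < \<eta>"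
        using u
      proof (cases rule: one_param_normal_form)
        \<comment> \<open>For the trivial group every point is periodic, so the case contradicts
          \<open>np\<close>.\<close>
        case 1
        have "act (u 1) p = p" unfolding h act_coset 1 by simp
        then show ?thesis using np unfolding periodic_pt_def by (metis zero_neq_one)
      next
        case (2 k \<epsilon>)
        define g where "g = adj k ** h"
        have g: "g \<in> SL2" using 2 h by (simp add: g_def)
        have hg: "h = k ** g" using 2 by (simp add: g_def)
        have uh: "u t ** h = k ** (U (of_int \<epsilon> * t) ** g)" for t
          unfolding hg 2(3) using 2(1) by (simp add: matrix_mul_assoc[symmetric])
        \<comment> \<open>Such a lattice element would make p periodic under u, with time
          \<open>\<epsilon> * \<tau>\<close>.\<close>
        have ng: "adj g ** U \<tau> ** g \<notin> \<Gamma>" if "\<tau> \<noteq> 0" for \<tau>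
        proof
          assume G: "adj g ** U \<tau> ** g \<in> \<Gamma>"
          have ee: "real_of_int \<epsilon> * (real_of_int \<epsilon> * \<tau>) = \<tau>" using 2(2) by auto
          have "u (of_int \<epsilon> * \<tau>) ** h = k ** (U \<tau> ** g)" by (simp only: uh ee)
          also have "\<dots> = h ** (adj g ** U \<tau> ** g)"
            unfolding hg using g by (simp add: matrix_mul_assoc[symmetric])
          finally have "u (of_int \<epsilon> * \<tau>) ** h = h ** (adj g ** U \<tau> ** g)" .
          then have "act (u (of_int \<epsilon> * \<tau>)) p = p" unfolding h act_coset by (simp add: coset_mult[OF G])
          moreover have "of_int \<epsilon> * \<tau> \<noteq> 0" using that 2(2) by auto
          ultimately show False using np unfolding periodic_pt_def by blast
        qed
        \<comment> \<open>Conjugation by k enlarges deviations from 1 by at most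
          \<open>nm k * nm k\<close>, so \<open>almost_prime_core\<close> is applied with a
          correspondingly smaller radius.\<close>
        have pk: "nm k * nm k + 1 > 0" using nm_nonneg[of k] by (simp add: add_nonneg_pos)
        have kz: "adj k ** z \<in> SL2" "0 < \<eta> / (nm k * nm k + 1)" using 2(1) z \<eta> pk by auto
        obtain n \<gamma> where n: "n \<in> almost_primes N" "\<gamma> \<in> \<Gamma>"
          "nm (U (of_int \<epsilon> * real n) ** g ** \<gamma> ** adj (adj k ** z) - mat 1) < \<eta> / (nm k * nm k + 1)"
          using almost_prime_core[OF B g ng 2(2) kz] unfolding N_def by blast
        define w where "w = u (real n) ** h ** \<gamma>"
        have wS: "w \<in> SL2" using uS h n(2) by (simp add: w_def)
        have "coset \<Gamma> w = act (u (real n)) p" unfolding w_def h act_coset by (rule coset_mult[OF n(2)])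
        moreover have "nm (w ** adj z - mat 1) < \<eta>"
        proof -
          define X where "X = U (of_int \<epsilon> * real n) ** g ** \<gamma> ** adj (adj k ** z) - mat 1"
          have "k ** X ** adj k = k ** (U (of_int \<epsilon> * real n) ** g ** \<gamma> ** adj z ** k) ** adj k - k ** adj k"
            unfolding X_def by (simp add: mat2_diff_left mat2_diff_right adj_mult matrix_mul_assoc)
          also have "\<dots> = w ** adj z - mat 1"
            unfolding w_def uh using 2(1) by (simp add: matrix_mul_assoc[symmetric])
          finally have "nm (w ** adj z - mat 1) \<le> nm (k ** X) * nm (adj k)" by (metis nm_mult)
          also have "\<dots> \<le> (nm k * nm X) * nm k" unfolding nm_adj by (intro mult_right_mono nm_mult) simp
          also have "\<dots> = (nm k * nm k) * nm X" by simp
          also have "\<dots> \<le> (nm k * nm k) * (\<eta> / (nm k * nm k + 1))"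
            using n(3) unfolding X_def[symmetric] by (intro mult_left_mono) auto
          also have "\<dots> < \<eta>" using pk \<eta> by (simp add: pos_divide_less_eq algebra_simps)
          finally show ?thesis .
        qed
        ultimately show ?thesis using wS n(1) by blast
      qed
    qed
  qed
  then show ?thesis by blast
qed

end
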